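(* Let $\Gamma\subset \mathrm{PSL}(2,\mathbb{R})$ be a discrete and cocompact subgroup. Let $\epsilon=\dim_{\mathbb{C}} I/(I\cap\widetilde{I}^2)$ and let $A_1,\dots,A_\epsilon$ be homogeneous elements of $I$, linearly independent modulo $\widetilde{I}^2$, of weights $w_1,\dots,w_\epsilon$ respectively. Then $$\dim_{\mathbb C}(\widetilde I/\widetilde I^2)_k=\epsilon\quad\text{for all even }k\ge\max_i w_i.$$ In particular, $\widetilde M_*$ is not finitely generated as a $\mathbb C$-algebra.
   Context: $\mathcal H$ is the upper half plane. A modular form of weight $k$ over $\Gamma$ is a holomorphic $f:\mathcal H\to\mathbb C$ of moderate growth (the usual polynomial growth condition, $|f(z)|=O(((1+|z|^2)/\operatorname{Im} z)^N)$ for some $N$) with $(cz+d)^{-k}f(\frac{az+b}{cz+d})=f(z)$ for all $\begin{pmatrix}a&b\\c&d\end{pmatrix}\in\Gamma$. A quasimodular form of weight $k$ and depth $\le p$ over $\Gamma$ is a holomorphic $f:\mathcal H\to\mathbb C$ of moderate growth for which there are functions $f_0,\dots,f_p:\mathcal H\to\mathbb C$ with $(cz+d)^{-k}f(\frac{az+b}{cz+d})=\sum_{j=0}^p f_j(z)\left(\frac{c}{cz+d}\right)^j$ for all $z\in\mathcal H$ and all $\begin{pmatrix}a&b\\c&d\end{pmatrix}\in\Gamma$. $M_*=\bigoplus_{k\ge0}M_k$ and $\widetilde M_*=\bigoplus_{k\ge0}\widetilde M_k$ are the graded rings of modular and quasimodular forms over $\Gamma$ (weights are even, since $\Gamma\subset\mathrm{PSL}(2,\mathbb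 R)$). $I=\bigoplus_{k>0}M_k$ and $\widetilde I=\bigoplus_{k>0}\widetilde M_k$ are the ideals of elements of positive weight in $M_*$ and $\widetilde M_*$; $\widetilde I^2$ is the graded ideal with $\widetilde I^2_k=\sum_{0<j<k}\widetilde M_j\widetilde M_{k-j}$, and the subscript $k$ denotes the weight-$k$ part. *)

theory Defs
  imports
    "HOL-Analysis.Analysis"
    "HOL-Computational_Algebra.Polynomial"
    "HOL-Library.Function_Algebras"
    "HOL-Algebra.Embedded_Algebras"
    "HOL-Algebra.Generated_Rings"
begin

section \<open>Quotient topologies\<close>

definition quotient_topology :: "'a topology \<Rightarrow> ('a \<Rightarrow> 'b) \<Rightarrow> 'b topology" where
  "quotient_topology X q =
     topology (\<lambda>U. U \<subseteq> q ` topspace X \<and> openin X {x \<in> topspace X. q x \<in> U})"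

lemma openin_quotient_topology:
  "openin (quotient_topology X q) U \<longleftrightarrow>
     U \<subseteq> q ` topspace X \<and> openin X {x \<in> topspace X. q x \<in> U}"
proof -
  have "istopology (\<lambda>U. U \<subseteq> q ` topspace X \<and> openin X {x \<in> topspace X. q x \<in> U})"
    unfolding istopology_def
  proof (intro conjI allI impI)
    fix S T
    assume S: "S \<subseteq> q ` topspace X \<and> openin X {x \<in> topspace X. q x \<in> S}"
      and T: "T \<subseteq> q ` topspace X \<and> openin X {x \<in> topspace X. q x \<in> T}"
    show "S \<inter> T \<subseteq> q ` topspace X" using S by blast
    have "{x \<in> topspace X. q x \<in> S \<inter> T} =
          {x \<in> topspace X. q x \<in> S} \<inter> {x \<in> topspace X. q x \<in> T}" by blast
    then show "openin X {x \<in> topspace X. q x \<in> S \<inter> T}" using S T by auto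
  next
    fix \<K>
    assume K: "\<forall>U\<in>\<K>. U \<subseteq> q ` topspace X \<and> openin X {x \<in> topspace X. q x \<in> U}"
    show "\<Union>\<K> \<subseteq> q ` topspace X" using K by blast
    have "{x \<in> topspace X. q x \<in> \<Union>\<K>} = (\<Union>U\<in>\<K>. {x \<in> topspace X. q x \<in> U})" by blast
    then show "openin X {x \<in> topspace X. q x \<in> \<Union>\<K>}" using K by auto
  qed
  then show ?thesis by (simp add: quotient_topology_def topology_inverse')
qed

lemma topspace_quotient_topology [simp]: "topspace (quotient_topology X q) = q ` topspace X"
proof -
  have "{x \<in> topspace X. q x \<in> q ` topspace X} = topspace X" by blast
  then have "openin (quotient_topology X q) (q ` topspace X)"
    by (simp add: openin_quotient_topology)
  then show ?thesis
    by (metis openin_quotient_topology openin_subset openin_topspace subset_antisym)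
qed

lemma quotient_map_quotient_topology: "quotient_map X (quotient_topology X q) q"
  by (auto simp: quotient_map_def openin_quotient_topology)


section \<open>The group \<open>PSL(2,\<real>)\<close> and its action on the upper half plane\<close>

definition SL2R :: "(real^2^2) monoid" where
  "SL2R = \<lparr>carrier = {A. det A = 1}, mult = (**), one = mat 1\<rparr>"

definition PSL2R :: "(real^2^2) set monoid" where
  "PSL2R = SL2R Mod {mat 1, - mat 1}"

definition PSL2R_topology :: "(real^2^2) set topology" where
  "PSL2R_topology =
     quotient_topology (top_of_set (carrier SL2R)) (\<lambda>A. {mat 1, - mat 1} #>\<^bsub>SL2R\<^esub> A)"

definition discrete_in_PSL2R :: "(real^2^2) set set \<Rightarrow> bool" where
  "discrete_in_PSL2R \<Gamma> \<longleftrightarrow> subtopology PSL2R_topology \<Gamma> = discrete_topology \<Gamma>"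

definition UHP :: "complex set" where
  "UHP = {z. Im z > 0}"

definition moebius :: "real^2^2 \<Rightarrow> complex \<Rightarrow> complex" where
  "moebius A z = (of_real (A$1$1) * z + of_real (A$1$2)) / (of_real (A$2$1) * z + of_real (A$2$2))"

text \<open>
  Elements of \<open>PSL2R\<close> are the sets \<open>{A, -A}\<close>, so for \<open>\<Gamma> \<subseteq> PSL(2,\<real>)\<close> the matrices
  representing an element of \<open>\<Gamma>\<close> are exactly the elements of \<open>\<Union>\<Gamma>\<close>.
\<close>

definition orbit_map :: "(real^2^2) set set \<Rightarrow> complex \<Rightarrow> complex set" where
  "orbit_map \<Gamma> z = (\<lambda>A. moebius A z) ` \<Union>\<Gamma>"

text \<open>Cocompactness: the orbit space of \<open>\<Gamma>\<close> on the upper half plane is compact.\<close>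

definition cocompact :: "(real^2^2) set set \<Rightarrow> bool" where
  "cocompact \<Gamma> \<longleftrightarrow> compact_space (quotient_topology (top_of_set UHP) (orbit_map \<Gamma>))"

lemma group_SL2R: "group SL2R"
proof (rule groupI)
  fix A assume "A \<in> carrier SL2R"
  then have d: "det A = 1" by (simp add: SL2R_def)
  then obtain B where B: "B ** A = mat 1"
    by (metis invertible_det_nz invertible_def zero_neq_one)
  then have "det B = 1"
    by (metis d det_I det_mul mult.right_neutral)
  with B show "\<exists>B\<in>carrier SL2R. B \<otimes>\<^bsub>SL2R\<^esub> A = \<one>\<^bsub>SL2R\<^esub>"
    by (auto simp: SL2R_def)
qed (auto simp: SL2R_def det_mul matrix_mul_assoc)

lemma det_uminus_2: "det (- A) = det (A :: real^2^2)"
  by (simp add: det_2)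

lemma uminus_matrix_mult: "(- A) ** B = - (A ** (B :: real^2^2))"
  by (simp add: matrix_matrix_mult_def vec_eq_iff sum_negf)

lemma matrix_mult_uminus: "A ** (- B) = - (A ** (B :: real^2^2))"
  by (simp add: matrix_matrix_mult_def vec_eq_iff sum_negf)

lemma normal_center_SL2R: "{mat 1, - mat 1} \<lhd> SL2R"
proof -
  interpret group SL2R by (rule group_SL2R)
  have inv: "inv\<^bsub>SL2R\<^esub> (- mat 1) = - mat 1"
    by (rule inv_equality) (auto simp: SL2R_def uminus_matrix_mult det_uminus_2)
  have sub: "subgroup {mat 1, - mat 1} SL2R"
  proof (rule subgroupI)
    show "inv\<^bsub>SL2R\<^esub> a \<in> {mat 1, - mat 1}" if "a \<in> {mat 1, - mat 1}" for a
      using that inv inv_one by (auto simp: SL2R_def)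
  qed (auto simp: SL2R_def uminus_matrix_mult matrix_mult_uminus det_uminus_2)
  show ?thesis
    by (rule normalI[OF sub])
       (auto simp: SL2R_def r_coset_def l_coset_def uminus_matrix_mult matrix_mult_uminus)
qed

lemma group_PSL2R: "group PSL2R"
  unfolding PSL2R_def by (rule normal.factorgroup_is_group[OF normal_center_SL2R])

lemma topspace_PSL2R_topology: "topspace PSL2R_topology = carrier PSL2R"
  by (auto simp: PSL2R_topology_def PSL2R_def FactGroup_def RCOSETS_def)


section \<open>Modular and quasimodular forms\<close>

text \<open>
  A function on the upper half plane is represented by the function on \<open>\<complex>\<close> that extends it
  by \<open>0\<close>; this makes equality of forms the equality of functions.
\<close>

definition moderate_growth :: "(complex \<Rightarrow> complex) \<Rightarrow> bool" where
  "moderate_growth f \<longleftrightarrow>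
     (\<exists>(C::real) (N::nat). \<forall>z\<in>UHP. norm (f z) \<le> C * ((1 + (norm z)\<^sup>2) / Im z) ^ N)"

definition modular_forms :: "(real^2^2) set set \<Rightarrow> nat \<Rightarrow> (complex \<Rightarrow> complex) set" where
  "modular_forms \<Gamma> k =
     {f. (\<forall>z. z \<notin> UHP \<longrightarrow> f z = 0) \<and> f holomorphic_on UHP \<and> moderate_growth f \<and>
         (\<forall>A\<in>\<Union>\<Gamma>. \<forall>z\<in>UHP.
            (of_real (A$2$1) * z + of_real (A$2$2)) powi (- int k) * f (moebius A z) = f z)}"

definition quasimodular_forms_depth ::
    "(real^2^2) set set \<Rightarrow> nat \<Rightarrow> nat \<Rightarrow> (complex \<Rightarrow> complex) set" where
  "quasimodular_forms_depth \<Gamma> k p =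
     {f. (\<forall>z. z \<notin> UHP \<longrightarrow> f z = 0) \<and> f holomorphic_on UHP \<and> moderate_growth f \<and>
         (\<exists>fs :: nat \<Rightarrow> complex \<Rightarrow> complex. \<forall>A\<in>\<Union>\<Gamma>. \<forall>z\<in>UHP.
            (of_real (A$2$1) * z + of_real (A$2$2)) powi (- int k) * f (moebius A z) =
            (\<Sum>j\<le>p. fs j z * (of_real (A$2$1) / (of_real (A$2$1) * z + of_real (A$2$2))) ^ j))}"

definition quasimodular_forms :: "(real^2^2) set set \<Rightarrow> nat \<Rightarrow> (complex \<Rightarrow> complex) set" where
  "quasimodular_forms \<Gamma> k = (\<Union>p. quasimodular_forms_depth \<Gamma> k p)"


section \<open>The graded rings\<close>

text \<open>
  The direct sum \<open>\<Oplus>k. S k\<close> of spaces of functions is the set of polynomials \<open>\<Sum>k. f\<^sub>k X^k\<close>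
  with \<open>f\<^sub>k \<in> S k\<close>, the formal variable recording the weight; polynomial multiplication is the
  graded multiplication. The unit is the constant function \<open>1\<close> on the upper half plane in
  weight \<open>0\<close>.
\<close>

type_synonym graded_form = "(complex \<Rightarrow> complex) poly"

definition graded_ring :: "(nat \<Rightarrow> (complex \<Rightarrow> complex) set) \<Rightarrow> graded_form ring" where
  "graded_ring S =
     \<lparr>carrier = {F. \<forall>k. poly.coeff F k \<in> S k}, mult = (*), one = [:indicator UHP:],
      zero = 0, add = (+)\<rparr>"

definition modular_ring :: "(real^2^2) set set \<Rightarrow> graded_form ring" where
  "modular_ring \<Gamma> = graded_ring (modular_forms \<Gamma>)"

definition quasimodular_ring :: "(real^2^2) set set \<Rightarrow> graded_form ring" where
  "quasimodular_ring \<Gamma> = graded_ring (quasimodular_forms \<Gamma>)"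

definition constants :: "graded_form set" where
  "constants = range (\<lambda>c. [:\<lambda>z. c * indicator UHP z:])"

definition positive_weight :: "graded_form ring \<Rightarrow> graded_form set" where
  "positive_weight R = {F \<in> carrier R. poly.coeff F 0 = 0}"

definition weight_part :: "graded_form set \<Rightarrow> nat \<Rightarrow> graded_form set" where
  "weight_part V k = {F \<in> V. \<forall>j. j \<noteq> k \<longrightarrow> poly.coeff F j = 0}"

abbreviation modular_ideal :: "(real^2^2) set set \<Rightarrow> graded_form set" where
  "modular_ideal \<Gamma> \<equiv> positive_weight (modular_ring \<Gamma>)"

abbreviation quasimodular_ideal :: "(real^2^2) set set \<Rightarrow> graded_form set" where
  "quasimodular_ideal \<Gamma> \<equiv> positive_weight (quasimodular_ring \<Gamma>)"

text \<open>\<open>\<Sum>\<^bsub>0<j<k\<^esub> S j \<cdot> S (k-j)\<close>, where the product of two spaces consists of the finite sums of products.\<close>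

definition product_component ::
    "(nat \<Rightarrow> (complex \<Rightarrow> complex) set) \<Rightarrow> nat \<Rightarrow> (complex \<Rightarrow> complex) set" where
  "product_component S k =
     {h. \<exists>(n::nat) (w :: nat \<Rightarrow> nat) f g.
           (\<forall>i<n. 0 < w i \<and> w i < k \<and> f i \<in> S (w i) \<and> g i \<in> S (k - w i)) \<and>
           h = (\<Sum>i<n. f i * g i)}"

definition quasimodular_ideal_sq :: "(real^2^2) set set \<Rightarrow> graded_form set" where
  "quasimodular_ideal_sq \<Gamma> = {F. \<forall>k. poly.coeff F k \<in> product_component (quasimodular_forms \<Gamma>) k}"


section \<open>Linear algebra modulo an ideal\<close>

text \<open>
  The image of \<open>E\<close> in the quotient ring \<open>R Quot J\<close>. For a subspace \<open>E \<supseteq> J\<close> over a field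
  \<open>K \<subseteq> R\<close> this is the quotient space \<open>E / J\<close>, a vector space over the image of \<open>K\<close>.
\<close>

definition image_mod :: "('a, 'b) ring_scheme \<Rightarrow> 'a set \<Rightarrow> 'a set \<Rightarrow> 'a set set" where
  "image_mod R J E = (\<lambda>x. J +>\<^bsub>R\<^esub> x) ` E"

definition has_dim_mod :: "('a, 'b) ring_scheme \<Rightarrow> 'a set \<Rightarrow> 'a set \<Rightarrow> 'a set \<Rightarrow> nat \<Rightarrow> bool" where
  "has_dim_mod R K J E n \<longleftrightarrow> ring.dimension (R Quot J) n (image_mod R J K) (image_mod R J E)"

definition independent_mod :: "('a, 'b) ring_scheme \<Rightarrow> 'a set \<Rightarrow> 'a set \<Rightarrow> 'a list \<Rightarrow> bool" where
  "independent_mod R K J Us \<longleftrightarrow>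
     ring.independent (R Quot J) (image_mod R J K) (map (\<lambda>x. J +>\<^bsub>R\<^esub> x) Us)"

definition finitely_generated_algebra :: "('a, 'b) ring_scheme \<Rightarrow> 'a set \<Rightarrow> bool" where
  "finitely_generated_algebra R K \<longleftrightarrow>
     (\<exists>S. finite S \<and> S \<subseteq> carrier R \<and> generate_ring R (K \<union> S) = carrier R)"

section \<open>The graded rings are rings and the ideals are ideals\<close>

lemma moebius_denom_nz:
  assumes A: "A \<in> carrier SL2R" and z: "z \<in> UHP"
  shows "of_real (A$2$1) * z + of_real (A$2$2) \<noteq> (0::complex)"
proof
  assume 0: "of_real (A$2$1) * z + of_real (A$2$2) = (0::complex)"
  from arg_cong[OF 0, of Im] z have c: "A$2$1 = 0" by (simp add: UHP_def)
  from arg_cong[OF 0, of Re] c have "A$2$2 = 0" by simp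
  with c A show False by (simp add: SL2R_def det_2)
qed

lemma Union_PSL2R_subset:
  assumes "\<Gamma> \<subseteq> carrier PSL2R" shows "\<Union>\<Gamma> \<subseteq> carrier SL2R"
proof -
  interpret group SL2R by (rule group_SL2R)
  interpret normal "{mat 1, - mat 1}" SL2R by (rule normal_center_SL2R)
  show ?thesis
    using assms by (force simp: PSL2R_def FactGroup_def dest: rcosets_carrier[OF is_group])
qed

lemma moebius_in_UHP:
  assumes "\<Gamma> \<subseteq> carrier PSL2R" "A \<in> \<Union>\<Gamma>" "z \<in> UHP"
  shows "moebius A z \<in> UHP"
proof -
  have A: "A \<in> carrier SL2R" using Union_PSL2R_subset[OF assms(1)] assms(2) by blast
  let ?d = "of_real (A$2$1) * z + of_real (A$2$2) :: complex"
  have d: "0 < (cmod ?d)\<^sup>2" using moebius_denom_nz[OF A assms(3)] by simp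
  have "Im (moebius A z) = (A$1$1 * A$2$2 - A$1$2 * A$2$1) * Im z / (cmod ?d)\<^sup>2"
    by (simp add: moebius_def Im_divide cmod_power2 algebra_simps)
  also have "\<dots> = Im z / (cmod ?d)\<^sup>2" using A by (simp add: SL2R_def det_2)
  finally show ?thesis using assms(3) d by (simp add: UHP_def)
qed

lemma moderate_growth_add:
  assumes "moderate_growth f" "moderate_growth g"
  shows "moderate_growth (f + g)"
proof -
  obtain C N where f: "\<And>z. z \<in> UHP \<Longrightarrow> norm (f z) \<le> C * ((1 + (norm z)\<^sup>2) / Im z) ^ N"
    using assms(1) unfolding moderate_growth_def by blast
  obtain D M where g: "\<And>z. z \<in> UHP \<Longrightarrow> norm (g z) \<le> D * ((1 + (norm z)\<^sup>2) / Im z) ^ M"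
    using assms(2) unfolding moderate_growth_def by blast
  have "norm ((f + g) z) \<le> (\<bar>C\<bar> + \<bar>D\<bar>) * ((1 + (norm z)\<^sup>2) / Im z) ^ (N + M)" if z: "z \<in> UHP" for z
  proof -
    let ?B = "(1 + (norm z)\<^sup>2) / Im z"
    have Im: "0 < Im z" using z by (simp add: UHP_def)
    have "Im z \<le> norm z" using abs_Im_le_cmod[of z] by linarith
    also have "\<dots> \<le> 1 + (norm z)\<^sup>2"
      using zero_le_power2[of "norm z - 1/2"] by (simp add: power2_eq_square algebra_simps)
    finally have B: "1 \<le> ?B" using Im by simp
    have "C * ?B ^ N \<le> \<bar>C\<bar> * ?B ^ (N + M)"
      by (rule mult_mono) (use B in \<open>auto intro: power_increasing\<close>)
    moreover have "D * ?B ^ M \<le> \<bar>D\<bar> * ?B ^ (N + M)"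
      by (rule mult_mono) (use B in \<open>auto intro: power_increasing\<close>)
    moreover have "norm ((f + g) z) \<le> norm (f z) + norm (g z)"
      by (simp add: norm_triangle_ineq)
    ultimately show ?thesis using f[OF z] g[OF z] unfolding distrib_right by linarith
  qed
  then show ?thesis unfolding moderate_growth_def by blast
qed

lemma moderate_growth_mult:
  assumes "moderate_growth f" "moderate_growth g"
  shows "moderate_growth (f * g)"
proof -
  obtain C N where f: "\<And>z. z \<in> UHP \<Longrightarrow> norm (f z) \<le> C * ((1 + (norm z)\<^sup>2) / Im z) ^ N"
    using assms(1) unfolding moderate_growth_def by blast
  obtain D M where g: "\<And>z. z \<in> UHP \<Longrightarrow> norm (g z) \<le> D * ((1 + (norm z)\<^sup>2) / Im z) ^ M"
    using assms(2) unfolding moderate_growth_def by blast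
  have "norm ((f * g) z) \<le> (C * D) * ((1 + (norm z)\<^sup>2) / Im z) ^ (N + M)" if z: "z \<in> UHP" for z
  proof -
    have "norm ((f * g) z) = norm (f z) * norm (g z)" by (simp add: norm_mult)
    also have "\<dots> \<le> (C * ((1 + (norm z)\<^sup>2) / Im z) ^ N) * (D * ((1 + (norm z)\<^sup>2) / Im z) ^ M)"
      using f[OF z] g[OF z] by (intro mult_mono) (auto intro: order_trans[OF norm_ge_zero])
    finally show ?thesis by (simp add: power_add mult_ac)
  qed
  then show ?thesis unfolding moderate_growth_def by blast
qed

lemma moderate_growth_const: "moderate_growth (\<lambda>z. c * indicator UHP z)"
  unfolding moderate_growth_def
  by (rule exI[of _ "norm c"], rule exI[of _ 0]) (auto simp: indicator_def)

lemma quasimodular_forms_iff: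
  "f \<in> quasimodular_forms \<Gamma> k \<longleftrightarrow>
     (\<forall>z. z \<notin> UHP \<longrightarrow> f z = 0) \<and> f holomorphic_on UHP \<and> moderate_growth f \<and>
     (\<exists>p (P :: complex \<Rightarrow> complex poly). (\<forall>z. degree (P z) \<le> p) \<and> (\<forall>A\<in>\<Union>\<Gamma>. \<forall>z\<in>UHP.
        (of_real (A$2$1) * z + of_real (A$2$2)) powi (- int k) * f (moebius A z) =
        poly (P z) (of_real (A$2$1) / (of_real (A$2$1) * z + of_real (A$2$2)))))"
  (is "_ \<longleftrightarrow> ?H \<and> ?h \<and> ?g \<and> (\<exists>p P. ?Q p P)")
proof -
  let ?x = "\<lambda>A z. of_real (A$2$1) / (of_real (A$2$1) * z + of_real (A$2$2)) :: complex"
  have "(\<exists>p fs. \<forall>A\<in>\<Union>\<Gamma>. \<forall>z\<in>UHP.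
            (of_real (A$2$1) * z + of_real (A$2$2)) powi (- int k) * f (moebius A z) =
            (\<Sum>j\<le>p. fs j z * ?x A z ^ j)) \<longleftrightarrow> (\<exists>p P. ?Q p P)" (is "?L \<longleftrightarrow> ?R")
  proof
    assume ?L
    then obtain p fs where fs: "\<And>A z. A \<in> \<Union>\<Gamma> \<Longrightarrow> z \<in> UHP \<Longrightarrow>
            (of_real (A$2$1) * z + of_real (A$2$2)) powi (- int k) * f (moebius A z) =
            (\<Sum>j\<le>p. fs j z * ?x A z ^ j)" by meson
    have "?Q p (\<lambda>z. \<Sum>j\<le>p. Polynomial.monom (fs j z) j)"
      using fs by (auto simp: poly_sum poly_monom intro!: degree_sum_le order_trans[OF degree_monom_le])
    then show ?R by (intro exI)
  next
    assume ?R
    then obtain p P where P: "?Q p P" by blast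
    have "poly (P z) x = (\<Sum>j\<le>p. poly.coeff (P z) j * x ^ j)" for z x
      unfolding poly_altdef using P by (intro sum.mono_neutral_left) (auto simp: coeff_eq_0)
    then show ?L using P by (intro exI[of _ p] exI[of _ "\<lambda>j z. poly.coeff (P z) j"]) simp
  qed
  then show ?thesis
    unfolding quasimodular_forms_def quasimodular_forms_depth_def by blast
qed

text \<open>The closure properties making \<open>graded_ring S\<close> a ring of functions on the upper half plane.\<close>

locale graded_spaces =
  fixes S :: "nat \<Rightarrow> (complex \<Rightarrow> complex) set"
  assumes vanish: "f \<in> S k \<Longrightarrow> z \<notin> UHP \<Longrightarrow> f z = 0"
    and const: "(\<lambda>z. c * indicator UHP z) \<in> S 0"
    and add: "f \<in> S k \<Longrightarrow> g \<in> S k \<Longrightarrow> f + g \<in> S k"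
    and mult: "f \<in> S k \<Longrightarrow> g \<in> S l \<Longrightarrow> f * g \<in> S (k + l)"
    and zero: "0 \<in> S k"
begin

lemma neg: "f \<in> S k \<Longrightarrow> - f \<in> S k"
proof -
  assume f: "f \<in> S k"
  have "(\<lambda>z. (-1) * indicator UHP z) * f = - f"
    using vanish[OF f] by (auto simp: fun_eq_iff indicator_def)
  then show ?thesis using mult[OF const f, of "-1"] by simp
qed

lemma sum: "(\<And>i. i \<in> I \<Longrightarrow> f i \<in> S k) \<Longrightarrow> (\<Sum>i\<in>I. f i) \<in> S k"
  by (induction I rule: infinite_finite_induct) (auto intro: zero add)

lemma one_mult:
  assumes "\<forall>k. poly.coeff F k \<in> S k" shows "[:indicator UHP:] * F = F"
proof (rule poly_eqI)
  fix k
  show "poly.coeff ([:indicator UHP:] * F) k = poly.coeff F k"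
    using vanish[of "poly.coeff F k" k] assms
    by (auto simp: fun_eq_iff indicator_def)
qed

lemma cring_graded_ring: "cring (graded_ring S)"
proof (rule cringI)
  show "abelian_group (graded_ring S)"
  proof (rule abelian_groupI)
    fix F assume "F \<in> carrier (graded_ring S)"
    then show "\<exists>G\<in>carrier (graded_ring S). G \<oplus>\<^bsub>graded_ring S\<^esub> F = \<zero>\<^bsub>graded_ring S\<^esub>"
      by (intro bexI[of _ "- F"]) (auto simp: graded_ring_def neg)
  qed (auto simp: graded_ring_def add zero)
  show "Group.comm_monoid (graded_ring S)"
  proof (rule comm_monoidI)
    show "\<one>\<^bsub>graded_ring S\<^esub> \<in> carrier (graded_ring S)"
      using const[of 1] zero by (auto simp: graded_ring_def coeff_pCons split: nat.split)
  next
    fix F G assume "F \<in> carrier (graded_ring S)" "G \<in> carrier (graded_ring S)"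
    then have "poly.coeff F i * poly.coeff G (k - i) \<in> S k" if "i \<le> k" for i k
      using mult[of "poly.coeff F i" i "poly.coeff G (k - i)" "k - i"] that
      by (simp add: graded_ring_def)
    then show "F \<otimes>\<^bsub>graded_ring S\<^esub> G \<in> carrier (graded_ring S)"
      by (auto simp: graded_ring_def coeff_mult intro: sum)
  next
    fix F assume "F \<in> carrier (graded_ring S)"
    then show "\<one>\<^bsub>graded_ring S\<^esub> \<otimes>\<^bsub>graded_ring S\<^esub> F = F"
      using one_mult by (simp add: graded_ring_def)
  qed (auto simp: graded_ring_def mult_ac)
qed (auto simp: graded_ring_def algebra_simps)

lemma product_component_subset: "product_component S k \<subseteq> S k"
proof
  fix h assume "h \<in> product_component S k"
  then obtain n w f g where *:
      "\<forall>i<n. 0 < w i \<and> w i < k \<and> f i \<in> S (w i) \<and> g i \<in> S (k - w i)"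
      and h: "h = (\<Sum>i<(n::nat). f i * g i)"
    unfolding product_component_def by blast
  show "h \<in> S k" unfolding h
  proof (rule sum)
    fix i assume "i \<in> {..<n}"
    with * show "f i * g i \<in> S k"
      using mult[of "f i" "w i" "g i" "k - w i"] by (simp add: less_imp_le)
  qed
qed

lemma product_component_zero: "0 \<in> product_component S k"
  unfolding product_component_def by (auto intro: exI[of _ 0])

lemma product_component_add:
  assumes "h \<in> product_component S k" "h' \<in> product_component S k"
  shows "h + h' \<in> product_component S k"
proof -
  obtain n w f g where 1: "\<forall>i<n. 0 < w i \<and> w i < k \<and> f i \<in> S (w i) \<and> g i \<in> S (k - w i)"
      and h: "h = (\<Sum>i<(n::nat). f i * g i)"
    using assms(1) unfolding product_component_def by blast
  obtain n' w' f' g' where 2: "\<forall>i<n'. 0 < w' i \<and> w' i < k \<and> f' i \<in> S (w' i) \<and> g' i \<in> S (k - w' i)"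
      and h': "h' = (\<Sum>i<(n'::nat). f' i * g' i)"
    using assms(2) unfolding product_component_def by blast
  let ?c = "\<lambda>u v i. if i < n then u i else v (i - n)"
  have "(\<Sum>i<n+n'. ?c f f' i * ?c g g' i) = h + h'"
    unfolding h h' by (induction n') (auto simp: add_ac)
  moreover have "\<forall>i<n+n'. 0 < ?c w w' i \<and> ?c w w' i < k \<and> ?c f f' i \<in> S (?c w w' i) \<and>
      ?c g g' i \<in> S (k - ?c w w' i)"
    using 1 2 by auto
  ultimately show ?thesis
    unfolding product_component_def
    by (intro CollectI exI[of _ "n+n'"] exI[of _ "?c w w'"] exI[of _ "?c f f'"] exI[of _ "?c g g'"]) simp
qed

lemma product_component_sum:
  "(\<And>i. i \<in> I \<Longrightarrow> f i \<in> product_component S k) \<Longrightarrow> (\<Sum>i\<in>I. f i) \<in> product_component S k"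
  by (induction I rule: infinite_finite_induct) (auto intro: product_component_zero product_component_add)

lemma product_component_mult:
  assumes "h \<in> product_component S k" "u \<in> S l"
  shows "h * u \<in> product_component S (k + l)"
proof -
  obtain n w f g where 1: "\<forall>i<n. 0 < w i \<and> w i < k \<and> f i \<in> S (w i) \<and> g i \<in> S (k - w i)"
      and h: "h = (\<Sum>i<(n::nat). f i * g i)"
    using assms(1) unfolding product_component_def by blast
  have "g i * u \<in> S (k + l - w i)" if "i < n" for i
    using mult[of "g i" "k - w i" u l] assms(2) 1 that by (simp add: less_imp_le)
  moreover have "h * u = (\<Sum>i<n. f i * (g i * u))"
    by (simp add: h sum_distrib_right mult.assoc)
  ultimately show ?thesis using 1
    unfolding product_component_def
    by (intro CollectI exI[of _ n] exI[of _ w] exI[of _ f] exI[of _ "\<lambda>i. g i * u"]) auto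
qed

lemma ideal_product_components:
  "ideal {F. \<forall>k. poly.coeff F k \<in> product_component S k} (graded_ring S)" (is "ideal ?J ?R")
proof -
  interpret cring ?R by (rule cring_graded_ring)
  have inv: "\<ominus>\<^bsub>?R\<^esub> F = - F" if "F \<in> carrier ?R" for F
    by (rule minus_equality) (use that in \<open>auto simp: graded_ring_def neg\<close>)
  have sub: "?J \<subseteq> carrier ?R" using product_component_subset by (auto simp: graded_ring_def)
  have mul: "F * G \<in> ?J" if F: "F \<in> ?J" and G: "G \<in> carrier ?R" for F G
  proof -
    have "poly.coeff F i * poly.coeff G (k - i) \<in> product_component S k" if "i \<le> k" for i k
      using product_component_mult[of "poly.coeff F i" i "poly.coeff G (k - i)" "k - i"] F G that
      by (simp add: graded_ring_def)
    then show ?thesis by (auto simp: coeff_mult intro: product_component_sum)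
  qed
  have m1: "- \<one>\<^bsub>?R\<^esub> \<in> carrier ?R" using inv[of "\<one>\<^bsub>?R\<^esub>"] a_inv_closed[OF one_closed] by simp
  have neg': "- F \<in> ?J" if F: "F \<in> ?J" for F
  proof -
    have "F * - \<one>\<^bsub>?R\<^esub> = - F"
      using one_mult[of F] F sub by (auto simp: graded_ring_def mult.commute)
    then show ?thesis using mul[OF F m1] by simp
  qed
  show ?thesis
  proof (rule idealI)
    show "ring ?R" ..
    show "subgroup ?J (add_monoid ?R)"
    proof (rule group.subgroupI)
      show "Group.group (add_monoid ?R)" by (rule a_group)
      show "?J \<noteq> {}" using product_component_zero by (auto intro: exI[of _ 0])
    next
      fix F assume F: "F \<in> ?J"
      then have "inv\<^bsub>add_monoid ?R\<^esub> F = - F"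
        using inv sub by (auto simp: a_inv_def)
      then show "inv\<^bsub>add_monoid ?R\<^esub> F \<in> ?J" using neg'[OF F] by simp
    qed (use sub product_component_add in \<open>auto simp: graded_ring_def\<close>)
  next
    fix F G assume "F \<in> ?J" "G \<in> carrier ?R"
    then show "G \<otimes>\<^bsub>?R\<^esub> F \<in> ?J" "F \<otimes>\<^bsub>?R\<^esub> G \<in> ?J"
      using mul[of F G] by (simp_all add: graded_ring_def mult.commute)
  qed
qed

end

lemma graded_spaces_quasimodular:
  assumes "\<Gamma> \<subseteq> carrier PSL2R" shows "graded_spaces (quasimodular_forms \<Gamma>)"
proof
  show "f z = 0" if "f \<in> quasimodular_forms \<Gamma> k" "z \<notin> UHP" for f k z
    using that by (simp add: quasimodular_forms_iff)
next
  fix c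
  have hol: "(\<lambda>z. c * indicator UHP z) holomorphic_on UHP"
    by (rule holomorphic_transform[of "\<lambda>_. c"]) auto
  note moeb = moebius_in_UHP[OF assms]
  have "\<exists>p (P :: complex \<Rightarrow> complex poly). (\<forall>z. degree (P z) \<le> p) \<and> (\<forall>A\<in>\<Union>\<Gamma>. \<forall>z\<in>UHP.
        (of_real (A$2$1) * z + of_real (A$2$2)) powi (- int 0) * (c * indicator UHP (moebius A z)) =
        poly (P z) (of_real (A$2$1) / (of_real (A$2$1) * z + of_real (A$2$2))))"
    by (intro exI[of _ 0] exI[of _ "\<lambda>_. [:c:]"]) (use moeb in auto)
  then show "(\<lambda>z. c * indicator UHP z) \<in> quasimodular_forms \<Gamma> 0"
    using hol moderate_growth_const[of c] by (simp add: quasimodular_forms_iff indicator_def)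
next
  fix f g k
  assume f: "f \<in> quasimodular_forms \<Gamma> k" and g: "g \<in> quasimodular_forms \<Gamma> k"
  let ?j = "\<lambda>A z. of_real (A$2$1) * z + of_real (A$2$2) :: complex"
  let ?x = "\<lambda>A z. of_real (A$2$1) / ?j A z"
  obtain p P where P: "\<forall>z. degree (P z) \<le> p" "\<forall>A\<in>\<Union>\<Gamma>. \<forall>z\<in>UHP. ?j A z powi (- int k) * f (moebius A z) = poly (P z) (?x A z)"
    using f unfolding quasimodular_forms_iff by blast
  obtain q Q where Q: "\<forall>z. degree (Q z) \<le> q" "\<forall>A\<in>\<Union>\<Gamma>. \<forall>z\<in>UHP. ?j A z powi (- int k) * g (moebius A z) = poly (Q z) (?x A z)"
    using g unfolding quasimodular_forms_iff by blast
  have "(\<forall>z. degree (P z + Q z) \<le> max p q) \<and> (\<forall>A\<in>\<Union>\<Gamma>. \<forall>z\<in>UHP. ?j A z powi (- int k) * (f + g) (moebius A z) = poly (P z + Q z) (?x A z))"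
  proof (intro conjI allI ballI)
    show "degree (P z + Q z) \<le> max p q" for z
      using P(1) Q(1) by (intro degree_add_le) (auto intro: le_max_iff_disj[THEN iffD2])
  next
    fix A z assume Az: "A \<in> \<Union>\<Gamma>" "z \<in> UHP"
    then show "?j A z powi (- int k) * (f + g) (moebius A z) = poly (P z + Q z) (?x A z)"
      using P(2)[rule_format, OF Az] Q(2)[rule_format, OF Az]
      unfolding plus_fun_apply poly_add distrib_left by (simp only:)
  qed
  moreover have "(f + g) holomorphic_on UHP"
    using f g holomorphic_on_add[of f UHP g] by (simp add: quasimodular_forms_iff plus_fun_def)
  ultimately show "f + g \<in> quasimodular_forms \<Gamma> k"
    using f g moderate_growth_add[of f g] unfolding quasimodular_forms_iff
    by (intro conjI exI[of _ "max p q"] exI[of _ "\<lambda>z. P z + Q z"]) simp_all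
next
  fix f g k l
  assume f: "f \<in> quasimodular_forms \<Gamma> k" and g: "g \<in> quasimodular_forms \<Gamma> l"
  let ?j = "\<lambda>A z. of_real (A$2$1) * z + of_real (A$2$2) :: complex"
  let ?x = "\<lambda>A z. of_real (A$2$1) / ?j A z"
  obtain p P where P: "\<forall>z. degree (P z) \<le> p" "\<forall>A\<in>\<Union>\<Gamma>. \<forall>z\<in>UHP. ?j A z powi (- int k) * f (moebius A z) = poly (P z) (?x A z)"
    using f unfolding quasimodular_forms_iff by blast
  obtain q Q where Q: "\<forall>z. degree (Q z) \<le> q" "\<forall>A\<in>\<Union>\<Gamma>. \<forall>z\<in>UHP. ?j A z powi (- int l) * g (moebius A z) = poly (Q z) (?x A z)"
    using g unfolding quasimodular_forms_iff by blast
  have "(\<forall>z. degree (P z * Q z) \<le> p + q) \<and> (\<forall>A\<in>\<Union>\<Gamma>. \<forall>z\<in>UHP. ?j A z powi (- int (k + l)) * (f * g) (moebius A z) = poly (P z * Q z) (?x A z))"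
  proof (intro conjI allI ballI)
    show "degree (P z * Q z) \<le> p + q" for z
      using P(1) Q(1) by (meson add_mono degree_mult_le order_trans)
  next
    fix A z assume Az: "A \<in> \<Union>\<Gamma>" "z \<in> UHP"
    have "?j A z \<noteq> 0" using moebius_denom_nz Union_PSL2R_subset[OF assms] Az by blast
    then have "?j A z powi (- int (k + l)) = ?j A z powi (- int k) * ?j A z powi (- int l)"
      by (simp add: power_int_add[symmetric])
    then have "?j A z powi (- int (k + l)) * (f * g) (moebius A z) =
        (?j A z powi (- int k) * f (moebius A z)) * (?j A z powi (- int l) * g (moebius A z))"
      by (simp only: times_fun_apply mult_ac)
    then show "?j A z powi (- int (k + l)) * (f * g) (moebius A z) = poly (P z * Q z) (?x A z)"
      using P(2)[rule_format, OF Az] Q(2)[rule_format, OF Az] by (simp only: poly_mult)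
  qed
  moreover have "(f * g) holomorphic_on UHP"
    using f g holomorphic_on_mult[of f UHP g] by (simp add: quasimodular_forms_iff times_fun_def)
  ultimately show "f * g \<in> quasimodular_forms \<Gamma> (k + l)"
    using f g moderate_growth_mult[of f g] unfolding quasimodular_forms_iff
    by (intro conjI exI[of _ "p + q"] exI[of _ "\<lambda>z. P z * Q z"]) simp_all
next
  fix k
  have "moderate_growth 0" using moderate_growth_const[of 0] by (simp add: zero_fun_def)
  then show "0 \<in> quasimodular_forms \<Gamma> k"
    unfolding quasimodular_forms_iff
    by (intro conjI exI[of _ 0] exI[of _ "\<lambda>_. 0"])
       (auto simp: zero_fun_def)
qed

lemma cring_quasimodular_ring: "\<Gamma> \<subseteq> carrier PSL2R \<Longrightarrow> cring (quasimodular_ring \<Gamma>)"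
  unfolding quasimodular_ring_def
  by (rule graded_spaces.cring_graded_ring[OF graded_spaces_quasimodular])

lemma ideal_quasimodular_ideal_sq:
  "\<Gamma> \<subseteq> carrier PSL2R \<Longrightarrow> ideal (quasimodular_ideal_sq \<Gamma>) (quasimodular_ring \<Gamma>)"
  unfolding quasimodular_ring_def quasimodular_ideal_sq_def
  by (rule graded_spaces.ideal_product_components[OF graded_spaces_quasimodular])

lemma modular_forms_subset_quasimodular: "modular_forms \<Gamma> k \<subseteq> quasimodular_forms \<Gamma> k"
proof
  fix f assume f: "f \<in> modular_forms \<Gamma> k"
  then have "f \<in> quasimodular_forms_depth \<Gamma> k 0"
    unfolding modular_forms_def quasimodular_forms_depth_def
    by (auto intro!: exI[of _ "\<lambda>_. f"])
  then show "f \<in> quasimodular_forms \<Gamma> k" by (auto simp: quasimodular_forms_def)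
qed

lemma graded_spaces_modular:
  assumes "\<Gamma> \<subseteq> carrier PSL2R" shows "graded_spaces (modular_forms \<Gamma>)"
proof
  show "f z = 0" if "f \<in> modular_forms \<Gamma> k" "z \<notin> UHP" for f k z
    using that by (simp add: modular_forms_def)
next
  fix c
  have "(\<lambda>z. c * indicator UHP z) holomorphic_on UHP"
    by (rule holomorphic_transform[of "\<lambda>_. c"]) auto
  then show "(\<lambda>z. c * indicator UHP z) \<in> modular_forms \<Gamma> 0"
    using moderate_growth_const[of c] moebius_in_UHP[OF assms]
    unfolding modular_forms_def mem_Collect_eq by (intro conjI ballI) (simp_all del: Union_iff)
next
  fix f g k
  assume f: "f \<in> modular_forms \<Gamma> k" and g: "g \<in> modular_forms \<Gamma> k"
  moreover have "(f + g) holomorphic_on UHP"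
    using f g holomorphic_on_add[of f UHP g] by (simp add: modular_forms_def plus_fun_def)
  ultimately show "f + g \<in> modular_forms \<Gamma> k"
    using moderate_growth_add[of f g] unfolding modular_forms_def mem_Collect_eq
    by (simp add: distrib_left del: Union_iff)
next
  fix f g k l
  assume f: "f \<in> modular_forms \<Gamma> k" and g: "g \<in> modular_forms \<Gamma> l"
  let ?j = "\<lambda>A z. of_real (A$2$1) * z + of_real (A$2$2) :: complex"
  have "?j A z powi (- int (k + l)) * (f * g) (moebius A z) = (f * g) z"
    if Az: "A \<in> \<Union>\<Gamma>" "z \<in> UHP" for A z
  proof -
    have "?j A z \<noteq> 0" using moebius_denom_nz Union_PSL2R_subset[OF assms] Az by blast
    then have "?j A z powi (- int (k + l)) = ?j A z powi (- int k) * ?j A z powi (- int l)"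
      by (simp add: power_int_add[symmetric])
    then have "?j A z powi (- int (k + l)) * (f * g) (moebius A z) =
        (?j A z powi (- int k) * f (moebius A z)) * (?j A z powi (- int l) * g (moebius A z))"
      by (simp only: times_fun_apply mult_ac)
    also have "?j A z powi (- int k) * f (moebius A z) = f z"
      using f Az unfolding modular_forms_def by blast
    also have "?j A z powi (- int l) * g (moebius A z) = g z"
      using g Az unfolding modular_forms_def by blast
    finally show ?thesis by simp
  qed
  moreover have "(f * g) holomorphic_on UHP"
    using f g holomorphic_on_mult[of f UHP g] by (simp add: modular_forms_def times_fun_def)
  ultimately show "f * g \<in> modular_forms \<Gamma> (k + l)"
    using f g moderate_growth_mult[of f g] unfolding modular_forms_def mem_Collect_eq
    by (intro conjI ballI) simp_all
next
  fix k
  have "moderate_growth 0" using moderate_growth_const[of 0] by (simp add: zero_fun_def)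
  then show "0 \<in> modular_forms \<Gamma> k"
    unfolding modular_forms_def by (auto simp: zero_fun_def)
qed

lemma cring_modular_ring: "\<Gamma> \<subseteq> carrier PSL2R \<Longrightarrow> cring (modular_ring \<Gamma>)"
  unfolding modular_ring_def
  by (rule graded_spaces.cring_graded_ring[OF graded_spaces_modular])

lemma ideal_modular_ideal_Int_sq:
  assumes "\<Gamma> \<subseteq> carrier PSL2R"
  shows "ideal (modular_ideal \<Gamma> \<inter> quasimodular_ideal_sq \<Gamma>) (modular_ring \<Gamma>)" (is "ideal ?J ?M")
proof -
  interpret M: cring ?M by (rule cring_modular_ring[OF assms])
  interpret Q: cring "quasimodular_ring \<Gamma>" by (rule cring_quasimodular_ring[OF assms])
  interpret J: ideal "quasimodular_ideal_sq \<Gamma>" "quasimodular_ring \<Gamma>"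
    by (rule ideal_quasimodular_ideal_sq[OF assms])
  interpret GM: graded_spaces "modular_forms \<Gamma>" by (rule graded_spaces_modular[OF assms])
  have inv: "\<ominus>\<^bsub>?M\<^esub> F = - F" if "F \<in> carrier ?M" for F
    by (rule M.minus_equality) (use that in \<open>auto simp: modular_ring_def graded_ring_def GM.neg\<close>)
  have MQ: "carrier ?M \<subseteq> carrier (quasimodular_ring \<Gamma>)"
    using modular_forms_subset_quasimodular
    by (auto simp: modular_ring_def quasimodular_ring_def graded_ring_def)
  have inv': "\<ominus>\<^bsub>quasimodular_ring \<Gamma>\<^esub> F = - F" if "F \<in> carrier ?M" for F
    by (rule Q.minus_equality)
       (use MQ that M.a_inv_closed[OF that] inv[OF that] in
         \<open>auto simp: quasimodular_ring_def graded_ring_def\<close>)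
  show ?thesis
  proof (rule idealI)
    show "ring ?M" ..
    show "subgroup ?J (add_monoid ?M)"
    proof (rule group.subgroupI)
      show "Group.group (add_monoid ?M)" by (rule M.a_group)
      have "0 \<in> ?J"
        using J.zero_closed M.zero_closed
        by (simp add: positive_weight_def modular_ring_def quasimodular_ring_def graded_ring_def)
      then show "?J \<noteq> {}" by blast
    next
      fix F assume F: "F \<in> ?J"
      then have c: "F \<in> carrier ?M" by (simp add: positive_weight_def)
      have "inv\<^bsub>add_monoid ?M\<^esub> F = - F" using inv[OF c] by (simp add: a_inv_def)
      moreover have "- F \<in> quasimodular_ideal_sq \<Gamma>"
        using J.a_inv_closed[of F] F inv'[OF c] by simp
      moreover have "- F \<in> carrier ?M" using M.a_inv_closed[OF c] inv[OF c] by simp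
      ultimately show "inv\<^bsub>add_monoid ?M\<^esub> F \<in> ?J" using F by (simp add: positive_weight_def)
    next
      fix F G assume FG: "F \<in> ?J" "G \<in> ?J"
      then have "F + G \<in> quasimodular_ideal_sq \<Gamma>"
        using J.a_closed[of F G] by (simp add: quasimodular_ring_def graded_ring_def)
      moreover have "F + G \<in> carrier ?M"
        using FG M.a_closed[of F G]
        by (simp add: positive_weight_def modular_ring_def graded_ring_def)
      ultimately show "F \<otimes>\<^bsub>add_monoid ?M\<^esub> G \<in> ?J"
        using FG by (simp add: positive_weight_def modular_ring_def graded_ring_def)
    qed (auto simp: positive_weight_def)
  next
    fix F G assume F: "F \<in> ?J" and G: "G \<in> carrier ?M"
    then have "F * G \<in> quasimodular_ideal_sq \<Gamma>"
      using J.I_r_closed[of F G] MQ by (auto simp: quasimodular_ring_def graded_ring_def)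
    moreover have "F * G \<in> carrier ?M"
      using F G M.m_closed[of F G]
      by (simp add: positive_weight_def modular_ring_def graded_ring_def)
    moreover have "poly.coeff (F * G) 0 = 0"
      using F by (simp add: coeff_mult positive_weight_def)
    ultimately have "F * G \<in> ?J" by (simp add: positive_weight_def)
    then show "G \<otimes>\<^bsub>?M\<^esub> F \<in> ?J" "F \<otimes>\<^bsub>?M\<^esub> G \<in> ?J"
      by (simp_all add: modular_ring_def graded_ring_def mult.commute)
  qed
qed

end

theory Submission
  imports Defs "HOL-Complex_Analysis.Complex_Analysis"
begin

text \<open>
  On a compact quotient there is no quasimodular form of weight \<open>2\<close> and depth \<open>1\<close>: it would give
  a primitive of the invariant area form, against Stokes. Hence a quasimodular form of weight
  \<open>k > 0\<close> is uniquely \<open>\<Sum>n<k/2. D\<^sup>n g\<^sub>n\<close> with \<open>g\<^sub>n\<close> modular of weight \<open>k - 2 n\<close>, and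
  the depth filtration shows that it is decomposable exactly if every \<open>g\<^sub>n\<close> is. So the derivatives
  \<open>D\<^sup>n b\<close>, \<open>b\<close> in a homogeneous basis of modular forms modulo decomposable quasimodular
  forms, give a basis of indecomposables. This basis is finite, because Poincare series provide
  modular forms \<open>f\<close>, \<open>g\<close> of the same weight without common zero, and comparing jets along the
  zeros of \<open>f\<close> shows that every modular form of large weight is of the form \<open>a g + f b\<close>. Each
  basis element contributes one dimension in every even weight from its own on.
\<close>

\<comment> \<open>Otherwise \<open>$\<close> is ambiguous between vector components and coefficients of power series.\<close>
unbundle no Formal_Power_Series.fps_syntax

text \<open>Everything rests on a sharper form of the weight two obstruction: in weight
  \<open>k > 0\<close> the depth is strictly below \<open>k / 2\<close> (\<open>qexp_depth\<close>).
  So the top coefficient of a form of depth \<open>p\<close> is modular of weight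
  \<open>m = k - 2 p > 0\<close>, the factor \<open>m (m + 1) ... (m + p - 1)\<close> that
  \<open>D^p\<close> puts in front of it is nonzero, and subtracting a derivative lowers the depth.
  For SL(2,Z) the Eisenstein series of weight 2 breaks exactly this step. The definition of a
  quasimodular form only asks for some functions \<open>f_j\<close>. That they are unique,
  holomorphic and quasimodular depends on \<open>c / (c z + d)\<close> taking infinitely many values
  at each point, which follows from the same obstruction. Stokes is used without a fundamental
  domain: a partition of unity cuts up the form, and the terms belonging to \<open>A\<close> and to
  its inverse are exchanged by a change of variables. The elements \<open>A_i\<close> of the
  statement need not belong to the chosen basis. They enter through a dimension count, which forces
  every basis element to have weight at most \<open>k\<close>.\<close>

definition jac :: "real^2^2 \<Rightarrow> complex \<Rightarrow> complex" where
  "jac A z = of_real (A$2$1) * z + of_real (A$2$2)"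

text \<open>This is the logarithmic derivative of \<open>jac A\<close>. Its additive relation
  \<open>xco_mult\<close> is the logarithmic derivative of the cocycle relation for
  \<open>jac\<close>, and it is the variable in which quasimodular transformation laws are
  polynomial.\<close>

definition xco :: "real^2^2 \<Rightarrow> complex \<Rightarrow> complex" where
  "xco A z = of_real (A$2$1) / jac A z"

section \<open>Moebius transformations and their cocycles\<close>

lemma matrix_mult_entry: "(A ** B)$i$j = A$i$1 * B$1$j + A$i$2 * (B :: real^2^2)$2$j"
  by (simp add: matrix_matrix_mult_def sum_2)

lemma open_UHP: "open UHP"
  unfolding UHP_def by (rule open_halfspace_Im_gt)

lemma connected_UHP: "connected UHP"
  unfolding UHP_def by (intro convex_connected convex_halfspace_Im_gt)

lemma jac_nonzero: "det A = 1 \<Longrightarrow> z \<in> UHP \<Longrightarrow> jac A z \<noteq> 0"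
  using moebius_denom_nz[of A z] by (simp add: jac_def SL2R_def)

lemma moebius_jac: "moebius A z = (of_real (A$1$1) * z + of_real (A$1$2)) / jac A z"
  by (simp add: moebius_def jac_def)

lemma Im_moebius:
  assumes "det A = 1"
  shows "Im (moebius A z) = Im z / (cmod (jac A z))\<^sup>2"
proof -
  have "Im (moebius A z) = (A$1$1 * A$2$2 - A$1$2 * A$2$1) * Im z / (cmod (jac A z))\<^sup>2"
    by (simp add: moebius_def jac_def Im_divide cmod_power2 algebra_simps)
  then show ?thesis using assms by (simp add: det_2)
qed

lemma moebius_UHP: "det A = 1 \<Longrightarrow> z \<in> UHP \<Longrightarrow> moebius A z \<in> UHP"
  using jac_nonzero[of A z] by (simp add: UHP_def Im_moebius)

lemma det_1_of_real:
  assumes "det (A::real^2^2) = 1"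
  shows "of_real (A$1$1) * of_real (A$2$2) = 1 + of_real (A$1$2) * (of_real (A$2$1) :: complex)"
proof -
  have "A$1$1 * A$2$2 = 1 + A$1$2 * A$2$1" using assms by (simp add: det_2)
  then have "(of_real (A$1$1 * A$2$2) :: complex) = of_real (1 + A$1$2 * A$2$1)" by (rule arg_cong)
  then show ?thesis by simp
qed

lemma jac_mult:
  assumes "det A = 1" "det B = 1" "z \<in> UHP"
  shows "jac (A ** B) z = jac A (moebius B z) * jac B z"
  using jac_nonzero[OF assms(2,3)]
  by (simp add: jac_def[of A] moebius_jac field_simps)
     (simp add: jac_def matrix_mult_entry algebra_simps)

lemma moebius_mult:
  assumes "det A = 1" "det B = 1" "z \<in> UHP"
  shows "moebius (A ** B) z = moebius A (moebius B z)"
proof -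
  have nz: "jac B z \<noteq> 0" "jac A (moebius B z) \<noteq> 0"
    using assms jac_nonzero moebius_UHP by blast+
  have "of_real ((A ** B)$1$1) * z + of_real ((A ** B)$1$2) =
      (of_real (A$1$1) * moebius B z + of_real (A$1$2)) * jac B z"
    using nz(1) by (simp add: moebius_jac[of B] field_simps)
       (simp add: jac_def matrix_mult_entry algebra_simps)
  then show ?thesis
    using nz by (simp add: moebius_jac[of "A ** B"] moebius_jac[of A] jac_mult[OF assms])
qed

lemma xco_mult:
  assumes "det A = 1" "det B = 1" "z \<in> UHP"
  shows "xco (A ** B) z = xco B z + xco A (moebius B z) / (jac B z)\<^sup>2"
proof -
  have nz: "jac B z \<noteq> 0" "jac A (moebius B z) \<noteq> 0" "jac (A ** B) z \<noteq> 0"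
    using assms jac_nonzero moebius_UHP jac_mult by (auto simp: det_mul)
  have d: "of_real (B$1$1) * of_real (B$2$2) = 1 + of_real (B$1$2) * (of_real (B$2$1) :: complex)"
    by (rule det_1_of_real[OF assms(2)])
  \<comment> \<open>The last summand is zero because \<open>det B = 1\<close>. With it the equation
    is a polynomial identity in all entries.\<close>
  have "of_real ((A ** B)$2$1) * jac B z =
      of_real (A$2$1) + of_real (B$2$1) * jac (A ** B) z + of_real (A$2$1) *
      (of_real (B$1$1) * of_real (B$2$2) - (1 + of_real (B$1$2) * of_real (B$2$1)))"
    by (simp add: jac_def matrix_mult_entry algebra_simps)
  then have "of_real ((A ** B)$2$1) * jac B z = of_real (A$2$1) + of_real (B$2$1) * jac (A ** B) z"
    by (simp add: d)
  then have "of_real ((A ** B)$2$1) = (of_real (A$2$1) + of_real (B$2$1) * (jac A (moebius B z) * jac B z)) / jac B z"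
    using nz jac_mult[OF assms] by (simp add: field_simps)
  then show ?thesis using nz
    unfolding xco_def jac_mult[OF assms] by (simp add: field_simps power2_eq_square)
qed

lemma jac_uminus: "jac (- A) z = - jac A z"
  by (simp add: jac_def)

lemma moebius_uminus: "moebius (- A) z = moebius A z"
proof -
  have "- (of_real (A$1$1) * z) - of_real (A$1$2) = - (of_real (A$1$1) * z + of_real (A$1$2))" by simp
  then show ?thesis by (simp only: moebius_jac jac_uminus vector_uminus_component of_real_minus
      mult_minus_left add_uminus_conv_diff minus_divide_divide)
qed

lemma jac_one [simp]: "jac (mat 1) z = 1"
  by (simp add: jac_def mat_def)

lemma moebius_one [simp]: "moebius (mat 1) z = z"
  by (simp add: moebius_jac) (simp add: mat_def)

lemma xco_one [simp]: "xco (mat 1) z = 0"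
  by (simp add: xco_def mat_def)

lemma jac_has_field_derivative: "(jac A has_field_derivative of_real (A$2$1)) (at z)"
  unfolding jac_def[abs_def] by (auto intro!: derivative_eq_intros)

lemma moebius_has_field_derivative:
  assumes "det A = 1" "z \<in> UHP"
  shows "(moebius A has_field_derivative 1 / (jac A z)\<^sup>2) (at z)"
proof -
  have nz: "jac A z \<noteq> 0" by (rule jac_nonzero[OF assms])
  have d: "of_real (A$1$1) * of_real (A$2$2) = 1 + of_real (A$1$2) * (of_real (A$2$1) :: complex)"
    by (rule det_1_of_real[OF assms(1)])
  have "((\<lambda>z. (of_real (A$1$1) * z + of_real (A$1$2)) / jac A z) has_field_derivative
      (of_real (A$1$1) * jac A z - (of_real (A$1$1) * z + of_real (A$1$2)) * of_real (A$2$1)) / (jac A z * jac A z)) (at z)"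
    using nz by (auto intro!: derivative_eq_intros jac_has_field_derivative)
  moreover have "of_real (A$1$1) * jac A z - (of_real (A$1$1) * z + of_real (A$1$2)) * of_real (A$2$1) = 1"
    by (simp add: jac_def algebra_simps d)
  ultimately show ?thesis unfolding moebius_jac[abs_def] by (simp add: power2_eq_square)
qed

lemma holomorphic_jac: "jac A holomorphic_on S"
  unfolding jac_def[abs_def] by (intro holomorphic_intros)

lemma holomorphic_moebius: "det A = 1 \<Longrightarrow> moebius A holomorphic_on UHP"
  by (metis field_differentiable_def holomorphic_on_def moebius_has_field_derivative
      field_differentiable_at_within)

lemma holomorphic_xco: "det A = 1 \<Longrightarrow> xco A holomorphic_on UHP"
  unfolding xco_def[abs_def] by (intro holomorphic_intros holomorphic_jac) (use jac_nonzero in auto)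

section \<open>The size of matrices and the counting of group elements\<close>

lemma cmod_jac_lower:
  assumes "z \<in> UHP"
  shows "\<bar>A$2$1\<bar> * Im z \<le> cmod (jac A z)"
    and "\<bar>A$2$2\<bar> \<le> (1 + cmod z / Im z) * cmod (jac A z)"
proof -
  have y: "Im z > 0" using assms by (simp add: UHP_def)
  have "\<bar>Im (jac A z)\<bar> \<le> cmod (jac A z)" by (rule abs_Im_le_cmod)
  then show 1: "\<bar>A$2$1\<bar> * Im z \<le> cmod (jac A z)" using y by (simp add: jac_def abs_mult)
  have "\<bar>A$2$2\<bar> = cmod (jac A z - of_real (A$2$1) * z)" by (simp add: jac_def)
  also have "\<dots> \<le> cmod (jac A z) + \<bar>A$2$1\<bar> * cmod z"
    by (metis norm_mult norm_of_real norm_triangle_ineq4)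
  also have "\<bar>A$2$1\<bar> * cmod z \<le> cmod (jac A z) / Im z * cmod z"
    using 1 y by (intro mult_right_mono) (auto simp: field_simps)
  finally show "\<bar>A$2$2\<bar> \<le> (1 + cmod z / Im z) * cmod (jac A z)" by (simp add: algebra_simps)
qed

text \<open>The l1 norm of all four entries, used as the height by which group elements are
  counted.\<close>

definition row_sum :: "real^2^2 \<Rightarrow> real" where
  "row_sum A = \<bar>A$1$1\<bar> + \<bar>A$1$2\<bar> + \<bar>A$2$1\<bar> + \<bar>A$2$2\<bar>"

text \<open>For \<open>z\<close> in a compact set the first factor is bounded, so the size of
  \<open>A\<close> is controlled by its automorphy factor and the position of the image point. This
  one estimate gives both proper discontinuity and the convergence of Poincare series.\<close>

lemma row_sum_bound:
  assumes z: "z \<in> UHP" and A: "det A = 1"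
  shows "row_sum A \<le> (1 + (1 + cmod z) / Im z) * (cmod (jac A z) * (1 + cmod (moebius A z)))"
proof -
  \<comment> \<open>The upper row of \<open>A\<close> is the lower row of \<open>B\<close>, so the bounds for \<open>jac\<close> apply to it too.\<close>
  define B where "B = ((\<chi> i j. if i = 1 then 0 else A$1$j) :: real^2^2)"
  have B: "jac B z = of_real (A$1$1) * z + of_real (A$1$2)" by (simp add: jac_def B_def)
  have "jac B z = moebius A z * jac A z"
    using jac_nonzero[OF A z] by (simp add: moebius_jac B)
  then have nB: "cmod (jac B z) = cmod (jac A z) * cmod (moebius A z)" by (simp add: norm_mult)
  have y: "Im z > 0" using z by (simp add: UHP_def)
  have *: "\<bar>M$2$1\<bar> + \<bar>M$2$2\<bar> \<le> (1 + (1 + cmod z) / Im z) * cmod (jac M z)" for M :: "real^2^2"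
  proof -
    have "\<bar>M$2$1\<bar> \<le> cmod (jac M z) / Im z" using cmod_jac_lower(1)[OF z, of M] y by (simp add: field_simps)
    with cmod_jac_lower(2)[OF z, of M] show ?thesis by (simp add: algebra_simps add_divide_distrib)
  qed
  let ?c = "1 + (1 + cmod z) / Im z"
  have "row_sum A = (\<bar>A$2$1\<bar> + \<bar>A$2$2\<bar>) + (\<bar>B$2$1\<bar> + \<bar>B$2$2\<bar>)" by (simp add: row_sum_def B_def)
  also have "\<dots> \<le> ?c * cmod (jac A z) + ?c * cmod (jac B z)" by (intro add_mono *)
  also have "\<dots> = ?c * (cmod (jac A z) * (1 + cmod (moebius A z)))" unfolding nB by (simp only: distrib_left mult_1_right)
  finally show ?thesis .
qed

text \<open>\<open>G\<close> is meant as the preimage in SL(2,R) of a subgroup of PSL(2,R), which is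
  why it contains \<open>- A\<close> along with \<open>A\<close>. Discreteness is stated at the
  identity, and cocompactness as a compact set that meets every orbit; these are the forms in which
  the two are used.\<close>

locale cocompact_group =
  fixes G :: "(real^2^2) set"
  assumes det_G: "A \<in> G \<Longrightarrow> det A = 1"
    and one_G: "mat 1 \<in> G"
    and neg_G: "A \<in> G \<Longrightarrow> - A \<in> G"
    and mult_G: "A \<in> G \<Longrightarrow> B \<in> G \<Longrightarrow> A ** B \<in> G"
    and inv_G: "A \<in> G \<Longrightarrow> \<exists>B\<in>G. A ** B = mat 1 \<and> B ** A = mat 1"
    and discrete_G: "\<exists>\<delta>>0. \<forall>A\<in>G. (\<forall>i j. \<bar>A$i$j - mat 1$i$j\<bar> < \<delta>) \<longrightarrow> A = mat 1"
    and cocompact_G: "\<exists>K. compact K \<and> K \<subseteq> UHP \<and> (\<forall>z\<in>UHP. \<exists>A\<in>G. moebius A z \<in> K)"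

text \<open>Bounds on the entries of a matrix thereby hold for its inverse too, as
  \<open>card_bounded_le\<close> requires.\<close>

lemma adjugate_mult:
  assumes "det A = 1" "A ** C = mat 1" "C ** A = mat (1::real)"
  shows "C = vector [vector [A$2$2, - A$1$2], vector [- A$2$1, (A::real^2^2)$1$1]]" (is "C = ?D")
proof -
  have "?D ** A = mat 1"
    using assms(1) by (simp add: vec_eq_iff forall_2 matrix_mult_entry mat_def det_2 algebra_simps vector_2)
  then have "?D = ?D ** (A ** C)" by (simp add: assms)
  also have "\<dots> = C" using \<open>?D ** A = mat 1\<close> by (simp add: matrix_mul_assoc)
  finally show ?thesis by simp
qed

context cocompact_group
begin


lemma moebius_G: "A \<in> G \<Longrightarrow> z \<in> UHP \<Longrightarrow> moebius A z \<in> UHP"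
  using det_G moebius_UHP by blast

text \<open>Two elements in the same box of a fine grid have a quotient close to the identity, so
  they are equal by discreteness. The mesh is of order \<open>1 / R\<close> in a cube of side
  \<open>R\<close>, which gives order \<open>R^2\<close> boxes in each of four coordinates. The
  exponent 8 is crude, but polynomial growth is all that is used.\<close>

lemma card_bounded_le:
  "\<exists>C::real. C > 0 \<and> (\<forall>R\<ge>1. finite {A\<in>G. row_sum A \<le> R} \<and> real (card {A\<in>G. row_sum A \<le> R}) \<le> C * R ^ 8)"
proof -
  obtain \<delta> where \<delta>: "\<delta> > 0" "\<And>A. A \<in> G \<Longrightarrow> (\<And>i j. \<bar>A$i$j - mat 1$i$j\<bar> < \<delta>) \<Longrightarrow> A = mat 1"
    using discrete_G by blast
  \<comment> \<open>The grid has mesh \<open>\<delta> / (2 * R)\<close>: multiplying a difference by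
    the inverse, whose entries are at most \<open>R\<close>, adds up two such errors.\<close>
  define N where "N = (\<lambda>R::real. 2 * R / \<delta>)"
  define \<Phi> where "\<Phi> = (\<lambda>R (A::real^2^2). (\<lfloor>N R * A$1$1\<rfloor>, \<lfloor>N R * A$1$2\<rfloor>, \<lfloor>N R * A$2$1\<rfloor>, \<lfloor>N R * A$2$2\<rfloor>))"
  have main: "finite {A\<in>G. row_sum A \<le> R} \<and> real (card {A\<in>G. row_sum A \<le> R}) \<le> (4 / \<delta> + 3) ^ 4 * R ^ 8"
    if R: "R \<ge> 1" for R
  proof -
    define S where "S = {A\<in>G. row_sum A \<le> R}"
    have Npos: "N R > 0" using R \<delta> by (simp add: N_def)
    have entry: "\<bar>A$i$j\<bar> \<le> R" if "A \<in> S" for A i j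
      using that exhaust_2[of i] exhaust_2[of j] unfolding S_def row_sum_def by force
    have inj: "inj_on (\<Phi> R) S"
    proof (rule inj_onI)
      fix A B assume A: "A \<in> S" and B: "B \<in> S" and eq: "\<Phi> R A = \<Phi> R B"
      have close: "\<bar>B$i$j - A$i$j\<bar> < \<delta> / (2 * R)" for i j
      proof -
        have "\<lfloor>N R * A$i$j\<rfloor> = \<lfloor>N R * B$i$j\<rfloor>"
          using eq exhaust_2[of i] exhaust_2[of j] unfolding \<Phi>_def by force
        then have "\<bar>N R * B$i$j - N R * A$i$j\<bar> < 1" by linarith
        then have "N R * \<bar>B$i$j - A$i$j\<bar> < 1"
          using Npos by (metis abs_mult abs_of_pos right_diff_distrib)
        then show ?thesis using Npos R \<delta>(1) by (simp add: N_def field_simps)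
      qed
      obtain C where C: "C \<in> G" "A ** C = mat 1" "C ** A = mat 1" using inv_G A S_def by blast
      have dA: "det A = 1" using A det_G S_def by blast
      have Cadj: "C = vector [vector [A$2$2, - A$1$2], vector [- A$2$1, A$1$1]]"
        by (rule adjugate_mult[OF dA C(2,3)])
      have Cent: "\<bar>C$i$j\<bar> \<le> R" for i j
        using entry[OF A] exhaust_2[of i] exhaust_2[of j] unfolding Cadj by (force simp: vector_2)
      have "C ** B = mat 1"
      proof (rule \<delta>(2))
        show "C ** B \<in> G" using C B mult_G S_def by blast
        fix i j
        have "(C ** B)$i$j - mat 1$i$j = (C ** B)$i$j - (C ** A)$i$j" by (simp add: C)
        also have "\<dots> = C$i$1 * (B$1$j - A$1$j) + C$i$2 * (B$2$j - A$2$j)"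
          by (simp add: matrix_mult_entry algebra_simps)
        also have "\<bar>\<dots>\<bar> \<le> \<bar>C$i$1\<bar> * \<bar>B$1$j - A$1$j\<bar> + \<bar>C$i$2\<bar> * \<bar>B$2$j - A$2$j\<bar>"
          by (rule order_trans[OF abs_triangle_ineq]) (simp add: abs_mult)
        also have "\<dots> \<le> R * \<bar>B$1$j - A$1$j\<bar> + R * \<bar>B$2$j - A$2$j\<bar>"
          using Cent by (intro add_mono mult_right_mono) auto
        also have "\<dots> < R * (\<delta> / (2 * R)) + R * (\<delta> / (2 * R))"
          using close R by (intro add_strict_mono mult_strict_left_mono) auto
        also have "\<dots> = \<delta>" using R by simp
        finally show "\<bar>(C ** B)$i$j - mat 1$i$j\<bar> < \<delta>" .
      qed
      then have "A ** (C ** B) = A" by simp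
      then show "A = B" using C by (simp add: matrix_mul_assoc)
    qed
    define b where "b = \<lceil>N R * R\<rceil>"
    have bnn: "b \<ge> 0" using mult_nonneg_nonneg[of "N R" R] Npos R unfolding b_def by linarith
    have fl: "\<lfloor>N R * A$i$j\<rfloor> \<in> {-b..b}" if "A \<in> S" for A i j
    proof -
      have "N R * \<bar>A$i$j\<bar> \<le> N R * R" using entry[OF that] Npos by simp
      then have "\<bar>N R * A$i$j\<bar> \<le> N R * R" using Npos by (simp add: abs_mult)
      then have "N R * A$i$j \<le> N R * R" "- (N R * R) \<le> N R * A$i$j" by linarith+
      then have "\<lfloor>N R * A$i$j\<rfloor> \<le> b" "- b \<le> \<lfloor>N R * A$i$j\<rfloor>" unfolding b_def by linarith+
      then show ?thesis by simp
    qed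
    let ?Box = "{-b..b} \<times> {-b..b} \<times> {-b..b} \<times> {-b..b}"
    have sub: "\<Phi> R ` S \<subseteq> ?Box" unfolding \<Phi>_def using fl by auto
    have finBox: "finite ?Box" by simp
    have fin: "finite S" using inj sub finBox by (meson finite_imageD finite_subset)
    have "card S \<le> card ?Box" using card_inj_on_le[OF inj sub finBox] .
    also have "\<dots> = nat (2 * b + 1) ^ 4" using bnn by (simp add: card_cartesian_product numeral_eq_Suc algebra_simps)
    finally have "real (card S) \<le> real (nat (2 * b + 1)) ^ 4" by (metis of_nat_le_iff of_nat_power)
    also have "real (nat (2 * b + 1)) \<le> (4 / \<delta> + 3) * R\<^sup>2"
    proof -
      have "real (nat (2 * b + 1)) = 2 * b + 1" using bnn by simp
      also have "\<dots> \<le> 2 * (N R * R + 1) + 1" 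
      proof -
        have "real_of_int b \<le> N R * R + 1" unfolding b_def by (rule of_int_ceiling_le_add_one)
        then show ?thesis by simp
      qed
      also have "\<dots> = 4 / \<delta> * R\<^sup>2 + 3" by (simp add: N_def power2_eq_square)
      also have "\<dots> \<le> 4 / \<delta> * R\<^sup>2 + 3 * R\<^sup>2" using one_le_power[OF R, of 2] by linarith
      also have "\<dots> = (4 / \<delta> + 3) * R\<^sup>2" by (simp only: distrib_right)
      finally show ?thesis .
    qed
    then have "real (nat (2 * b + 1)) ^ 4 \<le> ((4 / \<delta> + 3) * R\<^sup>2) ^ 4" by (intro power_mono) auto
    also have "\<dots> = (4 / \<delta> + 3) ^ 4 * R ^ 8" by (simp add: power_mult_distrib flip: power_mult)
    finally show ?thesis using fin by (simp add: S_def)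
  qed
  have "4 / \<delta> + 3 > 0" using \<delta>(1) by (simp add: add_pos_pos)
  then show ?thesis
    by (intro exI[of _ "(4 / \<delta> + 3) ^ 4"] conjI zero_less_power allI impI) (use main in auto)
qed

lemma finite_bounded: "finite {A\<in>G. row_sum A \<le> R}"
proof -
  have "finite {A\<in>G. row_sum A \<le> max 1 R}" using card_bounded_le by (meson max.cobounded1)
  then show ?thesis by (rule rev_finite_subset) auto
qed

lemma row_sum_ge_1:
  assumes "det A = 1" shows "row_sum A \<ge> 1"
proof (rule ccontr)
  assume "\<not> row_sum A \<ge> 1"
  then have l: "row_sum A < 1" by simp
  have "1 = \<bar>A$1$1 * A$2$2 - A$1$2 * A$2$1\<bar>" using assms by (simp add: det_2)
  also have "\<dots> \<le> \<bar>A$1$1\<bar> * \<bar>A$2$2\<bar> + \<bar>A$1$2\<bar> * \<bar>A$2$1\<bar>"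
    by (rule order_trans[OF abs_triangle_ineq4]) (simp add: abs_mult)
  also have "\<dots> \<le> \<bar>A$1$1\<bar> * 1 + \<bar>A$1$2\<bar> * 1"
    using l unfolding row_sum_def by (intro add_mono mult_left_mono) auto
  also have "\<dots> < 1" using l unfolding row_sum_def by linarith
  finally show False by simp
qed

text \<open>Sum over the shells where the integer part of \<open>row_sum\<close> is
  \<open>n\<close>. A shell has at most \<open>C (2 n)^8\<close> elements and terms at most
  \<open>n^(-10)\<close>, so it contributes order \<open>n^(-2)\<close>. This is the origin of the
  bound 10 for the weights of Poincare series.\<close>

lemma summable_row_sum:
  assumes "k \<ge> 10"
  shows "(\<lambda>A. 1 / row_sum A ^ k) summable_on G"
proof -
  obtain C where C: "C > 0" "\<And>R. R \<ge> 1 \<Longrightarrow> real (card {A\<in>G. row_sum A \<le> R}) \<le> C * R ^ 8"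
    using card_bounded_le by blast
  have sq: "summable (\<lambda>n. C * 2 ^ 8 * (1 / real n ^ 2))"
    using inverse_power_summable[of 2, where 'a = real] by (intro summable_mult) (simp add: field_simps)
  have "sum (\<lambda>A. 1 / row_sum A ^ k) F \<le> (\<Sum>n. C * 2 ^ 8 * (1 / real n ^ 2))"
    if F: "finite F" "F \<subseteq> G" for F
  proof -
    define fl where "fl = (\<lambda>A. nat \<lfloor>row_sum A\<rfloor>)"
    have g1: "row_sum A \<ge> 1" if "A \<in> F" for A using that F row_sum_ge_1 det_G by blast
    have flA: "real (fl A) \<le> row_sum A" "row_sum A < real (fl A) + 1" "fl A \<ge> 1" if "A \<in> F" for A
      using g1[OF that] unfolding fl_def by linarith+
    have "sum (\<lambda>A. 1 / row_sum A ^ k) F = (\<Sum>n\<in>fl ` F. sum (\<lambda>A. 1 / row_sum A ^ k) {A\<in>F. fl A = n})"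
      by (rule sum.image_gen[OF F(1)])
    also have "\<dots> \<le> (\<Sum>n\<in>fl ` F. C * 2 ^ 8 * (1 / real n ^ 2))"
    proof (rule sum_mono)
      fix n assume "n \<in> fl ` F"
      then have n: "n \<ge> 1" using flA by blast
      have "sum (\<lambda>A. 1 / row_sum A ^ k) {A\<in>F. fl A = n} \<le> (\<Sum>A\<in>{A\<in>F. fl A = n}. 1 / real n ^ 10)"
      proof (rule sum_mono)
        fix A assume A: "A \<in> {A\<in>F. fl A = n}"
        have "real n ^ 10 \<le> real n ^ k" using assms n by (intro power_increasing) auto
        also have "\<dots> \<le> row_sum A ^ k" using A flA by (intro power_mono) auto
        finally show "1 / row_sum A ^ k \<le> 1 / real n ^ 10" using n by (intro frac_le) auto
      qed
      also have "\<dots> = real (card {A\<in>F. fl A = n}) / real n ^ 10" by simp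
      also have "\<dots> \<le> (C * (2 * real n) ^ 8) / real n ^ 10"
      proof (rule divide_right_mono)
        have "{A\<in>F. fl A = n} \<subseteq> {A\<in>G. row_sum A \<le> 2 * real n}"
          using flA n F by fastforce
        then have "card {A\<in>F. fl A = n} \<le> card {A\<in>G. row_sum A \<le> 2 * real n}"
          by (intro card_mono finite_bounded)
        then show "real (card {A\<in>F. fl A = n}) \<le> C * (2 * real n) ^ 8"
          using C(2)[of "2 * real n"] n by linarith
      qed simp
      also have "\<dots> = C * 2 ^ 8 * (real n ^ 8 / (real n ^ 8 * real n ^ 2))"
        by (simp add: power_mult_distrib flip: power_add)
      also have "real n ^ 8 / (real n ^ 8 * real n ^ 2) = 1 / real n ^ 2"
        using n by (subst nonzero_divide_mult_cancel_left) auto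
      finally show "sum (\<lambda>A. 1 / row_sum A ^ k) {A\<in>F. fl A = n} \<le> C * 2 ^ 8 * (1 / real n ^ 2)" .
    qed
    also have "\<dots> \<le> (\<Sum>n. C * 2 ^ 8 * (1 / real n ^ 2))"
      using sq C(1) F by (intro sum_le_suminf) auto
    finally show ?thesis .
  qed
  then show ?thesis
    by (intro nonneg_bdd_above_summable_on bdd_aboveI2[where M = "\<Sum>n. C * 2 ^ 8 * (1 / real n ^ 2)"])
       (auto simp: row_sum_def)
qed

lemma compact_UHP_bounds:
  assumes "compact K" "K \<subseteq> UHP"
  shows "\<exists>m M. m > 0 \<and> M > 0 \<and> (\<forall>z\<in>K. m \<le> Im z \<and> cmod z \<le> M)"
proof (cases "K = {}")
  case False
  obtain w where w: "w \<in> K" "\<And>z. z \<in> K \<Longrightarrow> Im w \<le> Im z"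
    using continuous_attains_inf[OF assms(1) False, of Im] continuous_on_Im[OF continuous_on_id, of K]
    by (metis id_apply)
  obtain M where M: "M > 0" "\<And>z. z \<in> K \<Longrightarrow> cmod z \<le> M"
    using compact_imp_bounded[OF assms(1)] by (auto simp: bounded_pos)
  have "Im w > 0" using w(1) assms(2) by (auto simp: UHP_def)
  then show ?thesis using M w(2) by blast
next
  case True
  show ?thesis using True by (auto intro: exI[of _ 1])
qed

text \<open>Proper discontinuity: since \<open>Im (moebius A z) = Im z / |jac A z|^2\<close>, a
  lower bound for the image height bounds \<open>jac\<close>, then \<open>row_sum_bound\<close>
  bounds the matrix.\<close>

lemma finite_meeting:
  assumes K: "compact K" "K \<subseteq> UHP" and L: "compact L" "L \<subseteq> UHP"
  shows "finite {A\<in>G. \<exists>z\<in>K. moebius A z \<in> L}"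
proof -
  obtain m M where m: "m > 0" "M > 0" "\<And>z. z \<in> K \<Longrightarrow> m \<le> Im z" "\<And>z. z \<in> K \<Longrightarrow> cmod z \<le> M"
    using compact_UHP_bounds[OF K] by blast
  obtain m' M' where m': "m' > 0" "M' > 0" "\<And>z. z \<in> L \<Longrightarrow> m' \<le> Im z" "\<And>z. z \<in> L \<Longrightarrow> cmod z \<le> M'"
    using compact_UHP_bounds[OF L] by blast
  have "row_sum A \<le> (1 + (1 + M) / m) * (sqrt (M / m') * (1 + M'))" if A: "A \<in> G" "z \<in> K" "moebius A z \<in> L" for A z
  proof -
    have z: "z \<in> UHP" using A K by blast
    have y: "Im z > 0" using z by (simp add: UHP_def)
    have nz: "cmod (jac A z) > 0" using jac_nonzero[OF det_G[OF A(1)] z] by simp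
    have "m' \<le> Im z / (cmod (jac A z))\<^sup>2" using m'(3)[OF A(3)] Im_moebius[OF det_G[OF A(1)]] by simp
    then have "(cmod (jac A z))\<^sup>2 \<le> Im z / m'" using nz m'(1) by (simp add: field_simps)
    also have "\<dots> \<le> M / m'" using m(4)[OF A(2)] abs_Im_le_cmod[of z] m'(1) by (intro divide_right_mono) auto
    finally have j: "cmod (jac A z) \<le> sqrt (M / m')" by (rule real_le_rsqrt)
    have "row_sum A \<le> (1 + (1 + cmod z) / Im z) * (cmod (jac A z) * (1 + cmod (moebius A z)))"
      by (rule row_sum_bound[OF z det_G[OF A(1)]])
    also have "\<dots> \<le> (1 + (1 + M) / m) * (sqrt (M / m') * (1 + M'))"
      using m m' A y j
      by (intro mult_mono add_mono frac_le) (auto intro!: mult_nonneg_nonneg add_nonneg_nonneg divide_nonneg_nonneg)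
    finally show ?thesis .
  qed
  then have "{A\<in>G. \<exists>z\<in>K. moebius A z \<in> L} \<subseteq> {A\<in>G. row_sum A \<le> (1 + (1 + M) / m) * (sqrt (M / m') * (1 + M'))}"
    by blast
  then show ?thesis using finite_bounded by (rule finite_subset)
qed

end

section \<open>From cosets in PSL(2,R) to matrices\<close>

lemma center_coset: "{mat 1, - mat 1} #>\<^bsub>SL2R\<^esub> A = {A, - A}"
  by (auto simp add: r_coset_def SL2R_def uminus_matrix_mult)

lemma carrier_PSL2R: "carrier PSL2R = (\<lambda>A. {A, - A}) ` {A. det A = 1}"
  unfolding PSL2R_def FactGroup_def RCOSETS_def center_coset by (auto simp: SL2R_def)

lemma PSL2R_element:
  assumes "\<gamma> \<in> carrier PSL2R" "A \<in> \<gamma>"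
  shows "\<gamma> = {A, - A}" "det A = 1"
  using assms unfolding carrier_PSL2R by (auto simp: det_uminus_2)

lemma PSL2R_mult_mem: "A \<in> \<gamma> \<Longrightarrow> B \<in> \<gamma>' \<Longrightarrow> A ** B \<in> \<gamma> \<otimes>\<^bsub>PSL2R\<^esub> \<gamma>'"
  unfolding PSL2R_def FactGroup_def set_mult_def by (auto simp: SL2R_def)

lemma PSL2R_one: "\<one>\<^bsub>PSL2R\<^esub> = {mat 1, - mat 1}"
  by (simp add: PSL2R_def FactGroup_def)

text \<open>The identity class is relatively open, and by the quotient topology an open set of
  matrices cuts it out upstairs. A ball about \<open>mat 1\<close> inside that set can contain only
  \<open>mat 1\<close> and \<open>- mat 1\<close> from the group.\<close>

lemma discrete_matrices:
  assumes sub: "subgroup \<Gamma> PSL2R" and "discrete_in_PSL2R \<Gamma>"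
  shows "\<exists>\<delta>>0. \<forall>A\<in>\<Union>\<Gamma>. (\<forall>i j. \<bar>A$i$j - mat 1$i$j\<bar> < \<delta>) \<longrightarrow> A = mat 1"
proof -
  have 1: "{mat 1, - mat 1} \<in> \<Gamma>"
    using subgroup.one_closed[OF sub] by (simp add: PSL2R_one)
  have "openin (subtopology PSL2R_topology \<Gamma>) {{mat 1, - mat 1}}"
    using assms(2) 1 unfolding discrete_in_PSL2R_def by simp
  then obtain U where U: "openin PSL2R_topology U" "{{mat 1, - mat 1}} = U \<inter> \<Gamma>"
    unfolding openin_subtopology by blast
  have "openin (top_of_set (carrier SL2R)) {A \<in> carrier SL2R. {A, - A} \<in> U}"
    using U(1) unfolding PSL2R_topology_def openin_quotient_topology center_coset by simp
  then obtain T where T: "open T" "{A \<in> carrier SL2R. {A, - A} \<in> U} = carrier SL2R \<inter> T"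
    unfolding openin_open by blast
  have "mat 1 \<in> {A \<in> carrier SL2R. {A, - A} \<in> U}" using U(2) by (auto simp: SL2R_def)
  then obtain e where e: "e > 0" "ball (mat 1) e \<subseteq> T" using T open_contains_ball by blast
  \<comment> \<open>The 4 accounts for the four entries in the norm estimate. The 1 excludes
    \<open>- mat 1\<close>, whose first entry differs from that of \<open>mat 1\<close> by
    2.\<close>
  define \<delta> where "\<delta> = min 1 (e / 4)"
  have "A = mat 1" if A: "A \<in> \<Union>\<Gamma>" "\<And>i j. \<bar>A$i$j - mat 1$i$j\<bar> < \<delta>" for A
  proof -
    have sl: "A \<in> carrier SL2R"
      using Union_PSL2R_subset[OF subgroup.subset[OF sub]] A by blast
    have *: "norm x \<le> \<bar>x$1\<bar> + \<bar>x$2\<bar>" for x :: "real^2"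
      using norm_le_l1_cart[of x] by (simp add: sum_2)
    have "norm (A - mat 1) \<le> (\<Sum>i\<in>UNIV. norm ((A - mat 1)$i))"
      unfolding norm_vec_def[of "A - mat 1"] by (rule L2_set_le_sum) simp
    then have "norm (A - mat 1) \<le> norm ((A - mat 1)$1) + norm ((A - mat 1)$2)"
      by (simp only: sum_2)
    also have "\<dots> \<le> (\<bar>(A - mat 1)$1$1\<bar> + \<bar>(A - mat 1)$1$2\<bar>) + (\<bar>(A - mat 1)$2$1\<bar> + \<bar>(A - mat 1)$2$2\<bar>)"
      by (intro add_mono *)
    also have "\<dots> < e" using A(2)[of 1 1] A(2)[of 1 2] A(2)[of 2 1] A(2)[of 2 2]
      unfolding \<delta>_def by simp
    finally have "A \<in> T" using e by (auto simp: dist_norm norm_minus_commute)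
    then have "{A, - A} \<in> U" using T sl by blast
    moreover have "{A, - A} \<in> \<Gamma>"
    proof -
      obtain \<gamma> where "\<gamma> \<in> \<Gamma>" "A \<in> \<gamma>" using A(1) by blast
      then show ?thesis using PSL2R_element(1)[of \<gamma> A] subgroup.subset[OF sub] by auto
    qed
    ultimately have "{A, - A} \<in> {{mat 1, - mat 1}}" unfolding U(2) by (rule IntI)
    then have "A \<in> {mat 1, - mat 1}" by (metis insertI1 singletonD)
    then have "A = mat 1 \<or> A = - mat 1" by simp
    moreover have "A \<noteq> - mat 1" using A(2)[of 1 1] by (auto simp: \<delta>_def mat_def)
    ultimately show ?thesis by blast
  qed
  then show ?thesis using e(1) by (intro exI[of _ \<delta>]) (auto simp: \<delta>_def)
qed

text \<open>The half plane is exhausted by open sets \<open>U n\<close> with compact closure in it.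
  The images of their saturations \<open>W n\<close> form an open cover of the quotient; as the
  \<open>U n\<close> increase, a finite subcover means that one \<open>U N\<close> meets every
  orbit, and \<open>K\<close> contains it.\<close>

lemma cocompact_fundamental_set:
  assumes det: "\<And>A. A \<in> \<Union>\<Gamma> \<Longrightarrow> det A = 1" and one: "mat 1 \<in> \<Union>\<Gamma>"
    and "cocompact \<Gamma>"
  shows "\<exists>K. compact K \<and> K \<subseteq> UHP \<and> (\<forall>z\<in>UHP. \<exists>A\<in>\<Union>\<Gamma>. moebius A z \<in> K)"
proof -
  define U where "U = (\<lambda>n::nat. {z. Im z > 1 / (real n + 1) \<and> cmod z < real n + 1})"
  define W where "W = (\<lambda>n. {z \<in> UHP. \<exists>A\<in>\<Union>\<Gamma>. moebius A z \<in> U n})"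
  have openU: "open (U n)" for n
    unfolding U_def by (intro open_Collect_conj open_Collect_less continuous_intros)
  have openW: "open (W n)" for n
  proof -
    have "open (UHP \<inter> moebius A -` U n)" if "A \<in> \<Union>\<Gamma>" for A
      by (rule continuous_open_preimage[OF holomorphic_on_imp_continuous_on[OF holomorphic_moebius] open_UHP openU])
         (rule det[OF that])
    moreover have "W n = (\<Union>A\<in>\<Union>\<Gamma>. UHP \<inter> moebius A -` U n)" unfolding W_def by blast
    ultimately show ?thesis by (metis (no_types, lifting) open_UN)
  qed
  let ?q = "orbit_map \<Gamma>" and ?Q = "quotient_topology (top_of_set UHP) (orbit_map \<Gamma>)"
  \<comment> \<open>\<open>W n\<close> is saturated, so its image is open in the quotient
    topology.\<close>
  have sat: "{z \<in> topspace (top_of_set UHP). ?q z \<in> ?q ` W n} = W n" for n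
  proof -
    have "z \<in> W n" if z: "z \<in> UHP" "w \<in> W n" "?q z = ?q w" for z w
    proof -
      obtain A where "A \<in> \<Union>\<Gamma>" "moebius A w \<in> U n" using z(2) unfolding W_def by blast
      then have "moebius A w \<in> ?q z" using z(3) by (simp add: orbit_map_def)
      then obtain B where "B \<in> \<Union>\<Gamma>" "moebius A w = moebius B z"
        unfolding orbit_map_def by (metis (no_types, lifting) imageE)
      then have "\<exists>B\<in>\<Union>\<Gamma>. moebius B z \<in> U n" using \<open>moebius A w \<in> U n\<close> by metis
      then show ?thesis using z(1) unfolding W_def by (intro CollectI conjI)
    qed
    moreover have "W n \<subseteq> UHP" unfolding W_def by blast
    ultimately show ?thesis by auto
  qed
  have op: "openin ?Q (?q ` W n)" for n
    unfolding openin_quotient_topology sat using openW[of n] unfolding W_def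
    by (auto intro!: openin_open_subtopology[THEN iffD2] simp: openin_open_eq[OF open_UHP])
  have cover: "topspace ?Q \<subseteq> \<Union>(range (\<lambda>n. ?q ` W n))"
  proof -
    have "\<exists>n. z \<in> W n" if z: "z \<in> UHP" for z
    proof -
      have y: "Im z > 0" using z by (simp add: UHP_def)
      obtain n where n: "real n > max (1 / Im z) (cmod z)" using reals_Archimedean2 by blast
      have "1 < Im z * (real n + 1)" using n y by (simp add: field_simps)
      then have "moebius (mat 1) z \<in> U n" using n by (simp add: U_def field_simps)
      then show ?thesis using one z unfolding W_def by blast
    qed
    then show ?thesis unfolding topspace_quotient_topology topspace_euclidean_subtopology by fast
  qed
  have "compactin ?Q (topspace ?Q)" using assms(3) by (simp add: cocompact_def compact_space_def)
  then obtain F where F: "finite F" "F \<subseteq> range (\<lambda>n. ?q ` W n)" "topspace ?Q \<subseteq> \<Union>F"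
    using cover op unfolding compactin_def by (metis (no_types, lifting) rangeE)
  obtain I where I: "finite I" "F = (\<lambda>n. ?q ` W n) ` I"
    using finite_subset_image[OF F(1,2)] by blast
  define N where "N = Max (insert 0 I)"
  have mono: "U n \<subseteq> U N" if "n \<in> I" for n
  proof -
    have "n \<le> N" using that I by (simp add: N_def)
    then have "1 / (real N + 1) \<le> 1 / (real n + 1)" by (intro divide_left_mono) auto
    then show ?thesis using \<open>n \<le> N\<close> unfolding U_def by auto
  qed
  define K where "K = {z. Im z \<ge> 1 / (real N + 1) \<and> cmod z \<le> real N + 1}"
  have "closed K" unfolding K_def by (intro closed_Collect_conj closed_Collect_le continuous_intros)
  moreover have "bounded K" unfolding K_def bounded_iff by blast
  ultimately have "compact K" by (simp add: compact_eq_bounded_closed)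
  moreover have "K \<subseteq> UHP" unfolding K_def UHP_def by (auto intro: less_le_trans[rotated])
  moreover have "\<exists>A\<in>\<Union>\<Gamma>. moebius A z \<in> K" if z: "z \<in> UHP" for z
  proof -
    have "?q z \<in> \<Union>F" using F(3) z by auto
    then obtain n w where n: "n \<in> I" "w \<in> W n" "?q z = ?q w" using I(2) by auto
    then have "z \<in> W n" using sat[of n] z by auto
    then have "\<exists>A\<in>\<Union>\<Gamma>. moebius A z \<in> U N" using mono[OF n(1)] unfolding W_def by blast
    moreover have "U N \<subseteq> K" unfolding U_def K_def by auto
    ultimately show ?thesis by blast
  qed
  ultimately show ?thesis by blast
qed

lemma cocompact_group_Union:
  assumes sub: "subgroup \<Gamma> PSL2R" and "discrete_in_PSL2R \<Gamma>" and "cocompact \<Gamma>"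
  shows "cocompact_group (\<Union>\<Gamma>)"
proof -
  note el = PSL2R_element[OF subsetD[OF subgroup.subset[OF sub]]]
  have d: "det A = 1" if "A \<in> \<Union>\<Gamma>" for A using that el by blast
  have 1: "mat 1 \<in> \<Union>\<Gamma>" using subgroup.one_closed[OF sub] by (auto simp: PSL2R_one)
  have neg: "- A \<in> \<Union>\<Gamma>" if "A \<in> \<Union>\<Gamma>" for A using that el by blast
  show ?thesis
  proof
    fix A B assume "A \<in> \<Union>\<Gamma>" "B \<in> \<Union>\<Gamma>"
    then show "A ** B \<in> \<Union>\<Gamma>"
      using subgroup.m_closed[OF sub] PSL2R_mult_mem by (meson UnionE UnionI)
  next
    fix A assume A: "A \<in> \<Union>\<Gamma>"
    then obtain \<gamma> where \<gamma>: "\<gamma> \<in> \<Gamma>" "A \<in> \<gamma>" by blast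
    have inv: "inv\<^bsub>PSL2R\<^esub> \<gamma> \<in> \<Gamma>" by (rule subgroup.m_inv_closed[OF sub \<gamma>(1)])
    then obtain B where B: "B \<in> inv\<^bsub>PSL2R\<^esub> \<gamma>"
      using subgroup.subset[OF sub] unfolding carrier_PSL2R by blast
    have "A ** B \<in> \<one>\<^bsub>PSL2R\<^esub>"
      using PSL2R_mult_mem[OF \<gamma>(2) B] group.r_inv[OF group_PSL2R] \<gamma>(1) subgroup.subset[OF sub] by auto
    \<comment> \<open>A representative of the inverse class is an inverse matrix only up to
      sign.\<close>
    then have "A ** B = mat 1 \<or> A ** (- B) = mat 1" unfolding PSL2R_one by (auto simp: matrix_mult_uminus)
    moreover have "B \<in> \<Union>\<Gamma>" using B inv by blast
    ultimately show "\<exists>B\<in>\<Union>\<Gamma>. A ** B = mat 1 \<and> B ** A = mat 1"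
      using neg matrix_left_right_inverse by blast
  qed (use d 1 neg discrete_matrices[OF assms(1,2)] cocompact_fundamental_set[OF d 1 assms(3)] in auto)
qed

section \<open>Automorphic forms, and their vanishing in negative and odd weight\<close>

lemma i_in_UHP: "\<i> \<in> UHP" by (simp add: UHP_def)

context cocompact_group
begin

text \<open>Weights are integers because the coefficients of a quasimodular form of weight
  \<open>k\<close> have weights \<open>k - 2 i\<close>, possibly negative. Moderate growth is
  supplied by \<open>qexp_moderate_growth\<close>.\<close>

definition aut :: "int \<Rightarrow> (complex \<Rightarrow> complex) set" where
  "aut k = {f. f holomorphic_on UHP \<and> (\<forall>z. z \<notin> UHP \<longrightarrow> f z = 0) \<and>
     (\<forall>A\<in>G. \<forall>z\<in>UHP. f (moebius A z) = jac A z powi k * f z)}"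

text \<open>The pointwise Petersson norm. As an invariant function it attains its maximum on a
  compact set meeting every orbit.\<close>

lemma norm_aut_invariant:
  assumes "f \<in> aut k" "A \<in> G" "z \<in> UHP"
  shows "cmod (f (moebius A z)) * Im (moebius A z) powr (k / 2) = cmod (f z) * Im z powr (k / 2)"
proof -
  have nz: "cmod (jac A z) > 0" using jac_nonzero[OF det_G[OF assms(2)] assms(3)] by simp
  have y: "Im z > 0" using assms(3) by (simp add: UHP_def)
  have "((cmod (jac A z))\<^sup>2) powr (k / 2) = cmod (jac A z) powr k"
    using nz powr_powr[of "cmod (jac A z)" 2 "k / 2"] by (simp add: powr_numeral)
  also have "\<dots> = cmod (jac A z) powi k" using nz by (simp add: powr_real_of_int')
  finally have "((cmod (jac A z))\<^sup>2) powr (k / 2) = cmod (jac A z powi k)" by (simp add: norm_power_int)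
  moreover have "f (moebius A z) = jac A z powi k * f z" using assms by (simp add: aut_def)
  moreover have "Im (moebius A z) = Im z / (cmod (jac A z))\<^sup>2" by (rule Im_moebius[OF det_G[OF assms(2)]])
  moreover have "cmod (jac A z powi k) > 0" using nz by (simp add: norm_power_int)
  ultimately show ?thesis using y nz by (simp add: powr_divide norm_mult)
qed

lemma aut_attains_max:
  assumes "f \<in> aut k"
  obtains z0 where "z0 \<in> UHP" "\<And>z. z \<in> UHP \<Longrightarrow> cmod (f z) * Im z powr (k / 2) \<le> cmod (f z0) * Im z0 powr (k / 2)"
proof -
  obtain K where K: "compact K" "K \<subseteq> UHP" "\<And>z. z \<in> UHP \<Longrightarrow> \<exists>A\<in>G. moebius A z \<in> K"
    using cocompact_G by blast
  have "K \<noteq> {}" using K(3)[OF i_in_UHP] by blast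
  moreover have "continuous_on K f"
    using assms K(2) by (auto simp: aut_def intro: holomorphic_on_imp_continuous_on holomorphic_on_subset)
  then have "continuous_on K (\<lambda>z. cmod (f z) * Im z powr (k / 2))"
    using K(2) by (intro continuous_intros) (auto simp: UHP_def)
  ultimately obtain z0 where z0: "z0 \<in> K" "\<And>z. z \<in> K \<Longrightarrow> cmod (f z) * Im z powr (k / 2) \<le> cmod (f z0) * Im z0 powr (k / 2)"
    using continuous_attains_sup[OF K(1)] by blast
  show ?thesis
  proof (rule that[of z0])
    show "z0 \<in> UHP" using z0 K by blast
    fix z assume z: "z \<in> UHP"
    then obtain A where "A \<in> G" "moebius A z \<in> K" using K(3) by blast
    then show "cmod (f z) * Im z powr (k / 2) \<le> cmod (f z0) * Im z0 powr (k / 2)"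
      using z0(2)[of "moebius A z"] norm_aut_invariant[OF assms _ z] by simp
  qed
qed

text \<open>In weight zero the invariant norm is \<open>|f|\<close> itself, so the maximum modulus
  principle applies directly.\<close>

lemma aut_zero_weight_constant:
  assumes "f \<in> aut 0"
  obtains c where "\<And>z. z \<in> UHP \<Longrightarrow> f z = c"
proof -
  obtain z0 where z0: "z0 \<in> UHP" "\<And>z. z \<in> UHP \<Longrightarrow> cmod (f z) * Im z powr (of_int 0 / 2) \<le> cmod (f z0) * Im z0 powr (of_int 0 / 2)"
    using aut_attains_max[OF assms] by blast
  have "cmod (f z) \<le> cmod (f z0)" if "z \<in> UHP" for z
    using z0(2)[OF that] that z0(1) by (simp add: UHP_def)
  then have "f constant_on UHP"
    using assms z0(1) by (intro maximum_modulus_principle[OF _ open_UHP connected_UHP open_UHP]) (auto simp: aut_def)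
  then show ?thesis using that unfolding constant_on_def by blast
qed

text \<open>With \<open>z\<^sub>0\<close> the maximum point of \<open>|f| y\<^sup>k\<^sup>/\<^sup>2\<close>, multiplication by \<open>exp (i m z / y\<^sub>0)\<close>
  turns the bound into an honest maximum of a holomorphic function because \<open>ln t \<le> t - 1\<close>.\<close>

lemma aut_negative_weight:
  assumes f: "f \<in> aut k" and "k < 0"
  shows "f = 0"
proof -
  obtain z0 where z0: "z0 \<in> UHP" "\<And>z. z \<in> UHP \<Longrightarrow> cmod (f z) * Im z powr (k / 2) \<le> cmod (f z0) * Im z0 powr (k / 2)"
    using aut_attains_max[OF f] by blast
  define m :: real where "m = - (k / 2)"
  define y0 where "y0 = Im z0"
  have m: "m > 0" using assms(2) by (simp add: m_def)
  have y0: "y0 > 0" using z0(1) by (simp add: y0_def UHP_def)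
  have bound: "cmod (f z) \<le> cmod (f z0) * exp (m * ln (Im z / y0))" if z: "z \<in> UHP" for z
  proof -
    have y: "Im z > 0" using z by (simp add: UHP_def)
    have "cmod (f z) * exp (- m * ln (Im z)) \<le> cmod (f z0) * exp (- m * ln y0)"
      using z0(2)[OF z] y y0 by (simp add: powr_def m_def y0_def)
    then have "cmod (f z) * exp (- m * ln (Im z)) * exp (m * ln (Im z)) \<le> cmod (f z0) * exp (- m * ln y0) * exp (m * ln (Im z))"
      by (rule mult_right_mono) simp
    then show ?thesis using y y0 by (simp add: mult.assoc ln_div right_diff_distrib flip: exp_add)
  qed
  define g where "g = (\<lambda>z. f z * exp (\<i> * of_real (m / y0) * z))"
  have ng: "cmod (g z) = cmod (f z) * exp (- (m * (Im z / y0)))" for z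
    by (simp add: g_def norm_mult norm_exp_eq_Re)
  have gz0: "cmod (g z0) = cmod (f z0) * exp (- m)" using y0 by (simp add: ng flip: y0_def)
  have gb: "cmod (g z) \<le> cmod (f z0) * exp (m * (ln (Im z / y0) - Im z / y0))" if z: "z \<in> UHP" for z
    using mult_right_mono[OF bound[OF z], of "exp (- (m * (Im z / y0)))"]
    by (simp add: ng mult.assoc right_diff_distrib flip: exp_add)
  have "cmod (g z) \<le> cmod (g z0)" if z: "z \<in> UHP" for z
  proof -
    have "Im z / y0 > 0" using z y0 by (simp add: UHP_def)
    then have "ln (Im z / y0) - Im z / y0 \<le> - 1" using ln_le_minus_one[of "Im z / y0"] by linarith
    then have "m * (ln (Im z / y0) - Im z / y0) \<le> m * (- 1)" using m by (intro mult_left_mono) auto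
    then have "exp (m * (ln (Im z / y0) - Im z / y0)) \<le> exp (- m)" by simp
    then have "cmod (f z0) * exp (m * (ln (Im z / y0) - Im z / y0)) \<le> cmod (f z0) * exp (- m)"
      by (rule mult_left_mono) simp
    then show ?thesis using gb[OF z] unfolding gz0 by linarith
  qed
  moreover have "g holomorphic_on UHP"
    using f unfolding g_def aut_def by (intro holomorphic_intros) auto
  ultimately have "g constant_on UHP"
    using z0(1) by (intro maximum_modulus_principle[OF _ open_UHP connected_UHP open_UHP]) auto
  \<comment> \<open>At height \<open>2 * y0\<close> the inequality \<open>ln t \<le> t - 1\<close>
    is strict, so the constancy of \<open>g\<close> forces \<open>f z0 = 0\<close>, and then
    \<open>bound\<close> gives \<open>f = 0\<close>.\<close>
  moreover have w: "\<i> * of_real (2 * y0) \<in> UHP" using y0 by (simp add: UHP_def)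
  ultimately have "g (\<i> * of_real (2 * y0)) = g z0" using z0(1) unfolding constant_on_def by metis
  then have "cmod (f z0) * exp (- m) \<le> cmod (f z0) * exp (m * (ln 2 - 2))"
    using gb[OF w] y0 unfolding gz0[symmetric] by simp
  moreover have "m * (ln 2 - 2) < m * (-1)" using m ln_2_less_1 by (intro mult_strict_left_mono) auto
  then have "exp (m * (ln 2 - 2)) < exp (- m)" by simp
  ultimately have "cmod (f z0) \<le> 0"
    by (metis mult_le_cancel_left linorder_not_less)
  then have "f z = 0" if "z \<in> UHP" for z using bound[OF that] by simp
  then show ?thesis using f by (auto simp: aut_def fun_eq_iff)
qed

text \<open>\<open>- mat 1\<close> acts trivially on points but has automorphy factor -1.\<close>

lemma aut_odd_weight:
  assumes f: "f \<in> aut k" and "odd k"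
  shows "f = 0"
proof
  fix z
  have "f (moebius (- mat 1) z) = jac (- mat 1) z powi k * f z" if "z \<in> UHP"
    using f neg_G[OF one_G] that unfolding aut_def by blast
  then have "f z = - f z" if "z \<in> UHP" using that assms(2) by (simp add: moebius_uminus jac_uminus)
  then show "f z = 0 z" using f by (cases "z \<in> UHP") (auto simp: aut_def)
qed

end

section \<open>Continuously differentiable functions and the d-bar operator\<close>

definition C1_on :: "complex set \<Rightarrow> (complex \<Rightarrow> complex) \<Rightarrow> bool" where
  "C1_on S f \<longleftrightarrow> (\<forall>z\<in>S. f differentiable (at z)) \<and>
     (\<forall>h. continuous_on S (\<lambda>z. frechet_derivative f (at z) h))"

definition dbar :: "(complex \<Rightarrow> complex) \<Rightarrow> complex \<Rightarrow> complex" where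
  "dbar f z = (frechet_derivative f (at z) 1 + \<i> * frechet_derivative f (at z) \<i>) / 2"

lemma C1_onI:
  assumes "\<And>z. z \<in> S \<Longrightarrow> (f has_derivative f' z) (at z)" "\<And>h. continuous_on S (\<lambda>z. f' z h)"
  shows "C1_on S f"
proof -
  have eq: "frechet_derivative f (at z) = f' z" if "z \<in> S" for z
    using frechet_derivative_at[OF assms(1)[OF that]] by simp
  have "continuous_on S (\<lambda>z. frechet_derivative f (at z) h)" for h
    using assms(2)[of h] eq by (simp cong: continuous_on_cong_simp)
  then show ?thesis using assms(1) unfolding C1_on_def differentiable_def by blast
qed

lemma C1_on_has_derivative:
  "C1_on S f \<Longrightarrow> z \<in> S \<Longrightarrow> (f has_derivative frechet_derivative f (at z)) (at z)"
  by (simp add: C1_on_def frechet_derivative_works)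

lemma C1_on_continuous: "C1_on S f \<Longrightarrow> continuous_on S f"
  by (meson C1_on_has_derivative continuous_at_imp_continuous_on has_derivative_continuous)

lemma C1_on_subset: "C1_on S f \<Longrightarrow> T \<subseteq> S \<Longrightarrow> C1_on T f"
  unfolding C1_on_def by (meson continuous_on_subset subset_iff)

lemma C1_on_cong:
  assumes "C1_on S f" "open S" "\<And>z. z \<in> S \<Longrightarrow> f z = g z"
  shows "C1_on S g"
proof (rule C1_onI)
  show "(g has_derivative frechet_derivative f (at z)) (at z)" if "z \<in> S" for z
    by (rule has_derivative_transform_within_open[OF C1_on_has_derivative[OF assms(1) that] assms(2) that assms(3)])
  show "continuous_on S (\<lambda>z. frechet_derivative f (at z) h)" for h
    using assms(1) by (simp add: C1_on_def)
qed

lemma C1_on_locally: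
  assumes "\<And>z. z \<in> S \<Longrightarrow> \<exists>N. open N \<and> z \<in> N \<and> C1_on N f"
  shows "C1_on S f"
  unfolding C1_on_def
proof (intro conjI ballI allI)
  show "f differentiable at z" if "z \<in> S" for z using assms[OF that] by (auto simp: C1_on_def)
  show "continuous_on S (\<lambda>z. frechet_derivative f (at z) h)" for h
    unfolding continuous_on_eq_continuous_within
  proof
    fix z assume "z \<in> S"
    then obtain N where "open N" "z \<in> N" "C1_on N f" using assms by blast
    then have "continuous (at z) (\<lambda>z. frechet_derivative f (at z) h)"
      by (simp add: C1_on_def continuous_on_eq_continuous_at)
    then show "continuous (at z within S) (\<lambda>z. frechet_derivative f (at z) h)"
      by (rule continuous_at_imp_continuous_within)
  qed
qed

lemma C1_on_mult:
  assumes "C1_on S f" "C1_on S g"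
  shows "C1_on S (\<lambda>z. f z * g z)"
proof (rule C1_onI)
  show "((\<lambda>z. f z * g z) has_derivative (\<lambda>h. f z * frechet_derivative g (at z) h + frechet_derivative f (at z) h * g z)) (at z)"
    if "z \<in> S" for z
    by (rule has_derivative_mult[OF C1_on_has_derivative[OF assms(1) that] C1_on_has_derivative[OF assms(2) that]])
  show "continuous_on S (\<lambda>z. f z * frechet_derivative g (at z) h + frechet_derivative f (at z) h * g z)" for h
    using assms C1_on_continuous by (intro continuous_intros) (auto simp: C1_on_def)
qed

lemma C1_on_const: "C1_on S (\<lambda>z. c)"
  by (rule C1_onI[where f' = "\<lambda>_ _. 0"]) auto

lemma C1_on_sum:
  assumes "\<And>i. i \<in> I \<Longrightarrow> C1_on S (f i)"
  shows "C1_on S (\<lambda>z. \<Sum>i\<in>I. f i z)"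
proof (rule C1_onI)
  show "((\<lambda>z. \<Sum>i\<in>I. f i z) has_derivative (\<lambda>h. \<Sum>i\<in>I. frechet_derivative (f i) (at z) h)) (at z)"
    if "z \<in> S" for z
    by (rule has_derivative_sum) (rule C1_on_has_derivative[OF assms that])
  show "continuous_on S (\<lambda>z. \<Sum>i\<in>I. frechet_derivative (f i) (at z) h)" for h
    using assms by (intro continuous_intros) (auto simp: C1_on_def)
qed

lemma C1_on_inverse:
  assumes "C1_on S f" "\<And>z. z \<in> S \<Longrightarrow> f z \<noteq> 0"
  shows "C1_on S (\<lambda>z. inverse (f z))"
proof (rule C1_onI)
  show "((\<lambda>z. inverse (f z)) has_derivative (\<lambda>h. - (inverse (f z) * frechet_derivative f (at z) h * inverse (f z)))) (at z)"
    if "z \<in> S" for z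
    by (rule Deriv.has_derivative_inverse[OF assms(2)[OF that] C1_on_has_derivative[OF assms(1) that]])
  show "continuous_on S (\<lambda>z. - (inverse (f z) * frechet_derivative f (at z) h * inverse (f z)))" for h
    using assms C1_on_continuous by (intro continuous_intros) (auto simp: C1_on_def)
qed

lemma moebius_has_derivative:
  "det A = 1 \<Longrightarrow> z \<in> UHP \<Longrightarrow> (moebius A has_derivative (\<lambda>h. h / (jac A z)\<^sup>2)) (at z)"
proof -
  have "(*) (1 / (jac A z)\<^sup>2) = (\<lambda>h. h / (jac A z)\<^sup>2)" by auto
  then show "det A = 1 \<Longrightarrow> z \<in> UHP \<Longrightarrow> (moebius A has_derivative (\<lambda>h. h / (jac A z)\<^sup>2)) (at z)"
    using moebius_has_field_derivative[of A z] by (simp only: has_field_derivative_def)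
qed

lemma compose_moebius_has_derivative:
  assumes "C1_on UHP f" "det A = 1" "z \<in> UHP"
  shows "((\<lambda>z. f (moebius A z)) has_derivative (\<lambda>h. frechet_derivative f (at (moebius A z)) (h / (jac A z)\<^sup>2))) (at z)"
  using diff_chain_at[OF moebius_has_derivative[OF assms(2,3)] C1_on_has_derivative[OF assms(1) moebius_UHP[OF assms(2,3)]]]
  by (simp add: o_def)

lemma real_linear_complex:
  assumes "linear (L :: complex \<Rightarrow> complex)"
  shows "L u = of_real (Re u) * L 1 + of_real (Im u) * L \<i>"
proof -
  have "u = Re u *\<^sub>R 1 + Im u *\<^sub>R \<i>" by (simp add: complex_eq_iff)
  then have "L u = L (Re u *\<^sub>R 1 + Im u *\<^sub>R \<i>)" by simp
  then show ?thesis by (simp only: linear_add[OF assms] linear_scale[OF assms]) (simp add: scaleR_conv_of_real)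
qed

lemma C1_on_linear: "C1_on S f \<Longrightarrow> z \<in> S \<Longrightarrow> linear (frechet_derivative f (at z))"
  by (meson C1_on_has_derivative has_derivative_linear)

text \<open>The direction \<open>h / (jac A z)^2\<close> in which \<open>f\<close> is differentiated
  varies with \<open>z\<close>, whereas \<open>C1_on\<close> speaks of fixed directions. Hence the
  derivative is expanded in the real basis 1, \<open>\<i>\<close>.\<close>

lemma C1_on_compose_moebius:
  assumes f: "C1_on UHP f" and A: "det A = 1"
  shows "C1_on UHP (\<lambda>z. f (moebius A z))"
proof (rule C1_onI)
  let ?F = "\<lambda>w. frechet_derivative f (at w)"
  show "((\<lambda>z. f (moebius A z)) has_derivative (\<lambda>h. of_real (Re (h / (jac A z)\<^sup>2)) * ?F (moebius A z) 1 +
      of_real (Im (h / (jac A z)\<^sup>2)) * ?F (moebius A z) \<i>)) (at z)" if z: "z \<in> UHP" for z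
  proof -
    have "(\<lambda>h. ?F (moebius A z) (h / (jac A z)\<^sup>2)) = (\<lambda>h. of_real (Re (h / (jac A z)\<^sup>2)) * ?F (moebius A z) 1 +
      of_real (Im (h / (jac A z)\<^sup>2)) * ?F (moebius A z) \<i>)"
      by (intro ext real_linear_complex C1_on_linear[OF f moebius_UHP[OF A z]])
    with compose_moebius_has_derivative[OF f A z] show ?thesis by (simp only:)
  qed
  have "continuous_on UHP (\<lambda>z. ?F (moebius A z) u)" for u
  proof (rule continuous_on_compose2[of UHP "\<lambda>w. ?F w u"])
    show "continuous_on UHP (\<lambda>w. ?F w u)" using f by (simp add: C1_on_def)
    show "continuous_on UHP (moebius A)"
      by (intro holomorphic_on_imp_continuous_on holomorphic_moebius A)
  qed (use moebius_UHP[OF A] in auto)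
  then show "continuous_on UHP (\<lambda>z. of_real (Re (h / (jac A z)\<^sup>2)) * ?F (moebius A z) 1 +
      of_real (Im (h / (jac A z)\<^sup>2)) * ?F (moebius A z) \<i>)" for h
    using jac_nonzero[OF A] by (intro continuous_intros) (auto intro!: holomorphic_on_imp_continuous_on holomorphic_jac)
qed

text \<open>The antiholomorphic chain rule: \<open>moebius A\<close> is holomorphic, so
  \<open>dbar\<close> picks up the conjugate of its derivative \<open>1 / jac^2\<close>.\<close>

lemma dbar_compose_moebius:
  assumes f: "C1_on UHP f" and A: "det A = 1" and z: "z \<in> UHP"
  shows "dbar (\<lambda>z. f (moebius A z)) z = dbar f (moebius A z) / cnj ((jac A z)\<^sup>2)"
proof -
  define u where "u = 1 / (jac A z)\<^sup>2"
  define L where "L = frechet_derivative f (at (moebius A z))"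
  have lin: "linear L" unfolding L_def by (rule C1_on_linear[OF f moebius_UHP[OF A z]])
  have "frechet_derivative (\<lambda>z. f (moebius A z)) (at z) = (\<lambda>h. L (h * u))"
    using frechet_derivative_at[OF compose_moebius_has_derivative[OF assms]] by (simp add: L_def u_def)
  then have "dbar (\<lambda>z. f (moebius A z)) z = (L u + \<i> * L (\<i> * u)) / 2" by (simp add: dbar_def)
  also have "\<dots> = (of_real (Re u) * L 1 + of_real (Im u) * L \<i> + \<i> * (of_real (Re (\<i> * u)) * L 1 + of_real (Im (\<i> * u)) * L \<i>)) / 2"
    using real_linear_complex[OF lin, of u] real_linear_complex[OF lin, of "\<i> * u"] by simp
  also have "\<dots> = cnj u * ((L 1 + \<i> * L \<i>) / 2)"
    by (simp add: complex_eq_iff algebra_simps)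
  also have "cnj u = 1 / cnj ((jac A z)\<^sup>2)" by (simp add: u_def)
  finally show ?thesis unfolding dbar_def[of f] L_def[symmetric] by simp
qed

lemma dbar_eqI: "(f has_derivative f') (at z) \<Longrightarrow> dbar f z = (f' 1 + \<i> * f' \<i>) / 2"
  using frechet_derivative_at[of f f' z] by (simp add: dbar_def)

lemma dbar_mult:
  assumes "C1_on S f" "C1_on S g" "z \<in> S"
  shows "dbar (\<lambda>z. f z * g z) z = dbar f z * g z + f z * dbar g z"
  unfolding dbar_eqI[OF has_derivative_mult[OF C1_on_has_derivative[OF assms(1,3)] C1_on_has_derivative[OF assms(2,3)]]]
    dbar_def[of f] dbar_def[of g]
  by (simp add: field_simps)

lemma dbar_sum:
  assumes "\<And>i. i \<in> I \<Longrightarrow> C1_on S (f i)" "z \<in> S"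
  shows "dbar (\<lambda>z. \<Sum>i\<in>I. f i z) z = (\<Sum>i\<in>I. dbar (f i) z)"
proof -
  have "((\<lambda>z. \<Sum>i\<in>I. f i z) has_derivative (\<lambda>h. \<Sum>i\<in>I. frechet_derivative (f i) (at z) h)) (at z)"
    by (rule has_derivative_sum) (rule C1_on_has_derivative[OF assms])
  from dbar_eqI[OF this] show ?thesis
    by (simp add: dbar_def sum_distrib_left sum_divide_distrib sum.distrib add_divide_distrib)
qed

lemma dbar_cong:
  assumes "C1_on S f" "open S" "z \<in> S" "\<And>z. z \<in> S \<Longrightarrow> f z = g z"
  shows "dbar g z = dbar f z"
  using dbar_eqI[OF has_derivative_transform_within_open[OF C1_on_has_derivative[OF assms(1,3)] assms(2,3,4)]]
  by (simp add: dbar_def)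

lemma dbar_continuous: "C1_on S f \<Longrightarrow> continuous_on S (dbar f)"
  unfolding dbar_def[abs_def] C1_on_def by (intro continuous_intros) auto

text \<open>The half plane and the complement of \<open>S\<close> are open and cover the plane, and
  on the latter \<open>f\<close> is zero.\<close>

lemma C1_on_extend:
  assumes "C1_on UHP f" "compact S" "S \<subseteq> UHP" "\<And>z. z \<notin> S \<Longrightarrow> f z = 0"
  shows "C1_on UNIV f" "\<And>z. z \<notin> S \<Longrightarrow> dbar f z = 0"
proof -
  have o: "open (- S)" using assms(2) by (simp add: compact_imp_closed open_Compl)
  have c: "C1_on (- S) (\<lambda>z. 0)" by (rule C1_on_const)
  have "C1_on (- S) f" by (rule C1_on_cong[OF c o]) (simp add: assms(4))
  then show "C1_on UNIV f" using assms o open_UHP by (intro C1_on_locally) (metis ComplI subsetD)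
  show "dbar f z = 0" if "z \<notin> S" for z
    using dbar_cong[OF c o, of z f] that assms(4) dbar_eqI[of "\<lambda>z. 0" "\<lambda>h. 0" z] by simp
qed

section \<open>Integration over the plane\<close>

text \<open>The integral of the translate \<open>g (v + t e)\<close> does not depend on
  \<open>t\<close>. Differentiating it under the integral sign at \<open>t = 0\<close> gives the
  claim.\<close>

lemma has_integral_derivative_compact_support:
  fixes g :: "'a::euclidean_space \<Rightarrow> 'b::banach"
  assumes der: "\<And>v. (g has_derivative g' v) (at v)" and cont: "continuous_on UNIV (\<lambda>v. g' v e)"
    and S: "bounded S" and supp: "\<And>v. v \<notin> S \<Longrightarrow> g v = 0"
  shows "((\<lambda>v. g' v e) has_integral 0) UNIV"
proof -
  obtain B where B: "B > 0" "\<And>v. v \<in> S \<Longrightarrow> norm v \<le> B" using S by (auto simp: bounded_pos)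
  \<comment> \<open>Large enough for the supports of all translates by \<open>t e\<close> with
    \<open>|t| \<le> 1\<close>.\<close>
  define M where "M = B + norm e"
  obtain b :: 'a where b: "cball 0 M \<subseteq> cbox (- b) b"
    using bounded_subset_cbox_symmetric[OF bounded_cball] by blast
  define a where "a = - b"
  have in_box: "v \<in> cbox a b" if "norm v \<le> M" for v
    using b that unfolding a_def by (auto simp: dist_norm)
  have S_box: "S \<subseteq> cbox a b"
    using B(2) norm_ge_zero[of e] in_box unfolding M_def by (metis add_increasing2 subsetI)
  have contg: "continuous_on UNIV g"
    by (meson continuous_at_imp_continuous_on der has_derivative_continuous)
  have shift: "((\<lambda>v. g (v + t *\<^sub>R e)) has_integral integral UNIV g) (cbox a b)" if t: "t \<in> {-1..1}" for t
  proof -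
    have "g integrable_on cbox a b" by (intro integrable_continuous continuous_on_subset[OF contg]) auto
    then have "(g has_integral integral (cbox a b) g) (cbox a b)" by blast
    moreover have zero: "g v = 0" if "v \<notin> cbox a b" for v
      using that supp S_box by blast
    ultimately have i: "(g has_integral integral (cbox a b) g) UNIV"
      by (meson UNIV_I has_integral_on_superset subset_UNIV)
    obtain c d where cd: "bounded S" "S \<union> (\<lambda>v. v - t *\<^sub>R e) ` S \<subseteq> cbox c d"
    proof -
      have "bounded (S \<union> (\<lambda>v. v - t *\<^sub>R e) ` S)" using S by (auto intro: bounded_translation_minus)
      then show ?thesis using that S bounded_subset_cbox_symmetric by metis
    qed
    have "(g has_integral integral UNIV g) (cbox c d)"
    proof -
      have "(g has_integral integral UNIV g) UNIV" using i by (simp add: integral_unique)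
      moreover have "(\<lambda>v. if v \<in> cbox c d then g v else 0) = g"
      proof
        fix v show "(if v \<in> cbox c d then g v else 0) = g v" using cd(2) supp[of v] by (cases "v \<in> S") auto
      qed
      ultimately show ?thesis using has_integral_restrict_UNIV[of "cbox c d" g] by simp
    qed
    then have "((\<lambda>x. g (1 *\<^sub>R x + t *\<^sub>R e)) has_integral (1 / \<bar>1\<bar> ^ DIM('a)) *\<^sub>R integral UNIV g)
       ((\<lambda>x. (1 / 1) *\<^sub>R x + - ((1 / 1) *\<^sub>R t *\<^sub>R e)) ` cbox c d)"
      by (intro has_integral_affinity) auto
    then have "((\<lambda>x. g (x + t *\<^sub>R e)) has_integral integral UNIV g) ((\<lambda>x. x - t *\<^sub>R e) ` cbox c d)" by simp
    then have u: "((\<lambda>x. g (x + t *\<^sub>R e)) has_integral integral UNIV g) UNIV"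
    proof (rule has_integral_on_superset)
      fix x assume x: "x \<notin> (\<lambda>x. x - t *\<^sub>R e) ` cbox c d"
      have "x + t *\<^sub>R e \<notin> S"
      proof
        assume "x + t *\<^sub>R e \<in> S"
        then have "x + t *\<^sub>R e \<in> cbox c d" using cd by blast
        then have "(x + t *\<^sub>R e) - t *\<^sub>R e \<in> (\<lambda>x. x - t *\<^sub>R e) ` cbox c d" by (rule imageI)
        then show False using x by simp
      qed
      then show "g (x + t *\<^sub>R e) = 0" by (rule supp)
    qed auto
    have z: "g (v + t *\<^sub>R e) = 0" if v: "v \<notin> cbox a b" for v
    proof (rule supp, rule)
      assume "v + t *\<^sub>R e \<in> S"
      then have "norm (v + t *\<^sub>R e) \<le> B" by (rule B)
      moreover have "norm v \<le> norm (v + t *\<^sub>R e) + norm (t *\<^sub>R e)"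
        by (metis add_diff_cancel_right' norm_triangle_ineq4)
      moreover have "norm (t *\<^sub>R e) \<le> norm e" using t by (simp add: mult_left_le_one_le abs_le_iff)
      ultimately have "norm v \<le> M" unfolding M_def by linarith
      with v in_box show False by blast
    qed
    have "(\<lambda>v. if v \<in> cbox a b then g (v + t *\<^sub>R e) else 0) = (\<lambda>v. g (v + t *\<^sub>R e))"
      using z by auto
    then show ?thesis using u by (subst has_integral_restrict_UNIV[symmetric]) simp
  qed
  have der': "((\<lambda>t. g (v + t *\<^sub>R e)) has_vector_derivative g' (v + t *\<^sub>R e) e) (at t within {-1..1})" for t v
  proof -
    have "((\<lambda>t. v + t *\<^sub>R e) has_derivative (\<lambda>h. h *\<^sub>R e)) (at t within {-1..1})"
      by (auto intro!: derivative_eq_intros)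
    from diff_chain_within[OF this has_derivative_at_withinI[OF der]]
    have "((\<lambda>t. g (v + t *\<^sub>R e)) has_derivative (\<lambda>h. g' (v + t *\<^sub>R e) (h *\<^sub>R e))) (at t within {-1..1})"
      by (simp add: o_def)
    then show ?thesis using linear_scale[OF has_derivative_linear[OF der]]
      by (simp add: has_vector_derivative_def)
  qed
  have "((\<lambda>t. integral (cbox a b) (\<lambda>v. g (v + t *\<^sub>R e))) has_vector_derivative
      integral (cbox a b) (\<lambda>v. g' (v + 0 *\<^sub>R e) e)) (at 0 within {-1..1})"
  proof (rule leibniz_rule_vector_derivative)
    show "(\<lambda>v. g (v + t *\<^sub>R e)) integrable_on cbox a b" if "t \<in> {-1..1}" for t
      using shift[OF that] by blast
    show "continuous_on ({-1..1} \<times> cbox a b) (\<lambda>(t, v). g' (v + t *\<^sub>R e) e)"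
      unfolding split_beta by (rule continuous_on_compose2[OF cont]) (auto intro!: continuous_intros)
  qed (use der' in auto)
  moreover have "((\<lambda>t. integral (cbox a b) (\<lambda>v. g (v + t *\<^sub>R e))) has_vector_derivative 0) (at 0 within {-1..1})"
    by (rule has_vector_derivative_transform[of _ _ _ "\<lambda>_. integral UNIV g"])
       (use shift in \<open>auto simp: integral_unique\<close>)
  ultimately have "integral (cbox a b) (\<lambda>v. g' (v + 0 *\<^sub>R e) e) = 0"
    by (intro vector_derivative_unique_within_closed_interval[of "-1" 1 0]) auto
  then have "integral (cbox a b) (\<lambda>v. g' v e) = 0" by simp
  moreover have "(\<lambda>v. g' v e) integrable_on cbox a b"
    by (intro integrable_continuous continuous_on_subset[OF cont]) auto
  ultimately have "((\<lambda>v. g' v e) has_integral 0) (cbox a b)" by (metis integrable_integral)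
  then show ?thesis
  proof (rule has_integral_on_superset)
    fix v assume v: "v \<notin> cbox a b"
    have "(g has_derivative (\<lambda>h. 0)) (at v)"
    proof (rule has_derivative_transform_within_open[of "\<lambda>_. 0"])
      show "open (- cbox a b)" by (intro open_Compl closed_cbox)
      show "0 = g w" if "w \<in> - cbox a b" for w
        using that supp S_box by (metis ComplD subsetD)
    qed (use v in auto)
    then show "g' v e = 0" using has_derivative_unique[OF der] by metis
  qed auto
qed

text \<open>Integrals are taken over \<open>real^2\<close>, where the change of variables formula is
  expressed by a matrix determinant; \<open>cx\<close> and \<open>rv\<close> identify it with the
  complex plane.\<close>

definition cx :: "real^2 \<Rightarrow> complex" where "cx v = Complex (v$1) (v$2)"
definition rv :: "complex \<Rightarrow> real^2" where "rv z = vector [Re z, Im z]"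

lemma cx_rv [simp]: "cx (rv z) = z" by (simp add: cx_def rv_def)
lemma rv_cx [simp]: "rv (cx v) = v" by (simp add: cx_def rv_def vec_eq_iff forall_2)

lemma linear_cx: "linear cx" by (rule linearI) (simp_all add: cx_def complex_eq_iff)
lemma linear_rv: "linear rv" by (rule linearI) (simp_all add: rv_def vec_eq_iff forall_2)
lemma bounded_linear_cx: "bounded_linear cx" by (rule linear_conv_bounded_linear[THEN iffD1, OF linear_cx])
lemma bounded_linear_rv: "bounded_linear rv" by (rule linear_conv_bounded_linear[THEN iffD1, OF linear_rv])

definition plane_integral :: "(complex \<Rightarrow> complex) \<Rightarrow> complex" where
  "plane_integral h = integral UNIV (\<lambda>v. h (cx v))"

text \<open>For bounded \<open>S\<close> these are the continuous functions of compact support with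
  support controlled by \<open>S\<close>, for which all integrals below exist and add.\<close>

definition cc :: "complex set \<Rightarrow> (complex \<Rightarrow> complex) \<Rightarrow> bool" where
  "cc S h \<longleftrightarrow> continuous_on UNIV h \<and> (\<forall>z. z \<notin> S \<longrightarrow> h z = 0)"

lemma bounded_vimage_cx: "bounded S \<Longrightarrow> bounded (cx -` S)"
proof -
  assume "bounded S"
  then have "bounded (rv ` S)" by (rule bounded_linear_image[OF _ bounded_linear_rv])
  moreover have "cx -` S \<subseteq> rv ` S" by (metis image_iff rv_cx subsetI vimageE)
  ultimately show ?thesis by (rule bounded_subset)
qed

lemma cc_absolutely_integrable:
  fixes L :: "complex \<Rightarrow> 'b::euclidean_space"
  assumes h: "cc S h" and S: "bounded S" and L: "bounded_linear L"
  shows "(\<lambda>v. L (h (cx v))) absolutely_integrable_on UNIV"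
proof -
  obtain a where a: "cx -` S \<subseteq> cbox (-a) a"
    using bounded_subset_cbox_symmetric[OF bounded_vimage_cx[OF S]] by blast
  have "continuous_on (cbox (-a) a) (\<lambda>v. L (h (cx v)))"
    using h unfolding cc_def
    by (intro bounded_linear.continuous_on[OF L] continuous_on_compose2[of UNIV h _ cx]
        bounded_linear.continuous_on[OF bounded_linear_cx] continuous_on_id) auto
  then have "(\<lambda>v. L (h (cx v))) absolutely_integrable_on cbox (-a) a"
    by (rule absolutely_integrable_continuous)
  moreover have "(\<lambda>v. if v \<in> cbox (-a) a then L (h (cx v)) else 0) = (\<lambda>v. L (h (cx v)))"
  proof
    fix v
    have "L (h (cx v)) = 0" if "v \<notin> cbox (-a) a"
      using that a h linear_0[OF bounded_linear.linear[OF L]] unfolding cc_def by (metis subsetD vimageI)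
    then show "(if v \<in> cbox (-a) a then L (h (cx v)) else 0) = L (h (cx v))" by simp
  qed
  ultimately show ?thesis
    using absolutely_integrable_restrict_UNIV[of "cbox (-a) a" "\<lambda>v. L (h (cx v))"] by simp
qed

lemma cc_integrable:
  assumes "cc S h" "bounded S"
  shows "(\<lambda>v. h (cx v)) integrable_on UNIV"
proof -
  have "(\<lambda>v. h (cx v)) absolutely_integrable_on UNIV"
    using cc_absolutely_integrable[where L = "\<lambda>z. z", OF assms bounded_linear_ident] .
  then show ?thesis by (rule set_lebesgue_integral_eq_integral(1))
qed

lemma plane_integral_add: "cc S f \<Longrightarrow> cc S g \<Longrightarrow> bounded S \<Longrightarrow>
    plane_integral (\<lambda>z. f z + g z) = plane_integral f + plane_integral g"
  unfolding plane_integral_def by (intro integral_add cc_integrable)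

lemma plane_integral_sum: "finite I \<Longrightarrow> (\<And>i. i \<in> I \<Longrightarrow> cc S (f i)) \<Longrightarrow> bounded S \<Longrightarrow>
    plane_integral (\<lambda>z. \<Sum>i\<in>I. f i z) = (\<Sum>i\<in>I. plane_integral (f i))"
  unfolding plane_integral_def by (intro integral_sum cc_integrable)

lemma plane_integral_dbar:
  assumes f: "C1_on UNIV f" and S: "bounded S" "\<And>z. z \<notin> S \<Longrightarrow> f z = 0"
  shows "plane_integral (dbar f) = 0"
proof -
  let ?D = "\<lambda>z. frechet_derivative f (at z)"
  have der: "((\<lambda>v. f (cx v)) has_derivative (\<lambda>u. ?D (cx v) (cx u))) (at v)" for v
    using diff_chain_at[OF bounded_linear_imp_has_derivative[OF bounded_linear_cx, of "at v"] C1_on_has_derivative[OF f]]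
    by (simp add: o_def)
  have "continuous_on UNIV (\<lambda>v. ?D (cx v) (cx e))" for e
    using f by (intro continuous_on_compose2[of UNIV "\<lambda>z. ?D z (cx e)" _ cx]
        bounded_linear.continuous_on[OF bounded_linear_cx] continuous_on_id) (auto simp: C1_on_def)
  then have i: "((\<lambda>v. ?D (cx v) (cx e)) has_integral 0) UNIV" for e
    by (rule has_integral_derivative_compact_support[OF der _ bounded_vimage_cx[OF S(1)]]) (use S(2) in auto)
  have "((\<lambda>v. (?D (cx v) (cx (rv 1)) + \<i> * ?D (cx v) (cx (rv \<i>))) / 2) has_integral (0 + \<i> * 0) / 2) UNIV"
    by (intro has_integral_add has_integral_mult_right has_integral_divide i)
  then have "((\<lambda>v. dbar f (cx v)) has_integral 0) UNIV" by (simp add: dbar_def)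
  then show ?thesis unfolding plane_integral_def by (rule integral_unique)
qed

text \<open>Change of variables: the real Jacobian determinant of a holomorphic map is the squared
  modulus of its derivative, here \<open>|jac|^(-4)\<close>.\<close>

lemma plane_integral_moebius:
  assumes h: "cc S h" and S: "compact S" "S \<subseteq> UHP" and A: "det A = 1" and B: "det B = 1" "A ** B = mat 1" "B ** A = mat 1"
  shows "plane_integral (\<lambda>z. if z \<in> UHP then h (moebius A z) / of_real (cmod (jac A z) ^ 4) else 0) = plane_integral h"
proof -
  define H where "H = cx -` UHP"
  define g where "g = (\<lambda>v. rv (moebius A (cx v)))"
  define g' where "g' = (\<lambda>v u. rv (cx u / (jac A (cx v))\<^sup>2))"
  have oH: "open H" unfolding H_def
    by (intro open_vimage open_UHP bounded_linear.continuous_on[OF bounded_linear_cx] continuous_on_id)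
  have inv: "moebius B (moebius A z) = z" "moebius A (moebius B z) = z" if "z \<in> UHP" for z
    using moebius_mult[OF B(1) A that] moebius_mult[OF A B(1) that] B by simp_all
  have der: "(g has_derivative g' v) (at v within H)" if v: "v \<in> H" for v
  proof -
    have "(moebius A has_derivative (\<lambda>h. h / (jac A (cx v))\<^sup>2)) (at (cx v))"
      using v by (intro moebius_has_derivative[OF A]) (simp add: H_def)
    from diff_chain_at[OF bounded_linear_imp_has_derivative[OF bounded_linear_cx, of "at v"] this]
    have "(rv \<circ> (moebius A \<circ> cx) has_derivative (rv \<circ> ((\<lambda>h. h / (jac A (cx v))\<^sup>2) \<circ> cx))) (at v)"
      by (rule diff_chain_at[OF _ bounded_linear_imp_has_derivative[OF bounded_linear_rv]])
    then show ?thesis unfolding g_def g'_def o_def by (rule has_derivative_at_withinI)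
  qed
  have inj: "inj_on g H"
    by (rule inj_on_inverseI[where g = "\<lambda>v. rv (moebius B (cx v))"]) (simp add: g_def H_def inv)
  have img: "g ` H = H"
  proof
    show "g ` H \<subseteq> H" using moebius_UHP[OF A] by (auto simp: g_def H_def)
    show "H \<subseteq> g ` H"
      using moebius_UHP[OF B(1)] inv by (intro subsetI image_eqI[where x = "rv (moebius B (cx _))"]) (auto simp: g_def H_def)
  qed
  have det: "\<bar>det (matrix (g' v))\<bar> = 1 / cmod (jac A (cx v)) ^ 4" for v
  proof -
    define u where "u = 1 / (jac A (cx v))\<^sup>2"
    have "g' v e = rv (cx e * u)" for e by (simp add: g'_def u_def)
    then have "det (matrix (g' v)) = (Re u)\<^sup>2 + (Im u)\<^sup>2"
      by (simp add: det_2 matrix_def rv_def cx_def axis_def power2_eq_square)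
    also have "\<dots> = (cmod u)\<^sup>2" by (simp add: cmod_power2)
    also have "\<dots> = 1 / cmod (jac A (cx v)) ^ 4"
      by (simp add: u_def norm_divide norm_power power_divide flip: power_mult)
    finally show ?thesis by simp
  qed
  define f where "f = (\<lambda>v. rv (h (cx v)))"
  have ai: "f absolutely_integrable_on UNIV"
    unfolding f_def by (rule cc_absolutely_integrable[OF h compact_imp_bounded[OF S(1)] bounded_linear_rv])
  have fH: "(\<lambda>v. if v \<in> H then f v else 0) = f"
  proof
    fix v
    have "f v = 0" if "v \<notin> H"
      using that h S(2) unfolding f_def H_def cc_def by (metis linear_0[OF linear_rv] subsetD vimageI)
    then show "(if v \<in> H then f v else 0) = f v" by simp
  qed
  have "f absolutely_integrable_on H" using ai fH absolutely_integrable_restrict_UNIV by metis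
  then have "f absolutely_integrable_on g ` H \<and> integral (g ` H) f = integral H f" by (simp add: img)
  then have *: "(\<lambda>v. \<bar>det (matrix (g' v))\<bar> *\<^sub>R f (g v)) absolutely_integrable_on H \<and>
      integral H (\<lambda>v. \<bar>det (matrix (g' v))\<bar> *\<^sub>R f (g v)) = integral H f"
    by (subst has_absolute_integral_change_of_variables[OF _ der inj]) (use oH in auto)
  let ?k = "\<lambda>z. if z \<in> UHP then h (moebius A z) / of_real (cmod (jac A z) ^ 4) else 0"
  have eq: "\<bar>det (matrix (g' v))\<bar> *\<^sub>R f (g v) = rv (?k (cx v))" if "v \<in> H" for v
    using that unfolding det by (simp add: f_def g_def H_def flip: linear_scale[OF linear_rv])
      (simp add: scaleR_conv_of_real field_simps)
  have int: "(\<lambda>v. rv (?k (cx v))) integrable_on UNIV" "integral UNIV (\<lambda>v. rv (?k (cx v))) = integral H f"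
  proof -
    have "((\<lambda>v. \<bar>det (matrix (g' v))\<bar> *\<^sub>R f (g v)) has_integral integral H f) H"
      using integrable_integral[OF set_lebesgue_integral_eq_integral(1)[OF conjunct1[OF *]]] conjunct2[OF *] by simp
    then have "((\<lambda>v. rv (?k (cx v))) has_integral integral H f) H"
      by (rule has_integral_eq[rotated]) (use eq in auto)
    then have "((\<lambda>v. rv (?k (cx v))) has_integral integral H f) UNIV"
      by (rule has_integral_on_superset) (auto simp: H_def linear_0[OF linear_rv])
    then show "(\<lambda>v. rv (?k (cx v))) integrable_on UNIV" "integral UNIV (\<lambda>v. rv (?k (cx v))) = integral H f"
      by (auto simp: integral_unique)
  qed
  have "plane_integral ?k = integral UNIV (cx \<circ> (\<lambda>v. rv (?k (cx v))))" by (simp add: plane_integral_def o_def)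
  also have "\<dots> = cx (integral H f)" by (simp only: integral_linear[OF int(1) bounded_linear_cx] int(2))
  also have "integral H f = integral UNIV f" using integral_restrict_UNIV[of H f] fH by simp
  also have "cx (integral UNIV f) = integral UNIV (cx \<circ> f)"
    by (intro integral_linear[symmetric] bounded_linear_cx set_lebesgue_integral_eq_integral(1)[OF ai])
  also have "\<dots> = plane_integral h" by (simp add: plane_integral_def o_def f_def)
  finally show ?thesis .
qed

section \<open>Partitions of unity and the weight two obstruction\<close>

text \<open>Squaring makes the cutoff \<open>max 0 t\<close> continuously differentiable, which is
  the smoothness that \<open>dbar\<close> asks for.\<close>

lemma max_square_has_field_derivative:
  "((\<lambda>t::real. (max 0 t)\<^sup>2) has_field_derivative 2 * max 0 t) (at t)"
proof (cases t "0::real" rule: linorder_cases)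
  case less
  have "((\<lambda>t::real. 0) has_field_derivative 0) (at t)" by simp
  then have "((\<lambda>t::real. (max 0 t)\<^sup>2) has_field_derivative 0) (at t)"
    by (rule has_field_derivative_transform_within[of _ _ _ _ "- t"]) (use less in \<open>auto simp: dist_real_def max_def\<close>)
  then show ?thesis using less by simp
next
  case greater
  have "((\<lambda>t::real. t\<^sup>2) has_field_derivative 2 * t) (at t)" by (auto intro!: derivative_eq_intros)
  then have "((\<lambda>t::real. (max 0 t)\<^sup>2) has_field_derivative 2 * t) (at t)"
    by (rule has_field_derivative_transform_within[of _ _ _ _ t]) (use greater in \<open>auto simp: dist_real_def max_def\<close>)
  then show ?thesis using greater by simp
next
  case equal
  have "((\<lambda>h. ((max 0 (0 + h))\<^sup>2 - (max 0 0)\<^sup>2) / h) \<longlongrightarrow> 0) (at (0::real))"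
  proof (rule Lim_null_comparison)
    show "\<forall>\<^sub>F h in at (0::real). norm (((max 0 (0 + h))\<^sup>2 - (max 0 0)\<^sup>2) / h) \<le> \<bar>h\<bar>"
      by (rule always_eventually) (auto simp: max_def power2_eq_square)
    show "((\<lambda>h. \<bar>h\<bar>) \<longlongrightarrow> 0) (at (0::real))" by (rule tendsto_rabs_zero) simp
  qed
  then show ?thesis using equal by (simp add: DERIV_def)
qed

lemma C1_on_bump:
  "C1_on UNIV (\<lambda>z. of_real ((max 0 (r - (cmod (z - p))\<^sup>2))\<^sup>2))"
proof (rule C1_onI)
  let ?t = "\<lambda>z. r - (z - p) \<bullet> (z - p)"
  show "((\<lambda>z. of_real ((max 0 (r - (cmod (z - p))\<^sup>2))\<^sup>2) :: complex) has_derivative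
      (\<lambda>h. of_real (2 * max 0 (?t z) * - (2 * ((z - p) \<bullet> h))))) (at z)" for z
  proof -
    have t: "(?t has_derivative (\<lambda>h. - (2 * ((z - p) \<bullet> h)))) (at z)"
      by (auto intro!: derivative_eq_intros simp: inner_commute)
    from diff_chain_at[OF t has_field_derivative_imp_has_derivative[OF max_square_has_field_derivative]]
    have "((\<lambda>z. (max 0 (?t z))\<^sup>2) has_derivative (\<lambda>h. 2 * max 0 (?t z) * - (2 * ((z - p) \<bullet> h)))) (at z)"
      by (simp only: o_def)
    from has_derivative_of_real[OF this] show ?thesis by (simp only: power2_norm_eq_inner)
  qed
  show "continuous_on UNIV (\<lambda>z. of_real (2 * max 0 (?t z) * - (2 * ((z - p) \<bullet> h))) :: complex)" for h
    by (intro continuous_intros)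
qed

lemma cc_mult:
  assumes "cc S u" "compact S" "S \<subseteq> UHP" "continuous_on UHP v"
  shows "cc S (\<lambda>z. u z * v z)"
proof -
  have "continuous_on UHP (\<lambda>z. u z * v z)"
    using assms by (intro continuous_intros) (auto simp: cc_def intro: continuous_on_subset)
  moreover have "continuous_on (- S) (\<lambda>z. u z * v z)"
  proof -
    have "continuous_on (- S) (\<lambda>z. 0 :: complex)" by simp
    then show ?thesis by (rule continuous_on_eq) (use assms(1) in \<open>auto simp: cc_def\<close>)
  qed
  ultimately have "continuous_on (UHP \<union> - S) (\<lambda>z. u z * v z)"
    using assms(2) by (intro continuous_on_open_Un open_UHP) (auto simp: compact_imp_closed)
  moreover have "UHP \<union> - S = UNIV" using assms(3) by blast
  ultimately show ?thesis using assms(1) by (simp add: cc_def)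
qed

context cocompact_group
begin

lemma moebius_cancel:
  assumes "A \<in> G" "B \<in> G" "A ** B = mat 1" "z \<in> UHP"
  shows "moebius A (moebius B z) = z"
  using moebius_mult[OF det_G[OF assms(1)] det_G[OF assms(2)] assms(4)] assms(3) by simp

text \<open>\<open>\<eta>\<close> is a bump function divided by its sum over the group. That sum is
  locally finite by \<open>finite_meeting\<close>, invariant, and positive because the bump is
  positive on a set meeting every orbit.\<close>

lemma partition_of_unity:
  "\<exists>\<eta> S. compact S \<and> S \<subseteq> UHP \<and> C1_on UHP \<eta> \<and> (\<forall>z. z \<notin> S \<longrightarrow> \<eta> z = 0) \<and>
     (\<forall>z. \<exists>r\<ge>0. \<eta> z = of_real r) \<and>
     (\<forall>z\<in>UHP. (\<Sum>A\<in>{A\<in>G. moebius A z \<in> S}. \<eta> (moebius A z)) = 1)"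
proof -
  obtain K where K: "compact K" "K \<subseteq> UHP" "\<And>z. z \<in> UHP \<Longrightarrow> \<exists>A\<in>G. moebius A z \<in> K"
    using cocompact_G by blast
  obtain m M where m: "m > 0" "M > 0" "\<And>z. z \<in> K \<Longrightarrow> m \<le> Im z \<and> cmod z \<le> M"
    using compact_UHP_bounds[OF K(1,2)] by blast
  \<comment> \<open>One Euclidean disc about \<open>\<i> * Y\<close>, of squared radius
    \<open>q\<close>, contains \<open>K\<close> and stays in the half plane. Lying in it means
    \<open>|z|^2 + Y m \<le> 2 Y Im z\<close>. This forces \<open>Im z > 0\<close>, and on
    \<open>K\<close> it holds strictly because \<open>M^2 < Y m\<close>.\<close>
  define Y where "Y = M\<^sup>2 / m + m + 1"
  define q where "q = Y\<^sup>2 - Y * m"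
  define p where "p = \<i> * of_real Y"
  have Ym: "Y > m" "Y > 0" using m by (auto simp: Y_def add_pos_pos)
  have YM: "M\<^sup>2 < Y * m" using m(1) by (simp add: Y_def field_simps add_pos_pos)
  have dist: "(cmod (z - p))\<^sup>2 = (cmod z)\<^sup>2 - 2 * Y * Im z + Y\<^sup>2" for z
    unfolding cmod_power2 by (simp add: p_def) (simp add: power2_eq_square algebra_simps)
  define S where "S = {z. (cmod (z - p))\<^sup>2 \<le> q}"
  have KS: "(cmod (z - p))\<^sup>2 < q" if "z \<in> K" for z
  proof -
    have "(cmod z)\<^sup>2 \<le> M\<^sup>2" using m(3)[OF that] by (intro power_mono) auto
    moreover have "Y * m \<le> Y * Im z" using m(3)[OF that] Ym by (intro mult_left_mono) auto
    ultimately show ?thesis unfolding dist q_def using YM by linarith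
  qed
  have SU: "S \<subseteq> UHP"
  proof
    fix z assume "z \<in> S"
    then have "(cmod z)\<^sup>2 + Y * m \<le> 2 * Y * Im z" by (simp add: S_def dist q_def)
    moreover have "Y * m > 0" using Ym m by simp
    ultimately have "Y * Im z > 0" using zero_le_power2[of "cmod z"] by linarith
    then show "z \<in> UHP" using Ym by (simp add: UHP_def zero_less_mult_iff)
  qed
  have cS: "compact S"
  proof -
    have "closed S" unfolding S_def by (intro closed_Collect_le continuous_intros)
    moreover have "S \<subseteq> cball p (sqrt q)"
      by (auto simp: S_def dist_norm norm_minus_commute intro: real_le_rsqrt)
    ultimately show ?thesis using bounded_cball bounded_subset compact_eq_bounded_closed by metis
  qed
  define \<rho>' where "\<rho>' = (\<lambda>z. (max 0 (q - (cmod (z - p))\<^sup>2))\<^sup>2)"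
  define \<rho> where "\<rho> = (\<lambda>z. of_real (\<rho>' z) :: complex)"
  have C\<rho>: "C1_on UHP \<rho>" unfolding \<rho>_def \<rho>'_def by (rule C1_on_subset[OF C1_on_bump]) simp
  have \<rho>0: "\<rho> z = 0" if "z \<notin> S" for z using that by (simp add: \<rho>_def \<rho>'_def S_def max_def)
  have \<rho>'nn: "\<rho>' z \<ge> 0" for z by (simp add: \<rho>'_def)
  have \<rho>'pos: "\<rho>' z > 0" if "z \<in> K" for z using KS[OF that] by (simp add: \<rho>'_def max_def)
  define \<Theta>' where "\<Theta>' = (\<lambda>z. \<Sum>A\<in>{A\<in>G. moebius A z \<in> S}. \<rho>' (moebius A z))"
  define \<Theta> where "\<Theta> = (\<lambda>z. \<Sum>A\<in>{A\<in>G. moebius A z \<in> S}. \<rho> (moebius A z))"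
  have \<Theta>\<Theta>': "\<Theta> z = of_real (\<Theta>' z)" for z by (simp add: \<Theta>_def \<Theta>'_def \<rho>_def)
  have fin: "finite {A\<in>G. moebius A z \<in> S}" if "z \<in> UHP" for z
    using finite_meeting[of "{z}" S] that cS SU by simp
  have \<Theta>'pos: "\<Theta>' z > 0" if z: "z \<in> UHP" for z
  proof -
    obtain A where A: "A \<in> G" "moebius A z \<in> K" using K(3)[OF z] by blast
    then have "moebius A z \<in> S" using KS unfolding S_def by (simp add: less_imp_le)
    then show ?thesis unfolding \<Theta>'_def using A \<rho>'pos \<rho>'nn
      by (intro sum_pos2[OF fin[OF z], of A]) auto
  qed
  have C\<Theta>: "C1_on UHP \<Theta>"
  proof (rule C1_on_locally)
    fix z assume "z \<in> UHP"
    then obtain e where e: "e > 0" "cball z e \<subseteq> UHP" using open_UHP open_contains_cball by blast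
    \<comment> \<open>A closed ball is compact, so near \<open>z\<close> only the finitely many
      elements of \<open>T\<close> contribute and \<open>\<Theta>\<close> is a fixed finite
      sum.\<close>
    define T where "T = {A\<in>G. \<exists>w\<in>cball z e. moebius A w \<in> S}"
    have "finite T" unfolding T_def by (rule finite_meeting[OF compact_cball e(2) cS SU])
    have "C1_on UHP (\<lambda>w. \<Sum>A\<in>T. \<rho> (moebius A w))"
      using det_G by (intro C1_on_sum C1_on_compose_moebius C\<rho>) (auto simp: T_def)
    then have C: "C1_on (ball z e) (\<lambda>w. \<Sum>A\<in>T. \<rho> (moebius A w))"
      by (rule C1_on_subset) (use e ball_subset_cball in blast)
    have eq: "(\<Sum>A\<in>T. \<rho> (moebius A w)) = \<Theta> w" if "w \<in> ball z e" for w
      unfolding \<Theta>_def using \<open>finite T\<close> that \<rho>0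
      by (intro sum.mono_neutral_right) (auto simp: T_def intro!: bexI[of _ w])
    have "C1_on (ball z e) \<Theta>" by (rule C1_on_cong[OF C open_ball eq])
    then show "\<exists>N. open N \<and> z \<in> N \<and> C1_on N \<Theta>" using e(1) by (intro exI[of _ "ball z e"]) auto
  qed
  have inv: "\<Theta> (moebius B z) = \<Theta> z" if z: "z \<in> UHP" and B: "B \<in> G" for z B
  proof -
    obtain C where C: "C \<in> G" "B ** C = mat 1" "C ** B = mat 1" using inv_G[OF B] by blast
    have m: "moebius (A ** B) z = moebius A (moebius B z)" if "A \<in> G" for A
      by (rule moebius_mult[OF det_G[OF that] det_G[OF B] z])
    have m2: "moebius (A ** C) (moebius B z) = moebius A z" if "A \<in> G" for A
      using m[of "A ** C"] mult_G[OF that C(1)] C(3) by (simp flip: matrix_mul_assoc)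
    show ?thesis unfolding \<Theta>_def
      by (rule sum.reindex_bij_witness[where i = "\<lambda>A. A ** C" and j = "\<lambda>A. A ** B"])
         (use C B m m2 mult_G in \<open>auto simp: matrix_mul_assoc[symmetric]\<close>)
  qed
  define \<eta> where "\<eta> = (\<lambda>z. \<rho> z * inverse (\<Theta> z))"
  have "C1_on UHP \<eta>" unfolding \<eta>_def
    using \<Theta>'pos by (intro C1_on_mult C\<rho> C1_on_inverse C\<Theta>) (force simp: \<Theta>\<Theta>')
  moreover have "\<eta> z = 0" if "z \<notin> S" for z using \<rho>0[OF that] by (simp add: \<eta>_def)
  moreover have "\<exists>r\<ge>0. \<eta> z = of_real r" for z
  proof (intro exI conjI)
    show "\<eta> z = of_real (\<rho>' z * inverse (\<Theta>' z))" by (simp add: \<eta>_def \<rho>_def \<Theta>\<Theta>')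
    show "0 \<le> \<rho>' z * inverse (\<Theta>' z)"
      unfolding \<Theta>'_def using \<rho>'nn by (intro mult_nonneg_nonneg) (auto intro: sum_nonneg)
  qed
  moreover have "(\<Sum>A\<in>{A\<in>G. moebius A z \<in> S}. \<eta> (moebius A z)) = 1" if z: "z \<in> UHP" for z
  proof -
    have "(\<Sum>A\<in>{A\<in>G. moebius A z \<in> S}. \<eta> (moebius A z)) = (\<Sum>A\<in>{A\<in>G. moebius A z \<in> S}. \<rho> (moebius A z) * inverse (\<Theta> z))"
      by (rule sum.cong) (auto simp: \<eta>_def inv[OF z])
    also have "\<dots> = \<Theta> z * inverse (\<Theta> z)" by (simp add: \<Theta>_def sum_distrib_right)
    also have "\<dots> = 1" using \<Theta>'pos[OF z] by (simp add: \<Theta>\<Theta>')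
    finally show ?thesis .
  qed
  ultimately show ?thesis using cS SU by blast
qed

text \<open>Adding \<open>1 / (2 i y)\<close> to such a \<open>\<phi>\<close> gives an invariant form of type \<open>(1,0)\<close> on the compact
  quotient whose \<open>dbar\<close> is a nonzero multiple of the area form, contradicting Stokes.\<close>

theorem no_quasi_period:
  assumes hol: "\<phi> holomorphic_on UHP"
    and tr: "\<And>A z. A \<in> G \<Longrightarrow> z \<in> UHP \<Longrightarrow> \<phi> (moebius A z) = (jac A z)\<^sup>2 * \<phi> z + of_real (A$2$1) * jac A z"
  shows False
proof -
  from partition_of_unity obtain \<eta> S where P: "compact S" "S \<subseteq> UHP" "C1_on UHP \<eta>" "\<forall>z. z \<notin> S \<longrightarrow> \<eta> z = 0"
      "\<forall>z. \<exists>r\<ge>0. \<eta> z = of_real r"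
      "\<forall>z\<in>UHP. (\<Sum>A\<in>{A\<in>G. moebius A z \<in> S}. \<eta> (moebius A z)) = 1"
    by (elim exE conjE)
  note S = P(1,2) and \<eta> = P(3) P(4)[rule_format] P(5)[rule_format] P(6)[rule_format]
  note bS = compact_imp_bounded[OF S(1)]
  have y0: "Im z > 0" if "z \<in> UHP" for z using that by (simp add: UHP_def)
  define \<phi>s where "\<phi>s = (\<lambda>z. \<phi> z - \<i> / 2 * inverse (of_real (Im z)))"
  have der\<phi>: "(\<phi>s has_derivative (\<lambda>h. deriv \<phi> z * h - \<i> / 2 * - (inverse (of_real (Im z)) * of_real (Im h) * inverse (of_real (Im z))))) (at z)"
    if z: "z \<in> UHP" for z
    unfolding \<phi>s_def
    using holomorphic_derivI[OF hol open_UHP z] y0[OF z]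
    by (intro has_derivative_diff has_derivative_mult_right Deriv.has_derivative_inverse has_derivative_of_real
        bounded_linear_imp_has_derivative[OF bounded_linear_Im]) (auto simp: has_field_derivative_def)
  have C\<phi>: "C1_on UHP \<phi>s"
    by (rule C1_onI[OF der\<phi>])
       (auto intro!: continuous_intros holomorphic_on_imp_continuous_on[OF holomorphic_deriv[OF hol open_UHP]] dest: y0)
  have dbar\<phi>: "dbar \<phi>s z = - inverse (4 * of_real (Im z) ^ 2)" if z: "z \<in> UHP" for z
    unfolding dbar_eqI[OF der\<phi>[OF z]] using y0[OF z] by (simp add: field_simps power2_eq_square)
  have inv\<phi>: "\<phi>s (moebius A z) = (jac A z)\<^sup>2 * \<phi>s z" if A: "A \<in> G" and z: "z \<in> UHP" for A z
  proof -
    let ?j = "jac A z"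
    have nz: "?j \<noteq> 0" by (rule jac_nonzero[OF det_G[OF A] z])
    \<comment> \<open>Writing \<open>c\<close> as the imaginary part of \<open>jac\<close> divided
      by \<open>y\<close> shows how the correction term absorbs the inhomogeneous part of the law
      for \<open>\<phi>\<close>.\<close>
    have c: "of_real (A$2$1) = (?j - cnj ?j) / (2 * \<i> * of_real (Im z))"
    proof -
      have "?j - cnj ?j = of_real (A$2$1) * (2 * \<i> * of_real (Im z))"
        by (simp add: jac_def complex_eq_iff)
      then show ?thesis using y0[OF z] by simp
    qed
    have "inverse (of_real (Im (moebius A z))) = ?j * cnj ?j / of_real (Im z)"
      unfolding Im_moebius[OF det_G[OF A]] by (simp add: complex_norm_square[symmetric] field_simps)
    then have "\<phi>s (moebius A z) = ?j\<^sup>2 * \<phi> z + (?j - cnj ?j) / (2 * \<i> * of_real (Im z)) * ?j - \<i> / 2 * (?j * cnj ?j / of_real (Im z))"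
      unfolding \<phi>s_def tr[OF A z] c by simp
    also have "(?j - cnj ?j) / (2 * \<i> * of_real (Im z)) = - (\<i> / 2) * inverse (of_real (Im z)) * (?j - cnj ?j)"
      using y0[OF z] by (simp add: field_simps)
    also have "?j\<^sup>2 * \<phi> z + - (\<i> / 2) * inverse (of_real (Im z)) * (?j - cnj ?j) * ?j - \<i> / 2 * (?j * cnj ?j / of_real (Im z)) = ?j\<^sup>2 * \<phi>s z"
    proof -
      have alg: "j\<^sup>2 * f + - (\<i> / 2) * w * (j - c) * j - \<i> / 2 * (j * c * w) = j\<^sup>2 * (f - \<i> / 2 * w)" for j c w f :: complex
        by (simp add: power2_eq_square field_simps)
      show ?thesis unfolding \<phi>s_def divide_inverse[of _ "of_real (Im z)"] by (rule alg)
    qed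
    finally show ?thesis .
  qed
  have extn: "C1_on UNIV \<eta>" "\<And>z. z \<notin> S \<Longrightarrow> dbar \<eta> z = 0"
    using C1_on_extend[OF \<eta>(1) S] \<eta>(2) by blast+
  have cc\<eta>: "cc S \<eta>" using C1_on_continuous[OF extn(1)] \<eta>(2) by (simp add: cc_def)
  have ccD: "cc S (dbar \<eta>)" using dbar_continuous[OF extn(1)] extn(2) by (simp add: cc_def)
  define \<eta>A where "\<eta>A = (\<lambda>A z. \<eta> (moebius A z))"
  have C\<eta>A: "C1_on UHP (\<eta>A A)" if "A \<in> G" for A
    unfolding \<eta>A_def by (rule C1_on_compose_moebius[OF \<eta>(1) det_G[OF that]])
  \<comment> \<open>The Leibniz rule for \<open>\<eta> * \<eta>A A * \<phi>s\<close>, a function of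
    compact support in the plane, produces these three terms. By Stokes their integrals add up to
    zero for each single \<open>A\<close>.\<close>
  define \<alpha> where "\<alpha> = (\<lambda>A z. dbar \<eta> z * (\<eta>A A z * \<phi>s z))"
  define \<beta> where "\<beta> = (\<lambda>A z. \<eta> z * (dbar (\<eta>A A) z * \<phi>s z))"
  define \<gamma> where "\<gamma> = (\<lambda>A z. \<eta> z * (\<eta>A A z * dbar \<phi>s z))"
  have cc\<alpha>: "cc S (\<alpha> A)" if "A \<in> G" for A unfolding \<alpha>_def
    by (intro cc_mult[OF ccD S] continuous_intros C1_on_continuous[OF C\<eta>A[OF that]] C1_on_continuous[OF C\<phi>])
  have cc\<beta>: "cc S (\<beta> A)" if "A \<in> G" for A unfolding \<beta>_def
    by (intro cc_mult[OF cc\<eta> S] continuous_intros dbar_continuous[OF C\<eta>A[OF that]] C1_on_continuous[OF C\<phi>])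
  have cc\<gamma>: "cc S (\<gamma> A)" if "A \<in> G" for A unfolding \<gamma>_def
    by (intro cc_mult[OF cc\<eta> S] continuous_intros C1_on_continuous[OF C\<eta>A[OF that]] dbar_continuous[OF C\<phi>])
  have abc: "plane_integral (\<alpha> A) + plane_integral (\<beta> A) + plane_integral (\<gamma> A) = 0" if A: "A \<in> G" for A
  proof -
    let ?f = "\<lambda>z. \<eta> z * (\<eta>A A z * \<phi>s z)"
    have Cf: "C1_on UHP ?f" by (intro C1_on_mult \<eta>(1) C\<eta>A[OF A] C\<phi>)
    have f0: "?f z = 0" if "z \<notin> S" for z using \<eta>(2)[OF that] by simp
    have ef: "C1_on UNIV ?f" by (rule C1_on_extend(1)[OF Cf S]) (rule f0)
    have ef2: "dbar ?f z = 0" if "z \<notin> S" for z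
      by (rule C1_on_extend(2)[OF Cf S _ that]) (rule f0)
    have pd: "plane_integral (dbar ?f) = 0" by (rule plane_integral_dbar[OF ef bS]) (rule f0)
    have "dbar ?f z = \<alpha> A z + \<beta> A z + \<gamma> A z" for z
    proof (cases "z \<in> S")
      case True
      then have z: "z \<in> UHP" using S by blast
      show ?thesis
        unfolding dbar_mult[OF \<eta>(1) C1_on_mult[OF C\<eta>A[OF A] C\<phi>] z] dbar_mult[OF C\<eta>A[OF A] C\<phi> z]
        by (simp add: \<alpha>_def \<beta>_def \<gamma>_def algebra_simps)
    next
      case False
      then show ?thesis using ef2 \<eta>(2) extn(2) by (simp add: \<alpha>_def \<beta>_def \<gamma>_def)
    qed
    then have "dbar ?f = (\<lambda>z. (\<alpha> A z + \<beta> A z) + \<gamma> A z)" by (rule ext)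
    then have "plane_integral (\<lambda>z. (\<alpha> A z + \<beta> A z) + \<gamma> A z) = 0"
      using pd by (simp only:)
    moreover have "cc S (\<lambda>z. \<alpha> A z + \<beta> A z)"
      using cc\<alpha>[OF A] cc\<beta>[OF A] by (auto simp: cc_def intro: continuous_intros)
    ultimately show ?thesis
      using plane_integral_add[OF _ cc\<gamma>[OF A] bS] plane_integral_add[OF cc\<alpha>[OF A] cc\<beta>[OF A] bS] by simp
  qed
  \<comment> \<open>Substituting \<open>moebius A z\<close> turns the term with \<open>dbar\<close>
    on \<open>\<eta>\<close> into the one with \<open>dbar\<close> on the translate: the factor
    \<open>jac^2\<close> of \<open>\<phi>s\<close>, the conjugate square from \<open>dbar\<close>
    and the Jacobian \<open>|jac|^(-4)\<close> cancel.\<close>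
  have swap: "plane_integral (\<beta> A) = plane_integral (\<alpha> B)"
    if A: "A \<in> G" and B: "B \<in> G" "A ** B = mat 1" "B ** A = mat 1" for A B
  proof -
    have "(if z \<in> UHP then \<alpha> B (moebius A z) / of_real (cmod (jac A z) ^ 4) else 0) = \<beta> A z" for z
    proof (cases "z \<in> UHP")
      case True
      let ?j = "jac A z"
      have nz: "?j \<noteq> 0" by (rule jac_nonzero[OF det_G[OF A] True])
      have n4: "of_real (cmod ?j ^ 4) = ?j\<^sup>2 * cnj (?j\<^sup>2)"
      proof -
        have "of_real (cmod ?j ^ 4) = (of_real ((cmod ?j)\<^sup>2) :: complex)\<^sup>2" by (simp flip: power_mult)
        also have "\<dots> = ?j\<^sup>2 * cnj (?j\<^sup>2)" unfolding complex_norm_square by (simp add: power_mult_distrib)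
        finally show ?thesis .
      qed
      have "\<alpha> B (moebius A z) = dbar \<eta> (moebius A z) * (\<eta> z * (?j\<^sup>2 * \<phi>s z))"
        by (simp only: \<alpha>_def \<eta>A_def inv\<phi>[OF A True] moebius_cancel[OF B(1) A B(3) True])
      then show ?thesis using True nz unfolding \<beta>_def \<eta>A_def dbar_compose_moebius[OF \<eta>(1) det_G[OF A] True] n4
        by (simp add: field_simps)
    next
      case False
      then show ?thesis using \<eta>(2) S(2) by (auto simp: \<beta>_def)
    qed
    then show ?thesis
      using plane_integral_moebius[OF cc\<alpha>[OF B(1)] S det_G[OF A] det_G[OF B(1)] B(2,3)] by simp
  qed
  \<comment> \<open>Only these elements can contribute. \<open>T\<close> is finite and closed under
    inversion, which lets the \<open>\<alpha>\<close> and \<open>\<beta>\<close> integrals be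
    matched.\<close>
  define T where "T = {A\<in>G. \<exists>z\<in>S. moebius A z \<in> S}"
  have finT: "finite T" unfolding T_def by (rule finite_meeting[OF S S])
  have TG: "A \<in> G" if "A \<in> T" for A using that by (simp add: T_def)
  have sum1: "(\<Sum>A\<in>T. \<eta>A A z) = 1" if z: "z \<in> S" for z
  proof -
    have "(\<Sum>A\<in>T. \<eta>A A z) = (\<Sum>A\<in>{A\<in>G. moebius A z \<in> S}. \<eta>A A z)"
      using finT z \<eta>(2) by (intro sum.mono_neutral_right) (auto simp: T_def \<eta>A_def)
    then show ?thesis using \<eta>(4) z S by (auto simp: \<eta>A_def)
  qed
  \<comment> \<open>On the open set where \<open>\<eta>\<close> is nonzero the translates sum to 1,
    so their \<open>dbar\<close> sums to 0. This plays the role of the cancelling boundary terms of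
    a fundamental domain.\<close>
  have sum\<beta>: "(\<Sum>A\<in>T. \<beta> A z) = 0" for z
  proof (cases "\<eta> z = 0")
    case True then show ?thesis by (simp add: \<beta>_def)
  next
    case False
    define N where "N = {w. \<eta> w \<noteq> 0}"
    have oN: "open N" unfolding N_def
      by (intro open_Collect_neq C1_on_continuous[OF extn(1)] continuous_intros)
    have NS: "N \<subseteq> S" using \<eta>(2) by (auto simp: N_def)
    have zU: "z \<in> UHP" using False \<eta>(2) S by blast
    have "(\<Sum>A\<in>T. dbar (\<eta>A A) z) = dbar (\<lambda>z. \<Sum>A\<in>T. \<eta>A A z) z"
      by (rule dbar_sum[symmetric, OF C\<eta>A[OF TG] zU])
    also have "\<dots> = dbar (\<lambda>z. 1) z"
      by (rule dbar_cong[OF C1_on_const oN]) (use False sum1 NS in \<open>auto simp: N_def\<close>)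
    also have "\<dots> = 0" using dbar_eqI[of "\<lambda>z. 1" "\<lambda>h. 0" z] by simp
    finally have "(\<Sum>A\<in>T. dbar (\<eta>A A) z) = 0" .
    moreover have "(\<Sum>A\<in>T. \<beta> A z) = \<eta> z * ((\<Sum>A\<in>T. dbar (\<eta>A A) z) * \<phi>s z)"
      by (simp add: \<beta>_def sum_distrib_left sum_distrib_right)
    ultimately show ?thesis by simp
  qed
  have Isum: "plane_integral (\<lambda>z. \<Sum>A\<in>T. \<beta> A z) = (\<Sum>A\<in>T. plane_integral (\<beta> A))"
    by (rule plane_integral_sum[OF finT cc\<beta>[OF TG] bS])
  then have I\<beta>: "(\<Sum>A\<in>T. plane_integral (\<beta> A)) = 0" by (simp add: sum\<beta> plane_integral_def)
  have "\<exists>B. \<forall>A\<in>G. B A \<in> G \<and> A ** B A = mat 1 \<and> B A ** A = mat 1" using inv_G by metis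
  then obtain iv where iv: "\<And>A. A \<in> G \<Longrightarrow> iv A \<in> G \<and> A ** iv A = mat 1 \<and> iv A ** A = mat 1" by blast
  have ivT: "iv A \<in> T" if A: "A \<in> T" for A
  proof -
    obtain z where z: "z \<in> S" "moebius A z \<in> S" using A T_def by blast
    have "moebius (iv A) (moebius A z) = z" using iv[OF TG[OF A]] z S TG[OF A] by (intro moebius_cancel) auto
    then show ?thesis using z iv[OF TG[OF A]] unfolding T_def by force
  qed
  have iv2: "iv (iv A) = A" if "A \<in> G" for A
  proof -
    have "iv (iv A) = (A ** iv A) ** iv (iv A)" using iv[OF that] by simp
    also have "\<dots> = A ** (iv A ** iv (iv A))" by (simp only: matrix_mul_assoc)
    also have "iv A ** iv (iv A) = mat 1" using iv[of "iv A"] iv[OF that] by blast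
    finally show ?thesis by simp
  qed
  have "(\<Sum>A\<in>T. plane_integral (\<alpha> A)) = (\<Sum>A\<in>T. plane_integral (\<beta> A))"
    by (rule sum.reindex_bij_witness[where i = iv and j = iv])
       (use ivT iv2 TG iv swap in auto)
  then have I\<alpha>: "(\<Sum>A\<in>T. plane_integral (\<alpha> A)) = 0" using I\<beta> by simp
  have "(\<Sum>A\<in>T. plane_integral (\<alpha> A) + plane_integral (\<beta> A) + plane_integral (\<gamma> A)) = 0"
    using abc TG by simp
  then have "(\<Sum>A\<in>T. plane_integral (\<gamma> A)) = 0" using I\<alpha> I\<beta> by (simp add: sum.distrib)
  then have "plane_integral (\<lambda>z. \<Sum>A\<in>T. \<gamma> A z) = 0"
    using plane_integral_sum[OF finT cc\<gamma>[OF TG] bS] by simp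
  moreover have "(\<lambda>z. \<Sum>A\<in>T. \<gamma> A z) = (\<lambda>z. \<eta> z * dbar \<phi>s z)"
  proof
    fix z show "(\<Sum>A\<in>T. \<gamma> A z) = \<eta> z * dbar \<phi>s z"
  proof (cases "z \<in> S")
    case True
    have "(\<Sum>A\<in>T. \<gamma> A z) = \<eta> z * ((\<Sum>A\<in>T. \<eta>A A z) * dbar \<phi>s z)"
      by (simp add: \<gamma>_def sum_distrib_left sum_distrib_right)
    then show ?thesis by (simp add: sum1[OF True])
  qed (simp add: \<gamma>_def \<eta>(2))
  qed
  ultimately have I0: "plane_integral (\<lambda>z. \<eta> z * dbar \<phi>s z) = 0" by (simp only:)
  \<comment> \<open>Up to sign, what is left is \<open>\<eta>\<close> times the area density
    \<open>1 / (4 y^2)\<close>: continuous, nonnegative and of integral zero, hence zero.\<close>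
  define r where "r = (\<lambda>z. - Re (\<eta> z * dbar \<phi>s z))"
  have ccr: "cc S (\<lambda>z. \<eta> z * dbar \<phi>s z)" by (intro cc_mult[OF cc\<eta> S] dbar_continuous[OF C\<phi>])
  have rr: "r z = Re (\<eta> z) / (4 * (Im z)\<^sup>2) \<and> Re (\<eta> z) \<ge> 0" for z
  proof (cases "z \<in> S")
    case True
    obtain t where t: "t \<ge> 0" "\<eta> z = of_real t" using \<eta>(3) by blast
    have z: "z \<in> UHP" using S True by blast
    have "\<eta> z * dbar \<phi>s z = of_real (- (t / (4 * (Im z)\<^sup>2)))"
      unfolding t(2) dbar\<phi>[OF z] by (simp add: field_simps)
    then have "r z = t / (4 * (Im z)\<^sup>2)" unfolding r_def by (simp only: Re_complex_of_real minus_minus)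
    then show ?thesis using t by simp
  qed (simp add: r_def \<eta>(2))
  have Ir: "((\<lambda>v. r (cx v)) has_integral 0) UNIV"
  proof -
    have "((\<lambda>v. \<eta> (cx v) * dbar \<phi>s (cx v)) has_integral 0) UNIV"
      using integrable_integral[OF cc_integrable[OF ccr bS]] I0 by (simp add: plane_integral_def)
    from has_integral_neg[OF has_integral_linear[OF this bounded_linear_Re]]
    show ?thesis by (simp add: o_def r_def)
  qed
  have contr: "continuous_on UNIV (\<lambda>v. r (cx v))"
    unfolding r_def using ccr
    by (intro continuous_on_minus continuous_on_Re continuous_on_compose2[of UNIV "\<lambda>z. \<eta> z * dbar \<phi>s z" _ cx]
        bounded_linear.continuous_on[OF bounded_linear_cx] continuous_on_id) (auto simp: cc_def)
  have rnn: "r z \<ge> 0" for z using rr[of z] by simp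
  have r0: "r (cx v) = 0" for v
  proof -
    let ?a = "v - (\<chi> i. 1)" and ?b = "v + (\<chi> i. 1)"
    have int: "(\<lambda>v. r (cx v)) integrable_on cbox ?a ?b"
      by (intro integrable_continuous continuous_on_subset[OF contr]) auto
    have "integral (cbox ?a ?b) (\<lambda>v. r (cx v)) \<le> integral UNIV (\<lambda>v. r (cx v))"
      using int Ir rnn by (intro integral_subset_le) auto
    moreover have "integral (cbox ?a ?b) (\<lambda>v. r (cx v)) \<ge> 0" using int rnn by (intro integral_nonneg) auto
    ultimately have "integral (cbox ?a ?b) (\<lambda>v. r (cx v)) = 0" using Ir by (simp add: integral_unique)
    then have "((\<lambda>v. r (cx v)) has_integral 0) (cbox ?a ?b)" using int by (metis integrable_integral)
    then show ?thesis
    proof (rule has_integral_0_cbox_imp_0[rotated 2])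
      show "continuous_on (cbox ?a ?b) (\<lambda>v. r (cx v))" by (rule continuous_on_subset[OF contr]) simp
      have "v \<in> box ?a ?b" by (simp add: mem_box_cart)
      then show "box ?a ?b \<noteq> {}" by blast
    qed (auto simp: rnn mem_box_cart)
  qed
  have "\<eta> z = 0" if z: "z \<in> UHP" for z
  proof -
    have "r z = 0" using r0[of "rv z"] by simp
    then have "Re (\<eta> z) = 0" using rr[of z] y0[OF z] by simp
    then show ?thesis using \<eta>(3)[of z] by auto
  qed
  then have "(\<Sum>A\<in>{A\<in>G. moebius A \<i> \<in> S}. \<eta> (moebius A \<i>)) = 0"
    using S(2) by (intro sum.neutral) auto
  then show False using \<eta>(4)[OF i_in_UHP] by simp
qed

end

section \<open>Poincare series\<close>

context cocompact_group
begin

lemma autD: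
  assumes "f \<in> aut k"
  shows "f holomorphic_on UHP" "\<And>z. z \<notin> UHP \<Longrightarrow> f z = 0"
    "\<And>A z. A \<in> G \<Longrightarrow> z \<in> UHP \<Longrightarrow> f (moebius A z) = jac A z powi k * f z"
  using assms by (auto simp: aut_def)

lemma jac_nz: "A \<in> G \<Longrightarrow> z \<in> UHP \<Longrightarrow> jac A z \<noteq> 0"
  using jac_nonzero det_G by blast

lemma aut_mult: "f \<in> aut k \<Longrightarrow> g \<in> aut l \<Longrightarrow> (\<lambda>z. f z * g z) \<in> aut (k + l)"
  by (auto simp: aut_def power_int_add jac_nz intro!: holomorphic_intros)

lemma aut_power: "f \<in> aut k \<Longrightarrow> n > 0 \<Longrightarrow> (\<lambda>z. f z ^ n) \<in> aut (k * int n)"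
  by (auto simp: aut_def power_int_mult power_mult_distrib intro!: holomorphic_intros)

lemma aut_scale: "f \<in> aut k \<Longrightarrow> (\<lambda>z. c * f z) \<in> aut k"
  by (auto simp: aut_def intro!: holomorphic_intros)

lemma aut_add: "f \<in> aut k \<Longrightarrow> g \<in> aut k \<Longrightarrow> (\<lambda>z. f z + g z) \<in> aut k"
  by (auto simp: aut_def algebra_simps intro!: holomorphic_intros)

lemma aut_diff: "f \<in> aut k \<Longrightarrow> g \<in> aut k \<Longrightarrow> (\<lambda>z. f z - g z) \<in> aut k"
  by (auto simp: aut_def algebra_simps intro!: holomorphic_intros)

lemma aut_zero: "(\<lambda>z. 0) \<in> aut k"
  by (auto simp: aut_def)

lemma aut_sum: "(\<And>i. i \<in> I \<Longrightarrow> f i \<in> aut k) \<Longrightarrow> (\<lambda>z. \<Sum>i\<in>I. f i z) \<in> aut k"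
  by (auto simp: aut_def sum_distrib_left intro!: holomorphic_intros)

text \<open>This is \<open>jac A z * (moebius A z - cnj z0)\<close> with denominators cleared. It
  has no zero in the half plane because \<open>cnj z0\<close> lies in the lower one.\<close>

definition pden :: "complex \<Rightarrow> real^2^2 \<Rightarrow> complex \<Rightarrow> complex" where
  "pden z0 A z = of_real (A$1$1) * z + of_real (A$1$2) - cnj z0 * jac A z"

lemma pden_eq: "A \<in> G \<Longrightarrow> z \<in> UHP \<Longrightarrow> pden z0 A z = jac A z * (moebius A z - cnj z0)"
  using jac_nz[of A z] by (simp add: pden_def moebius_jac right_diff_distrib)

text \<open>On the half plane \<open>|w - cnj z0|\<close> is at least \<open>Im z0\<close> and
  therefore dominates \<open>1 + |w|\<close>, so \<open>row_sum_bound\<close> applies. Uniformity in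
  \<open>w\<close> gives locally uniform convergence.\<close>

lemma pden_lower:
  assumes z0: "z0 \<in> UHP" and L: "compact L" "L \<subseteq> UHP"
  shows "\<exists>C>0. \<forall>w\<in>L. \<forall>A\<in>G. row_sum A \<le> C * cmod (pden z0 A w)"
proof -
  obtain m M where m: "m > 0" "M > 0" "\<And>z. z \<in> L \<Longrightarrow> m \<le> Im z \<and> cmod z \<le> M"
    using compact_UHP_bounds[OF L] by blast
  define y0 where "y0 = Im z0"
  have y0: "y0 > 0" using z0 by (simp add: UHP_def y0_def)
  define a where "a = 1 + (1 + M) / m"
  define b where "b = 1 + (cmod z0 + 1) / y0"
  have ab: "a > 0" "b > 0" using m y0 by (simp_all add: a_def b_def add_pos_nonneg)
  have low: "1 + cmod w \<le> b * cmod (w - cnj z0)" if w: "w \<in> UHP" for w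
  proof -
    have "y0 \<le> Im (w - cnj z0)" using w by (simp add: y0_def UHP_def)
    then have d: "y0 \<le> cmod (w - cnj z0)" using abs_Im_le_cmod[of "w - cnj z0"] by linarith
    have "cmod w \<le> cmod (w - cnj z0) + cmod (cnj z0)" by (metis diff_add_cancel norm_triangle_ineq)
    then have "1 + cmod w \<le> cmod (w - cnj z0) + (cmod z0 + 1) / y0 * y0" using y0 by simp
    also have "\<dots> \<le> cmod (w - cnj z0) + (cmod z0 + 1) / y0 * cmod (w - cnj z0)"
      using d y0 by (intro add_left_mono mult_left_mono) auto
    finally show ?thesis by (simp add: b_def distrib_right)
  qed
  have "row_sum A \<le> (a * b) * cmod (pden z0 A w)" if w: "w \<in> L" and A: "A \<in> G" for w A
  proof -
    have wU: "w \<in> UHP" using w L by blast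
    have y: "Im w > 0" using wU by (simp add: UHP_def)
    have "row_sum A \<le> (1 + (1 + cmod w) / Im w) * (cmod (jac A w) * (1 + cmod (moebius A w)))"
      by (rule row_sum_bound[OF wU det_G[OF A]])
    also have "\<dots> \<le> a * (cmod (jac A w) * (b * cmod (moebius A w - cnj z0)))"
      unfolding a_def using m m(3)[OF w] y low[OF moebius_G[OF A wU]]
      by (intro mult_mono add_mono frac_le) (auto intro!: mult_nonneg_nonneg add_nonneg_nonneg divide_nonneg_nonneg)
    also have "\<dots> = (a * b) * cmod (pden z0 A w)" by (simp add: pden_eq[OF A wU] norm_mult)
    finally show ?thesis .
  qed
  then show ?thesis using ab by (intro exI[of _ "a * b"]) simp
qed

text \<open>The average over the group of the kernel \<open>(z - cnj z0)^(-k)\<close> under the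
  weight \<open>k\<close> action.\<close>

definition poincare :: "complex \<Rightarrow> nat \<Rightarrow> complex \<Rightarrow> complex" where
  "poincare z0 k z = (if z \<in> UHP then (\<Sum>\<^sub>\<infinity>A\<in>G. 1 / pden z0 A z ^ k) else 0)"

lemma poincare_aut:
  assumes z0: "z0 \<in> UHP" and k: "k \<ge> 10"
  shows "poincare z0 k \<in> aut (int k)"
  unfolding aut_def
proof (intro CollectI conjI ballI allI impI)
  let ?P = "\<lambda>z. \<Sum>\<^sub>\<infinity>A\<in>G. 1 / pden z0 A z ^ k"
  have nz: "pden z0 A z \<noteq> 0" if "A \<in> G" "z \<in> UHP" for A z
  proof -
    have "Im (moebius A z - cnj z0) > 0" using z0 moebius_G[OF that] by (simp add: UHP_def)
    then have "moebius A z - cnj z0 \<noteq> 0" by force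
    then show ?thesis using jac_nz[OF that] by (simp add: pden_eq[OF that])
  qed
  have "?P holomorphic_on UHP"
    unfolding holomorphic_on_def
  proof
    fix z assume "z \<in> UHP"
    then obtain e where e: "e > 0" "cball z e \<subseteq> UHP" using open_UHP open_contains_cball by blast
    obtain C where C: "C > 0" "\<And>w A. w \<in> cball z e \<Longrightarrow> A \<in> G \<Longrightarrow> row_sum A \<le> C * cmod (pden z0 A w)"
      using pden_lower[OF z0 compact_cball e(2)] by blast
    have bd: "norm (1 / pden z0 A w ^ k) \<le> C ^ k * (1 / row_sum A ^ k)" if "A \<in> G" "w \<in> cball z e" for A w
    proof -
      have r: "row_sum A > 0" using row_sum_ge_1[OF det_G[OF that(1)]] by simp
      have "row_sum A ^ k \<le> (C * cmod (pden z0 A w)) ^ k" using C(2)[OF that(2,1)] r by (intro power_mono) auto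
      moreover have "cmod (pden z0 A w) > 0" using nz[OF that(1)] that(2) e(2) by auto
      ultimately show ?thesis using r by (simp add: norm_divide norm_power power_mult_distrib field_simps)
    qed
    have ul: "uniform_limit (cball z e) (\<lambda>X w. \<Sum>A\<in>X. 1 / pden z0 A w ^ k) ?P (finite_subsets_at_top G)"
      by (rule Weierstrass_m_test_general[OF bd summable_on_cmult_right[OF summable_row_sum[OF k]]])
    have "?P holomorphic_on ball z e"
    proof (rule holomorphic_uniform_limit[OF _ ul])
      have "(\<lambda>w. \<Sum>A\<in>X. 1 / pden z0 A w ^ k) holomorphic_on cball z e" if "X \<subseteq> G" for X
      proof -
        have "pden z0 A holomorphic_on cball z e" for A
          unfolding pden_def[abs_def] by (intro holomorphic_intros holomorphic_jac)
        moreover have "pden z0 A w ^ k \<noteq> 0" if "A \<in> X" "w \<in> cball z e" for A w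
        proof -
          have "A \<in> G" "w \<in> UHP" using that e(2) \<open>X \<subseteq> G\<close> by blast+
          then show ?thesis using nz by simp
        qed
        ultimately show ?thesis by (intro holomorphic_intros) auto
      qed
      then show "\<forall>\<^sub>F X in finite_subsets_at_top G. continuous_on (cball z e) (\<lambda>w. \<Sum>A\<in>X. 1 / pden z0 A w ^ k) \<and>
          (\<lambda>w. \<Sum>A\<in>X. 1 / pden z0 A w ^ k) holomorphic_on ball z e"
        by (intro eventually_finite_subsets_at_top_weakI conjI)
           (auto intro: holomorphic_on_imp_continuous_on holomorphic_on_subset[OF _ ball_subset_cball])
    qed auto
    then have "?P field_differentiable (at z)"
      using e(1) by (intro holomorphic_on_imp_differentiable_at[OF _ open_ball]) auto
    then show "?P field_differentiable (at z within UHP)" by (rule field_differentiable_at_within)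
  qed
  then show "poincare z0 k holomorphic_on UHP"
    by (rule holomorphic_transform) (simp add: poincare_def)
  show "poincare z0 k z = 0" if "z \<notin> UHP" for z using that by (simp add: poincare_def)
  fix B z assume B: "B \<in> G" and z: "z \<in> UHP"
  obtain C where C: "C \<in> G" "B ** C = mat 1" "C ** B = mat 1" using inv_G[OF B] by blast
  have bij: "bij_betw (\<lambda>A. A ** B) G G"
    by (rule bij_betw_byWitness[where f' = "\<lambda>A. A ** C"])
       (use B C mult_G in \<open>auto simp: matrix_mul_assoc[symmetric]\<close>)
  have "1 / pden z0 A (moebius B z) ^ k = jac B z ^ k * (1 / pden z0 (A ** B) z ^ k)" if A: "A \<in> G" for A
  proof -
    have "pden z0 (A ** B) z = pden z0 A (moebius B z) * jac B z"
      unfolding pden_eq[OF mult_G[OF A B] z] pden_eq[OF A moebius_G[OF B z]]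
        jac_mult[OF det_G[OF A] det_G[OF B] z] moebius_mult[OF det_G[OF A] det_G[OF B] z] by simp
    then show ?thesis using jac_nz[OF B z] by (simp add: power_mult_distrib)
  qed
  then have "?P (moebius B z) = (\<Sum>\<^sub>\<infinity>A\<in>G. jac B z ^ k * (1 / pden z0 (A ** B) z ^ k))"
    by (rule infsum_cong)
  also have "\<dots> = jac B z ^ k * (\<Sum>\<^sub>\<infinity>A\<in>G. 1 / pden z0 (A ** B) z ^ k)" by (rule infsum_cmult_right')
  also have "(\<Sum>\<^sub>\<infinity>A\<in>G. 1 / pden z0 (A ** B) z ^ k) = ?P z"
    by (rule infsum_reindex_bij_betw[OF bij])
  finally show "poincare z0 k (moebius B z) = jac B z powi int k * poincare z0 k z"
    using z moebius_G[OF B z] by (simp add: poincare_def)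
qed

text \<open>On the stabilizer of \<open>z0\<close> the cocycle relation makes \<open>jac\<close>
  multiplicative, so its values at \<open>z0\<close> form a finite set \<open>U\<close> of nonzero
  numbers closed under multiplication. Multiplication by \<open>x\<close> permutes \<open>U\<close>,
  and comparing the products over \<open>U\<close> gives \<open>x ^ card U = 1\<close>.\<close>

lemma stabilizer_jac_root_of_unity:
  assumes z0: "z0 \<in> UHP"
  shows "\<exists>n>0. \<forall>A\<in>{A\<in>G. moebius A z0 = z0}. jac A z0 ^ n = 1"
proof -
  let ?S = "{A\<in>G. moebius A z0 = z0}"
  define U where "U = (\<lambda>A. jac A z0) ` ?S"
  have "finite ?S" using finite_meeting[of "{z0}" "{z0}"] z0 by simp
  then have fin: "finite U" by (simp add: U_def)
  have "1 \<in> U" unfolding U_def using one_G by (intro image_eqI[of _ _ "mat 1"]) auto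
  then have "card U > 0" using fin by (auto simp: card_gt_0_iff)
  moreover have "x ^ card U = 1" if x: "x \<in> U" for x
  proof -
    have nz: "y \<noteq> 0" if "y \<in> U" for y using that jac_nz z0 by (auto simp: U_def)
    have "(*) x ` U \<subseteq> U"
    proof
      fix y assume "y \<in> (*) x ` U"
      then obtain A B where AB: "A \<in> ?S" "B \<in> ?S" "x = jac A z0" "y = x * jac B z0"
        using x by (auto simp: U_def)
      then have "jac (A ** B) z0 = y" "moebius (A ** B) z0 = z0"
        using jac_mult[of A B z0] moebius_mult[of A B z0] det_G z0 by auto
      then show "y \<in> U" unfolding U_def using AB mult_G by (intro image_eqI[of _ _ "A ** B"]) auto
    qed
    moreover have inj: "inj_on ((*) x) U" using nz[OF x] by (simp add: inj_on_def)
    ultimately have "(*) x ` U = U" using fin by (simp add: endo_inj_surj)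
    then have "(\<Prod>y\<in>U. y) = (\<Prod>y\<in>U. x * y)" using prod.reindex[OF inj, of id] by simp
    also have "\<dots> = x ^ card U * (\<Prod>y\<in>U. y)" by (simp add: prod.distrib)
    finally show ?thesis using nz fin by simp
  qed
  ultimately show ?thesis by (intro exI[of _ "card U"]) (auto simp: U_def)
qed

text \<open>At \<open>z\<^sub>0\<close> the terms of the Poincare series of largest modulus are those of the stabilizer, and
  they add up coherently when the weight is a multiple of the order of its automorphy factors.\<close>

lemma exists_nonvanishing_form:
  assumes z0: "z0 \<in> UHP"
  shows "\<exists>k f. k > 0 \<and> f \<in> aut (int k) \<and> f z0 \<noteq> 0"
proof -
  define y0 where "y0 = Im z0"
  have y0: "y0 > 0" using z0 by (simp add: UHP_def y0_def)
  define S where "S = {A\<in>G. moebius A z0 = z0}"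
  have finS: "finite S" using finite_meeting[of "{z0}" "{z0}"] z0 by (simp add: S_def)
  obtain n where n: "n > 0" "\<And>A. A \<in> S \<Longrightarrow> jac A z0 ^ n = 1"
    using stabilizer_jac_root_of_unity[OF z0] by (auto simp: S_def)
  define p where "p = (\<lambda>A. pden z0 A z0)"
  define t where "t = (\<lambda>A. 2 * y0 / cmod (p A))"
  have two: "z0 - cnj z0 = 2 * \<i> * of_real y0" by (simp add: y0_def complex_eq_iff)
  \<comment> \<open>It comes from \<open>|w - cnj z0|^2 = |w - z0|^2 + 4 Im w Im z0\<close> and
    shows that the stabilizer has exactly the smallest denominators. Accordingly \<open>t A\<close>,
    the modulus of the term of \<open>A\<close> relative to the identity before taking powers, is
    below 1 off the stabilizer.\<close>
  have psq: "(cmod (p A))\<^sup>2 = (cmod (jac A z0))\<^sup>2 * (cmod (moebius A z0 - z0))\<^sup>2 + (2 * y0)\<^sup>2" if A: "A \<in> G" for A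
  proof -
    define w where "w = moebius A z0"
    have nz: "cmod (jac A z0) \<noteq> 0" using jac_nz[OF A z0] by simp
    have "Im w = y0 / (cmod (jac A z0))\<^sup>2" unfolding w_def y0_def by (rule Im_moebius[OF det_G[OF A]])
    then have iw: "(cmod (jac A z0))\<^sup>2 * Im w = y0" using nz by simp
    have "(cmod (w - cnj z0))\<^sup>2 = (cmod (w - z0))\<^sup>2 + 4 * Im w * y0"
      unfolding cmod_power2 by (simp add: y0_def power2_eq_square algebra_simps)
    then have "(cmod (p A))\<^sup>2 = (cmod (jac A z0))\<^sup>2 * (cmod (w - z0))\<^sup>2 + 4 * ((cmod (jac A z0))\<^sup>2 * Im w) * y0"
      unfolding p_def pden_eq[OF A z0] w_def[symmetric] norm_mult power_mult_distrib by (simp only: algebra_simps)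
    then show ?thesis unfolding iw by (simp add: w_def power2_eq_square)
  qed
  have pos: "cmod (p A) > 0" if "A \<in> G" for A
  proof -
    have "(cmod (p A))\<^sup>2 \<ge> (2 * y0)\<^sup>2" using psq[OF that] by simp
    then have "(cmod (p A))\<^sup>2 > 0" using y0 by (smt (verit) zero_less_power2)
    then show ?thesis by simp
  qed
  have t1: "t A < 1" if "A \<in> G - S" for A
  proof -
    have "A \<in> G" "moebius A z0 \<noteq> z0" using that by (auto simp: S_def)
    then have "(cmod (jac A z0))\<^sup>2 * (cmod (moebius A z0 - z0))\<^sup>2 > 0" using jac_nz[OF _ z0] by simp
    then have "(2 * y0)\<^sup>2 < (cmod (p A))\<^sup>2" using psq[OF \<open>A \<in> G\<close>] by simp
    then have "2 * y0 < cmod (p A)" by (rule power2_less_imp_less) simp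
    then show ?thesis using pos[OF \<open>A \<in> G\<close>] by (simp add: t_def)
  qed
  have t0: "t A \<ge> 0" for A using y0 by (simp add: t_def)
  obtain C where C: "C > 0" "\<And>A. A \<in> G \<Longrightarrow> row_sum A \<le> C * cmod (p A)"
    using pden_lower[OF z0, of "{z0}"] z0 by (auto simp: p_def)
  have summ: "(\<lambda>A. t A ^ 10) summable_on G"
  proof (rule summable_on_comparison_test[OF summable_on_cmult_right[OF summable_row_sum[of 10], of "(2 * y0 * C) ^ 10"]])
    fix A assume A: "A \<in> G"
    have r: "row_sum A > 0" using row_sum_ge_1[OF det_G[OF A]] by simp
    have "t A \<le> 2 * y0 * C * (1 / row_sum A)"
      using C(2)[OF A] pos[OF A] r y0 unfolding t_def by (simp add: field_simps)
    then have "t A ^ 10 \<le> (2 * y0 * C * (1 / row_sum A)) ^ 10" using t0 by (intro power_mono)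
    then show "t A ^ 10 \<le> (2 * y0 * C) ^ 10 * (1 / row_sum A ^ 10)"
      by (simp add: power_mult_distrib power_divide)
  qed (use t0 in auto)
  \<comment> \<open>Only finitely many elements off the stabilizer have \<open>t\<close> above 1/2,
    so a single \<open>q < 1\<close> bounds \<open>t\<close> on all of \<open>G - S\<close>.\<close>
  define F where "F = {A\<in>G - S. t A > 1/2}"
  have "F \<subseteq> {A\<in>G. row_sum A \<le> C * (4 * y0)}"
  proof
    fix A assume "A \<in> F"
    then have A: "A \<in> G" "t A > 1/2" by (auto simp: F_def)
    then have "cmod (p A) \<le> 4 * y0" using pos[OF A(1)] by (simp add: t_def field_simps)
    then have "C * cmod (p A) \<le> C * (4 * y0)" using C(1) by simp
    then show "A \<in> {A\<in>G. row_sum A \<le> C * (4 * y0)}" using C(2)[OF A(1)] A by auto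
  qed
  then have finF: "finite F" using finite_bounded finite_subset by blast
  define q where "q = Max (insert (1/2) (t ` F))"
  have q1: "q < 1" unfolding q_def using finF t1 by (subst Max_less_iff) (auto simp: F_def)
  have q0: "q > 0" unfolding q_def using finF by (intro less_le_trans[OF _ Max_ge[of _ "1/2"]]) auto
  have tq: "t A \<le> q" if "A \<in> G - S" for A
  proof (cases "A \<in> F")
    case True then show ?thesis unfolding q_def using finF by (intro Max_ge) auto
  next
    case False
    then have "t A \<le> 1/2" using that by (auto simp: F_def)
    also have "1/2 \<le> q" unfolding q_def using finF by (intro Max_ge) auto
    finally show ?thesis .
  qed
  define W where "W = (\<Sum>\<^sub>\<infinity>A\<in>G. t A ^ 10)"
  have W0: "W \<ge> 0" unfolding W_def using t0 by (intro infsum_nonneg) auto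
  have "(\<lambda>N. q ^ N * W) \<longlonglongrightarrow> 0 * W"
    using q0 q1 by (intro tendsto_mult_right LIMSEQ_power_zero) auto
  then have "\<forall>\<^sub>F N in sequentially. q ^ N * W < 1" by (intro order_tendstoD(2)[where y = 0 and a = 1]) auto
  then obtain N where N: "\<And>m. m \<ge> N \<Longrightarrow> q ^ m * W < 1" by (auto simp: eventually_sequentially)
  \<comment> \<open>A multiple of \<open>n\<close>, so that each stabilizer term equals 1. Ten
    powers of \<open>t\<close> are kept for convergence, and at least \<open>N\<close> powers of
    \<open>q\<close> remain to push the tail below 1.\<close>
  define k where "k = n * (N + 10)"
  have kN: "k \<ge> N + 10" using n(1) by (simp add: k_def)
  have bnd: "norm ((2 * \<i> * of_real y0 / p A) ^ k) \<le> q ^ (k - 10) * t A ^ 10" if "A \<in> G - S" for A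
  proof -
    have "norm ((2 * \<i> * of_real y0 / p A) ^ k) = t A ^ k"
      using y0 by (simp add: t_def norm_power norm_divide norm_mult)
    also have "\<dots> = t A ^ (k - 10) * t A ^ 10" using kN by (simp flip: power_add)
    also have "\<dots> \<le> q ^ (k - 10) * t A ^ 10" using tq[OF that] t0 by (intro mult_right_mono power_mono) auto
    finally show ?thesis .
  qed
  let ?u = "\<lambda>A. (2 * \<i> * of_real y0 / p A) ^ k"
  have sG: "(\<lambda>A. q ^ (k - 10) * t A ^ 10) summable_on (G - S)"
    by (intro summable_on_cmult_right summable_on_subset_banach[OF summ]) auto
  have s1: "?u summable_on (G - S)"
    by (rule abs_summable_summable[OF Infinite_Sum.abs_summable_on_comparison_test'[OF sG bnd]])
  have sum_eq: "(\<Sum>\<^sub>\<infinity>A\<in>G. ?u A) = (\<Sum>A\<in>S. ?u A) + (\<Sum>\<^sub>\<infinity>A\<in>G - S. ?u A)"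
  proof -
    have "G = S \<union> (G - S)" by (auto simp: S_def)
    then show ?thesis
      using infsum_Un_disjoint[of ?u S "G - S"] s1 finS by (simp add: summable_on_finite)
  qed
  have "(\<Sum>A\<in>S. ?u A) = of_nat (card S)"
  proof -
    have "?u A = 1" if A: "A \<in> S" for A
    proof -
      have "p A = jac A z0 * (2 * \<i> * of_real y0)"
        using A pden_eq[of A z0 z0] z0 two by (simp add: p_def S_def)
      moreover have "jac A z0 ^ k = 1" using n(2)[OF A] by (simp add: k_def power_mult)
      ultimately show ?thesis using y0 by (simp add: power_divide power_mult_distrib)
    qed
    then show ?thesis by simp
  qed
  moreover have "mat 1 \<in> S" using one_G by (simp add: S_def)
  then have "card S \<ge> 1" using finS by (metis One_nat_def Suc_leI card_gt_0_iff empty_iff)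
  moreover have "norm (\<Sum>\<^sub>\<infinity>A\<in>G - S. ?u A) < 1"
  proof -
    have "norm (\<Sum>\<^sub>\<infinity>A\<in>G - S. ?u A) \<le> (\<Sum>\<^sub>\<infinity>A\<in>G - S. q ^ (k - 10) * t A ^ 10)"
      by (rule norm_infsum_le[OF has_sum_infsum[OF s1] has_sum_infsum[OF sG] bnd])
    also have "\<dots> = q ^ (k - 10) * (\<Sum>\<^sub>\<infinity>A\<in>G - S. t A ^ 10)" by (rule infsum_cmult_right')
    also have "\<dots> \<le> q ^ (k - 10) * W"
      unfolding W_def using q0 t0
      by (intro mult_left_mono infsum_mono2 summable_on_subset_banach[OF summ] summ) auto
    also have "\<dots> < 1" using kN by (intro N) simp
    finally show ?thesis .
  qed
  ultimately have nz: "(\<Sum>\<^sub>\<infinity>A\<in>G. ?u A) \<noteq> 0"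
    unfolding sum_eq by (metis add.commute add_eq_0_iff norm_minus_cancel norm_of_nat not_less of_nat_1 of_nat_le_iff)
  have "(\<Sum>\<^sub>\<infinity>A\<in>G. ?u A) = (2 * \<i> * of_real y0) ^ k * poincare z0 k z0"
  proof -
    have "(\<Sum>\<^sub>\<infinity>A\<in>G. ?u A) = (\<Sum>\<^sub>\<infinity>A\<in>G. (2 * \<i> * of_real y0) ^ k * (1 / pden z0 A z0 ^ k))"
      by (simp add: p_def power_divide)
    also have "\<dots> = (2 * \<i> * of_real y0) ^ k * (\<Sum>\<^sub>\<infinity>A\<in>G. 1 / pden z0 A z0 ^ k)" by (rule infsum_cmult_right')
    finally show ?thesis using z0 by (simp add: poincare_def)
  qed
  then have "poincare z0 k z0 \<noteq> 0" using nz by auto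
  moreover have "poincare z0 k \<in> aut (int k)" by (rule poincare_aut[OF z0]) (use kN in simp)
  ultimately show ?thesis using kN by (intro exI[of _ k] exI[of _ "poincare z0 k"]) auto
qed

lemma aut_finite_zeros:
  assumes f: "f \<in> aut k" "f \<noteq> (\<lambda>z. 0)" and K: "compact K" "K \<subseteq> UHP"
  shows "finite {z\<in>K. f z = 0}"
proof (cases "f constant_on UHP")
  case True
  then obtain c where c: "\<And>z. z \<in> UHP \<Longrightarrow> f z = c" unfolding constant_on_def by blast
  then have "c \<noteq> 0" using f autD(2)[OF f(1)] by (metis ext)
  then have "{z\<in>K. f z = 0} = {}" using c K(2) by fastforce
  then show ?thesis by (simp only: finite.emptyI)
next
  case False
  then show ?thesis
    by (rule holomorphic_compact_finite_zeros[OF autD(1)[OF f(1)] open_UHP connected_UHP K])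
qed

text \<open>By compactness finitely many forms, brought to a common weight, have no common zero on
  \<open>K\<close>. One of them is \<open>f\<close>. A combination with coefficients
  \<open>t^i\<close> of all of them serves as \<open>g\<close>, with \<open>t\<close> chosen to
  avoid the finitely many zeros of \<open>f\<close> in \<open>K\<close>.\<close>

lemma exists_forms_without_common_zero:
  "\<exists>k f g. k > 0 \<and> f \<in> aut (int k) \<and> g \<in> aut (int k) \<and> f \<noteq> (\<lambda>z. 0) \<and>
     (\<forall>z\<in>UHP. f z \<noteq> 0 \<or> g z \<noteq> 0)"
proof -
  obtain K where K: "compact K" "K \<subseteq> UHP" "\<And>z. z \<in> UHP \<Longrightarrow> \<exists>A\<in>G. moebius A z \<in> K"
    using cocompact_G by blast
  have "\<exists>kf. fst kf > 0 \<and> snd kf \<in> aut (int (fst kf)) \<and> snd kf z \<noteq> 0" if "z \<in> UHP" for z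
    using exists_nonvanishing_form[OF that] by auto
  then obtain kf where kf: "\<And>z. z \<in> UHP \<Longrightarrow> fst (kf z) > (0::nat) \<and> snd (kf z) \<in> aut (int (fst (kf z))) \<and> snd (kf z) z \<noteq> 0"
    by metis
  define wt where "wt = (\<lambda>z. fst (kf z))"
  define F where "F = (\<lambda>z. snd (kf z))"
  have F: "wt z > 0" "F z \<in> aut (int (wt z))" "F z z \<noteq> 0" if "z \<in> UHP" for z
    using kf[OF that] by (auto simp: wt_def F_def)
  define N where "N = (\<lambda>z. {w\<in>UHP. F z w \<noteq> 0})"
  have "open (N z)" if "z \<in> UHP" for z
  proof -
    have "N z = UHP \<inter> F z -` (- {0})" unfolding N_def by auto
    then show ?thesis
      using holomorphic_on_imp_continuous_on[OF autD(1)[OF F(2)[OF that]]] open_UHP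
      by (metis continuous_open_preimage open_Compl closed_singleton)
  qed
  moreover have "K \<subseteq> (\<Union>z\<in>K. N z)"
  proof
    fix z assume "z \<in> K"
    moreover have "z \<in> UHP" using \<open>z \<in> K\<close> K(2) by blast
    ultimately show "z \<in> (\<Union>z\<in>K. N z)" using F(3)[of z] unfolding N_def by blast
  qed
  ultimately obtain Z where Z: "Z \<subseteq> K" "finite Z" "K \<subseteq> (\<Union>z\<in>Z. N z)"
    using compactE_image[OF K(1), of K N] K(2) by (metis subsetD)
  have ZU: "z \<in> UHP" if "z \<in> Z" for z using that Z K by blast
  \<comment> \<open>A common multiple of the weights; taking powers reaches weight \<open>k\<close>
    and keeps the zero sets.\<close>
  define k where "k = (\<Prod>z\<in>Z. wt z)"
  have k0: "k > 0" unfolding k_def using F(1) ZU by (simp add: prod_pos)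
  have dv: "wt z dvd k" if "z \<in> Z" for z unfolding k_def using that Z(2) by (rule dvd_prodI[rotated])
  define h where "h = (\<lambda>z w. F z w ^ (k div wt z))"
  have hk: "k div wt z > 0" if "z \<in> Z" for z
    using dv[OF that] k0 F(1)[OF ZU[OF that]] by (simp add: dvd_imp_le div_greater_zero_iff)
  have h: "h z \<in> aut (int k)" if "z \<in> Z" for z
  proof -
    have "h z \<in> aut (int (wt z) * int (k div wt z))"
      unfolding h_def by (rule aut_power[OF F(2)[OF ZU[OF that]] hk[OF that]])
    also have "int (wt z) * int (k div wt z) = int k" using dv[OF that] by (simp flip: of_nat_mult)
    finally show ?thesis .
  qed
  have hnz: "\<exists>z\<in>Z. h z w \<noteq> 0" if "w \<in> K" for w using that Z(3) by (auto simp: h_def N_def)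
  have "K \<noteq> {}" using K(3)[OF i_in_UHP] by blast
  then obtain z1 w1 where z1: "z1 \<in> Z" "h z1 w1 \<noteq> 0" using hnz by blast
  define f where "f = h z1"
  define Q where "Q = {w\<in>K. f w = 0}"
  have f: "f \<in> aut (int k)" "f \<noteq> (\<lambda>z. 0)" using h z1 by (auto simp: f_def)
  have finQ: "finite Q" unfolding Q_def by (rule aut_finite_zeros[OF f K(1,2)])
  obtain e where e: "bij_betw e {..<card Z} Z" using ex_bij_betw_nat_finite[OF Z(2)] atLeast0LessThan by metis
  \<comment> \<open>The combination at \<open>w\<close>, as a polynomial in its parameter. It is
    nonzero because some \<open>h z\<close> does not vanish at \<open>w\<close>, so each zero of
    \<open>f\<close> in \<open>K\<close> excludes finitely many parameters.\<close>
  define R where "R = (\<lambda>w. \<Sum>i<card Z. Polynomial.monom (h (e i) w) i)"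
  have cR: "poly.coeff (R w) i = h (e i) w" if "i < card Z" for w i
  proof -
    have "poly.coeff (R w) i = (\<Sum>j<card Z. if j = i then h (e j) w else 0)"
      unfolding R_def coeff_sum coeff_monom ..
    also have "\<dots> = h (e i) w" using that by simp
    finally show ?thesis .
  qed
  have "R w \<noteq> 0" if w: "w \<in> K" for w
  proof -
    obtain z where "z \<in> Z" "h z w \<noteq> 0" using hnz[OF w] by blast
    then have "z \<in> e ` {..<card Z}" by (simp only: bij_betw_imp_surj_on[OF e])
    then obtain i where "e i = z" "i < card Z" by (metis imageE lessThan_iff)
    then have "i < card Z" "h (e i) w \<noteq> 0" using \<open>h z w \<noteq> 0\<close> by auto
    then have "poly.coeff (R w) i \<noteq> 0" using cR[of i w] by simp
    then show ?thesis by (metis coeff_0)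
  qed
  then have "finite (\<Union>w\<in>Q. {t. poly (R w) t = 0})"
    using finQ by (auto simp: Q_def intro!: poly_roots_finite)
  then obtain t where t: "t \<notin> (\<Union>w\<in>Q. {t. poly (R w) t = 0})"
    using ex_new_if_finite[OF infinite_UNIV_char_0] by metis
  define g where "g = (\<lambda>w. \<Sum>i<card Z. t ^ i * h (e i) w)"
  have "e i \<in> Z" if "i < card Z" for i using e that unfolding bij_betw_def by blast
  then have g: "g \<in> aut (int k)" unfolding g_def by (intro aut_sum aut_scale h) auto
  have gR: "g w = poly (R w) t" for w
    unfolding g_def R_def by (simp add: poly_sum poly_monom mult.commute)
  have "f z \<noteq> 0 \<or> g z \<noteq> 0" if z: "z \<in> UHP" for z
  proof -
    obtain A where A: "A \<in> G" "moebius A z \<in> K" using K(3)[OF z] by blast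
    have "f (moebius A z) \<noteq> 0 \<or> g (moebius A z) \<noteq> 0"
      using t A(2) unfolding gR by (auto simp: Q_def)
    then show ?thesis using autD(3)[OF f(1) A(1) z] autD(3)[OF g A(1) z] by auto
  qed
  then show ?thesis using k0 f g by blast
qed

end

section \<open>Division of automorphic forms\<close>

text \<open>Makes the complex functions a complex vector space, so that spans and subspaces can be
  used.\<close>

definition cscale :: "complex \<Rightarrow> (complex \<Rightarrow> complex) \<Rightarrow> complex \<Rightarrow> complex" where
  "cscale c f = (\<lambda>z. c * f z)"

interpretation cf: vector_space cscale
  by unfold_locales (auto simp: cscale_def fun_eq_iff algebra_simps)

lemma cf_subspaceI:
  assumes "(\<lambda>z. 0) \<in> V" "\<And>f g. f \<in> V \<Longrightarrow> g \<in> V \<Longrightarrow> (\<lambda>z. f z + g z) \<in> V"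
    "\<And>c f. f \<in> V \<Longrightarrow> (\<lambda>z. c * f z) \<in> V"
  shows "cf.subspace V"
  unfolding cf.subspace_def using assms by (simp add: zero_fun_def plus_fun_def cscale_def)

text \<open>The functionals are linear on \<open>V\<close> only: they will be derivatives at points,
  additive on holomorphic functions. The induction passes to the kernel \<open>V0\<close> of one
  functional; a vector \<open>u\<close> outside it, if there is one, completes the spanning
  set.\<close>

lemma finite_functionals_spanning:
  fixes l :: "'i \<Rightarrow> (complex \<Rightarrow> complex) \<Rightarrow> complex"
  assumes "finite I" "cf.subspace V"
    and "\<And>i v w. i \<in> I \<Longrightarrow> v \<in> V \<Longrightarrow> w \<in> V \<Longrightarrow> l i (v + w) = l i v + l i w"
    and "\<And>i c v. i \<in> I \<Longrightarrow> v \<in> V \<Longrightarrow> l i (cscale c v) = c * l i v"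
  shows "\<exists>B. finite B \<and> B \<subseteq> V \<and> (\<forall>v\<in>V. \<exists>w\<in>cf.span B. \<forall>i\<in>I. l i (v - w) = 0)"
  using assms
proof (induction I arbitrary: V rule: finite_induct)
  case empty
  then show ?case by (intro exI[of _ "{}"]) (auto intro: cf.span_zero)
next
  case (insert i I)
  define V0 where "V0 = {v\<in>V. l i v = 0}"
  have "cscale 0 0 = 0" by (simp add: cscale_def zero_fun_def)
  then have z: "l i 0 = 0" using insert.prems(3)[of i 0 0] cf.subspace_0[OF insert.prems(1)]
    by (metis insertI1 mult_zero_left)
  have add: "l i (x + y) = l i x + l i y" if "x \<in> V" "y \<in> V" for x y
    by (rule insert.prems(2)) (use that in auto)
  have scale: "l i (cscale c x) = c * l i x" if "x \<in> V" for c x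
    by (rule insert.prems(3)) (use that in auto)
  have sub0: "cf.subspace V0"
    unfolding cf.subspace_def
  proof (intro conjI ballI allI)
    show "0 \<in> V0" using z cf.subspace_0[OF insert.prems(1)] by (simp only: V0_def mem_Collect_eq)
    show "x + y \<in> V0" if "x \<in> V0" "y \<in> V0" for x y
    proof -
      have xy: "x \<in> V" "y \<in> V" "l i x = 0" "l i y = 0" using that unfolding V0_def by blast+
      have "l i (x + y) = 0" unfolding add[OF xy(1,2)] xy(3,4) by (rule add_0)
      then show ?thesis using cf.subspace_add[OF insert.prems(1) xy(1,2)] unfolding V0_def by blast
    qed
    show "cscale c x \<in> V0" if "x \<in> V0" for c x
    proof -
      have x: "x \<in> V" "l i x = 0" using that unfolding V0_def by blast+
      have "l i (cscale c x) = 0" unfolding scale[OF x(1)] x(2) by (rule mult_zero_right)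
      then show ?thesis using cf.subspace_scale[OF insert.prems(1) x(1)] unfolding V0_def by blast
    qed
  qed
  obtain B where B: "finite B" "B \<subseteq> V0" "\<And>v. v \<in> V0 \<Longrightarrow> \<exists>w\<in>cf.span B. \<forall>i\<in>I. l i (v - w) = 0"
  proof -
    have "\<exists>B. finite B \<and> B \<subseteq> V0 \<and> (\<forall>v\<in>V0. \<exists>w\<in>cf.span B. \<forall>i\<in>I. l i (v - w) = 0)"
    proof (rule insert.IH[OF sub0])
      fix j v w assume "j \<in> I" "v \<in> V0" "w \<in> V0"
      then show "l j (v + w) = l j v + l j w" by (intro insert.prems(2)) (simp_all add: V0_def)
    next
      fix j c v assume "j \<in> I" "v \<in> V0"
      then show "l j (cscale c v) = c * l j v" by (intro insert.prems(3)) (simp_all add: V0_def)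
    qed
    then show ?thesis using that by blast
  qed
  have BV: "B \<subseteq> V" using B by (auto simp: V0_def)
  have spanV0: "cf.span B \<subseteq> V0" by (rule cf.span_minimal[OF B(2) sub0])
  show ?case
  proof (cases "V0 = V")
    case True
    have "\<exists>w\<in>cf.span B. \<forall>i\<in>insert i I. l i (v - w) = 0" if v: "v \<in> V" for v
    proof -
      obtain w where w: "w \<in> cf.span B" "\<forall>i\<in>I. l i (v - w) = 0" using B(3) v True by blast
      have "v - w \<in> V0" using cf.subspace_diff[OF sub0] v True w spanV0 by blast
      then show ?thesis using w by (auto simp: V0_def)
    qed
    then show ?thesis using B(1) BV by (intro exI[of _ B]) blast
  next
    case False
    then obtain u where u: "u \<in> V" "l i u \<noteq> 0" by (auto simp: V0_def)
    have "\<exists>w\<in>cf.span (insert u B). \<forall>i\<in>insert i I. l i (v - w) = 0" if v: "v \<in> V" for v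
    proof -
      define a where "a = l i v / l i u"
      define v' where "v' = v + cscale (- a) u"
      have "v' \<in> V" unfolding v'_def
        by (intro cf.subspace_add[OF insert.prems(1)] cf.subspace_scale[OF insert.prems(1)] v u(1))
      moreover have "l i v' = 0"
      proof -
        have "cscale (- a) u \<in> V" by (rule cf.subspace_scale[OF insert.prems(1) u(1)])
        then have "l i v' = l i v + (- a) * l i u"
          unfolding v'_def by (simp only: add[OF v] scale[OF u(1)])
        then show ?thesis using u(2) by (simp add: a_def)
      qed
      ultimately have v': "v' \<in> V0" by (simp add: V0_def)
      then obtain w where w: "w \<in> cf.span B" "\<forall>i\<in>I. l i (v' - w) = 0" using B(3) by blast
      have "v' - w \<in> V0" using cf.subspace_diff[OF sub0 v'] w spanV0 by blast
      then have "\<forall>i\<in>insert i I. l i (v' - w) = 0" using w by (auto simp: V0_def)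
      moreover have "v' - w = v - (cscale a u + w)" by (simp add: v'_def cscale_def fun_eq_iff)
      moreover have "cscale a u + w \<in> cf.span (insert u B)"
      proof (rule cf.span_add)
        show "cscale a u \<in> cf.span (insert u B)" by (intro cf.span_scale cf.span_base) simp
        show "w \<in> cf.span (insert u B)" using w(1) cf.span_mono[of B "insert u B"] by blast
      qed
      ultimately show ?thesis by metis
    qed
    moreover have "finite (insert u B)" "insert u B \<subseteq> V" using B(1) BV u(1) by simp_all
    ultimately show ?thesis by blast
  qed
qed

definition locally_divides :: "(complex \<Rightarrow> complex) \<Rightarrow> complex \<Rightarrow> (complex \<Rightarrow> complex) \<Rightarrow> bool" where
  "locally_divides f q v \<longleftrightarrow>
     (\<exists>r>0. \<exists>u. u holomorphic_on ball q r \<and> (\<forall>w\<in>ball q r. v w = f w * u w))"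

text \<open>At a zero \<open>q\<close> of \<open>f\<close> the bound \<open>N\<close> is its order:
  vanishing to at least that order makes the quotient holomorphic near \<open>q\<close>. Only local
  holomorphy of \<open>v\<close> is asked for, because quotients \<open>a / g^n\<close> will be
  tested too.\<close>

lemma locally_divides_of_jets:
  assumes f: "f holomorphic_on UHP" "z1 \<in> UHP" "f z1 \<noteq> 0" and q: "q \<in> UHP"
  shows "\<exists>N. \<forall>v r. 0 < r \<longrightarrow> v holomorphic_on ball q r \<longrightarrow> (\<forall>j<N. (deriv ^^ j) v q = 0) \<longrightarrow> locally_divides f q v"
proof (cases "f q = 0")
  case False
  have "continuous_on UHP f" using f(1) by (rule holomorphic_on_imp_continuous_on)
  then have "open (UHP \<inter> f -` (- {0}))" by (intro continuous_open_preimage open_UHP) auto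
  then obtain s where s: "s > 0" "ball q s \<subseteq> UHP \<inter> f -` (- {0})"
    using q False open_contains_ball by (metis ComplI IntI singletonD vimageI)
  have "locally_divides f q v" if r: "0 < r" "v holomorphic_on ball q r" for v r
    unfolding locally_divides_def
  proof (intro exI conjI ballI)
    show "min r s > 0" using r s by simp
    have sub: "ball q (min r s) \<subseteq> ball q r" "ball q (min r s) \<subseteq> UHP" "\<And>w. w \<in> ball q (min r s) \<Longrightarrow> f w \<noteq> 0"
      using s(2) by auto
    show "(\<lambda>w. v w / f w) holomorphic_on ball q (min r s)"
      by (intro holomorphic_intros holomorphic_on_subset[OF r(2) sub(1)] holomorphic_on_subset[OF f(1) sub(2)] sub(3))
    show "v w = f w * (v w / f w)" if "w \<in> ball q (min r s)" for w using sub(3)[OF that] by simp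
  qed
  then show ?thesis by blast
next
  case True
  have "\<not> f constant_on UHP" using f q True unfolding constant_on_def by metis
  then obtain g s n where n: "0 < n" "0 < s" "ball q s \<subseteq> UHP" "g holomorphic_on ball q s"
      "\<And>w. w \<in> ball q s \<Longrightarrow> f w = (w - q) ^ n * g w" "\<And>w. w \<in> ball q s \<Longrightarrow> g w \<noteq> 0"
    using holomorphic_factor_zero_nonconstant[OF f(1) open_UHP connected_UHP q True] by metis
  have "locally_divides f q v" if r: "0 < r" "v holomorphic_on ball q r" and j: "\<forall>j<n. (deriv ^^ j) v q = 0" for v r
  proof (cases "\<forall>j. (deriv ^^ j) v q = 0")
    case True
    then have "v w = 0" if "w \<in> ball q r" for w using holomorphic_fun_eq_0_on_ball[OF r(2) that] by blast
    then show ?thesis unfolding locally_divides_def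
      by (intro exI[of _ r] exI[of _ "\<lambda>w. 0"]) (use r in auto)
  next
    case False
    define l where "l = (LEAST j. (deriv ^^ j) v q \<noteq> 0)"
    have l: "(deriv ^^ l) v q \<noteq> 0" "\<And>i. i < l \<Longrightarrow> (deriv ^^ i) v q = 0"
      using False LeastI_ex[of "\<lambda>j. (deriv ^^ j) v q \<noteq> 0"] not_less_Least[of _ "\<lambda>j. (deriv ^^ j) v q \<noteq> 0"]
      unfolding l_def by blast+
    have nl: "n \<le> l" using j l(1) by (meson not_le)
    then have l0: "0 < l" using n(1) by simp
    have vq: "v q = 0" using l(2)[OF l0] by simp
    obtain h t where t: "0 < t" "h holomorphic_on ball q t" "\<And>w. w \<in> ball q t \<Longrightarrow> v w - v q = (w - q) ^ l * h w"
      using holomorphic_factor_order_of_zero[OF r(2) open_ball _ l0 l(1)] l(2) r(1) by (metis centre_in_ball)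
    show ?thesis unfolding locally_divides_def
    proof (intro exI conjI ballI)
      show "min s t > 0" using n t by simp
      have sub: "ball q (min s t) \<subseteq> ball q s" "ball q (min s t) \<subseteq> ball q t" by auto
      show "(\<lambda>w. (w - q) ^ (l - n) * h w / g w) holomorphic_on ball q (min s t)"
        by (intro holomorphic_intros holomorphic_on_subset[OF t(2) sub(2)] holomorphic_on_subset[OF n(4) sub(1)])
           (use n(6) sub in blast)
      show "v w = f w * ((w - q) ^ (l - n) * h w / g w)" if w: "w \<in> ball q (min s t)" for w
      proof -
        have "v w = (w - q) ^ (n + (l - n)) * h w" using t(3) w sub nl vq by auto
        then show ?thesis using n(5,6)[of w] w sub by (auto simp: power_add)
      qed
    qed
  qed
  then show ?thesis by blast
qed

lemma eventually_nonzero: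
  assumes f: "f holomorphic_on UHP" "z1 \<in> UHP" "f z1 \<noteq> 0" and z: "z \<in> UHP"
  shows "eventually (\<lambda>w. w \<in> UHP \<and> f w \<noteq> 0) (at z)"
proof (cases "f z = 0")
  case True
  obtain r where "0 < r" "ball z r \<subseteq> UHP" "\<And>w. w \<in> ball z r - {z} \<Longrightarrow> f w \<noteq> 0"
    using isolated_zeros[OF f(1) open_UHP connected_UHP z True f(2,3)] by metis
  then show ?thesis unfolding eventually_at by (intro exI[of _ r]) (auto simp: dist_commute)
next
  case False
  have "continuous_on UHP f" using f(1) by (rule holomorphic_on_imp_continuous_on)
  then have "open (UHP \<inter> f -` (- {0}))" by (intro continuous_open_preimage open_UHP) auto
  then have "eventually (\<lambda>w. w \<in> UHP \<inter> f -` (- {0})) (at z)"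
    using z False by (intro eventually_at_in_open') auto
  then show ?thesis by eventually_elim auto
qed

text \<open>The zeros of \<open>f\<close> are isolated, so \<open>D\<close> vanishes on a punctured
  neighbourhood of each point and by continuity at the point.\<close>

lemma zero_of_product_zero:
  assumes f: "f holomorphic_on UHP" "z1 \<in> UHP" "f z1 \<noteq> 0"
    and D: "continuous_on UHP D" "\<And>w. w \<in> UHP \<Longrightarrow> f w * D w = 0" and z: "z \<in> UHP"
  shows "D z = 0"
proof -
  have "(D \<longlongrightarrow> D z) (at z)"
    using D(1) z open_UHP by (simp add: continuous_on_eq_continuous_at isCont_def)
  moreover have "eventually (\<lambda>w. D w = 0) (at z)"
    using eventually_nonzero[OF f z] by eventually_elim (use D(2) in auto)
  then have "(D \<longlongrightarrow> 0) (at z)" by (rule tendsto_eventually)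
  ultimately show ?thesis by (rule tendsto_unique[OF trivial_limit_at])
qed

context cocompact_group
begin

lemma aut_nonzero_point: "f \<in> aut k \<Longrightarrow> f \<noteq> (\<lambda>z. 0) \<Longrightarrow> \<exists>z1\<in>UHP. f z1 \<noteq> 0"
  using autD(2) by (metis ext)

text \<open>Divisibility at the zeros in \<open>K\<close> is enough, since the transformation laws
  carry a local quotient at \<open>moebius A z\<close> back to \<open>z\<close>. The quotients glue,
  and the law of the result follows by cancelling \<open>f\<close>.\<close>

lemma aut_divide:
  assumes f: "f \<in> aut k" "f \<noteq> (\<lambda>z. 0)" and b: "b \<in> aut m"
    and K: "K \<subseteq> UHP" "\<And>z. z \<in> UHP \<Longrightarrow> \<exists>A\<in>G. moebius A z \<in> K"
    and loc: "\<And>q. q \<in> K \<Longrightarrow> f q = 0 \<Longrightarrow> locally_divides f q b"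
  shows "\<exists>g\<in>aut (m - k). b = (\<lambda>z. f z * g z)"
proof -
  obtain z1 where z1: "z1 \<in> UHP" "f z1 \<noteq> 0" using aut_nonzero_point[OF f] by blast
  note hf = autD(1)[OF f(1)] and hb = autD(1)[OF b]
  note nz = eventually_nonzero[OF hf z1]
  have locK: "locally_divides f q b" if q: "q \<in> K" for q
  proof (cases "f q = 0")
    case False
    have "q \<in> UHP" using q K by blast
    have "continuous_on UHP f" using hf by (rule holomorphic_on_imp_continuous_on)
    then have "open (UHP \<inter> f -` (- {0}))" by (intro continuous_open_preimage open_UHP) auto
    then obtain s where s: "s > 0" "ball q s \<subseteq> UHP \<inter> f -` (- {0})"
      using \<open>q \<in> UHP\<close> False open_contains_ball by (metis ComplI IntI singletonD vimageI)
    then have sub: "ball q s \<subseteq> UHP" "\<And>w. w \<in> ball q s \<Longrightarrow> f w \<noteq> 0" by auto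
    have "(\<lambda>w. b w / f w) holomorphic_on ball q s"
      by (intro holomorphic_intros holomorphic_on_subset[OF hb sub(1)] holomorphic_on_subset[OF hf sub(1)] sub(2))
    moreover have "\<forall>w\<in>ball q s. b w = f w * (b w / f w)" using sub(2) by auto
    ultimately show ?thesis unfolding locally_divides_def using s(1) by blast
  qed (use loc q in blast)
  have locU: "locally_divides f z b" if z: "z \<in> UHP" for z
  proof -
    obtain A where A: "A \<in> G" "moebius A z \<in> K" using K(2)[OF z] by blast
    obtain r u where r: "r > 0" "u holomorphic_on ball (moebius A z) r" "\<And>w. w \<in> ball (moebius A z) r \<Longrightarrow> b w = f w * u w"
      using locK[OF A(2)] unfolding locally_divides_def by blast
    have hA: "moebius A holomorphic_on UHP" by (rule holomorphic_moebius[OF det_G[OF A(1)]])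
    have "open (UHP \<inter> moebius A -` ball (moebius A z) r)"
      by (intro continuous_open_preimage holomorphic_on_imp_continuous_on hA open_UHP open_ball)
    moreover have "z \<in> UHP \<inter> moebius A -` ball (moebius A z) r" using z r by simp
    ultimately obtain s where s: "s > 0" "ball z s \<subseteq> UHP \<inter> moebius A -` ball (moebius A z) r"
      using open_contains_ball by blast
    have s1: "w \<in> UHP" "moebius A w \<in> ball (moebius A z) r" if "w \<in> ball z s" for w
      using s(2) that by auto
    \<comment> \<open>The quotient will have weight \<open>m - k\<close>, so pulling
      \<open>u\<close> back along \<open>A\<close> costs a factor
      \<open>jac^(k - m)\<close>.\<close>
    define v where "v = (\<lambda>w. jac A w powi (k - m) * u (moebius A w))"
    have "v holomorphic_on ball z s"
      unfolding v_def
    proof (intro holomorphic_intros holomorphic_jac)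
      show "(\<lambda>w. u (moebius A w)) holomorphic_on ball z s"
        by (rule holomorphic_on_compose_gen[of "moebius A" "ball z s" u "ball (moebius A z) r", unfolded o_def])
           (use hA s1 r(2) in \<open>auto intro: holomorphic_on_subset\<close>)
    qed (use jac_nz[OF A(1)] s1 in auto)
    moreover have "b w = f w * v w" if w: "w \<in> ball z s" for w
    proof -
      have nzj: "jac A w \<noteq> 0" using jac_nz[OF A(1) s1(1)[OF w]] .
      have "jac A w powi m * b w = jac A w powi k * f w * u (moebius A w)"
        using r(3)[OF s1(2)[OF w]] autD(3)[OF b A(1) s1(1)[OF w]] autD(3)[OF f(1) A(1) s1(1)[OF w]] by simp
      then have "jac A w powi (- m) * (jac A w powi m * b w) = jac A w powi (- m) * (jac A w powi k * f w * u (moebius A w))"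
        by simp
      moreover have "jac A w powi (- m) * jac A w powi m = 1" using nzj by (simp flip: power_int_add)
      moreover have "jac A w powi (- m) * jac A w powi k = jac A w powi (k - m)" using nzj by (simp flip: power_int_add)
      ultimately show ?thesis unfolding v_def by (metis mult.assoc mult.commute mult_1)
    qed
    ultimately show ?thesis unfolding locally_divides_def using s(1) by blast
  qed
  \<comment> \<open>The limit fills the removable singularities at the zeros of \<open>f\<close>;
    the value 0 off the half plane is the convention of \<open>aut\<close>.\<close>
  define g where "g = (\<lambda>z. if z \<in> UHP then Lim (at z) (\<lambda>w. b w / f w) else 0)"
  have gloc: "\<exists>r>0. ball z r \<subseteq> UHP \<and> g holomorphic_on ball z r \<and> (\<forall>w\<in>ball z r. b w = f w * g w)" if z: "z \<in> UHP" for z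
  proof -
    obtain r u where r: "r > 0" "u holomorphic_on ball z r" "\<And>w. w \<in> ball z r \<Longrightarrow> b w = f w * u w"
      using locU[OF z] unfolding locally_divides_def by blast
    obtain s where s: "s > 0" "ball z s \<subseteq> UHP" using z open_UHP open_contains_ball by blast
    define t where "t = min r s"
    have t: "t > 0" "ball z t \<subseteq> ball z r" "ball z t \<subseteq> UHP" using r s by (auto simp: t_def)
    have gu: "g w = u w" if w: "w \<in> ball z t" for w
    proof -
      have wU: "w \<in> UHP" using w t by blast
      have "eventually (\<lambda>x. x \<in> ball z t) (at w)" using w by (intro eventually_at_in_open') auto
      then have "eventually (\<lambda>x. u x = b x / f x) (at w)"
        using nz[OF wU] by eventually_elim (use r(3) t in auto)
      moreover have "(u \<longlongrightarrow> u w) (at w)"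
      proof -
        have "continuous_on (ball z r) u" using r(2) by (rule holomorphic_on_imp_continuous_on)
        then show ?thesis using w t by (auto simp: continuous_on_eq_continuous_at isCont_def)
      qed
      ultimately have "((\<lambda>x. b x / f x) \<longlongrightarrow> u w) (at w)" by (rule Lim_transform_eventually[rotated])
      then have "Lim (at w) (\<lambda>x. b x / f x) = u w" by (rule tendsto_Lim[OF trivial_limit_at])
      then show ?thesis using wU by (simp add: g_def)
    qed
    have "g holomorphic_on ball z t"
      by (rule holomorphic_transform[OF holomorphic_on_subset[OF r(2) t(2)]]) (simp add: gu)
    moreover have "\<forall>w\<in>ball z t. b w = f w * g w" using r(3) t(2) by (auto simp: gu)
    ultimately show ?thesis using t by blast
  qed
  have hg: "g holomorphic_on UHP"
    unfolding holomorphic_on_def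
  proof
    fix z assume "z \<in> UHP"
    then obtain r where "r > 0" "g holomorphic_on ball z r" using gloc by blast
    then have "g field_differentiable at z" by (intro holomorphic_on_imp_differentiable_at[of g "ball z r"]) auto
    then show "g field_differentiable at z within UHP" by (rule field_differentiable_at_within)
  qed
  have bfg: "b z = f z * g z" for z
  proof (cases "z \<in> UHP")
    case True
    then show ?thesis using gloc by (metis centre_in_ball)
  next
    case False
    then show ?thesis using autD(2)[OF b] autD(2)[OF f(1)] by simp
  qed
  have "g (moebius A z) = jac A z powi (m - k) * g z" if A: "A \<in> G" and z: "z \<in> UHP" for A z
  proof -
    have "g (moebius A z) - jac A z powi (m - k) * g z = 0"
    proof (rule zero_of_product_zero[OF hf z1 _ _ z])
      have c1: "continuous_on UHP (\<lambda>z. g (moebius A z))"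
        by (rule continuous_on_compose2[OF holomorphic_on_imp_continuous_on[OF hg]
              holomorphic_on_imp_continuous_on[OF holomorphic_moebius[OF det_G[OF A]]]])
           (use moebius_G[OF A] in auto)
      have "(\<lambda>z. jac A z powi (m - k) * g z) holomorphic_on UHP"
        by (intro holomorphic_intros holomorphic_jac hg) (use jac_nz[OF A] in auto)
      then show "continuous_on UHP (\<lambda>z. g (moebius A z) - jac A z powi (m - k) * g z)"
        by (intro continuous_on_diff c1 holomorphic_on_imp_continuous_on)
      fix w assume w: "w \<in> UHP"
      have nzj: "jac A w \<noteq> 0" by (rule jac_nz[OF A w])
      have "jac A w powi m * (f w * g w) = jac A w powi k * f w * g (moebius A w)"
        using bfg[of "moebius A w"] autD(3)[OF b A w] autD(3)[OF f(1) A w] bfg[of w] by simp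
      moreover have "jac A w powi m = jac A w powi k * jac A w powi (m - k)"
        using nzj by (simp flip: power_int_add)
      moreover have "jac A w powi k \<noteq> 0" using nzj by simp
      ultimately have "f w * g (moebius A w) = jac A w powi (m - k) * (f w * g w)"
        by (metis (no_types, lifting) mult.assoc mult_left_cancel)
      then show "f w * (g (moebius A w) - jac A w powi (m - k) * g w) = 0" by (simp add: algebra_simps)
    qed
    then show ?thesis by simp
  qed
  then have "g \<in> aut (m - k)" using hg unfolding aut_def by (auto simp: g_def)
  then show ?thesis using bfg by blast
qed

lemma subspace_aut: "cf.subspace (aut k)"
  by (rule cf_subspaceI) (auto intro: aut_zero aut_add aut_scale)

end

section \<open>Finite generation of the ring of automorphic forms\<close>

lemma cf_span_mult:
  assumes "x \<in> cf.span B"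
  shows "(\<lambda>z. f z * x z) \<in> cf.span ((\<lambda>b z. f z * b z) ` B)"
proof -
  let ?S = "{x. (\<lambda>z. f z * x z) \<in> cf.span ((\<lambda>b z. f z * b z) ` B)}"
  have "cf.subspace ?S"
  proof (rule cf_subspaceI)
    show "(\<lambda>z. 0) \<in> ?S" using cf.span_zero by (simp add: zero_fun_def)
    fix x y assume "x \<in> ?S" "y \<in> ?S"
    then have "(\<lambda>z. f z * x z) + (\<lambda>z. f z * y z) \<in> cf.span ((\<lambda>b z. f z * b z) ` B)" by (auto intro: cf.span_add)
    then show "(\<lambda>z. x z + y z) \<in> ?S" by (simp add: plus_fun_def distrib_left)
  next
    fix c x assume "x \<in> ?S"
    then have "cscale c (\<lambda>z. f z * x z) \<in> cf.span ((\<lambda>b z. f z * b z) ` B)" by (auto intro: cf.span_scale)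
    then show "(\<lambda>z. c * x z) \<in> ?S" by (simp add: cscale_def mult_ac)
  qed
  moreover have "B \<subseteq> ?S" by (auto intro: cf.span_base)
  ultimately have "cf.span B \<subseteq> ?S" by (rule cf.span_minimal[rotated])
  then show ?thesis using assms by blast
qed

context cocompact_group
begin

text \<open>Finitely many linear conditions for divisibility by \<open>f\<close>: derivatives up to
  a suitable order at each of its finitely many zeros in \<open>K\<close>. One set \<open>J\<close>
  serves functions of every weight.\<close>

lemma jets_exist:
  assumes f: "f \<in> aut k" "f \<noteq> (\<lambda>z. 0)" and K: "compact K" "K \<subseteq> UHP"
  shows "\<exists>J. finite J \<and> fst ` J \<subseteq> {q\<in>K. f q = 0} \<and>
    (\<forall>q\<in>K. f q = 0 \<longrightarrow> (\<forall>v r. 0 < r \<longrightarrow> v holomorphic_on ball q r \<longrightarrow> (\<forall>(p, j)\<in>J. (deriv ^^ j) v p = 0) \<longrightarrow> locally_divides f q v))"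
proof -
  obtain z1 where z1: "z1 \<in> UHP" "f z1 \<noteq> 0" using aut_nonzero_point[OF f] by blast
  have "\<exists>N. \<forall>v r. 0 < r \<longrightarrow> v holomorphic_on ball q r \<longrightarrow> (\<forall>j<N. (deriv ^^ j) v q = 0) \<longrightarrow> locally_divides f q v"
    if "q \<in> UHP" for q
    by (rule locally_divides_of_jets[OF autD(1)[OF f(1)] z1 that])
  then obtain N where N: "\<And>q v r. q \<in> UHP \<Longrightarrow> 0 < r \<Longrightarrow> v holomorphic_on ball q r \<Longrightarrow> (\<forall>j<N q. (deriv ^^ j) v q = 0) \<Longrightarrow> locally_divides f q v"
    by metis
  have fin: "finite {q\<in>K. f q = 0}" by (rule aut_finite_zeros[OF f K])
  show ?thesis
  proof (intro exI[of _ "Sigma {q\<in>K. f q = 0} (\<lambda>q. {..<N q})"] conjI ballI allI impI)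
    fix q v r assume q: "q \<in> K" "f q = 0" and r: "0 < (r::real)" "v holomorphic_on ball q r"
      and j: "\<forall>(p, j)\<in>Sigma {q\<in>K. f q = 0} (\<lambda>q. {..<N q}). (deriv ^^ j) v p = 0"
    show "locally_divides f q v" by (rule N[OF _ r]) (use q j K in auto)
  qed (use fin in auto)
qed

text \<open>Induction in steps of the weight \<open>k\<close> of \<open>f\<close>. Modulo finitely
  many forms all jets along the zeros of \<open>f\<close> vanish, and what remains is
  \<open>f\<close> times a form of weight \<open>m - k\<close>, which is zero if
  \<open>m < k\<close>.\<close>

lemma aut_finite_span: "\<exists>B. finite B \<and> B \<subseteq> aut (int m) \<and> aut (int m) \<subseteq> cf.span B"
proof -
  obtain k f g where k: "k > 0" "f \<in> aut (int k)" "f \<noteq> (\<lambda>z. 0)"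
    using exists_forms_without_common_zero by blast
  obtain K where K: "compact K" "K \<subseteq> UHP" "\<And>z. z \<in> UHP \<Longrightarrow> \<exists>A\<in>G. moebius A z \<in> K"
    using cocompact_G by blast
  from jets_exist[OF k(2,3) K(1,2)] obtain J where J0: "finite J" "fst ` J \<subseteq> {q\<in>K. f q = 0}"
    "\<forall>q\<in>K. f q = 0 \<longrightarrow> (\<forall>v r. 0 < r \<longrightarrow> v holomorphic_on ball q r \<longrightarrow> (\<forall>(p, j)\<in>J. (deriv ^^ j) v p = 0) \<longrightarrow> locally_divides f q v)"
    by (elim exE conjE)
  note J = J0(1,2) J0(3)[THEN bspec, THEN mp, THEN spec, THEN spec, THEN mp, THEN mp, THEN mp]
  show ?thesis
  proof (induction m rule: less_induct)
    case (less m)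
    define l where "l = (\<lambda>(p, j) v. (deriv ^^ j) v p :: complex)"
    have hol: "v holomorphic_on UHP" if "v \<in> aut (int m)" for v using autD(1)[OF that] .
    have JU: "p \<in> UHP" if "(p, j) \<in> J" for p j using J(2) K(2) that by force
    have "\<exists>B. finite B \<and> B \<subseteq> aut (int m) \<and> (\<forall>v\<in>aut (int m). \<exists>w\<in>cf.span B. \<forall>i\<in>J. l i (v - w) = 0)"
    proof (rule finite_functionals_spanning[OF J(1) subspace_aut])
      fix i v w assume i: "i \<in> J" and v: "v \<in> aut (int m)" and w: "w \<in> aut (int m)"
      obtain p j where pj: "i = (p, j)" by force
      show "l i (v + w) = l i v + l i w"
        unfolding l_def pj prod.case plus_fun_def
        by (rule higher_deriv_add[OF hol[OF v] hol[OF w] open_UHP]) (use JU i pj in blast)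
    next
      fix i c v assume i: "i \<in> J" and v: "v \<in> aut (int m)"
      obtain p j where pj: "i = (p, j)" by force
      show "l i (cscale c v) = c * l i v"
        unfolding l_def pj prod.case cscale_def
        by (rule higher_deriv_cmult[OF hol[OF v] _ open_UHP]) (use JU i pj in blast)
    qed
    then obtain B where B: "finite B" "B \<subseteq> aut (int m)" "\<And>v. v \<in> aut (int m) \<Longrightarrow> \<exists>w\<in>cf.span B. \<forall>i\<in>J. l i (v - w) = 0"
      by blast
    have div: "\<exists>w\<in>cf.span B. \<exists>g\<in>aut (int m - int k). v - w = (\<lambda>z. f z * g z)" if v: "v \<in> aut (int m)" for v
    proof -
      obtain w where w: "w \<in> cf.span B" "\<forall>i\<in>J. l i (v - w) = 0" using B(3)[OF v] by blast
      have "w \<in> aut (int m)" using cf.span_minimal[OF B(2) subspace_aut] w by blast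
      then have vw: "v - w \<in> aut (int m)" by (rule cf.subspace_diff[OF subspace_aut v])
      have "\<exists>g\<in>aut (int m - int k). v - w = (\<lambda>z. f z * g z)"
      proof (rule aut_divide[OF k(2,3) vw K(2,3)])
        fix q assume q: "q \<in> K" "f q = 0"
        then obtain r where r: "r > 0" "ball q r \<subseteq> UHP" using K(2) open_UHP open_contains_ball by blast
        show "locally_divides f q (v - w)"
          by (rule J(3)[OF q r(1) holomorphic_on_subset[OF hol[OF vw] r(2)]])
             (use w(2) in \<open>auto simp: l_def\<close>)
      qed
      then show ?thesis using w by blast
    qed
    show ?case
    proof (cases "m < k")
      case True
      have "v \<in> cf.span B" if v: "v \<in> aut (int m)" for v
      proof -
        obtain w g where w: "w \<in> cf.span B" "g \<in> aut (int m - int k)" "v - w = (\<lambda>z. f z * g z)" using div[OF v] by blast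
        have "g = 0" by (rule aut_negative_weight[OF w(2)]) (use True in simp)
        then have "v = w" using w(3) by (simp add: fun_eq_iff)
        then show ?thesis using w by simp
      qed
      then show ?thesis using B by blast
    next
      case False
      then have mk: "int m - int k = int (m - k)" by simp
      obtain C where C: "finite C" "C \<subseteq> aut (int (m - k))" "aut (int (m - k)) \<subseteq> cf.span C"
        using less.IH[of "m - k"] k(1) False by auto
      let ?D = "B \<union> (\<lambda>b z. f z * b z) ` C"
      have "?D \<subseteq> aut (int m)"
      proof -
        have "(\<lambda>z. f z * b z) \<in> aut (int m)" if "b \<in> C" for b
          using aut_mult[OF k(2), of b "int (m - k)"] C(2) that False by auto
        then show ?thesis using B(2) by blast
      qed
      moreover have "v \<in> cf.span ?D" if v: "v \<in> aut (int m)" for v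
      proof -
        obtain w g where w: "w \<in> cf.span B" "g \<in> aut (int (m - k))" "v - w = (\<lambda>z. f z * g z)"
          using div[OF v] unfolding mk by blast
        have "(\<lambda>z. f z * g z) \<in> cf.span ?D"
          using cf_span_mult[of g C f] C(3) w(2) cf.span_mono[of "(\<lambda>b z. f z * b z) ` C" ?D] by blast
        moreover have "w \<in> cf.span ?D" using w(1) cf.span_mono[of B ?D] by blast
        ultimately have "w + (v - w) \<in> cf.span ?D" unfolding w(3) by (intro cf.span_add)
        then show ?thesis by simp
      qed
      ultimately show ?thesis using B(1) C(1) by (intro exI[of _ ?D]) auto
    qed
  qed
qed

text \<open>For fixed \<open>m\<^sub>0\<close> the jets of \<open>a / g\<^sup>n\<close>, \<open>a\<close> of weight \<open>m\<^sub>0 + n k\<close>, along the zeros of \<open>f\<close> fill an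
  increasing chain of subspaces of a finite dimensional space, which becomes stationary.\<close>

lemma aut_stable_range:
  assumes k: "k > 0" and f: "f \<in> aut (int k)" "f \<noteq> (\<lambda>z. 0)" and g: "g \<in> aut (int k)"
    and nocommon: "\<And>z. z \<in> UHP \<Longrightarrow> f z \<noteq> 0 \<or> g z \<noteq> 0"
  shows "\<exists>n\<ge>1. \<forall>n'>n. \<forall>h\<in>aut (int (m0 + n' * k)). \<exists>a\<in>aut (int (m0 + n * k)).
     \<exists>b\<in>aut (int (m0 + n' * k) - int k). h = (\<lambda>z. a z * g z ^ (n' - n) + f z * b z)"
proof -
  obtain K where K: "compact K" "K \<subseteq> UHP" "\<And>z. z \<in> UHP \<Longrightarrow> \<exists>A\<in>G. moebius A z \<in> K"
    using cocompact_G by blast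
  from jets_exist[OF f K(1,2)] obtain J where J0: "finite J" "fst ` J \<subseteq> {q\<in>K. f q = 0}"
    "\<forall>q\<in>K. f q = 0 \<longrightarrow> (\<forall>v r. 0 < r \<longrightarrow> v holomorphic_on ball q r \<longrightarrow> (\<forall>(p, j)\<in>J. (deriv ^^ j) v p = 0) \<longrightarrow> locally_divides f q v)"
    by (elim exE conjE)
  note J = J0(1,2) J0(3)[THEN bspec, THEN mp, THEN spec, THEN spec, THEN mp, THEN mp, THEN mp]
  \<comment> \<open>Quotients by powers of \<open>g\<close> are holomorphic here, and since
    \<open>f\<close> and \<open>g\<close> have no common zero all zeros of \<open>f\<close> in
    \<open>K\<close> lie in \<open>U\<close>.\<close>
  define U where "U = UHP \<inter> g -` (- {0})"
  have oU: "open U" unfolding U_def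
    by (intro continuous_open_preimage open_UHP holomorphic_on_imp_continuous_on autD(1)[OF g]) auto
  have gU: "z \<in> UHP" "g z \<noteq> 0" if "z \<in> U" for z using that by (auto simp: U_def)
  have gU': "g z = 0" if "z \<notin> U" for z using that autD(2)[OF g] by (auto simp: U_def)
  define Vn where "Vn = (\<lambda>n. (\<lambda>a z. if z \<in> U then a z / g z ^ n else 0) ` aut (int (m0 + n * k)))"
  have VnE: "\<exists>a\<in>aut (int (m0 + n * k)). v = (\<lambda>z. if z \<in> U then a z / g z ^ n else 0)" if "v \<in> Vn n" for v n
    using that by (auto simp: Vn_def)
  have VnI: "(\<lambda>z. if z \<in> U then a z / g z ^ n else 0) \<in> Vn n" if "a \<in> aut (int (m0 + n * k))" for a n
    using that by (auto simp: Vn_def)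
  have step: "Vn n \<subseteq> Vn (Suc n)" for n
  proof
    fix v assume "v \<in> Vn n"
    then obtain a where a: "a \<in> aut (int (m0 + n * k))" "v = (\<lambda>z. if z \<in> U then a z / g z ^ n else 0)" using VnE by blast
    have "(\<lambda>z. a z * g z) \<in> aut (int (m0 + n * k) + int k)" by (rule aut_mult[OF a(1) g])
    then have "(\<lambda>z. a z * g z) \<in> aut (int (m0 + Suc n * k))" by (simp add: algebra_simps)
    from VnI[OF this] show "v \<in> Vn (Suc n)" using gU(2) by (simp add: a(2) cong: if_cong)
  qed
  have mono: "Vn n \<subseteq> Vn n'" if "n \<le> n'" for n n' using that by (rule lift_Suc_mono_le[of Vn, OF step])
  have subn: "cf.subspace (Vn n)" for n
  proof (rule cf_subspaceI)
    show "(\<lambda>z. 0) \<in> Vn n" using VnI[OF aut_zero, of n] by (simp cong: if_cong)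
  next
    fix v w assume "v \<in> Vn n" "w \<in> Vn n"
    then obtain a b where ab: "a \<in> aut (int (m0 + n * k))" "v = (\<lambda>z. if z \<in> U then a z / g z ^ n else 0)"
      "b \<in> aut (int (m0 + n * k))" "w = (\<lambda>z. if z \<in> U then b z / g z ^ n else 0)"
      using VnE[of v n] VnE[of w n] by blast
    have "(\<lambda>z. v z + w z) = (\<lambda>z. if z \<in> U then (a z + b z) / g z ^ n else 0)"
      by (auto simp: ab add_divide_distrib)
    then show "(\<lambda>z. v z + w z) \<in> Vn n" using VnI[OF aut_add[OF ab(1,3)]] by simp
  next
    fix c v assume "v \<in> Vn n"
    then obtain a where a: "a \<in> aut (int (m0 + n * k))" "v = (\<lambda>z. if z \<in> U then a z / g z ^ n else 0)" using VnE by blast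
    have "(\<lambda>z. c * v z) = (\<lambda>z. if z \<in> U then (c * a z) / g z ^ n else 0)" by (auto simp: a)
    then show "(\<lambda>z. c * v z) \<in> Vn n" using VnI[OF aut_scale[OF a(1)]] by simp
  qed
  define V where "V = (\<Union>n. Vn n)"
  have subV: "cf.subspace V"
  proof (rule cf_subspaceI)
    show "(\<lambda>z. 0) \<in> V" using cf.subspace_0[OF subn] by (auto simp: V_def zero_fun_def)
  next
    fix v w assume "v \<in> V" "w \<in> V"
    then obtain n n' where n: "v \<in> Vn n" "w \<in> Vn n'" by (auto simp: V_def)
    then have "v \<in> Vn (max n n')" "w \<in> Vn (max n n')" using mono max.cobounded1 max.cobounded2 by blast+
    then have "v + w \<in> Vn (max n n')" by (rule cf.subspace_add[OF subn])
    then show "(\<lambda>z. v z + w z) \<in> V" by (auto simp: V_def plus_fun_def)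
  next
    fix c v assume "v \<in> V"
    then obtain n where "v \<in> Vn n" by (auto simp: V_def)
    then have "cscale c v \<in> Vn n" by (rule cf.subspace_scale[OF subn])
    then show "(\<lambda>z. c * v z) \<in> V" by (auto simp: V_def cscale_def)
  qed
  have hol: "v holomorphic_on U" if "v \<in> V" for v
  proof -
    obtain n a where a: "a \<in> aut (int (m0 + n * k))" "v = (\<lambda>z. if z \<in> U then a z / g z ^ n else 0)"
      using \<open>v \<in> V\<close> VnE unfolding V_def by blast
    have "U \<subseteq> UHP" using gU by blast
    then have "(\<lambda>z. a z / g z ^ n) holomorphic_on U"
      using gU(2) by (intro holomorphic_intros holomorphic_on_subset[OF autD(1)[OF a(1)]] holomorphic_on_subset[OF autD(1)[OF g]]) auto
    then show ?thesis by (rule holomorphic_transform) (simp add: a)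
  qed
  have QU: "q \<in> U" if "q \<in> K" "f q = 0" for q using that nocommon K(2) by (auto simp: U_def)
  have JU: "p \<in> U" if "(p, j) \<in> J" for p j using QU J(2) that by force
  define l where "l = (\<lambda>(p, j) v. (deriv ^^ j) v p :: complex)"
  have "\<exists>B. finite B \<and> B \<subseteq> V \<and> (\<forall>v\<in>V. \<exists>w\<in>cf.span B. \<forall>i\<in>J. l i (v - w) = 0)"
  proof (rule finite_functionals_spanning[OF J(1) subV])
    fix i v w assume i: "i \<in> J" and v: "v \<in> V" and w: "w \<in> V"
    obtain p j where pj: "i = (p, j)" by force
    show "l i (v + w) = l i v + l i w"
      unfolding l_def pj prod.case plus_fun_def
      by (rule higher_deriv_add[OF hol[OF v] hol[OF w] oU]) (use JU i pj in blast)
  next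
    fix i c v assume i: "i \<in> J" and v: "v \<in> V"
    obtain p j where pj: "i = (p, j)" by force
    show "l i (cscale c v) = c * l i v"
      unfolding l_def pj prod.case cscale_def
      by (rule higher_deriv_cmult[OF hol[OF v] _ oU]) (use JU i pj in blast)
  qed
  then obtain B where B: "finite B" "B \<subseteq> V" "\<And>v. v \<in> V \<Longrightarrow> \<exists>w\<in>cf.span B. \<forall>i\<in>J. l i (v - w) = 0"
    by blast
  \<comment> \<open>This is the stationarity: finitely many elements exhaust the jets of the whole
    union, and they all occur at one level.\<close>
  have "\<exists>n. B \<subseteq> Vn n" using B(1,2)
  proof (induction B rule: finite_induct)
    case (insert b B)
    then obtain n n' where n: "B \<subseteq> Vn n" "b \<in> Vn n'" by (auto simp: V_def)
    then have "insert b B \<subseteq> Vn (max n n')" using mono[of n "max n n'"] mono[of n' "max n n'"] by auto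
    then show ?case by blast
  qed auto
  then obtain n1 where n1: "B \<subseteq> Vn n1" by blast
  \<comment> \<open>At least 1, so that the weight \<open>m0 + n * k\<close> of \<open>a\<close> is
    positive even for \<open>m0 = 0\<close>.\<close>
  define n where "n = max n1 1"
  have nB: "cf.span B \<subseteq> Vn n"
    using n1 mono[of n1 n] by (intro cf.span_minimal subn) (auto simp: n_def)
  show ?thesis
  proof (intro exI[of _ n] conjI allI impI ballI)
    show "1 \<le> n" by (simp add: n_def)
    fix n' h assume n': "n < n'" and h: "h \<in> aut (int (m0 + n' * k))"
    define v where "v = (\<lambda>z. if z \<in> U then h z / g z ^ n' else 0)"
    have vV: "v \<in> V" using VnI[OF h] by (auto simp: V_def v_def)
    obtain w where w: "w \<in> cf.span B" "\<forall>i\<in>J. l i (v - w) = 0" using B(3)[OF vV] by blast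
    obtain a where a: "a \<in> aut (int (m0 + n * k))" "w = (\<lambda>z. if z \<in> U then a z / g z ^ n else 0)"
      using VnE[of w n] nB w(1) by blast
    have wV: "w \<in> V" using nB w(1) by (auto simp: V_def)
    define c where "c = (\<lambda>z. h z - a z * g z ^ (n' - n))"
    have "(\<lambda>z. a z * g z ^ (n' - n)) \<in> aut (int (m0 + n * k) + int k * int (n' - n))"
      using n' by (intro aut_mult a(1) aut_power g) simp
    moreover have "int (m0 + n * k) + int k * int (n' - n) = int (m0 + n' * k)"
      using n' by (simp add: of_nat_diff algebra_simps)
    ultimately have c: "c \<in> aut (int (m0 + n' * k))" unfolding c_def using h by (metis aut_diff)
    \<comment> \<open>Multiplying by \<open>g ^ n'\<close> clears the denominators, so divisibility
      of \<open>v - w\<close> by \<open>f\<close> passes on to \<open>c\<close>.\<close>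
    have cv: "c z = (v - w) z * g z ^ n'" if "z \<in> U" for z
    proof -
      have "g z ^ n' = g z ^ n * g z ^ (n' - n)" using n' by (simp flip: power_add)
      then show ?thesis using gU(2)[OF that] that by (simp add: c_def v_def a(2) field_simps)
    qed
    have "\<exists>b\<in>aut (int (m0 + n' * k) - int k). c = (\<lambda>z. f z * b z)"
    proof (rule aut_divide[OF f c K(2,3)])
      fix q assume q: "q \<in> K" "f q = 0"
      then obtain r where r: "r > 0" "ball q r \<subseteq> U" using QU oU open_contains_ball by blast
      have "v - w \<in> V" by (rule cf.subspace_diff[OF subV vV wV])
      then have "locally_divides f q (v - w)"
        by (intro J(3)[OF q r(1) holomorphic_on_subset[OF hol r(2)]]) (use w(2) in \<open>auto simp: l_def\<close>)
      then obtain s u where s: "s > 0" "u holomorphic_on ball q s" "\<And>x. x \<in> ball q s \<Longrightarrow> (v - w) x = f x * u x"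
        unfolding locally_divides_def by blast
      have sub: "ball q (min r s) \<subseteq> ball q s" "ball q (min r s) \<subseteq> U" "ball q (min r s) \<subseteq> UHP"
        using r(2) gU by auto
      show "locally_divides f q c"
        unfolding locally_divides_def
      proof (intro exI conjI ballI)
        show "min r s > 0" using r s by simp
        show "(\<lambda>x. u x * g x ^ n') holomorphic_on ball q (min r s)"
          by (intro holomorphic_intros holomorphic_on_subset[OF s(2) sub(1)] holomorphic_on_subset[OF autD(1)[OF g] sub(3)])
        show "c x = f x * (u x * g x ^ n')" if "x \<in> ball q (min r s)" for x
          using cv[of x] s(3)[of x] sub that by auto
      qed
    qed
    then obtain b where b: "b \<in> aut (int (m0 + n' * k) - int k)" "c = (\<lambda>z. f z * b z)" by blast
    have "h = (\<lambda>z. a z * g z ^ (n' - n) + f z * b z)"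
      using b(2) by (auto simp: c_def fun_eq_iff algebra_simps)
    then show "\<exists>a\<in>aut (int (m0 + n * k)). \<exists>b\<in>aut (int (m0 + n' * k) - int k). h = (\<lambda>z. a z * g z ^ (n' - n) + f z * b z)"
      using a(1) b(1) by blast
  qed
qed

text \<open>\<open>aut_stable_range\<close> is applied to each residue of the weight modulo
  \<open>k\<close>. In the resulting sum all factors have positive weight below \<open>m\<close>, so
  \<open>h\<close> is decomposable.\<close>

lemma aut_large_weight_decomposable:
  "\<exists>M. \<forall>m>M. \<forall>h\<in>aut (int m). \<exists>p q a g f b. 0 < p \<and> p < m \<and> 0 < q \<and> q < m \<and>
     a \<in> aut (int p) \<and> g \<in> aut (int (m - p)) \<and> f \<in> aut (int q) \<and> b \<in> aut (int (m - q)) \<and>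
     h = (\<lambda>z. a z * g z + f z * b z)"
proof -
  obtain k f g where k: "k > 0" "f \<in> aut (int k)" "g \<in> aut (int k)" "f \<noteq> (\<lambda>z. 0)" "\<And>z. z \<in> UHP \<Longrightarrow> f z \<noteq> 0 \<or> g z \<noteq> 0"
    using exists_forms_without_common_zero by blast
  define P where "P = (\<lambda>m0 n. \<forall>n'>n. \<forall>h\<in>aut (int (m0 + n' * k)). \<exists>a\<in>aut (int (m0 + n * k)).
     \<exists>b\<in>aut (int (m0 + n' * k) - int k). h = (\<lambda>z. a z * g z ^ (n' - n) + f z * b z))"
  have "\<forall>m0. \<exists>n\<ge>1. P m0 n"
    unfolding P_def by (intro allI aut_stable_range[OF k(1,2,4,3,5)])
  from choice[OF this] obtain n where nP: "\<And>m0. 1 \<le> n m0 \<and> P m0 (n m0)" by blast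
  have n: "n m0 \<ge> 1" for m0 using nP by blast
  \<comment> \<open>Above \<open>M\<close> the quotient \<open>m div k\<close> exceeds the stable
    level of every residue class.\<close>
  define M where "M = (Max (n ` {..<k}) + 1) * k"
  show ?thesis
  proof (rule exI[of _ M], intro allI impI ballI)
    fix m h assume m: "M < m" and h: "h \<in> aut (int m)"
    define m0 where "m0 = m mod k"
    define n' where "n' = m div k"
    have meq: "m = m0 + n' * k" by (simp add: m0_def n'_def)
    have "m0 < k" using k(1) by (simp add: m0_def)
    then have "n m0 \<le> Max (n ` {..<k})" by (intro Max_ge) auto
    moreover have "Max (n ` {..<k}) + 1 \<le> n'"
      using m k(1) unfolding M_def n'_def by (simp add: less_eq_div_iff_mult_less_eq)
    ultimately have n': "n' > n m0" by simp
    obtain a b where ab: "a \<in> aut (int (m0 + n m0 * k))" "b \<in> aut (int m - int k)"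
      "h = (\<lambda>z. a z * g z ^ (n' - n m0) + f z * b z)"
      using nP[of m0] n' h unfolding P_def meq by blast
    have pos: "m0 + n m0 * k > 0" using n[of m0] k(1) by simp
    have "n m0 * k < n' * k" using n' k(1) by simp
    then have lt: "m0 + n m0 * k < m" by (simp add: meq)
    have "1 * k < n' * k" using n' n[of m0] k(1) by (intro mult_strict_right_mono) auto
    then have km: "k < m" unfolding meq by linarith
    have "(\<lambda>z. g z ^ (n' - n m0)) \<in> aut (int k * int (n' - n m0))" using n' by (intro aut_power k(3)) simp
    moreover have "int k * int (n' - n m0) = int (m - (m0 + n m0 * k))"
      using n' lt by (simp add: meq of_nat_diff algebra_simps)
    ultimately have g': "(\<lambda>z. g z ^ (n' - n m0)) \<in> aut (int (m - (m0 + n m0 * k)))" by simp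
    have b': "b \<in> aut (int (m - k))" using ab(2) km by (simp add: of_nat_diff)
    show "\<exists>p q a g f b. 0 < p \<and> p < m \<and> 0 < q \<and> q < m \<and>
     a \<in> aut (int p) \<and> g \<in> aut (int (m - p)) \<and> f \<in> aut (int q) \<and> b \<in> aut (int (m - q)) \<and>
     h = (\<lambda>z. a z * g z + f z * b z)"
      using pos lt k(1) km ab(1) g' k(2) b' ab(3) by blast
  qed
qed

end

section \<open>The structure of quasimodular forms\<close>

text \<open>Interpolation at \<open>p + 1\<close> holomorphic nodes. Synthetic division at the last
  node lowers the degree; at the remaining nodes the quotient takes the divided differences as
  values, which are holomorphic since the nodes stay distinct.\<close>

lemma holomorphic_poly_coeffs:
  fixes P :: "complex \<Rightarrow> complex poly"
  assumes "\<And>i. i \<le> p \<Longrightarrow> x i holomorphic_on N" "\<And>i. i \<le> p \<Longrightarrow> h i holomorphic_on N"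
    and "\<And>i l z. i \<le> p \<Longrightarrow> l \<le> p \<Longrightarrow> i \<noteq> l \<Longrightarrow> z \<in> N \<Longrightarrow> x i z \<noteq> x l z"
    and "\<And>i z. i \<le> p \<Longrightarrow> z \<in> N \<Longrightarrow> poly (P z) (x i z) = h i z"
    and "\<And>z. z \<in> N \<Longrightarrow> degree (P z) \<le> p"
  shows "(\<lambda>z. poly.coeff (P z) j) holomorphic_on N"
  using assms
proof (induction p arbitrary: P h j)
  case 0
  have "h 0 z = poly.coeff (P z) 0" if z: "z \<in> N" for z
  proof -
    have "degree (P z) = 0" using 0(5)[OF z] by simp
    then obtain a where "P z = [:a:]" by (rule degree_eq_zeroE)
    then show ?thesis using 0(4)[of 0 z] z by simp
  qed
  then have c0: "(\<lambda>z. poly.coeff (P z) 0) holomorphic_on N" using 0(2)[of 0] by (simp cong: holomorphic_cong)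
  show ?case
  proof (cases j)
    case (Suc i)
    have "(\<lambda>z. 0) holomorphic_on N" by simp
    then show ?thesis
      by (rule holomorphic_transform) (use 0(5) Suc in \<open>auto simp: coeff_eq_0\<close>)
  qed (use c0 in simp)
next
  case (Suc p)
  define a where "a = x (Suc p)"
  define Q where "Q = (\<lambda>z. synthetic_div (P z) (a z))"
  have PQ: "P z = [:- a z, 1:] * Q z + [:h (Suc p) z:]" if "z \<in> N" for z
    using synthetic_div_correct'[of "a z" "P z"] Suc.prems(4)[of "Suc p" z] that by (simp add: Q_def a_def)
  have hQ: "(\<lambda>z. poly.coeff (Q z) j) holomorphic_on N" for j
  proof (rule Suc.IH[where h = "\<lambda>i z. (h i z - h (Suc p) z) / (x i z - a z)"])
    show "(\<lambda>z. (h i z - h (Suc p) z) / (x i z - a z)) holomorphic_on N" if "i \<le> p" for i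
      unfolding a_def using Suc.prems(1,2,3) that by (intro holomorphic_intros) (auto simp: Suc_n_not_le_n)
    show "poly (Q z) (x i z) = (h i z - h (Suc p) z) / (x i z - a z)" if "i \<le> p" "z \<in> N" for i z
    proof -
      have "x i z \<noteq> a z" unfolding a_def using Suc.prems(3)[of i "Suc p" z] that by auto
      moreover have "h i z = (x i z - a z) * poly (Q z) (x i z) + h (Suc p) z"
        using Suc.prems(4)[of i z] that PQ[OF that(2)] by (simp add: algebra_simps)
      ultimately show ?thesis by simp
    qed
    show "degree (Q z) \<le> p" if "z \<in> N" for z
      using Suc.prems(5)[OF that] by (simp add: Q_def degree_synthetic_div)
  qed (use Suc.prems in auto)
  have ha: "a holomorphic_on N" "h (Suc p) holomorphic_on N" using Suc.prems(1,2) by (auto simp: a_def)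
  show ?case
  proof (cases j)
    case 0
    have "(\<lambda>z. - a z * poly.coeff (Q z) 0 + h (Suc p) z) holomorphic_on N"
      by (intro holomorphic_intros ha hQ)
    then show ?thesis by (rule holomorphic_transform) (simp add: PQ 0)
  next
    case (Suc i)
    have "(\<lambda>z. - a z * poly.coeff (Q z) (Suc i) + poly.coeff (Q z) i) holomorphic_on N"
      by (intro holomorphic_intros ha hQ)
    then show ?thesis by (rule holomorphic_transform) (simp add: PQ Suc)
  qed
qed

lemma poly_eqI_infinite:
  fixes p q :: "complex poly"
  assumes "infinite X" "\<And>x. x \<in> X \<Longrightarrow> poly p x = poly q x"
  shows "p = q"
proof (rule ccontr)
  assume "p \<noteq> q"
  then have "finite {x. poly (p - q) x = 0}" by (intro poly_roots_finite) simp
  moreover have "X \<subseteq> {x. poly (p - q) x = 0}" using assms(2) by auto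
  ultimately show False using assms(1) finite_subset by blast
qed

text \<open>Binomial expansion of \<open>P (x + y X)\<close>. The coefficient is sorted as
  \<open>y^i\<close> times a polynomial in \<open>x\<close> because for \<open>x = xco\<close> that
  is again a transformation law, see \<open>qexp_coeff\<close>.\<close>

lemma coeff_pcompose_linear:
  fixes P :: "complex poly"
  assumes "degree P \<le> p"
  shows "poly.coeff (pcompose P [:x, y:]) i =
    y ^ i * poly (\<Sum>l\<in>{i..p}. Polynomial.monom (poly.coeff P l * of_nat (l choose i)) (l - i)) x"
proof -
  have "P = (\<Sum>l\<le>p. Polynomial.monom (poly.coeff P l) l)"
    using assms by (simp add: poly_as_sum_of_monoms')
  then have "pcompose P [:x, y:] = pcompose (\<Sum>l\<le>p. Polynomial.monom (poly.coeff P l) l) [:x, y:]" by simp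
  also have "\<dots> = (\<Sum>l\<le>p. Polynomial.smult (poly.coeff P l) ([:x, y:] ^ l))"
  proof -
    have "pcompose ([:0, 1:] ^ l) [:x, y:] = [:x, y:] ^ l" for l
      by (induction l) (simp_all add: pcompose_mult pcompose_pCons pcompose_1)
    then show ?thesis by (simp add: pcompose_sum monom_altdef pcompose_smult)
  qed
  finally have "poly.coeff (pcompose P [:x, y:]) i = (\<Sum>l\<le>p. poly.coeff P l * poly.coeff ([:x, y:] ^ l) i)"
    by (simp add: coeff_sum)
  also have "\<dots> = (\<Sum>l\<in>{i..p}. poly.coeff P l * (of_nat (l choose i) * y ^ i * x ^ (l - i)))"
  proof (rule sum.mono_neutral_cong_right)
    have "poly.coeff ([:x, y:] ^ l) i = 0" if "l < i" for l
    proof (rule coeff_eq_0)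
      have "degree ([:x, y:] ^ l) \<le> degree [:x, y:] * l" by (rule degree_power_le)
      also have "\<dots> \<le> 1 * l" by (intro mult_right_mono) auto
      finally show "degree ([:x, y:] ^ l) < i" using that by simp
    qed
    then show "\<forall>l\<in>{..p} - {i..p}. poly.coeff P l * poly.coeff ([:x, y:] ^ l) i = 0" by auto
  qed (auto simp: coeff_linear_poly_power)
  also have "\<dots> = y ^ i * poly (\<Sum>l\<in>{i..p}. Polynomial.monom (poly.coeff P l * of_nat (l choose i)) (l - i)) x"
    by (simp add: poly_sum poly_monom sum_distrib_left mult_ac)
  finally show ?thesis .
qed

context cocompact_group
begin

text \<open>If \<open>c / (c z + d)\<close> took only finitely many values, minus their mean would be a
  quasimodular form as excluded by \<open>no_quasi_period\<close>.\<close>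

lemma infinite_xco:
  assumes z0: "z0 \<in> UHP"
  shows "infinite ((\<lambda>A. xco A z0) ` G)"
proof
  assume fin: "finite ((\<lambda>A. xco A z0) ` G)"
  define X where "X = (\<lambda>z. (\<lambda>A. xco A z) ` G)"
  \<comment> \<open>The value of \<open>xco A\<close> at \<open>w\<close> is a fractional linear
    function, independent of \<open>A\<close>, of its value at \<open>z\<close>. Hence the number of
    values is the same at all points and their sum is holomorphic.\<close>
  have move: "xco A w = xco A z / (1 + xco A z * (w - z)) \<and> 1 + xco A z * (w - z) \<noteq> 0"
    if A: "A \<in> G" and z: "z \<in> UHP" and w: "w \<in> UHP" for A z w
  proof -
    have nz: "jac A z \<noteq> 0" "jac A w \<noteq> 0" using jac_nz A z w by blast+
    have e: "1 + xco A z * (w - z) = jac A w / jac A z"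
      using nz(1) by (simp add: xco_def field_simps) (simp add: jac_def algebra_simps)
    show ?thesis unfolding e using nz by (simp add: xco_def)
  qed
  have Xw: "X w = (\<lambda>x. x / (1 + x * (w - z0))) ` X z0" if "w \<in> UHP" for w
    unfolding X_def image_image using move[OF _ z0 that] by (intro image_cong) auto
  have injw: "inj_on (\<lambda>x. x / (1 + x * (w - z0))) (X z0)" if w: "w \<in> UHP" for w
  proof (rule inj_on_inverseI[where g = "\<lambda>x. x / (1 + x * (z0 - w))"])
    fix x assume "x \<in> X z0"
    then obtain A where A: "A \<in> G" "x = xco A z0" by (auto simp: X_def)
    show "x / (1 + x * (w - z0)) / (1 + x / (1 + x * (w - z0)) * (z0 - w)) = x"
      using move[OF A(1) z0 w] move[OF A(1) w z0] A(2) by metis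
  qed
  define r where "r = card (X z0)"
  have finX: "finite (X w)" if "w \<in> UHP" for w
    unfolding Xw[OF that] using fin by (simp add: X_def)
  have cardX: "card (X w) = r" if "w \<in> UHP" for w
    unfolding Xw[OF that] r_def by (rule card_image[OF injw[OF that]])
  have r0: "r > 0" unfolding r_def using fin one_G by (auto simp: X_def card_gt_0_iff)
  define \<phi> where "\<phi> = (\<lambda>z. - (\<Sum>v\<in>X z. v) / of_nat r)"
  show False
  proof (rule no_quasi_period)
    have "(\<lambda>z. - (\<Sum>x\<in>X z0. x / (1 + x * (z - z0))) / of_nat r) holomorphic_on UHP"
      using r0 move[OF _ z0] by (intro holomorphic_intros) (auto simp: X_def)
    then show "\<phi> holomorphic_on UHP"
      by (rule holomorphic_transform) (simp add: \<phi>_def Xw sum.reindex[OF injw] o_def)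
    fix B z assume B: "B \<in> G" and z: "z \<in> UHP"
    obtain C where C: "C \<in> G" "B ** C = mat 1" "C ** B = mat 1" using inv_G[OF B] by blast
    have nz: "jac B z \<noteq> 0" by (rule jac_nz[OF B z])
    have Bz: "moebius B z \<in> UHP" by (rule moebius_G[OF B z])
    have GB: "(\<lambda>A. A ** B) ` G = G"
    proof
      show "(\<lambda>A. A ** B) ` G \<subseteq> G" using mult_G B by blast
      show "G \<subseteq> (\<lambda>A. A ** B) ` G"
      proof
        fix A assume "A \<in> G"
        then show "A \<in> (\<lambda>A. A ** B) ` G"
          using mult_G C by (intro image_eqI[of _ _ "A ** C"]) (auto simp: matrix_mul_assoc[symmetric])
      qed
    qed
    have "X z = (\<lambda>A. xco A z) ` (\<lambda>A. A ** B) ` G" unfolding X_def GB ..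
    also have "\<dots> = (\<lambda>A. xco (A ** B) z) ` G" by (rule image_image)
    also have "\<dots> = (\<lambda>v. xco B z + v / (jac B z)\<^sup>2) ` X (moebius B z)"
      unfolding X_def image_image by (intro image_cong xco_mult det_G B z) auto
    finally have "(\<Sum>v\<in>X z. v) = (\<Sum>v\<in>(\<lambda>v. xco B z + v / (jac B z)\<^sup>2) ` X (moebius B z). v)" by simp
    also have "\<dots> = (\<Sum>v\<in>X (moebius B z). xco B z + v / (jac B z)\<^sup>2)"
      using nz by (subst sum.reindex) (auto simp: inj_on_def)
    also have "\<dots> = of_nat r * xco B z + (\<Sum>v\<in>X (moebius B z). v) / (jac B z)\<^sup>2"
      by (simp add: sum.distrib cardX[OF Bz] sum_divide_distrib)
    finally have s: "(\<Sum>v\<in>X z. v) = of_nat r * xco B z + (\<Sum>v\<in>X (moebius B z). v) / (jac B z)\<^sup>2" .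
    have "xco B z * (jac B z)\<^sup>2 = of_real (B$2$1) * jac B z"
      using nz by (simp add: xco_def power2_eq_square)
    moreover have "\<phi> (moebius B z) = (jac B z)\<^sup>2 * \<phi> z + xco B z * (jac B z)\<^sup>2"
      unfolding \<phi>_def s using nz r0 by (simp add: field_simps)
    ultimately show "\<phi> (moebius B z) = (jac B z)\<^sup>2 * \<phi> z + of_real (B$2$1) * jac B z" by simp
  qed
qed

text \<open>The quasimodular law with the functions \<open>f_j\<close> collected into a polynomial
  \<open>P z\<close>, in integer weight so that it applies to coefficients as well. Setting
  \<open>P\<close> to 0 off the half plane makes it unique.\<close>

definition qexp :: "int \<Rightarrow> (complex \<Rightarrow> complex) \<Rightarrow> nat \<Rightarrow> (complex \<Rightarrow> complex poly) \<Rightarrow> bool" where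
  "qexp k f p P \<longleftrightarrow> f holomorphic_on UHP \<and> (\<forall>z. z \<notin> UHP \<longrightarrow> f z = 0) \<and>
     (\<forall>z. degree (P z) \<le> p) \<and> (\<forall>z. z \<notin> UHP \<longrightarrow> P z = 0) \<and>
     (\<forall>A\<in>G. \<forall>z\<in>UHP. f (moebius A z) = jac A z powi k * poly (P z) (xco A z))"

lemma qexpD:
  assumes "qexp k f p P"
  shows "f holomorphic_on UHP" "\<And>z. z \<notin> UHP \<Longrightarrow> f z = 0" "\<And>z. degree (P z) \<le> p"
    "\<And>z. z \<notin> UHP \<Longrightarrow> P z = 0"
    "\<And>A z. A \<in> G \<Longrightarrow> z \<in> UHP \<Longrightarrow> f (moebius A z) = jac A z powi k * poly (P z) (xco A z)"
  using assms by (auto simp: qexp_def)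

text \<open>By \<open>infinite_xco\<close> the law prescribes \<open>P z\<close> at infinitely many
  points, whatever the two depth bounds are.\<close>

lemma qexp_unique:
  assumes "qexp k f p P" "qexp k f q Q"
  shows "P = Q"
proof
  fix z
  show "P z = Q z"
  proof (cases "z \<in> UHP")
    case True
    show ?thesis
    proof (rule poly_eqI_infinite[OF infinite_xco[OF True]])
      fix x assume "x \<in> (\<lambda>A. xco A z) ` G"
      then obtain A where A: "A \<in> G" "x = xco A z" by blast
      have "jac A z powi k * poly (P z) x = jac A z powi k * poly (Q z) x"
        unfolding A(2) by (rule trans[OF qexpD(5)[OF assms(1) A(1) True, symmetric] qexpD(5)[OF assms(2) A(1) True]])
      moreover have "jac A z powi k \<noteq> 0" using jac_nz[OF A(1) True] by simp
      ultimately show "poly (P z) x = poly (Q z) x" by (metis mult_left_cancel)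
    qed
  qed (use qexpD(4)[OF assms(1)] qexpD(4)[OF assms(2)] in simp)
qed

text \<open>Expand \<open>f\<close> at the image of \<open>z\<close> under \<open>A ** B\<close> in
  two ways. As \<open>A\<close> varies the two sides agree at infinitely many points.\<close>

lemma qexp_moebius:
  assumes "qexp k f p P" "B \<in> G" "z \<in> UHP"
  shows "P (moebius B z) = Polynomial.smult (jac B z powi k) (pcompose (P z) [:xco B z, 1 / (jac B z)\<^sup>2:])"
proof (rule poly_eqI_infinite[OF infinite_xco[OF moebius_G[OF assms(2,3)]]])
  fix x assume "x \<in> (\<lambda>A. xco A (moebius B z)) ` G"
  then obtain A where A: "A \<in> G" "x = xco A (moebius B z)" by blast
  note dets = det_G[OF A(1)] det_G[OF assms(2)] assms(3)
  have nz: "jac A (moebius B z) \<noteq> 0" using jac_nz[OF A(1) moebius_G[OF assms(2,3)]] .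
  have "jac A (moebius B z) powi k * poly (P (moebius B z)) x = f (moebius (A ** B) z)"
    using qexpD(5)[OF assms(1) A(1) moebius_G[OF assms(2,3)]] A(2) moebius_mult[OF dets] by simp
  also have "\<dots> = jac (A ** B) z powi k * poly (P z) (xco (A ** B) z)"
    by (rule qexpD(5)[OF assms(1) mult_G[OF A(1) assms(2)] assms(3)])
  also have "\<dots> = jac A (moebius B z) powi k * (jac B z powi k * poly (P z) (xco B z + x / (jac B z)\<^sup>2))"
    by (simp add: jac_mult[OF dets] xco_mult[OF dets] power_int_mult_distrib A(2))
  finally show "poly (P (moebius B z)) x = poly (Polynomial.smult (jac B z powi k) (pcompose (P z) [:xco B z, 1 / (jac B z)\<^sup>2:])) x"
    using nz by (simp add: poly_pcompose mult.commute)
qed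

lemma qexp_coeff_0: "qexp k f p P \<Longrightarrow> f z = poly.coeff (P z) 0"
  using qexpD(5)[of k f p P "mat 1" z] one_G qexpD(2,4)[of k f p P z]
  by (cases "z \<in> UHP") (auto simp: poly_0_coeff_0)

text \<open>A priori the coefficients are arbitrary functions. At a given point \<open>p + 1\<close>
  group elements have distinct values of \<open>xco\<close>, and these stay distinct nearby. The
  laws for these elements determine the coefficients by interpolation.\<close>

lemma qexp_coeff_holomorphic:
  assumes q: "qexp k f p P"
  shows "(\<lambda>z. poly.coeff (P z) j) holomorphic_on UHP"
  unfolding holomorphic_on_def
proof
  fix z assume z: "z \<in> UHP"
  obtain Y where Y: "Y \<subseteq> (\<lambda>A. xco A z) ` G" "finite Y" "card Y = Suc p"
    using infinite_arbitrarily_large[OF infinite_xco[OF z]] by metis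
  obtain e where e: "bij_betw e {0..<card Y} Y" using ex_bij_betw_nat_finite[OF Y(2)] by blast
  have "\<exists>A\<in>G. e i = xco A z" if "i \<le> p" for i
  proof -
    have "e i \<in> Y" using that bij_betwE[OF e] Y(3) by simp
    then show ?thesis using Y(1) by blast
  qed
  then obtain A where A: "\<And>i. i \<le> p \<Longrightarrow> A i \<in> G \<and> e i = xco (A i) z" by metis
  have dist: "xco (A i) z \<noteq> xco (A l) z" if "i \<le> p" "l \<le> p" "i \<noteq> l" for i l
    using that A bij_betw_imp_inj_on[OF e] Y(3) by (metis atLeastLessThan_iff inj_on_def le0 less_Suc_eq_le)
  define N where "N = UHP \<inter> (\<Inter>(i, l)\<in>{(i, l). i \<le> p \<and> l \<le> p \<and> i \<noteq> l}. {w. w \<in> UHP \<and> xco (A i) w \<noteq> xco (A l) w})"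
  have ox: "open {w. w \<in> UHP \<and> xco (A i) w \<noteq> xco (A l) w}" if "i \<le> p" "l \<le> p" for i l
  proof -
    have "continuous_on UHP (\<lambda>w. xco (A i) w - xco (A l) w)"
      using A that by (intro continuous_on_diff holomorphic_on_imp_continuous_on holomorphic_xco det_G) auto
    then have "open (UHP \<inter> (\<lambda>w. xco (A i) w - xco (A l) w) -` (- {0}))"
      by (intro continuous_open_preimage open_UHP) auto
    moreover have "UHP \<inter> (\<lambda>w. xco (A i) w - xco (A l) w) -` (- {0}) = {w. w \<in> UHP \<and> xco (A i) w \<noteq> xco (A l) w}"
      by auto
    ultimately show ?thesis by simp
  qed
  have "finite {(i, l). i \<le> p \<and> l \<le> p \<and> i \<noteq> l}"
    by (rule finite_subset[of _ "{..p} \<times> {..p}"]) auto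
  then have oN: "open N" unfolding N_def using ox by (intro open_Int open_UHP open_INT) auto
  have zN: "z \<in> N" unfolding N_def using z dist by auto
  have NU: "N \<subseteq> UHP" by (auto simp: N_def)
  have "(\<lambda>z. poly.coeff (P z) j) holomorphic_on N"
  proof (rule holomorphic_poly_coeffs[where p = p and x = "\<lambda>i. xco (A i)" and h = "\<lambda>i w. jac (A i) w powi (- k) * f (moebius (A i) w)"])
    show "xco (A i) holomorphic_on N" if "i \<le> p" for i
      using holomorphic_xco[OF det_G] A[OF that] holomorphic_on_subset NU by blast
    show "(\<lambda>w. jac (A i) w powi (- k) * f (moebius (A i) w)) holomorphic_on N" if i: "i \<le> p" for i
    proof (intro holomorphic_intros holomorphic_jac)
      have AG: "A i \<in> G" using A[OF i] by blast
      show "(\<lambda>w. f (moebius (A i) w)) holomorphic_on N"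
        by (rule holomorphic_on_compose_gen[of "moebius (A i)" N f UHP, unfolded o_def])
           (use holomorphic_on_subset[OF holomorphic_moebius[OF det_G[OF AG]] NU] qexpD(1)[OF q] moebius_G[OF AG] NU in auto)
    qed (use jac_nz A[OF i] NU in auto)
    show "poly (P w) (xco (A i) w) = jac (A i) w powi (- k) * f (moebius (A i) w)" if "i \<le> p" "w \<in> N" for i w
    proof -
      have AG: "A i \<in> G" and w: "w \<in> UHP" using A[OF that(1)] that NU by blast+
      have "jac (A i) w powi (- k) * jac (A i) w powi k = 1" using jac_nz[OF AG w] by (simp flip: power_int_add)
      then show ?thesis unfolding qexpD(5)[OF q AG w] by (simp flip: mult.assoc)
    qed
    show "degree (P w) \<le> p" for w by (rule qexpD(3)[OF q])
    show "xco (A i) w \<noteq> xco (A l) w" if "i \<le> p" "l \<le> p" "i \<noteq> l" "w \<in> N" for i l w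
      using that by (auto simp: N_def)
  qed
  then have "(\<lambda>z. poly.coeff (P z) j) field_differentiable at z"
    by (rule holomorphic_on_imp_differentiable_at[OF _ oN zN])
  then show "(\<lambda>z. poly.coeff (P z) j) field_differentiable at z within UHP"
    by (rule field_differentiable_at_within)
qed

text \<open>Compare coefficients in \<open>qexp_moebius\<close>: the factor
  \<open>(1 / jac^2)^i\<close> lowers the weight by \<open>2 i\<close>.\<close>

lemma qexp_coeff:
  assumes q: "qexp k f p P"
  shows "qexp (k - 2 * int i) (\<lambda>z. poly.coeff (P z) i) p
     (\<lambda>z. \<Sum>l\<in>{i..p}. Polynomial.monom (poly.coeff (P z) l * of_nat (l choose i)) (l - i))"
  unfolding qexp_def
proof (intro conjI allI ballI impI)
  show "(\<lambda>z. poly.coeff (P z) i) holomorphic_on UHP" by (rule qexp_coeff_holomorphic[OF q])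
  show "poly.coeff (P z) i = 0" if "z \<notin> UHP" for z using qexpD(4)[OF q that] by simp
  show "degree (\<Sum>l = i..p. Polynomial.monom (poly.coeff (P z) l * of_nat (l choose i)) (l - i)) \<le> p" for z
    by (intro degree_sum_le) (auto intro: order_trans[OF degree_monom_le])
  show "(\<Sum>l = i..p. Polynomial.monom (poly.coeff (P z) l * of_nat (l choose i)) (l - i)) = 0" if "z \<notin> UHP" for z
    using qexpD(4)[OF q that] by simp
next
  fix A z assume A: "A \<in> G" and z: "z \<in> UHP"
  have nz: "jac A z \<noteq> 0" by (rule jac_nz[OF A z])
  have "jac A z powi k * (1 / (jac A z)\<^sup>2) ^ i = jac A z powi (k - 2 * int i)"
    using nz by (simp add: power_int_diff power_int_mult power_divide power_mult)
  then show "poly.coeff (P (moebius A z)) i = jac A z powi (k - 2 * int i) *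
      poly (\<Sum>l = i..p. Polynomial.monom (poly.coeff (P z) l * of_nat (l choose i)) (l - i)) (xco A z)"
    unfolding qexp_moebius[OF q A z] coeff_smult coeff_pcompose_linear[OF qexpD(3)[OF q]]
    by (simp add: mult.assoc[symmetric])
qed

lemma aut_qexp: "f \<in> aut k \<Longrightarrow> qexp k f 0 (\<lambda>z. [:f z:])"
  by (auto simp: aut_def qexp_def)

lemma qexp_0_aut: "qexp k f 0 P \<Longrightarrow> f \<in> aut k"
  unfolding aut_def
proof (intro CollectI conjI ballI allI impI)
  assume q: "qexp k f 0 P"
  show "f holomorphic_on UHP" "\<And>z. z \<notin> UHP \<Longrightarrow> f z = 0" using qexpD[OF q] by blast+
  fix A z assume A: "A \<in> G" "z \<in> UHP"
  have "degree (P z) = 0" using qexpD(3)[OF q, of z] by simp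
  then obtain a where "P z = [:a:]" by (rule degree_eq_zeroE)
  then show "f (moebius A z) = jac A z powi k * f z"
    using qexpD(5)[OF q A] qexp_coeff_0[OF q, of z] by simp
qed

lemma qexp_degree: "qexp k f p P \<Longrightarrow> (\<And>z. degree (P z) \<le> p') \<Longrightarrow> qexp k f p' P"
  by (simp add: qexp_def)

lemma qexp_coeff_gt: "qexp k f p P \<Longrightarrow> p < j \<Longrightarrow> poly.coeff (P z) j = 0"
  using qexpD(3)[of k f p P z] by (intro coeff_eq_0) simp

lemma qexp_top_aut:
  assumes q: "qexp k f p P" and top: "\<And>z j. j > i \<Longrightarrow> poly.coeff (P z) j = 0"
  shows "(\<lambda>z. poly.coeff (P z) i) \<in> aut (k - 2 * int i)"
proof (rule qexp_0_aut[OF qexp_degree[OF qexp_coeff[OF q]]])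
  fix z
  show "degree (\<Sum>l = i..p. Polynomial.monom (poly.coeff (P z) l * of_nat (l choose i)) (l - i)) \<le> 0"
  proof (intro degree_sum_le)
    fix l assume "l \<in> {i..p}"
    then show "degree (Polynomial.monom (poly.coeff (P z) l * of_nat (l choose i)) (l - i)) \<le> 0"
      using top[of l z] by (cases "l = i") (auto simp: monom_0)
  qed auto
qed

text \<open>Let \<open>m\<close> be the largest index of a nonzero coefficient. That coefficient is
  modular of weight \<open>k - 2 m\<close>, which is at most 0 and so must be 0, making the
  coefficient a nonzero constant. The coefficient before it then has weight 2 and a constant
  inhomogeneity, as excluded by \<open>no_quasi_period\<close>.\<close>

lemma qexp_depth:
  assumes q: "qexp k f p P" and i: "0 < i" "k \<le> 2 * int i"
  shows "poly.coeff (P z) i = 0"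
proof (rule ccontr)
  assume nz: "poly.coeff (P z) i \<noteq> 0"
  define S where "S = {i. \<exists>z. poly.coeff (P z) i \<noteq> 0}"
  have "S \<subseteq> {..p}" unfolding S_def using qexp_coeff_gt[OF q] by (auto simp: not_le[symmetric])
  then have finS: "finite S" using finite_subset by blast
  define m where "m = Max S"
  have iS: "i \<in> S" using nz by (auto simp: S_def)
  then have im: "i \<le> m" unfolding m_def using finS by simp
  have mS: "m \<in> S" unfolding m_def using finS iS by (intro Max_in) auto
  have top: "poly.coeff (P z) j = 0" if "j > m" for j z
    using that Max_ge[OF finS, of j] unfolding m_def S_def by force
  let ?c = "\<lambda>z. poly.coeff (P z) m"
  have c: "?c \<in> aut (k - 2 * int m)" by (rule qexp_top_aut[OF q top])
  have cnz: "?c \<noteq> 0" using mS by (auto simp: S_def fun_eq_iff)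
  have "\<not> k - 2 * int m < 0" using aut_negative_weight[OF c] cnz by blast
  then have km: "k - 2 * int m = 0" using i im by simp
  obtain a where a: "\<And>z. z \<in> UHP \<Longrightarrow> ?c z = a" using aut_zero_weight_constant[of ?c] c km by metis
  have a0: "a \<noteq> 0"
  proof
    assume "a = 0"
    then have "?c z = 0" for z using a autD(2)[OF c] by (cases "z \<in> UHP") auto
    then show False using cnz by (simp add: zero_fun_def)
  qed
  have m0: "m > 0" using i im by simp
  have mp: "m \<le> p" using mS \<open>S \<subseteq> {..p}\<close> by blast
  \<comment> \<open>Since \<open>k = 2 m\<close> this has weight 2, and of its expansion only the
    indices \<open>m - 1\<close> and \<open>m\<close> survive. Dividing by \<open>m * a\<close>
    normalizes the inhomogeneous term.\<close>
  let ?b = "\<lambda>z. poly.coeff (P z) (m - 1)"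
  have qb: "qexp 2 ?b p (\<lambda>z. \<Sum>l\<in>{m-1..p}. Polynomial.monom (poly.coeff (P z) l * of_nat (l choose (m-1))) (l - (m-1)))"
    using qexp_coeff[OF q, of "m - 1"] km m0 by (simp add: of_nat_diff)
  have tr: "?b (moebius A z) = (jac A z)\<^sup>2 * (?b z + of_nat m * a * xco A z)" if A: "A \<in> G" and z: "z \<in> UHP" for A z
  proof -
    have "(\<Sum>l\<in>{m-1..p}. Polynomial.monom (poly.coeff (P z) l * of_nat (l choose (m-1))) (l - (m-1)))
        = (\<Sum>l\<in>{m-1, m}. Polynomial.monom (poly.coeff (P z) l * of_nat (l choose (m-1))) (l - (m-1)))"
    proof (intro sum.mono_neutral_right ballI)
      fix l assume "l \<in> {m-1..p} - {m-1, m}"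
      then have "l > m" by auto
      then show "Polynomial.monom (poly.coeff (P z) l * of_nat (l choose (m-1))) (l - (m-1)) = 0"
        using top by simp
    qed (use mp in auto)
    also have "\<dots> = [:?b z:] + Polynomial.monom (?c z * of_nat m) 1"
    proof -
      have "m choose (m - 1) = m" using m0 by (metis binomial_symmetric choose_one diff_diff_cancel diff_le_self One_nat_def Suc_leI)
      then show ?thesis using m0 by (simp add: monom_0)
    qed
    finally show ?thesis using qexpD(5)[OF qb A z] a[OF z] by (simp add: poly_monom)
  qed
  show False
  proof (rule no_quasi_period)
    show "(\<lambda>z. ?b z / (of_nat m * a)) holomorphic_on UHP"
      using a0 m0 by (intro holomorphic_intros qexp_coeff_holomorphic[OF q]) auto
    fix A z assume A: "A \<in> G" and z: "z \<in> UHP"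
    have "xco A z * (jac A z)\<^sup>2 = of_real (A$2$1) * jac A z"
      using jac_nz[OF A z] by (simp add: xco_def power2_eq_square)
    then show "?b (moebius A z) / (of_nat m * a) = (jac A z)\<^sup>2 * (?b z / (of_nat m * a)) + of_real (A$2$1) * jac A z"
      unfolding tr[OF A z] using a0 m0 by (simp add: field_simps)
  qed
qed

section \<open>The derivative and the decomposition into derivatives of modular forms\<close>

definition D :: "(complex \<Rightarrow> complex) \<Rightarrow> complex \<Rightarrow> complex" where
  "D f z = (if z \<in> UHP then deriv f z else 0)"

lemma D_holomorphic: "f holomorphic_on UHP \<Longrightarrow> D f holomorphic_on UHP"
  by (rule holomorphic_transform[OF holomorphic_deriv[OF _ open_UHP]]) (auto simp: D_def)

text \<open>Differentiate the law in \<open>z\<close>, using that \<open>moebius A\<close> has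
  derivative \<open>1 / jac^2\<close>, \<open>jac\<close> has logarithmic derivative
  \<open>xco\<close>, and \<open>xco\<close> has derivative \<open>- xco^2\<close>. A power
  \<open>x^i\<close> in weight \<open>k\<close> thus yields \<open>(k - i) x^(i + 1)\<close>, the
  shifted coefficient with \<open>i = j - 1\<close>.\<close>

lemma qexp_D:
  assumes q: "qexp k f p P"
  shows "qexp (k + 2) (D f) (Suc p) (\<lambda>z. \<Sum>j\<le>Suc p. Polynomial.monom
     (D (\<lambda>z. poly.coeff (P z) j) z + (of_int k - of_nat j + 1) * (if j = 0 then 0 else poly.coeff (P z) (j - 1))) j)"
    (is "qexp _ _ _ (\<lambda>z. ?Q z)")
  unfolding qexp_def
proof (intro conjI allI ballI impI)
  show "D f holomorphic_on UHP" by (rule D_holomorphic[OF qexpD(1)[OF q]])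
  show "D f z = 0" if "z \<notin> UHP" for z using that by (simp add: D_def)
  show "degree (?Q z) \<le> Suc p" for z by (intro degree_sum_le) (auto intro: order_trans[OF degree_monom_le])
  show "?Q z = 0" if "z \<notin> UHP" for z
    using qexpD(4)[OF q that] that by (intro sum.neutral) (auto simp: D_def)
next
  fix A z assume A: "A \<in> G" and z: "z \<in> UHP"
  let ?j = "jac A z" and ?x = "xco A z"
  define c where "c = (\<lambda>j z. poly.coeff (P z) j)"
  have hc: "(c j has_field_derivative D (c j) z) (at z)" for j
    using holomorphic_derivI[OF qexp_coeff_holomorphic[OF q] open_UHP z, of j] z by (simp add: c_def D_def)
  have nz: "?j \<noteq> 0" by (rule jac_nz[OF A z])
  have Az: "moebius A z \<in> UHP" by (rule moebius_G[OF A z])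
  have lhs: "((\<lambda>w. f (moebius A w)) has_field_derivative deriv f (moebius A z) * (1 / ?j\<^sup>2)) (at z)"
    by (rule DERIV_chain2[OF holomorphic_derivI[OF qexpD(1)[OF q] open_UHP Az] moebius_has_field_derivative[OF det_G[OF A] z]])
  have dj: "(jac A has_field_derivative of_real (A$2$1)) (at z)" by (rule jac_has_field_derivative)
  have dx: "(xco A has_field_derivative - ?x\<^sup>2) (at z)"
  proof -
    have "((\<lambda>w. of_real (A$2$1) / jac A w) has_field_derivative (0 * ?j - of_real (A$2$1) * of_real (A$2$1)) / (?j * ?j)) (at z)"
      by (rule DERIV_divide[OF DERIV_const dj nz])
    then show ?thesis by (simp add: xco_def[abs_def] power2_eq_square)
  qed
  have pe: "poly (P w) x = (\<Sum>i\<le>p. c i w * x ^ i)" for w x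
    unfolding poly_altdef c_def using qexpD(3)[OF q, of w] by (intro sum.mono_neutral_left) (auto simp: coeff_eq_0)
  have rhs: "((\<lambda>w. jac A w powi k * (\<Sum>i\<le>p. c i w * xco A w ^ i)) has_field_derivative
      (of_int k * ?j powi (k - 1) * of_real (A$2$1)) * (\<Sum>i\<le>p. c i z * ?x ^ i) +
      (\<Sum>i\<le>p. D (c i) z * ?x ^ i + (of_nat i * ?x ^ (i - 1) * - ?x\<^sup>2) * c i z) * ?j powi k) (at z)"
  proof (rule DERIV_mult)
    show "((\<lambda>w. jac A w powi k) has_field_derivative of_int k * ?j powi (k - 1) * of_real (A$2$1)) (at z)"
      using DERIV_power_int[OF dj disjI2[OF nz], of k] by simp
    show "((\<lambda>w. \<Sum>i\<le>p. c i w * xco A w ^ i) has_field_derivative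
        (\<Sum>i\<le>p. D (c i) z * ?x ^ i + (of_nat i * ?x ^ (i - 1) * - ?x\<^sup>2) * c i z)) (at z)"
    proof (rule DERIV_sum)
      fix i
      have "((\<lambda>w. xco A w ^ i) has_field_derivative of_nat i * ?x ^ (i - 1) * - ?x\<^sup>2) (at z)"
        using DERIV_power[OF dx, of i] by (simp add: mult_ac)
      then show "((\<lambda>w. c i w * xco A w ^ i) has_field_derivative D (c i) z * ?x ^ i + (of_nat i * ?x ^ (i - 1) * - ?x\<^sup>2) * c i z) (at z)"
        by (rule DERIV_mult[OF hc])
    qed
  qed
  have "((\<lambda>w. f (moebius A w)) has_field_derivative
      (of_int k * ?j powi (k - 1) * of_real (A$2$1)) * (\<Sum>i\<le>p. c i z * ?x ^ i) +
      (\<Sum>i\<le>p. D (c i) z * ?x ^ i + (of_nat i * ?x ^ (i - 1) * - ?x\<^sup>2) * c i z) * ?j powi k) (at z)"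
  proof (rule has_field_derivative_transform_within_open[OF rhs open_UHP z])
    show "jac A w powi k * (\<Sum>i\<le>p. c i w * xco A w ^ i) = f (moebius A w)" if "w \<in> UHP" for w
      using qexpD(5)[OF q A that] by (simp add: pe)
  qed
  from DERIV_unique[OF lhs this]
  have e1: "deriv f (moebius A z) / ?j\<^sup>2 = (of_int k * ?j powi (k - 1) * of_real (A$2$1)) * (\<Sum>i\<le>p. c i z * ?x ^ i) +
      (\<Sum>i\<le>p. D (c i) z * ?x ^ i + (of_nat i * ?x ^ (i - 1) * - ?x\<^sup>2) * c i z) * ?j powi k" by simp
  have j1: "?j powi (k - 1) * of_real (A$2$1) = ?j powi k * ?x"
    using nz by (simp add: power_int_diff xco_def)
  \<comment> \<open>For \<open>i = 0\<close> the truncated exponent \<open>i - 1\<close> does no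
    harm, since both sides vanish.\<close>
  have tm: "of_nat i * ?x ^ (i - 1) * - ?x\<^sup>2 = - of_nat i * ?x ^ Suc i" for i
    by (cases i) (simp_all add: power2_eq_square algebra_simps)
  have "deriv f (moebius A z) / ?j\<^sup>2 = ?j powi k * (of_int k * ?x * (\<Sum>i\<le>p. c i z * ?x ^ i) +
      (\<Sum>i\<le>p. D (c i) z * ?x ^ i + (- of_nat i * ?x ^ Suc i) * c i z))"
    unfolding e1 tm using j1 by (simp add: algebra_simps)
  also have "of_int k * ?x * (\<Sum>i\<le>p. c i z * ?x ^ i) + (\<Sum>i\<le>p. D (c i) z * ?x ^ i + (- of_nat i * ?x ^ Suc i) * c i z)
     = (\<Sum>i\<le>p. D (c i) z * ?x ^ i) + (\<Sum>i\<le>p. (of_int k - of_nat i) * c i z * ?x ^ Suc i)"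
    by (simp add: sum_distrib_left algebra_simps flip: sum.distrib)
  also have "(\<Sum>i\<le>p. D (c i) z * ?x ^ i) = (\<Sum>i\<le>Suc p. D (c i) z * ?x ^ i)"
  proof -
    have "c (Suc p) = (\<lambda>z. 0)" using qexp_coeff_gt[OF q, of "Suc p"] by (auto simp: c_def)
    then have "D (c (Suc p)) z = 0" by (simp add: D_def)
    then show ?thesis by simp
  qed
  also have "(\<Sum>i\<le>p. (of_int k - of_nat i) * c i z * ?x ^ Suc i) =
      (\<Sum>i\<le>Suc p. (of_int k - of_nat i + 1) * (if i = 0 then 0 else c (i - 1) z) * ?x ^ i)"
    unfolding sum.atMost_Suc_shift by (simp add: algebra_simps)
  also have "(\<Sum>i\<le>Suc p. D (c i) z * ?x ^ i) + \<dots> = poly (?Q z) ?x"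
    unfolding c_def by (simp add: poly_sum poly_monom distrib_right flip: sum.distrib del: sum.atMost_Suc)
  finally have "deriv f (moebius A z) / ?j\<^sup>2 = ?j powi k * poly (?Q z) ?x" .
  then have "deriv f (moebius A z) = ?j powi k * ?j\<^sup>2 * poly (?Q z) ?x" using nz by (simp add: field_simps)
  moreover have "?j powi (k + 2) = ?j powi k * ?j\<^sup>2" using nz by (simp add: power_int_add)
  ultimately show "D f (moebius A z) = ?j powi (k + 2) * poly (?Q z) ?x" using Az by (simp add: D_def)
qed

lemma qexp_D_coeff_top:
  assumes q: "qexp k f p P" and q': "qexp (k + 2) (D f) (Suc p) Q"
  shows "poly.coeff (Q z) (Suc p) = (of_int k - of_nat p) * poly.coeff (P z) p"
proof -
  have "(\<lambda>z. poly.coeff (P z) (Suc p)) = (\<lambda>z. 0)" using qexp_coeff_gt[OF q, of "Suc p"] by auto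
  then have "D (\<lambda>z. poly.coeff (P z) (Suc p)) z = 0" by (simp add: D_def)
  then show ?thesis unfolding qexp_unique[OF q' qexp_D[OF q]] by (simp add: coeff_sum)
qed

end

context cocompact_group
begin

lemma qexp_add:
  assumes "qexp k f p P" "qexp k g q Q"
  shows "qexp k (\<lambda>z. f z + g z) (max p q) (\<lambda>z. P z + Q z)"
proof -
  have "degree (P z + Q z) \<le> max p q" for z
    using qexpD(3)[OF assms(1), of z] qexpD(3)[OF assms(2), of z] by (intro degree_add_le) auto
  then show ?thesis
    using qexpD[OF assms(1)] qexpD[OF assms(2)] unfolding qexp_def
    by (intro conjI holomorphic_on_add) (auto simp: distrib_left)
qed

lemma qexp_mult:
  assumes "qexp k f p P" "qexp l g q Q"
  shows "qexp (k + l) (\<lambda>z. f z * g z) (p + q) (\<lambda>z. P z * Q z)"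
  unfolding qexp_def
proof (intro conjI holomorphic_on_mult allI ballI impI)
  show "degree (P z * Q z) \<le> p + q" for z
    using qexpD(3)[OF assms(1), of z] qexpD(3)[OF assms(2), of z] degree_mult_le[of "P z" "Q z"] by linarith
  fix A z assume "A \<in> G" "z \<in> UHP"
  then show "f (moebius A z) * g (moebius A z) = jac A z powi (k + l) * poly (P z * Q z) (xco A z)"
    using qexpD(5)[OF assms(1), of A z] qexpD(5)[OF assms(2), of A z] jac_nz[of A z]
    by (simp add: power_int_add mult_ac)
qed (use qexpD[OF assms(1)] qexpD[OF assms(2)] in auto)

lemma qexp_scale: "qexp k f p P \<Longrightarrow> qexp k (\<lambda>z. c * f z) p (\<lambda>z. Polynomial.smult c (P z))"
  unfolding qexp_def by (auto simp: mult_ac intro!: holomorphic_intros)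

lemma qexp_zero: "qexp k (\<lambda>z. 0) 0 (\<lambda>z. 0)"
  by (auto simp: qexp_def)

lemma qexp_sum:
  assumes "finite I" "\<And>i. i \<in> I \<Longrightarrow> qexp k (f i) p (P i)"
  shows "qexp k (\<lambda>z. \<Sum>i\<in>I. f i z) p (\<lambda>z. \<Sum>i\<in>I. P i z)"
  using assms
proof (induction I rule: finite_induct)
  case empty
  then show ?case using qexp_degree[OF qexp_zero] by simp
next
  case (insert i I)
  then have "qexp k (\<lambda>z. f i z + (\<Sum>i\<in>I. f i z)) (max p p) (\<lambda>z. P i z + (\<Sum>i\<in>I. P i z))"
    by (intro qexp_add) auto
  then show ?case using insert by simp
qed

text \<open>The step from \<open>n\<close> to \<open>n + 1\<close> multiplies the top coefficient by
  weight minus depth, that is \<open>m + 2 n - n = m + n\<close>. For \<open>m > 0\<close> the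
  product is nonzero, so \<open>D^n\<close> raises the depth of a nonzero form to exactly
  \<open>n\<close>.\<close>

lemma aut_Dn_qexp:
  assumes g: "g \<in> aut m"
  shows "\<exists>P. qexp (m + 2 * int n) ((D ^^ n) g) n P \<and>
    (\<forall>z. poly.coeff (P z) n = (\<Prod>i<n. of_int m + of_nat i) * g z)"
proof (induction n)
  case 0
  show ?case using aut_qexp[OF g] by (intro exI[of _ "\<lambda>z. [:g z:]"]) auto
next
  case (Suc n)
  then obtain P where P: "qexp (m + 2 * int n) ((D ^^ n) g) n P"
    "\<And>z. poly.coeff (P z) n = (\<Prod>i<n. of_int m + of_nat i) * g z" by blast
  obtain Q where Q: "qexp (m + 2 * int n + 2) (D ((D ^^ n) g)) (Suc n) Q"
    using qexp_D[OF P(1)] by blast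
  have "poly.coeff (Q z) (Suc n) = (\<Prod>i<Suc n. of_int m + of_nat i) * g z" for z
    using qexp_D_coeff_top[OF P(1) Q, of z] P(2)[of z] by (simp add: algebra_simps)
  moreover have "m + 2 * int n + 2 = m + 2 * int (Suc n)" by simp
  ultimately show ?case using Q by (metis funpow.simps(2) comp_apply)
qed

lemma rising_factorial_nonzero: "m > 0 \<Longrightarrow> (\<Prod>i<n. of_int m + of_nat i :: complex) \<noteq> 0"
proof -
  assume m: "m > 0"
  have "of_int m + of_nat i \<noteq> (0::complex)" for i
  proof -
    have "of_int m + of_nat i = (of_int (m + int i) :: complex)" by simp
    moreover have "m + int i \<noteq> 0" using m by linarith
    ultimately show ?thesis by (metis of_int_eq_0_iff)
  qed
  then show ?thesis by simp
qed

lemma D_power_zero [simp]: "(D ^^ n) (\<lambda>z. 0) = (\<lambda>z. 0)"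
proof (induction n)
  case (Suc n)
  have "D (\<lambda>z. 0) = (\<lambda>z. 0)" by (auto simp: D_def)
  then show ?case by (simp add: Suc)
qed simp

text \<open>Induction on the depth. The top coefficient is modular, and it vanishes by
  \<open>qexp_depth\<close> unless its weight \<open>m\<close> is positive; in that case a multiple
  of its derivative of order \<open>Suc p\<close> has the same top coefficient and can be
  subtracted.\<close>

lemma qexp_structure:
  assumes "qexp k f p P"
  shows "\<exists>g. (\<forall>n. g n \<in> aut (k - 2 * int n)) \<and> (\<forall>n. 0 < n \<longrightarrow> k \<le> 2 * int n \<longrightarrow> g n = (\<lambda>z. 0)) \<and>
    f = (\<lambda>z. \<Sum>n\<le>p. (D ^^ n) (g n) z)"
  using assms
proof (induction p arbitrary: f P)
  case 0
  have "f \<in> aut k" by (rule qexp_0_aut[OF 0])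
  then show ?case by (intro exI[of _ "\<lambda>n. if n = 0 then f else (\<lambda>z. 0)"]) (auto intro: aut_zero)
next
  case (Suc p)
  define c where "c = (\<lambda>z. poly.coeff (P z) (Suc p))"
  show ?case
  proof (cases "k \<le> 2 * int (Suc p)")
    case True
    then have c0: "poly.coeff (P z) (Suc p) = 0" for z using qexp_depth[OF Suc.prems] by simp
    have "degree (P z) \<le> p" for z
      by (rule degree_le) (use c0 qexp_coeff_gt[OF Suc.prems] in \<open>metis Suc_lessI\<close>)
    then obtain g where g: "\<forall>n. g n \<in> aut (k - 2 * int n)" "\<forall>n. 0 < n \<longrightarrow> k \<le> 2 * int n \<longrightarrow> g n = (\<lambda>z. 0)"
      "f = (\<lambda>z. \<Sum>n\<le>p. (D ^^ n) (g n) z)"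
      using Suc.IH[OF qexp_degree[OF Suc.prems]] by blast
    moreover have "g (Suc p) = (\<lambda>z. 0)" using g(2) True by blast
    ultimately show ?thesis by (intro exI[of _ g]) (auto simp del: funpow.simps)
  next
    case False
    define m where "m = k - 2 * int (Suc p)"
    have m: "m > 0" using False by (simp add: m_def)
    have c: "c \<in> aut m" unfolding c_def m_def
      by (rule qexp_top_aut[OF Suc.prems qexp_coeff_gt[OF Suc.prems]])
    define C where "C = (\<Prod>i<Suc p. of_int m + of_nat i :: complex)"
    have C: "C \<noteq> 0" unfolding C_def by (rule rising_factorial_nonzero[OF m])
    \<comment> \<open>Division by the rising factorial \<open>C\<close> makes the top coefficient of
      \<open>D^(Suc p) h\<close> equal to \<open>c\<close>.\<close>
    define h where "h = (\<lambda>z. inverse C * c z)"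
    have h: "h \<in> aut m" unfolding h_def by (rule aut_scale[OF c])
    obtain Q where Q: "qexp (m + 2 * int (Suc p)) ((D ^^ Suc p) h) (Suc p) Q"
      "\<And>z. poly.coeff (Q z) (Suc p) = C * h z" using aut_Dn_qexp[OF h, of "Suc p"] unfolding C_def by blast
    have mk: "m + 2 * int (Suc p) = k" by (simp add: m_def)
    define f' where "f' = (\<lambda>z. f z + (- 1) * (D ^^ Suc p) h z)"
    define P' where "P' = (\<lambda>z. P z + Polynomial.smult (- 1) (Q z))"
    have q': "qexp k f' (Suc p) P'"
      unfolding f'_def P'_def using qexp_add[OF Suc.prems qexp_scale[OF Q(1)[unfolded mk], of "-1"]] by simp
    have "poly.coeff (P' z) (Suc p) = 0" for z
      unfolding P'_def using C by (simp add: Q(2) h_def c_def)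
    then have "degree (P' z) \<le> p" for z
      by (intro degree_le) (use qexp_coeff_gt[OF q'] in \<open>metis Suc_lessI\<close>)
    then obtain g where g: "\<forall>n. g n \<in> aut (k - 2 * int n)" "\<forall>n. 0 < n \<longrightarrow> k \<le> 2 * int n \<longrightarrow> g n = (\<lambda>z. 0)"
      "f' = (\<lambda>z. \<Sum>n\<le>p. (D ^^ n) (g n) z)"
      using Suc.IH[OF qexp_degree[OF q']] by blast
    define g' where "g' = g (Suc p := h)"
    have "\<forall>n. g' n \<in> aut (k - 2 * int n)" using g(1) h by (simp add: g'_def m_def)
    moreover have "\<forall>n. 0 < n \<longrightarrow> k \<le> 2 * int n \<longrightarrow> g' n = (\<lambda>z. 0)" using g(2) False by (auto simp: g'_def)
    moreover have "f = (\<lambda>z. \<Sum>n\<le>Suc p. (D ^^ n) (g' n) z)"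
    proof
      fix z
      have "f z = f' z + (D ^^ Suc p) h z" by (simp add: f'_def del: funpow.simps)
      also have "f' z = (\<Sum>n\<le>p. (D ^^ n) (g' n) z)" unfolding g(3) g'_def by (intro sum.cong) auto
      also have "h = g' (Suc p)" by (simp add: g'_def)
      finally show "f z = (\<Sum>n\<le>Suc p. (D ^^ n) (g' n) z)" by (simp del: funpow.simps)
    qed
    ultimately show ?thesis by blast
  qed
qed

text \<open>Write \<open>w\<close> as the image of a point \<open>z\<close> of the compact set
  \<open>K\<close>. There the coefficients and \<open>xco\<close> are bounded, and
  \<open>|jac A z|^2 = Im z / Im w\<close> is bounded by a multiple of
  \<open>1 / Im w\<close>.\<close>

lemma qexp_moderate_growth:
  assumes q: "qexp (int k) f p P"
  shows "moderate_growth f"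
proof -
  obtain K where K: "compact K" "K \<subseteq> UHP" "\<And>z. z \<in> UHP \<Longrightarrow> \<exists>A\<in>G. moebius A z \<in> K"
    using cocompact_G by blast
  obtain m M where m: "m > 0" "M > 0" "\<And>z. z \<in> K \<Longrightarrow> m \<le> Im z \<and> cmod z \<le> M"
    using compact_UHP_bounds[OF K(1,2)] by blast
  have "\<exists>C>0. \<forall>z\<in>K. cmod (poly.coeff (P z) j) \<le> C" for j
  proof -
    have "continuous_on K (\<lambda>z. poly.coeff (P z) j)"
      by (rule continuous_on_subset[OF holomorphic_on_imp_continuous_on[OF qexp_coeff_holomorphic[OF q]] K(2)])
    then have "bounded ((\<lambda>z. poly.coeff (P z) j) ` K)"
      by (intro compact_imp_bounded compact_continuous_image K(1))
    then show ?thesis by (auto simp: bounded_pos)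
  qed
  then obtain C where C: "\<And>j. C j > 0" "\<And>j z. z \<in> K \<Longrightarrow> cmod (poly.coeff (P z) j) \<le> C j" by metis
  define E where "E = (\<Sum>j\<le>p. C j * (1 / m) ^ j)"
  have E0: "E \<ge> 0" unfolding E_def using C(1) m by (intro sum_nonneg) (auto simp: less_imp_le)
  have "norm (f w) \<le> (E * (1 + M) ^ k) * ((1 + (norm w)\<^sup>2) / Im w) ^ k" if w: "w \<in> UHP" for w
  proof -
    obtain A' where A': "A' \<in> G" "moebius A' w \<in> K" using K(3)[OF w] by blast
    define z where "z = moebius A' w"
    obtain A where A: "A \<in> G" "A' ** A = mat 1" "A ** A' = mat 1" using inv_G[OF A'(1)] by blast
    have zK: "z \<in> K" using A' by (simp add: z_def)
    have z: "z \<in> UHP" using zK K(2) by blast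
    have Azw: "moebius A z = w" unfolding z_def by (rule moebius_cancel[OF A(1) A'(1) A(3) w])
    have yz: "Im z > 0" "Im w > 0" using z w by (simp_all add: UHP_def)
    have jnz: "cmod (jac A z) > 0" using jac_nz[OF A(1) z] by simp
    have x: "cmod (xco A z) \<le> 1 / m"
    proof -
      have "\<bar>A$2$1\<bar> * m \<le> \<bar>A$2$1\<bar> * Im z" using m(3)[OF zK] by (intro mult_left_mono) auto
      also have "\<dots> \<le> cmod (jac A z)" by (rule cmod_jac_lower(1)[OF z])
      finally show ?thesis using jnz m(1) by (simp add: xco_def norm_divide field_simps)
    qed
    have "cmod (poly (P z) (xco A z)) = cmod (\<Sum>j\<le>p. poly.coeff (P z) j * xco A z ^ j)"
    proof -
      have "poly (P z) (xco A z) = (\<Sum>j\<le>p. poly.coeff (P z) j * xco A z ^ j)"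
        unfolding poly_altdef using qexpD(3)[OF q, of z] by (intro sum.mono_neutral_left) (auto simp: coeff_eq_0)
      then show ?thesis by simp
    qed
    also have "\<dots> \<le> E"
      unfolding E_def using C(2)[OF zK] x C(1)
      by (intro sum_norm_le) (auto simp: norm_mult norm_power less_imp_le intro!: mult_mono power_mono)
    finally have pE: "cmod (poly (P z) (xco A z)) \<le> E" .
    let ?B = "(1 + (norm w)\<^sup>2) / Im w"
    have "Im w \<le> norm w" using abs_Im_le_cmod[of w] by linarith
    also have "\<dots> \<le> 1 + (norm w)\<^sup>2"
      using zero_le_power2[of "norm w - 1/2"] by (simp add: power2_eq_square algebra_simps)
    finally have B1: "1 \<le> ?B" using yz by simp
    have B2: "1 / Im w \<le> ?B" using yz by (intro divide_right_mono) auto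
    have "Im w = Im z / (cmod (jac A z))\<^sup>2" using Im_moebius[OF det_G[OF A(1)], of z] Azw by simp
    then have "Im w * (cmod (jac A z))\<^sup>2 = Im z" using jnz by simp
    then have j2: "(cmod (jac A z))\<^sup>2 = Im z / Im w" using yz(2) by (simp add: eq_divide_eq mult.commute)
    \<comment> \<open>The estimate \<open>t \<le> 1 + t^2\<close> avoids a square root, so that the
      exponent in the growth bound can be the weight \<open>k\<close>.\<close>
    have "cmod (jac A z) \<le> 1 + (cmod (jac A z))\<^sup>2"
      using zero_le_power2[of "cmod (jac A z) - 1/2"] by (simp add: power2_eq_square algebra_simps)
    also have "\<dots> \<le> 1 + M * (1 / Im w)"
      using m(3)[OF zK] abs_Im_le_cmod[of z] yz unfolding j2 by (simp add: divide_right_mono)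
    also have "\<dots> \<le> ?B + M * ?B" using B1 B2 m(2) by (intro add_mono mult_left_mono) auto
    finally have j: "cmod (jac A z) \<le> (1 + M) * ?B" by (simp only: distrib_right mult_1_left)
    have "norm (f w) = cmod (jac A z) ^ k * cmod (poly (P z) (xco A z))"
      using qexpD(5)[OF q A(1) z] Azw by (simp add: norm_mult norm_power)
    also have "\<dots> \<le> ((1 + M) * ?B) ^ k * E"
    proof (rule mult_mono[OF power_mono[OF j norm_ge_zero] pE])
      have "0 \<le> (1 + M) * ?B" using j norm_ge_zero order_trans by blast
      then show "0 \<le> ((1 + M) * ?B) ^ k" by (rule zero_le_power)
    qed simp
    finally show ?thesis by (simp only: power_mult_distrib mult_ac)
  qed
  then show ?thesis unfolding moderate_growth_def by blast
qed

end

lemma sum_fun_apply: "(\<Sum>i\<in>I. f i) x = (\<Sum>i\<in>I. f i x)" for f :: "'i \<Rightarrow> complex \<Rightarrow> complex"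
  by (induction I rule: infinite_finite_induct) auto

section \<open>The ideal of decomposable quasimodular forms\<close>

locale cocompact_fuchsian =
  fixes \<Gamma> :: "(real^2^2) set set"
  assumes subgroup: "subgroup \<Gamma> PSL2R" and discrete: "discrete_in_PSL2R \<Gamma>" and cocompact: "cocompact \<Gamma>"
begin

sublocale cocompact_group "\<Union>\<Gamma>"
  by (rule cocompact_group_Union[OF subgroup discrete cocompact])

lemma carrier: "\<Gamma> \<subseteq> carrier PSL2R"
  by (rule subgroup.subset[OF subgroup])

sublocale Q: graded_spaces "quasimodular_forms \<Gamma>"
  by (rule graded_spaces_quasimodular[OF carrier])

sublocale M: graded_spaces "modular_forms \<Gamma>"
  by (rule graded_spaces_modular[OF carrier])

lemma powi_transfer:
  assumes "A \<in> \<Union>\<Gamma>" "z \<in> UHP"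
  shows "jac A z powi (- k) * a = b \<longleftrightarrow> a = jac A z powi k * b"
proof -
  have "jac A z \<noteq> 0" by (rule jac_nz[OF assms])
  then show ?thesis by (auto simp: power_int_minus field_simps)
qed

text \<open>Expresses the given notion through \<open>qexp\<close>: the polynomial is reset to 0 off
  the half plane, and in the converse direction growth comes from cocompactness.\<close>

lemma quasimodular_forms_eq: "quasimodular_forms \<Gamma> k = {f. \<exists>p P. qexp (int k) f p P}"
proof (intro equalityI subsetI)
  fix f assume "f \<in> quasimodular_forms \<Gamma> k"
  then obtain p P where f: "\<forall>z. z \<notin> UHP \<longrightarrow> f z = 0" "f holomorphic_on UHP" "\<forall>z. degree (P z) \<le> p"
    and P: "\<And>A z. A \<in> \<Union>\<Gamma> \<Longrightarrow> z \<in> UHP \<Longrightarrow> jac A z powi (- int k) * f (moebius A z) = poly (P z) (xco A z)"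
    unfolding quasimodular_forms_iff jac_def[symmetric] xco_def[symmetric] by blast
  have "qexp (int k) f p (\<lambda>z. if z \<in> UHP then P z else 0)"
    unfolding qexp_def using f P powi_transfer by (simp del: Union_iff)
  then show "f \<in> {f. \<exists>p P. qexp (int k) f p P}" by blast
next
  fix f assume "f \<in> {f. \<exists>p P. qexp (int k) f p P}"
  then obtain p P where q: "qexp (int k) f p P" by blast
  have "\<forall>A\<in>\<Union>\<Gamma>. \<forall>z\<in>UHP. jac A z powi (- int k) * f (moebius A z) = poly (P z) (xco A z)"
    using qexpD(5)[OF q] powi_transfer by blast
  then show "f \<in> quasimodular_forms \<Gamma> k"
    unfolding quasimodular_forms_iff jac_def[symmetric] xco_def[symmetric]
    using qexpD[OF q] qexp_moderate_growth[OF q] by blast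
qed

lemma modular_forms_eq: "modular_forms \<Gamma> k = aut (int k)"
proof (intro equalityI subsetI)
  fix f assume f: "f \<in> modular_forms \<Gamma> k"
  have "\<forall>A\<in>\<Union>\<Gamma>. \<forall>z\<in>UHP. jac A z powi (- int k) * f (moebius A z) = f z"
    using f unfolding modular_forms_def jac_def[symmetric] by blast
  then have "\<forall>A\<in>\<Union>\<Gamma>. \<forall>z\<in>UHP. f (moebius A z) = jac A z powi int k * f z"
    using powi_transfer by blast
  then show "f \<in> aut (int k)" using f unfolding aut_def modular_forms_def by blast
next
  fix f assume f: "f \<in> aut (int k)"
  have "\<forall>A\<in>\<Union>\<Gamma>. \<forall>z\<in>UHP. jac A z powi (- int k) * f (moebius A z) = f z"
    using autD(3)[OF f] powi_transfer by blast
  then show "f \<in> modular_forms \<Gamma> k"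
    unfolding modular_forms_def jac_def[symmetric]
    using autD[OF f] qexp_moderate_growth[OF aut_qexp[OF f]] by blast
qed

abbreviation QM :: "nat \<Rightarrow> (complex \<Rightarrow> complex) set" where "QM \<equiv> quasimodular_forms \<Gamma>"

abbreviation QJ :: "nat \<Rightarrow> (complex \<Rightarrow> complex) set" where "QJ \<equiv> product_component QM"

lemma QM_holomorphic: "f \<in> QM k \<Longrightarrow> f holomorphic_on UHP"
  unfolding quasimodular_forms_eq using qexpD(1) by blast

lemma aut_subset_QM: "aut (int k) \<subseteq> QM k"
  unfolding quasimodular_forms_eq using aut_qexp by blast

lemma QM_D: "f \<in> QM k \<Longrightarrow> D f \<in> QM (k + 2)"
proof -
  assume "f \<in> QM k"
  then obtain p P where "qexp (int k) f p P" unfolding quasimodular_forms_eq by blast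
  from qexp_D[OF this] have "\<exists>p P. qexp (int (k + 2)) (D f) p P" by (simp only: of_nat_add of_nat_numeral) blast
  then show ?thesis unfolding quasimodular_forms_eq by blast
qed

lemma product_mem_QJ:
  assumes "0 < w" "w < k" "f \<in> QM w" "g \<in> QM (k - w)"
  shows "f * g \<in> QJ k"
  unfolding product_component_def
  by (intro CollectI exI[of _ 1] exI[of _ "\<lambda>_. w"] exI[of _ "\<lambda>_. f"] exI[of _ "\<lambda>_. g"]) (use assms in auto)

lemma QJ_scale: "h \<in> QJ k \<Longrightarrow> (\<lambda>z. c * h z) \<in> QJ k"
proof -
  assume h: "h \<in> QJ k"
  have "h * (\<lambda>z. c * indicator UHP z) \<in> QJ (k + 0)" by (rule Q.product_component_mult[OF h Q.const])
  moreover have "h * (\<lambda>z. c * indicator UHP z) = (\<lambda>z. c * h z)"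
    using Q.vanish[of h k] Q.product_component_subset h by (auto simp: fun_eq_iff indicator_def)
  ultimately show ?thesis by simp
qed

lemma subspace_QJ: "cf.subspace (QJ k)"
proof (rule cf_subspaceI)
  show "(\<lambda>z. 0) \<in> QJ k" using Q.product_component_zero by (simp add: zero_fun_def)
  show "(\<lambda>z. f z + g z) \<in> QJ k" if "f \<in> QJ k" "g \<in> QJ k" for f g
    using Q.product_component_add[OF that] by (simp add: plus_fun_def)
qed (rule QJ_scale)

lemma D_sum:
  assumes "finite I" "\<And>i. i \<in> I \<Longrightarrow> f i holomorphic_on UHP"
  shows "D (\<lambda>z. \<Sum>i\<in>I. f i z) = (\<lambda>z. \<Sum>i\<in>I. D (f i) z)"
proof
  fix z
  show "D (\<lambda>z. \<Sum>i\<in>I. f i z) z = (\<Sum>i\<in>I. D (f i) z)"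
  proof (cases "z \<in> UHP")
    case True
    have "((\<lambda>z. \<Sum>i\<in>I. f i z) has_field_derivative (\<Sum>i\<in>I. deriv (f i) z)) (at z)"
      by (rule DERIV_sum) (rule holomorphic_derivI[OF assms(2) open_UHP True])
    then show ?thesis using True by (simp add: D_def DERIV_imp_deriv)
  qed (simp add: D_def)
qed

lemma D_mult:
  assumes "f holomorphic_on UHP" "g holomorphic_on UHP"
  shows "D (f * g) = D f * g + f * D g"
proof
  fix z
  show "D (f * g) z = (D f * g + f * D g) z"
  proof (cases "z \<in> UHP")
    case True
    have "((\<lambda>z. f z * g z) has_field_derivative deriv f z * g z + deriv g z * f z) (at z)"
      by (rule DERIV_mult[OF holomorphic_derivI[OF assms(1) open_UHP True] holomorphic_derivI[OF assms(2) open_UHP True]])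
    then show ?thesis using True by (simp add: D_def times_fun_def DERIV_imp_deriv)
  qed (simp add: D_def)
qed

text \<open>In the Leibniz rule one factor gains weight 2, so both weights stay strictly between 0
  and \<open>k + 2\<close>.\<close>

lemma QJ_D:
  assumes "h \<in> QJ k"
  shows "D h \<in> QJ (k + 2)"
proof -
  obtain n w f g where *: "\<And>i. i < n \<Longrightarrow> 0 < w i \<and> w i < k \<and> f i \<in> QM (w i) \<and> g i \<in> QM (k - w i)"
    and h: "h = (\<Sum>i<(n::nat). f i * g i)"
    using assms unfolding product_component_def by blast
  have hol: "f i holomorphic_on UHP" "g i holomorphic_on UHP" if "i < n" for i
    using *[OF that] QM_holomorphic by blast+
  have "h = (\<lambda>z. \<Sum>i<n. (f i * g i) z)" by (simp add: h sum_fun_apply fun_eq_iff)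
  then have "D h = (\<lambda>z. \<Sum>i<n. D (f i * g i) z)"
    using hol by (simp only:) (intro D_sum, auto simp: times_fun_def intro!: holomorphic_intros)
  also have "\<dots> = (\<Sum>i<n. D (f i) * g i + f i * D (g i))"
    using D_mult hol by (auto simp: fun_eq_iff sum_fun_apply)
  also have "\<dots> \<in> QJ (k + 2)"
  proof (rule Q.product_component_sum)
    fix i assume i: "i \<in> {..<n}"
    then have w: "0 < w i" "w i < k" "f i \<in> QM (w i)" "g i \<in> QM (k - w i)" using * by auto
    have "D (f i) * g i \<in> QJ (k + 2)"
      using w QM_D[OF w(3)] by (intro product_mem_QJ[of "w i + 2"]) auto
    moreover have "f i * D (g i) \<in> QJ (k + 2)"
      using w QM_D[OF w(4)] by (intro product_mem_QJ[of "w i"]) (auto simp: Suc_diff_le less_imp_le)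
    ultimately show "D (f i) * g i + f i * D (g i) \<in> QJ (k + 2)" by (rule Q.product_component_add)
  qed
  finally show ?thesis .
qed

lemma QJ_Dn: "h \<in> QJ k \<Longrightarrow> (D ^^ n) h \<in> QJ (k + 2 * n)"
  by (induction n) (auto dest: QJ_D)

lemma QM_Dn: "h \<in> QM k \<Longrightarrow> (D ^^ n) h \<in> QM (k + 2 * n)"
  by (induction n) (auto dest: QM_D)

lemma qexp_coeff_QM:
  assumes q: "qexp (int k) f p P" and i: "2 * i \<le> k"
  shows "(\<lambda>z. poly.coeff (P z) i) \<in> QM (k - 2 * i)"
proof -
  have "int (k - 2 * i) = int k - 2 * int i" using i by simp
  then show ?thesis unfolding quasimodular_forms_eq using qexp_coeff[OF q, of i] by (simp only:) blast
qed

text \<open>The coefficients of a product are sums of products of coefficients; coefficients of weight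
  zero or less do not occur, so decomposable forms have decomposable coefficients.\<close>

lemma QJ_coeff:
  assumes h: "h \<in> QJ k" and q: "qexp (int k) h p P" and N: "2 * N < k"
  shows "(\<lambda>z. poly.coeff (P z) N) \<in> QJ (k - 2 * N)"
proof -
  obtain n w f g where *: "\<And>i. i < n \<Longrightarrow> 0 < w i \<and> w i < k \<and> f i \<in> QM (w i) \<and> g i \<in> QM (k - w i)"
    and h: "h = (\<Sum>i<(n::nat). f i * g i)"
    using h unfolding product_component_def by blast
  have "\<exists>p P. qexp (int (w i)) (f i) p P" if "i < n" for i
    using *[OF that] unfolding quasimodular_forms_eq by blast
  then obtain pf F where F: "\<And>i. i < n \<Longrightarrow> qexp (int (w i)) (f i) (pf i) (F i)" by metis
  have "\<exists>p P. qexp (int (k - w i)) (g i) p P" if "i < n" for i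
    using *[OF that] unfolding quasimodular_forms_eq by blast
  then obtain pg H where H: "\<And>i. i < n \<Longrightarrow> qexp (int (k - w i)) (g i) (pg i) (H i)" by metis
  define r where "r = Max ((\<lambda>i. pf i + pg i) ` {..<n} \<union> {0})"
  have "qexp (int k) (\<lambda>z. f i z * g i z) r (\<lambda>z. F i z * H i z)" if i: "i < n" for i
  proof -
    have "int (w i) + int (k - w i) = int k" using *[OF i] by simp
    then have q1: "qexp (int k) (\<lambda>z. f i z * g i z) (pf i + pg i) (\<lambda>z. F i z * H i z)"
      using qexp_mult[OF F[OF i] H[OF i]] by simp
    have "pf i + pg i \<le> r" unfolding r_def using i by (intro Max_ge) auto
    then show ?thesis using qexpD(3)[OF q1] order_trans by (intro qexp_degree[OF q1]) blast
  qed
  then have "qexp (int k) (\<lambda>z. \<Sum>i<n. f i z * g i z) r (\<lambda>z. \<Sum>i<n. F i z * H i z)"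
    by (intro qexp_sum) auto
  moreover have "(\<lambda>z. \<Sum>i<n. f i z * g i z) = h" by (simp add: h sum_fun_apply fun_eq_iff)
  ultimately have "P = (\<lambda>z. \<Sum>i<n. F i z * H i z)" using qexp_unique[OF q] by simp
  then have "(\<lambda>z. poly.coeff (P z) N) =
      (\<Sum>i<n. \<Sum>a\<le>N. (\<lambda>z. poly.coeff (F i z) a) * (\<lambda>z. poly.coeff (H i z) (N - a)))"
    by (simp add: fun_eq_iff sum_fun_apply coeff_sum coeff_mult)
  also have "\<dots> \<in> QJ (k - 2 * N)"
  proof (intro Q.product_component_sum)
    fix i a assume "i \<in> {..<n}" "a \<in> {..N}"
    then have i: "i < n" and a: "a \<le> N" by auto
    have w: "0 < w i" "w i < k" using *[OF i] by auto
    show "(\<lambda>z. poly.coeff (F i z) a) * (\<lambda>z. poly.coeff (H i z) (N - a)) \<in> QJ (k - 2 * N)"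
    proof (cases "2 * a < w i \<and> 2 * (N - a) < k - w i")
      case True
      have "(\<lambda>z. poly.coeff (F i z) a) \<in> QM (w i - 2 * a)"
        using True by (intro qexp_coeff_QM[OF F[OF i]]) simp
      moreover have "(\<lambda>z. poly.coeff (H i z) (N - a)) \<in> QM (k - w i - 2 * (N - a))"
        using True by (intro qexp_coeff_QM[OF H[OF i]]) simp
      moreover have "k - w i - 2 * (N - a) = (k - 2 * N) - (w i - 2 * a)" using True a w by auto
      ultimately show ?thesis using True a w by (intro product_mem_QJ[of "w i - 2 * a"]) auto
    next
      case False
      have "(\<lambda>z. poly.coeff (F i z) a) * (\<lambda>z. poly.coeff (H i z) (N - a)) = 0"
      proof (cases "2 * a < w i")
        case True
        then have "k - w i \<le> 2 * (N - a)" using False by simp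
        then have "int (k - w i) \<le> 2 * int (N - a)" by linarith
        moreover have "0 < N - a" using \<open>k - w i \<le> 2 * (N - a)\<close> w by linarith
        ultimately have "poly.coeff (H i z) (N - a) = 0" for z by (intro qexp_depth[OF H[OF i]])
        then show ?thesis by (simp add: fun_eq_iff)
      next
        case False
        then have "0 < a" "int (w i) \<le> 2 * int a" using w by linarith+
        then have "poly.coeff (F i z) a = 0" for z by (intro qexp_depth[OF F[OF i]])
        then show ?thesis by (simp add: fun_eq_iff)
      qed
      then show ?thesis using Q.product_component_zero by simp
    qed
  qed
  finally show ?thesis .
qed

text \<open>The summand of index \<open>n\<close> has depth at most \<open>n\<close>, so the last
  coefficient of the sum is a nonzero multiple of the last \<open>g\<close>. By
  \<open>QJ_coeff\<close> this \<open>g\<close> is decomposable, hence so is its derivative, which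
  is subtracted before the induction continues.\<close>

lemma QJ_components:
  assumes "\<And>n. g n \<in> aut (int k - 2 * int n)" "\<And>n. n \<le> N \<Longrightarrow> k \<le> 2 * n \<Longrightarrow> g n = (\<lambda>z. 0)"
    and "(\<lambda>z. \<Sum>n\<le>N. (D ^^ n) (g n) z) \<in> QJ k" and "n \<le> N" "2 * n < k"
  shows "g n \<in> QJ (k - 2 * n)"
  using assms(2-5)
proof (induction N)
  case 0
  then show ?case by simp
next
  case (Suc N)
  let ?s = "\<lambda>z. \<Sum>n\<le>N. (D ^^ n) (g n) z"
  have top: "2 * Suc N < k \<Longrightarrow> g (Suc N) \<in> QJ (k - 2 * Suc N)"
  proof -
    assume l: "2 * Suc N < k"
    define m where "m = int k - 2 * int (Suc N)"
    have m: "m > 0" using l by (simp add: m_def)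
    have ex: "\<exists>P. qexp (int k) ((D ^^ n) (g n)) n P \<and> (\<forall>z. poly.coeff (P z) n = (\<Prod>i<n. of_int (int k - 2 * int n) + of_nat i) * g n z)" for n
      using aut_Dn_qexp[OF assms(1), of n n] by simp
    then obtain P where P: "\<And>n. qexp (int k) ((D ^^ n) (g n)) n (P n)"
      "\<And>n z. poly.coeff (P n z) n = (\<Prod>i<n. of_int (int k - 2 * int n) + of_nat i) * g n z" by metis
    have "qexp (int k) (\<lambda>z. \<Sum>n\<le>Suc N. (D ^^ n) (g n) z) (Suc N) (\<lambda>z. \<Sum>n\<le>Suc N. P n z)"
      using qexpD(3)[OF P(1)] by (intro qexp_sum qexp_degree[OF P(1)]) (auto intro: order_trans)
    from QJ_coeff[OF Suc.prems(2) this l]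
    have "(\<lambda>z. poly.coeff (\<Sum>n\<le>Suc N. P n z) (Suc N)) \<in> QJ (k - 2 * Suc N)" .
    moreover have "poly.coeff (\<Sum>n\<le>Suc N. P n z) (Suc N) = (\<Prod>i<Suc N. of_int m + of_nat i) * g (Suc N) z" for z
    proof -
      have "poly.coeff (\<Sum>n\<le>Suc N. P n z) (Suc N) = (\<Sum>n\<le>N. poly.coeff (P n z) (Suc N)) + poly.coeff (P (Suc N) z) (Suc N)"
        by (simp add: coeff_sum)
      also have "(\<Sum>n\<le>N. poly.coeff (P n z) (Suc N)) = 0"
        using qexp_coeff_gt[OF P(1)] by (intro sum.neutral) auto
      finally show ?thesis unfolding P(2) m_def by simp
    qed
    ultimately have "(\<lambda>z. (\<Prod>i<Suc N. of_int m + of_nat i) * g (Suc N) z) \<in> QJ (k - 2 * Suc N)" by (simp only:)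
    from QJ_scale[OF this, of "inverse (\<Prod>i<Suc N. of_int m + of_nat i)"]
    show ?thesis using rising_factorial_nonzero[OF m, of "Suc N"] by (simp add: mult.assoc[symmetric] del: prod.lessThan_Suc)
  qed
  have DJ: "(D ^^ Suc N) (g (Suc N)) \<in> QJ k"
  proof (cases "2 * Suc N < k")
    case True
    then have "k - 2 * Suc N + 2 * Suc N = k" by linarith
    then show ?thesis using QJ_Dn[OF top[OF True], of "Suc N"] by (simp only:)
  next
    case False
    then have "g (Suc N) = (\<lambda>z. 0)" using Suc.prems(1) by simp
    then have "(D ^^ Suc N) (g (Suc N)) = 0" by (simp only: D_power_zero) (simp add: zero_fun_def)
    then show ?thesis using Q.product_component_zero by simp
  qed
  have "(\<lambda>z. \<Sum>n\<le>Suc N. (D ^^ n) (g n) z) - (D ^^ Suc N) (g (Suc N)) \<in> QJ k"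
    by (rule cf.subspace_diff[OF subspace_QJ Suc.prems(2) DJ])
  then have "?s \<in> QJ k" by (simp add: fun_diff_def del: funpow.simps)
  then show ?case using Suc.IH Suc.prems top by (metis le_Suc_eq)
qed

end

section \<open>Dimensions modulo an ideal of a graded ring\<close>

text \<open>Scalars act by multiplication with a weight zero constant, matching the subfield
  \<open>constants\<close> over which dimensions are taken.\<close>

definition cmul :: "complex \<Rightarrow> graded_form \<Rightarrow> graded_form" where
  "cmul c F = [:\<lambda>z. c * indicator UHP z:] * F"

lemma constant_mult: "[:\<lambda>z. (a::complex) * indicator UHP z:] * [:\<lambda>z. b * indicator UHP z:] = [:\<lambda>z. a * b * indicator UHP z:]"
proof -
  have "(\<lambda>z. a * indicator UHP z) * (\<lambda>z. b * indicator UHP z) = (\<lambda>z. a * b * indicator UHP z)"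
    by (rule ext) (simp add: indicator_def)
  then show ?thesis by (simp add: mult.commute)
qed

lemma constantI: "[:\<lambda>z. c * indicator UHP z:] \<in> constants"
  unfolding constants_def by (rule rangeI)

lemma coeff_cmul: "poly.coeff (cmul c F) j = (\<lambda>z. c * indicator UHP z * poly.coeff F j z)"
  by (simp add: cmul_def times_fun_def)

context graded_spaces
begin

lemma constants_carrier: "constants \<subseteq> carrier (graded_ring S)"
  using const zero by (auto simp: constants_def graded_ring_def coeff_pCons split: nat.split)

lemma cmul_carrier: "F \<in> carrier (graded_ring S) \<Longrightarrow> cmul c F \<in> carrier (graded_ring S)"
proof -
  interpret R: cring "graded_ring S" by (rule cring_graded_ring)
  assume F: "F \<in> carrier (graded_ring S)"
  have "[:\<lambda>z. c * indicator UHP z:] \<in> carrier (graded_ring S)" using constants_carrier by (auto simp: constants_def)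
  from R.m_closed[OF this F] show ?thesis by (simp add: graded_ring_def cmul_def)
qed

lemma sum_carrier: "(\<And>x. x \<in> X \<Longrightarrow> f x \<in> carrier (graded_ring S)) \<Longrightarrow> sum f X \<in> carrier (graded_ring S)"
  by (auto simp: graded_ring_def coeff_sum intro: sum)

lemma a_inv_graded_ring:
  assumes "F \<in> carrier (graded_ring S)"
  shows "\<ominus>\<^bsub>graded_ring S\<^esub> F = - F"
proof -
  interpret R: cring "graded_ring S" by (rule cring_graded_ring)
  show ?thesis by (rule R.minus_equality) (use assms in \<open>auto simp: graded_ring_def neg\<close>)
qed

lemma minus_graded_ring:
  assumes "F \<in> carrier (graded_ring S)" "H \<in> carrier (graded_ring S)"
  shows "F \<ominus>\<^bsub>graded_ring S\<^esub> H = F - H"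
  using a_inv_graded_ring[OF assms(2)] by (simp add: a_minus_def graded_ring_def)

lemma subfield_constants: "subfield constants (graded_ring S)"
proof -
  interpret R: cring "graded_ring S" by (rule cring_graded_ring)
  have eq0: "[:\<lambda>z. c * indicator UHP z:] = (0 :: graded_form) \<longleftrightarrow> c = 0" for c
  proof
    assume "[:\<lambda>z. c * indicator UHP z:] = (0 :: graded_form)"
    then have "(\<lambda>z. c * indicator UHP z) = 0" by simp
    then have "c * indicator UHP \<i> = 0" by (metis zero_fun_apply)
    moreover have "indicator UHP \<i> = (1 :: complex)" using i_in_UHP by (rule indicator_simps(1))
    ultimately show "c = 0" by (metis mult.right_neutral)
  qed (simp add: zero_fun_def[symmetric])
  have one: "[:indicator UHP:] = ([:\<lambda>z. 1 * indicator UHP z:] :: graded_form)" by simp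
  have sub: "subring constants (graded_ring S)"
  proof (rule R.subringI)
    show "constants \<subseteq> carrier (graded_ring S)" by (rule constants_carrier)
    have "[:indicator UHP:] \<in> constants" unfolding one constants_def by (rule rangeI)
    then show "\<one>\<^bsub>graded_ring S\<^esub> \<in> constants" by (simp add: graded_ring_def)
    fix h assume "h \<in> constants"
    then obtain a where a: "h = [:\<lambda>z. a * indicator UHP z:]" by (auto simp: constants_def)
    have "\<ominus>\<^bsub>graded_ring S\<^esub> h = - h"
      using constants_carrier \<open>h \<in> constants\<close> by (intro a_inv_graded_ring) blast
    also have "- h = [:\<lambda>z. (- a) * indicator UHP z:]" by (simp add: a fun_eq_iff)
    finally show "\<ominus>\<^bsub>graded_ring S\<^esub> h \<in> constants" by (simp only: constantI)
    fix h' assume "h' \<in> constants"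
    then obtain b where b: "h' = [:\<lambda>z. b * indicator UHP z:]" by (auto simp: constants_def)
    have "h * h' = [:\<lambda>z. (a * b) * indicator UHP z:]" unfolding a b by (rule constant_mult)
    then have "h * h' \<in> constants" by (simp only: constantI)
    then show "h \<otimes>\<^bsub>graded_ring S\<^esub> h' \<in> constants" by (simp add: graded_ring_def)
    have "h + h' = [:\<lambda>z. (a + b) * indicator UHP z:]" by (simp add: a b fun_eq_iff distrib_right)
    then have "h + h' \<in> constants" by (simp only: constantI)
    then show "h \<oplus>\<^bsub>graded_ring S\<^esub> h' \<in> constants" by (simp add: graded_ring_def)
  qed
  show ?thesis
  proof (rule R.subfieldI)
    show "subcring constants (graded_ring S)" by (rule R.subcringI'[OF sub])
    show "Units (graded_ring S\<lparr>carrier := constants\<rparr>) = constants - {\<zero>\<^bsub>graded_ring S\<^esub>}"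
    proof (intro equalityI subsetI)
      fix h assume "h \<in> Units (graded_ring S\<lparr>carrier := constants\<rparr>)"
      then obtain h' where h: "h \<in> constants" "h * h' = [:indicator UHP:]" by (auto simp: Units_def graded_ring_def)
      have "h \<noteq> 0"
      proof
        assume "h = 0"
        then have "[:indicator UHP:] = (0 :: graded_form)" using h(2) by (simp only: mult_zero_left)
        then show False unfolding one eq0 by simp
      qed
      then show "h \<in> constants - {\<zero>\<^bsub>graded_ring S\<^esub>}" using h(1) by (simp add: graded_ring_def)
    next
      fix h assume h: "h \<in> constants - {\<zero>\<^bsub>graded_ring S\<^esub>}"
      then obtain a where a: "h = [:\<lambda>z. a * indicator UHP z:]" by (auto simp: constants_def)
      have "a \<noteq> 0" using h eq0[of a] by (simp add: a graded_ring_def)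
      then have "h * [:\<lambda>z. inverse a * indicator UHP z:] = [:indicator UHP:]"
        unfolding a constant_mult by simp
      moreover have "[:\<lambda>z. inverse a * indicator UHP z:] \<in> constants" by (rule constantI)
      ultimately show "h \<in> Units (graded_ring S\<lparr>carrier := constants\<rparr>)"
        using h by (auto simp: Units_def graded_ring_def mult.commute intro!: bexI[of _ "[:\<lambda>z. inverse a * indicator UHP z:]"])
    qed
  qed
qed

lemma subfield_constants_mod:
  assumes J: "ideal J (graded_ring S)" and "[:indicator UHP:] \<notin> J"
  shows "subfield (image_mod (graded_ring S) J constants) (graded_ring S Quot J)"
proof -
  interpret R: cring "graded_ring S" by (rule cring_graded_ring)
  interpret J: ideal J "graded_ring S" by (rule J)
  interpret h: ring_hom_ring "graded_ring S" "graded_ring S Quot J" "(+>\<^bsub>graded_ring S\<^esub>) J"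
    by (rule J.rcos_ring_hom_ring)
  have "\<one>\<^bsub>graded_ring S Quot J\<^esub> \<noteq> \<zero>\<^bsub>graded_ring S Quot J\<^esub>"
  proof
    assume "\<one>\<^bsub>graded_ring S Quot J\<^esub> = \<zero>\<^bsub>graded_ring S Quot J\<^esub>"
    then have "J +>\<^bsub>graded_ring S\<^esub> \<one>\<^bsub>graded_ring S\<^esub> = J"
      unfolding FactRing_def by (simp only: ring_record_simps monoid.simps)
    then have "\<one>\<^bsub>graded_ring S\<^esub> \<in> J"
      using J.a_rcos_self[OF R.one_closed] by (simp only:)
    then show False using assms(2) by (simp add: graded_ring_def)
  qed
  from h.img_is_subfield(2)[OF subfield_constants this] show ?thesis by (simp add: image_mod_def)
qed

text \<open>Translates a basis given by explicit finite sums into the inductive notion of dimension.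
  The elements of \<open>X\<close> are added one at a time as line extensions, and
  \<open>indep\<close> shows that each new one lies outside the image \<open>Esp\<close> of the span
  of the previous ones.\<close>

lemma has_dim_mod_basis:
  fixes u :: "'x \<Rightarrow> graded_form"
  assumes J: "ideal J (graded_ring S)" and X: "finite X" and E: "E \<subseteq> carrier (graded_ring S)"
    and lin: "\<And>c. (\<Sum>x\<in>X. cmul (c x) (u x)) \<in> E"
    and span: "\<And>F. F \<in> E \<Longrightarrow> \<exists>c. F - (\<Sum>x\<in>X. cmul (c x) (u x)) \<in> J"
    and indep: "\<And>c x. (\<Sum>x\<in>X. cmul (c x) (u x)) \<in> J \<Longrightarrow> x \<in> X \<Longrightarrow> c x = 0"
    and u: "\<And>x. x \<in> X \<Longrightarrow> u x \<in> carrier (graded_ring S)"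
  shows "has_dim_mod (graded_ring S) constants J E (card X)"
proof -
  let ?R = "graded_ring S"
  interpret R: cring ?R by (rule cring_graded_ring)
  interpret J: ideal J ?R by (rule J)
  interpret Q: ring "?R Quot J" by (rule J.quotient_is_ring)
  define \<pi> where "\<pi> = (\<lambda>x. J +>\<^bsub>?R\<^esub> x)"
  have \<pi>hom: "\<pi> \<in> ring_hom ?R (?R Quot J)" unfolding \<pi>_def using J.rcos_ring_hom by simp
  have \<pi>add: "\<pi> (F + H) = \<pi> F \<oplus>\<^bsub>?R Quot J\<^esub> \<pi> H" if "F \<in> carrier ?R" "H \<in> carrier ?R" for F H
    using ring_hom_add[OF \<pi>hom that] by (simp add: graded_ring_def)
  have \<pi>mult: "\<pi> (F * H) = \<pi> F \<otimes>\<^bsub>?R Quot J\<^esub> \<pi> H" if "F \<in> carrier ?R" "H \<in> carrier ?R" for F H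
    using ring_hom_mult[OF \<pi>hom that] by (simp add: graded_ring_def)
  have \<pi>c: "\<pi> F \<in> carrier (?R Quot J)" if "F \<in> carrier ?R" for F
    using ring_hom_closed[OF \<pi>hom that] .
  have \<pi>eq: "\<pi> F = \<pi> H \<longleftrightarrow> F - H \<in> J" if "F \<in> carrier ?R" "H \<in> carrier ?R" for F H
    using R.quotient_eq_iff_same_a_r_cos[OF J that] minus_graded_ring[OF that] by (simp add: \<pi>_def)
  define \<kappa> where "\<kappa> = (\<lambda>c. [:\<lambda>z. c * indicator UHP z:] :: graded_form)"
  have \<kappa>: "\<kappa> c \<in> carrier ?R" for c using constants_carrier by (auto simp: \<kappa>_def constants_def)
  define L where "L = (\<lambda>c Y. \<Sum>x\<in>Y. cmul (c x) (u x))"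
  have Lc: "L c Y \<in> carrier ?R" if "Y \<subseteq> X" for c Y
    unfolding L_def using that u by (intro sum_carrier cmul_carrier) auto
  have cm1: "cmul 1 F = F" if "F \<in> carrier ?R" for F
    using one_mult[of F] that by (simp add: cmul_def graded_ring_def)
  define Esp where "Esp = (\<lambda>Y. \<pi> ` range (\<lambda>c. L c Y))"
  have main: "distinct ys \<Longrightarrow> set ys \<subseteq> X \<Longrightarrow> ring.dimension (?R Quot J) (length ys) (image_mod ?R J constants) (Esp (set ys))" for ys
  proof (induction ys)
    case Nil
    have "Esp (set []) = {\<zero>\<^bsub>?R Quot J\<^esub>}"
      using ring_hom_zero[OF \<pi>hom R.ring_axioms Q.ring_axioms] by (auto simp: Esp_def L_def graded_ring_def)
    then show ?case using Q.zero_dim by simp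
  next
    case (Cons y ys)
    have y: "y \<in> X" "y \<notin> set ys" "set ys \<subseteq> X" using Cons.prems by auto
    have uy: "u y \<in> carrier ?R" by (rule u[OF y(1)])
    have notin: "\<pi> (u y) \<notin> Esp (set ys)"
    proof
      assume "\<pi> (u y) \<in> Esp (set ys)"
      then obtain c where "\<pi> (u y) = \<pi> (L c (set ys))" by (auto simp: Esp_def)
      then have inJ: "u y - L c (set ys) \<in> J" using \<pi>eq[OF uy Lc[OF y(3)]] by simp
      \<comment> \<open>The relation that expresses \<open>u y\<close> by its predecessors, moved to
        one side, with coefficient 1 at \<open>y\<close>.\<close>
      define c' where "c' = (\<lambda>x. if x = y then 1 else if x \<in> set ys then - c x else 0)"
      have c0: "cmul 0 F = 0" for F by (simp add: cmul_def zero_fun_def[symmetric])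
      have cneg: "cmul (- a) F = - cmul a F" for a F
      proof -
        have "(\<lambda>z. - a * indicator UHP z) = - (\<lambda>z. a * indicator UHP z :: complex)" by auto
        then show ?thesis by (simp only: cmul_def) simp
      qed
      have "(\<Sum>x\<in>X. cmul (c' x) (u x)) = (\<Sum>x\<in>insert y (set ys). cmul (c' x) (u x))"
        using X y by (intro sum.mono_neutral_right) (auto simp: c'_def c0)
      also have "\<dots> = cmul 1 (u y) + (\<Sum>x\<in>set ys. cmul (- c x) (u x))"
      proof -
        have "(\<Sum>x\<in>set ys. cmul (c' x) (u x)) = (\<Sum>x\<in>set ys. cmul (- c x) (u x))"
          using y(2) by (intro sum.cong) (auto simp: c'_def)
        then show ?thesis using y(2) by (simp add: c'_def)
      qed
      also have "\<dots> = u y - L c (set ys)" by (simp add: cm1[OF uy] cneg L_def sum_negf)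
      finally have "(\<Sum>x\<in>X. cmul (c' x) (u x)) \<in> J" using inJ by simp
      from indep[OF this y(1)] show False by (simp add: c'_def)
    qed
    have "Q.line_extension (image_mod ?R J constants) (\<pi> (u y)) (Esp (set ys)) = Esp (set (y # ys))"
    proof (intro equalityI subsetI)
      fix v assume "v \<in> Q.line_extension (image_mod ?R J constants) (\<pi> (u y)) (Esp (set ys))"
      then obtain a c where v: "v = \<pi> (\<kappa> a) \<otimes>\<^bsub>?R Quot J\<^esub> \<pi> (u y) \<oplus>\<^bsub>?R Quot J\<^esub> \<pi> (L c (set ys))"
        unfolding Q.line_extension_mem_iff image_mod_def Esp_def \<pi>_def \<kappa>_def constants_def by blast
      have "v = \<pi> (cmul a (u y) + L c (set ys))"
        unfolding v \<pi>mult[OF \<kappa> uy, symmetric] cmul_def \<kappa>_def[symmetric]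
        using \<pi>add[OF _ Lc[OF y(3)]] cmul_carrier[OF uy, of a] by (simp add: cmul_def \<kappa>_def)
      also have "cmul a (u y) + L c (set ys) = L (c(y := a)) (set (y # ys))"
      proof -
        have "(\<Sum>x\<in>set ys. cmul ((c(y := a)) x) (u x)) = (\<Sum>x\<in>set ys. cmul (c x) (u x))"
          using y(2) by (intro sum.cong) auto
        then show ?thesis using y(2) by (simp add: L_def)
      qed
      finally show "v \<in> Esp (set (y # ys))" by (auto simp: Esp_def)
    next
      fix v assume "v \<in> Esp (set (y # ys))"
      then obtain c where v: "v = \<pi> (L c (set (y # ys)))" by (auto simp: Esp_def)
      have "L c (set (y # ys)) = \<kappa> (c y) * u y + L c (set ys)"
        using y(2) by (simp add: L_def cmul_def \<kappa>_def)
      then have "v = \<pi> (\<kappa> (c y)) \<otimes>\<^bsub>?R Quot J\<^esub> \<pi> (u y) \<oplus>\<^bsub>?R Quot J\<^esub> \<pi> (L c (set ys))"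
        unfolding v using \<pi>add[OF _ Lc[OF y(3)]] cmul_carrier[OF uy, of "c y"] \<pi>mult[OF \<kappa> uy]
        by (simp add: cmul_def \<kappa>_def)
      moreover have "\<pi> (\<kappa> (c y)) \<in> image_mod ?R J constants"
        by (auto simp: image_mod_def \<pi>_def \<kappa>_def constants_def)
      moreover have "\<pi> (L c (set ys)) \<in> Esp (set ys)" by (auto simp: Esp_def)
      ultimately show "v \<in> Q.line_extension (image_mod ?R J constants) (\<pi> (u y)) (Esp (set ys))"
        unfolding Q.line_extension_mem_iff by blast
    qed
    moreover have "Q.dimension (Suc (length ys)) (image_mod ?R J constants)
        (Q.line_extension (image_mod ?R J constants) (\<pi> (u y)) (Esp (set ys)))"
      using Cons by (intro Q.Suc_dim \<pi>c uy notin) auto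
    ultimately show ?case by simp
  qed
  obtain xs where xs: "distinct xs" "set xs = X" using finite_distinct_list[OF X] by blast
  have "image_mod ?R J E = Esp X"
  proof (intro equalityI subsetI)
    fix v assume "v \<in> image_mod ?R J E"
    then obtain F where F: "F \<in> E" "v = \<pi> F" by (auto simp: image_mod_def \<pi>_def)
    then obtain c where "F - L c X \<in> J" using span unfolding L_def by blast
    then have "\<pi> F = \<pi> (L c X)" using \<pi>eq[of F "L c X"] F E Lc by auto
    then show "v \<in> Esp X" using F by (auto simp: Esp_def)
  next
    fix v assume "v \<in> Esp X"
    then show "v \<in> image_mod ?R J E" using lin by (auto simp: Esp_def image_mod_def \<pi>_def L_def)
  qed
  moreover have "length xs = card X" using xs distinct_card by metis
  ultimately show ?thesis unfolding has_dim_mod_def using main[OF xs(1)] xs(2) by simp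
qed

lemma independent_mod_length_le:
  assumes J: "ideal J (graded_ring S)" "[:indicator UHP:] \<notin> J"
    and dim: "has_dim_mod (graded_ring S) constants J E n"
    and ind: "independent_mod (graded_ring S) constants J Us" and sub: "set Us \<subseteq> E"
  shows "length Us \<le> n"
proof -
  interpret J: ideal J "graded_ring S" by (rule J(1))
  interpret Q: ring "graded_ring S Quot J" by (rule J.quotient_is_ring)
  have "length (map (\<lambda>x. J +>\<^bsub>graded_ring S\<^esub> x) Us) \<le> n"
    using sub by (intro Q.independent_length_le_dimension[OF subfield_constants_mod[OF J]
        dim[unfolded has_dim_mod_def] ind[unfolded independent_mod_def]]) (auto simp: image_mod_def)
  then show ?thesis by simp
qed

end

lemma coeff_sum_cmul_monom:
  assumes "finite Y" "\<And>w b z. (w, b) \<in> Y \<Longrightarrow> z \<notin> UHP \<Longrightarrow> b z = 0"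
  shows "poly.coeff (\<Sum>x\<in>Y. cmul (c x) (Polynomial.monom (snd x) (fst x))) j =
    (\<lambda>z. \<Sum>b\<in>{b. (j, b) \<in> Y}. c (j, b) * b z)"
proof
  fix z
  have "poly.coeff (\<Sum>x\<in>Y. cmul (c x) (Polynomial.monom (snd x) (fst x))) j z =
      (\<Sum>x\<in>Y. c x * indicator UHP z * poly.coeff (Polynomial.monom (snd x) (fst x)) j z)"
    by (simp only: coeff_sum sum_fun_apply coeff_cmul)
  also have "\<dots> = (\<Sum>x\<in>{x\<in>Y. fst x = j}. c x * snd x z)"
  proof (rule sum.mono_neutral_cong_right[OF assms(1)])
    show "c x * indicator UHP z * poly.coeff (Polynomial.monom (snd x) (fst x)) j z = c x * snd x z"
      if "x \<in> {x\<in>Y. fst x = j}" for x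
      using that assms(2)[of "fst x" "snd x" z] by (cases "z \<in> UHP") auto
  qed auto
  also have "\<dots> = (\<Sum>b\<in>{b. (j, b) \<in> Y}. c (j, b) * b z)"
    by (rule sum.reindex_bij_witness[where i = "\<lambda>b. (j, b)" and j = snd]) auto
  finally show "poly.coeff (\<Sum>x\<in>Y. cmul (c x) (Polynomial.monom (snd x) (fst x))) j z = \<dots>" .
qed

text \<open>Among the subsets of \<open>S\<close> that span modulo \<open>J\<close> take one of
  minimal size. A relation with \<open>c b0\<close> nonzero would allow \<open>b0\<close> to be
  removed.\<close>

lemma basis_mod_subspace:
  assumes J: "cf.subspace J" and S: "finite S" "\<And>h. h \<in> V \<Longrightarrow> \<exists>s\<in>cf.span S. h - s \<in> J"
  shows "\<exists>B\<subseteq>S. (\<forall>h\<in>V. \<exists>s\<in>cf.span B. h - s \<in> J) \<and>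
    (\<forall>c. (\<lambda>z. \<Sum>b\<in>B. c b * b z) \<in> J \<longrightarrow> (\<forall>b\<in>B. c b = 0))"
proof -
  define P where "P = (\<lambda>B. B \<subseteq> S \<and> (\<forall>h\<in>V. \<exists>s\<in>cf.span B. h - s \<in> J))"
  have "P S" using S by (auto simp: P_def)
  then obtain B where B: "P B" "\<And>B'. P B' \<Longrightarrow> card B \<le> card B'"
    using arg_min_nat_lemma[of P S card] by metis
  have finB: "finite B" using B(1) S(1) by (auto simp: P_def intro: finite_subset)
  have "c b0 = 0" if c: "(\<lambda>z. \<Sum>b\<in>B. c b * b z) \<in> J" and b0: "b0 \<in> B" for c b0
  proof (rule ccontr)
    assume c0: "c b0 \<noteq> 0"
    define t where "t = (\<Sum>b\<in>B. cscale (c b) b)"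
    have "t = (\<lambda>z. \<Sum>b\<in>B. c b * b z)" by (simp add: t_def fun_eq_iff sum_fun_apply cscale_def)
    then have tJ: "t \<in> J" using c by simp
    have t2: "t = cscale (c b0) b0 + (\<Sum>b\<in>B - {b0}. cscale (c b) b)"
      unfolding t_def by (rule sum.remove[OF finB b0])
    have rest: "(\<Sum>b\<in>B - {b0}. cscale (c b) b) \<in> cf.span (B - {b0})"
      by (intro cf.span_sum cf.span_scale cf.span_base)
    have "P (B - {b0})"
      unfolding P_def
    proof (intro conjI ballI)
      show "B - {b0} \<subseteq> S" using B(1) by (auto simp: P_def)
      fix h assume "h \<in> V"
      then obtain s where s: "s \<in> cf.span B" "h - s \<in> J" using B(1) by (auto simp: P_def)
      obtain a where a: "s - cscale a b0 \<in> cf.span (B - {b0})" using cf.span_breakdown[OF b0 s(1)] by blast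
      define s' where "s' = (s - cscale a b0) - cscale (a / c b0) (\<Sum>b\<in>B - {b0}. cscale (c b) b)"
      have "s' \<in> cf.span (B - {b0})" unfolding s'_def by (intro cf.span_diff a cf.span_scale rest)
      moreover have "h - s' = (h - s) + cscale (a / c b0) t"
        unfolding s'_def t2 using c0 by (simp add: cscale_def fun_eq_iff algebra_simps)
      then have "h - s' \<in> J" using cf.subspace_add[OF J s(2) cf.subspace_scale[OF J tJ]] by (simp only:)
      ultimately show "\<exists>s\<in>cf.span (B - {b0}). h - s \<in> J" by blast
    qed
    then have "card B \<le> card (B - {b0})" by (rule B(2))
    then show False using finB b0 by (metis card_Diff1_less not_less)
  qed
  then show ?thesis using B(1) unfolding P_def by blast
qed

lemma cf_span_finiteE:
  assumes "finite B" "s \<in> cf.span B"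
  obtains c where "s = (\<lambda>z. \<Sum>b\<in>B. c b * b z)"
proof -
  obtain c where "s = (\<Sum>b\<in>B. cscale (c b) b)" using assms cf.span_finite[OF assms(1)] by auto
  then have "s = (\<lambda>z. \<Sum>b\<in>B. c b * b z)" by (simp add: fun_eq_iff sum_fun_apply cscale_def)
  then show ?thesis by (rule that)
qed

section \<open>Generators modulo decomposable forms\<close>

context cocompact_fuchsian
begin

lemma QJ_0: "QJ 0 = {0}"
proof
  show "QJ 0 \<subseteq> {0}"
  proof
    fix h assume "h \<in> QJ 0"
    then obtain n :: nat and w :: "nat \<Rightarrow> nat" and f g where "\<And>i. i < n \<Longrightarrow> w i < 0" and h: "h = (\<Sum>i<n. f i * g i)"
      unfolding product_component_def by blast
    then have "n = 0" by (cases n) auto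
    then show "h \<in> {0}" by (simp add: h)
  qed
  show "{0} \<subseteq> QJ 0" using Q.product_component_zero by blast
qed

lemma one_notin_sq: "[:indicator UHP:] \<notin> quasimodular_ideal_sq \<Gamma>"
proof
  assume "[:indicator UHP:] \<in> quasimodular_ideal_sq \<Gamma>"
  then have "poly.coeff [:indicator UHP:] 0 \<in> QJ 0" unfolding quasimodular_ideal_sq_def by blast
  then have "indicator UHP = (0 :: complex \<Rightarrow> complex)" by (simp add: QJ_0)
  then have "indicator UHP \<i> = (0 :: complex)" by (metis zero_fun_apply)
  then show False using i_in_UHP by simp
qed

text \<open>A finite spanning set in each weight contains a basis modulo decomposables. In large
  weight every modular form is decomposable, and an independent family of decomposable forms is
  empty.\<close>

lemma decomposable_basis:
  "\<exists>B W. (\<forall>w. finite (B w) \<and> B w \<subseteq> aut (int w) \<and> (\<forall>h\<in>aut (int w). \<exists>s\<in>cf.span (B w). h - s \<in> QJ w) \<and>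
     (\<forall>c. (\<lambda>z. \<Sum>b\<in>B w. c b * b z) \<in> QJ w \<longrightarrow> (\<forall>b\<in>B w. c b = 0))) \<and> (\<forall>w>W. B w = {})"
proof -
  have "\<exists>B. finite B \<and> B \<subseteq> aut (int w) \<and> (\<forall>h\<in>aut (int w). \<exists>s\<in>cf.span B. h - s \<in> QJ w) \<and>
     (\<forall>c. (\<lambda>z. \<Sum>b\<in>B. c b * b z) \<in> QJ w \<longrightarrow> (\<forall>b\<in>B. c b = 0))" for w
  proof -
    obtain S where S: "finite S" "S \<subseteq> aut (int w)" "aut (int w) \<subseteq> cf.span S" using aut_finite_span by blast
    have "\<exists>s\<in>cf.span S. h - s \<in> QJ w" if "h \<in> aut (int w)" for h
      using that S(3) Q.product_component_zero by (intro bexI[of _ h]) auto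
    then have "\<exists>B\<subseteq>S. (\<forall>h\<in>aut (int w). \<exists>s\<in>cf.span B. h - s \<in> QJ w) \<and>
        (\<forall>c. (\<lambda>z. \<Sum>b\<in>B. c b * b z) \<in> QJ w \<longrightarrow> (\<forall>b\<in>B. c b = 0))"
      by (intro basis_mod_subspace[OF subspace_QJ S(1)])
    then obtain B where B: "B \<subseteq> S" "\<forall>h\<in>aut (int w). \<exists>s\<in>cf.span B. h - s \<in> QJ w"
      "\<forall>c. (\<lambda>z. \<Sum>b\<in>B. c b * b z) \<in> QJ w \<longrightarrow> (\<forall>b\<in>B. c b = 0)"
      by (elim exE conjE)
    have "finite B" "B \<subseteq> aut (int w)" using B(1) S(1,2) finite_subset by blast+
    then show ?thesis using B(2,3) by (intro exI[of _ B] conjI)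
  qed
  then have "\<forall>w. \<exists>B. finite B \<and> B \<subseteq> aut (int w) \<and> (\<forall>h\<in>aut (int w). \<exists>s\<in>cf.span B. h - s \<in> QJ w) \<and>
     (\<forall>c. (\<lambda>z. \<Sum>b\<in>B. c b * b z) \<in> QJ w \<longrightarrow> (\<forall>b\<in>B. c b = 0))" by (rule allI)
  from choice[OF this] obtain B where B: "\<forall>w. finite (B w) \<and> B w \<subseteq> aut (int w) \<and>
     (\<forall>h\<in>aut (int w). \<exists>s\<in>cf.span (B w). h - s \<in> QJ w) \<and>
     (\<forall>c. (\<lambda>z. \<Sum>b\<in>B w. c b * b z) \<in> QJ w \<longrightarrow> (\<forall>b\<in>B w. c b = 0))" by (rule exE)
  have Bfin: "finite (B w)" and Bsub: "B w \<subseteq> aut (int w)" for w using B by blast+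
  have Bind: "c b = 0" if "(\<lambda>z. \<Sum>b\<in>B w. c b * b z) \<in> QJ w" "b \<in> B w" for w c b
    using B[rule_format, of w] that by (elim conjE allE impE) (assumption, blast)
  obtain W where W: "\<And>m h. m > W \<Longrightarrow> h \<in> aut (int m) \<Longrightarrow> \<exists>p q a g f b. 0 < p \<and> p < m \<and> 0 < q \<and> q < m \<and>
     a \<in> aut (int p) \<and> g \<in> aut (int (m - p)) \<and> f \<in> aut (int q) \<and> b \<in> aut (int (m - q)) \<and>
     h = (\<lambda>z. a z * g z + f z * b z)"
    using aut_large_weight_decomposable by blast
  have "B w = {}" if w: "w > W" for w
  proof (rule ccontr)
    assume "B w \<noteq> {}"
    then obtain b0 where b0: "b0 \<in> B w" by blast
    then have "b0 \<in> aut (int w)" using Bsub by blast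
    then obtain p q a g f b where d: "0 < p" "p < w" "0 < q" "q < w" "a \<in> aut (int p)" "g \<in> aut (int (w - p))"
      "f \<in> aut (int q)" "b \<in> aut (int (w - q))" "b0 = (\<lambda>z. a z * g z + f z * b z)" using W[OF w] by blast
    have m: "a \<in> QM p" "g \<in> QM (w - p)" "f \<in> QM q" "b \<in> QM (w - q)" using d(5-8) aut_subset_QM by blast+
    have "a * g \<in> QJ w" by (rule product_mem_QJ[of p]) (use d m in blast)+
    moreover have "f * b \<in> QJ w" by (rule product_mem_QJ[of q]) (use d m in blast)+
    ultimately have "a * g + f * b \<in> QJ w" by (rule Q.product_component_add)
    moreover have "a * g + f * b = (\<lambda>z. \<Sum>b\<in>B w. (if b = b0 then 1 else 0) * b z)"
    proof
      fix z
      have "(\<Sum>b\<in>B w. (if b = b0 then 1 else 0) * b z) = (\<Sum>b\<in>{b0}. b z)"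
        using Bfin[of w] b0 by (intro sum.mono_neutral_cong_right) auto
      then show "(a * g + f * b) z = (\<Sum>b\<in>B w. (if b = b0 then 1 else 0) * b z)" by (simp add: d(9))
    qed
    ultimately have "(\<lambda>z. \<Sum>b\<in>B w. (if b = b0 then 1 else 0) * b z) \<in> QJ w" by simp
    from Bind[OF this b0] show False by simp
  qed
  then show ?thesis using B by (intro exI[of _ B] exI[of _ W] conjI allI impI) blast+
qed

text \<open>For \<open>k > 0\<close> the index 0 is not among those with
  \<open>k \<le> 2 * n\<close>, so all of these drop out. Padding by zero makes the index set depend
  on the weight and no longer on the depth.\<close>

lemma QM_structure:
  assumes f: "f \<in> QM k" and k: "0 < k"
  shows "\<exists>g. (\<forall>n. g n \<in> aut (int k - 2 * int n)) \<and> (\<forall>n. k \<le> 2 * n \<longrightarrow> g n = (\<lambda>z. 0)) \<and>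
    f = (\<lambda>z. \<Sum>n\<in>{n. 2 * n < k}. (D ^^ n) (g n) z)"
proof -
  obtain p P where q: "qexp (int k) f p P" using f unfolding quasimodular_forms_eq by blast
  from qexp_structure[OF this] obtain g where g: "\<forall>n. g n \<in> aut (int k - 2 * int n)"
    "\<forall>n. 0 < n \<longrightarrow> int k \<le> 2 * int n \<longrightarrow> g n = (\<lambda>z. 0)" "f = (\<lambda>z. \<Sum>n\<le>p. (D ^^ n) (g n) z)" by blast
  define h where "h = (\<lambda>n. if n \<le> p then g n else (\<lambda>z. 0))"
  have "h n \<in> aut (int k - 2 * int n)" for n using g(1) aut_zero by (simp add: h_def)
  moreover have h0: "h n = (\<lambda>z. 0)" if "k \<le> 2 * n" for n
  proof -
    have "0 < n" "int k \<le> 2 * int n" using that k by linarith+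
    then show ?thesis using g(2) by (simp add: h_def)
  qed
  moreover have "f z = (\<Sum>n\<in>{n. 2 * n < k}. (D ^^ n) (h n) z)" for z
  proof -
    have fin: "finite {n. 2 * n < k}" by (rule finite_subset[of _ "{..k}"]) auto
    have "f z = (\<Sum>n\<le>p. (D ^^ n) (h n) z)" unfolding g(3) h_def by (intro sum.cong) auto
    also have "\<dots> = (\<Sum>n\<in>{..p} \<inter> {n. 2 * n < k}. (D ^^ n) (h n) z)"
      using h0 by (intro sum.mono_neutral_right) (auto simp: not_less)
    also have "\<dots> = (\<Sum>n\<in>{n. 2 * n < k}. (D ^^ n) (h n) z)"
      using fin by (intro sum.mono_neutral_left) (auto simp: h_def)
    finally show ?thesis .
  qed
  ultimately show ?thesis by (intro exI[of _ h]) auto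
qed

lemma QJ_components':
  assumes g: "\<And>n. g n \<in> aut (int k - 2 * int n)" "\<And>n. k \<le> 2 * n \<Longrightarrow> g n = (\<lambda>z. 0)"
    and s: "(\<lambda>z. \<Sum>n\<in>{n. 2 * n < k}. (D ^^ n) (g n) z) \<in> QJ k" and n: "2 * n < k"
  shows "g n \<in> QJ (k - 2 * n)"
proof (rule QJ_components[where N = k, OF g(1)])
  have "(\<Sum>n\<in>{n. 2 * n < k}. (D ^^ n) (g n) z) = (\<Sum>n\<le>k. (D ^^ n) (g n) z)" for z
    using g(2) by (intro sum.mono_neutral_left) (auto simp: not_less)
  then show "(\<lambda>z. \<Sum>n\<le>k. (D ^^ n) (g n) z) \<in> QJ k" using s by simp
qed (use g(2) n in auto)

lemma D_power_holomorphic: "f holomorphic_on UHP \<Longrightarrow> (D ^^ n) f holomorphic_on UHP"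
  by (induction n) (auto intro: D_holomorphic)

lemma D_power_lincomb:
  assumes "finite B" "\<And>b. b \<in> B \<Longrightarrow> b holomorphic_on UHP"
  shows "(D ^^ n) (\<lambda>z. \<Sum>b\<in>B. c b * b z) = (\<lambda>z. \<Sum>b\<in>B. c b * (D ^^ n) b z)"
proof (induction n)
  case (Suc n)
  have "(D ^^ Suc n) (\<lambda>z. \<Sum>b\<in>B. c b * b z) = D (\<lambda>z. \<Sum>b\<in>B. c b * (D ^^ n) b z)"
    using Suc by simp
  also have "\<dots> = (\<lambda>z. \<Sum>b\<in>B. D (\<lambda>z. c b * (D ^^ n) b z) z)"
    using assms D_power_holomorphic by (intro D_sum) (auto intro!: holomorphic_intros)
  also have "\<dots> = (\<lambda>z. \<Sum>b\<in>B. c b * (D ^^ Suc n) b z)"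
  proof
    fix z
    have "D (\<lambda>z. c b * (D ^^ n) b z) z = c b * (D ^^ Suc n) b z" if "b \<in> B" for b
    proof (cases "z \<in> UHP")
      case True
      have "((D ^^ n) b) field_differentiable at z"
        using D_power_holomorphic[OF assms(2)[OF that]] open_UHP True holomorphic_on_imp_differentiable_at by blast
      then show ?thesis using True by (simp add: D_def deriv_cmult)
    qed (simp add: D_def)
    then show "(\<Sum>b\<in>B. D (\<lambda>z. c b * (D ^^ n) b z) z) = (\<Sum>b\<in>B. c b * (D ^^ Suc n) b z)" by simp
  qed
  finally show ?case .
qed simp

text \<open>Take the lowest positive weight with a nonzero modular form. By the structure theorem
  there are no nonzero quasimodular forms of smaller positive weight, hence no products in that
  weight.\<close>

lemma exists_indecomposable:
  "\<exists>w f. 0 < w \<and> f \<in> aut (int w) \<and> f \<notin> QJ w"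
proof -
  define P where "P = (\<lambda>w. 0 < w \<and> (\<exists>f\<in>aut (int w). f \<noteq> (\<lambda>z. 0)))"
  have "\<exists>w. P w" using exists_forms_without_common_zero unfolding P_def by blast
  define w where "w = (LEAST w. P w)"
  have Pw: "P w" unfolding w_def using \<open>\<exists>w. P w\<close> by (rule LeastI_ex)
  have low: "f = (\<lambda>z. 0)" if "0 < a" "a < w" "f \<in> aut (int a)" for a f
    using not_less_Least[of a P] that unfolding w_def P_def by blast
  have lowQ: "f = 0" if a: "0 < a" "a < w" "f \<in> QM a" for a f
  proof -
    from QM_structure[OF a(3,1)]
    obtain g where g: "\<forall>n. g n \<in> aut (int a - 2 * int n)" "\<forall>n. a \<le> 2 * n \<longrightarrow> g n = (\<lambda>z. 0)"
      "f = (\<lambda>z. \<Sum>n\<in>{n. 2 * n < a}. (D ^^ n) (g n) z)" by (elim exE conjE)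
    have "g n = (\<lambda>z. 0)" for n
    proof (cases "2 * n < a")
      case True
      then have "int a - 2 * int n = int (a - 2 * n)" by simp
      then show ?thesis using g(1)[rule_format, of n] True a by (intro low[of "a - 2 * n"]) auto
    qed (use g(2) in simp)
    then show ?thesis by (simp add: g(3) zero_fun_def)
  qed
  obtain f where f: "0 < w" "f \<in> aut (int w)" "f \<noteq> (\<lambda>z. 0)" using Pw by (auto simp: P_def)
  have "f \<notin> QJ w"
  proof
    assume "f \<in> QJ w"
    then obtain n wt F H where *: "\<And>i. i < n \<Longrightarrow> 0 < wt i \<and> wt i < w \<and> F i \<in> QM (wt i) \<and> H i \<in> QM (w - wt i)"
      and fs: "f = (\<Sum>i<(n::nat). F i * H i)"
      unfolding product_component_def by blast
    have "F i = 0" if "i < n" for i using *[OF that] lowQ by blast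
    then have "f = 0" unfolding fs by simp
    then show False using f(3) by (simp add: zero_fun_def)
  qed
  then show ?thesis using f by blast
qed

text \<open>A single derivative is a decomposition with one nonzero component, and decomposability
  would pass to that component.\<close>

lemma Dn_notin_QJ:
  assumes "f \<in> aut (int w)" "f \<notin> QJ w" "0 < w"
  shows "(D ^^ n) f \<notin> QJ (w + 2 * n)"
proof
  assume J: "(D ^^ n) f \<in> QJ (w + 2 * n)"
  define g where "g = (\<lambda>i. if i = n then f else (\<lambda>z. 0))"
  have "g n \<in> QJ (w + 2 * n - 2 * n)"
  proof (rule QJ_components')
    show "g i \<in> aut (int (w + 2 * n) - 2 * int i)" for i using assms(1) aut_zero by (simp add: g_def)
    show "g i = (\<lambda>z. 0)" if "w + 2 * n \<le> 2 * i" for i using that assms(3) by (simp add: g_def)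
    have fin: "finite {i. 2 * i < w + 2 * n}" by (rule finite_subset[of _ "{..w + 2 * n}"]) auto
    have "(\<Sum>i\<in>{i. 2 * i < w + 2 * n}. (D ^^ i) (g i) z) = (\<Sum>i\<in>{n}. (D ^^ i) (g i) z)" for z
      using assms(3) by (intro sum.mono_neutral_right fin) (auto simp: g_def)
    then show "(\<lambda>z. \<Sum>i\<in>{i. 2 * i < w + 2 * n}. (D ^^ i) (g i) z) \<in> QJ (w + 2 * n)" using J by (simp add: g_def)
  qed (use assms(3) in simp)
  then show False using assms(2) by (simp add: g_def)
qed

text \<open>In weights above the largest degree \<open>d\<close> of the generators every generated
  element has decomposable coefficients: products of two positive weights are decomposable by
  definition, and a weight zero factor preserves decomposability. Derivatives of an indecomposable
  modular form remain indecomposable beyond \<open>d\<close>.\<close>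

lemma not_finitely_generated: "\<not> finitely_generated_algebra (quasimodular_ring \<Gamma>) constants"
proof
  assume "finitely_generated_algebra (quasimodular_ring \<Gamma>) constants"
  then obtain S where S: "finite S" "S \<subseteq> carrier (quasimodular_ring \<Gamma>)"
    "generate_ring (quasimodular_ring \<Gamma>) (constants \<union> S) = carrier (quasimodular_ring \<Gamma>)"
    unfolding finitely_generated_algebra_def by blast
  let ?R = "graded_ring QM"
  interpret R: cring ?R by (rule Q.cring_graded_ring)
  define d where "d = Max (insert 0 (degree ` S))"
  have dS: "degree s \<le> d" if "s \<in> S" for s unfolding d_def using S(1) that by (intro Max_ge) auto
  have J0: "0 \<in> QJ k" for k by (rule Q.product_component_zero)
  have gen: "F \<in> carrier ?R \<and> (\<forall>k>d. poly.coeff F k \<in> QJ k)" if "F \<in> generate_ring ?R (constants \<union> S)" for F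
    using that
  proof (induction rule: generate_ring.induct)
    case one
    show ?case using R.one_closed J0 by (auto simp: graded_ring_def coeff_pCons split: nat.split)
  next
    case (incl h)
    then show ?case
    proof
      assume h: "h \<in> constants"
      then have "poly.coeff h k = 0" if "k > d" for k using that by (auto simp: constants_def coeff_pCons split: nat.split)
      then have "poly.coeff h k \<in> QJ k" if "k > d" for k using that J0[of k] by (simp only:)
      then show ?thesis using h Q.constants_carrier by blast
    next
      assume h: "h \<in> S"
      then have "poly.coeff h k = 0" if "k > d" for k using dS[OF h] that by (intro coeff_eq_0) simp
      then have "poly.coeff h k \<in> QJ k" if "k > d" for k using that J0[of k] by (simp only:)
      then show ?thesis using h S(2) unfolding quasimodular_ring_def by blast
    qed
  next
    case (a_inv h)
    have "\<ominus>\<^bsub>?R\<^esub> h = - h" using a_inv by (intro Q.a_inv_graded_ring) blast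
    moreover have "- poly.coeff h k \<in> QJ k" if "k > d" for k
      using a_inv that cf.subspace_neg[OF subspace_QJ] by blast
    moreover have "\<ominus>\<^bsub>?R\<^esub> h \<in> carrier ?R" using a_inv R.a_inv_closed by blast
    ultimately show ?case by (simp only: coeff_minus) blast
  next
    case (eng_add h1 h2)
    have "poly.coeff h1 k + poly.coeff h2 k \<in> QJ k" if "k > d" for k
      using eng_add that by (intro Q.product_component_add) blast+
    moreover have "h1 \<oplus>\<^bsub>?R\<^esub> h2 \<in> carrier ?R" using eng_add R.a_closed by blast
    moreover have "h1 \<oplus>\<^bsub>?R\<^esub> h2 = h1 + h2" by (simp add: graded_ring_def)
    ultimately show ?case by (simp only: coeff_add) blast
  next
    case (eng_mult h1 h2)
    have "poly.coeff (h1 * h2) k \<in> QJ k" if k: "k > d" for k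
      unfolding coeff_mult
    proof (rule Q.product_component_sum)
      fix i assume "i \<in> {..k}"
      then have i: "i \<le> k" by simp
      have c: "poly.coeff h1 i \<in> QM i" "poly.coeff h2 (k - i) \<in> QM (k - i)"
        using eng_mult by (auto simp: graded_ring_def)
      consider "i = 0" | "i = k" | "0 < i" "i < k" using i by linarith
      then show "poly.coeff h1 i * poly.coeff h2 (k - i) \<in> QJ k"
      proof cases
        case 1
        have "poly.coeff h2 k \<in> QJ k" using eng_mult k by blast
        from Q.product_component_mult[OF this c(1)] show ?thesis using 1 by (simp add: mult.commute)
      next
        case 2
        have "poly.coeff h1 k \<in> QJ k" using eng_mult k by blast
        from Q.product_component_mult[OF this c(2)] show ?thesis using 2 by simp
      next
        case 3
        then show ?thesis using c by (intro product_mem_QJ[of i]) auto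
      qed
    qed
    then show ?case using eng_mult R.m_closed[of h1 h2] by (simp add: graded_ring_def)
  qed
  obtain w f where f: "0 < w" "f \<in> aut (int w)" "f \<notin> QJ w" using exists_indecomposable by blast
  define k where "k = w + 2 * Suc d"
  define F where "F = Polynomial.monom ((D ^^ Suc d) f) k"
  have "(D ^^ Suc d) f \<in> QM k" unfolding k_def using QM_Dn[of f w "Suc d"] f(2) aut_subset_QM by blast
  then have "F \<in> carrier ?R" using Q.zero by (auto simp: F_def graded_ring_def coeff_monom)
  then have "F \<in> generate_ring ?R (constants \<union> S)" using S(3) by (simp add: quasimodular_ring_def)
  moreover have "k > d" by (simp add: k_def)
  ultimately have "poly.coeff F k \<in> QJ k" using gen by blast
  then have "(D ^^ Suc d) f \<in> QJ (w + 2 * Suc d)" by (simp add: F_def k_def del: funpow.simps)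
  then show False using Dn_notin_QJ[OF f(2,3,1)] by blast
qed

text \<open>\<open>\<epsilon>\<close> is the number of pairs of a positive weight and a basis
  element. In weight \<open>k\<close> the derivatives \<open>D^n b\<close>, with \<open>b\<close> of
  weight \<open>k - 2 n\<close>, are counted by the basis elements of weight at most
  \<open>k\<close>. That these are all of them is where the independent \<open>A\<close> come
  in.\<close>

lemma dimension_theorem:
  "\<exists>\<epsilon>. has_dim_mod (modular_ring \<Gamma>) constants
            (modular_ideal \<Gamma> \<inter> quasimodular_ideal_sq \<Gamma>) (modular_ideal \<Gamma>) \<epsilon> \<and>
         (\<forall>A w. length A = \<epsilon> \<and> length w = \<epsilon> \<and>
            (\<forall>i<\<epsilon>. A ! i \<in> weight_part (modular_ideal \<Gamma>) (w ! i)) \<and>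
            independent_mod (quasimodular_ring \<Gamma>) constants (quasimodular_ideal_sq \<Gamma>) A \<longrightarrow>
            (\<forall>k. even k \<and> (\<forall>i<\<epsilon>. w ! i \<le> k) \<longrightarrow>
               has_dim_mod (quasimodular_ring \<Gamma>) constants (quasimodular_ideal_sq \<Gamma>)
                 (weight_part (quasimodular_ideal \<Gamma>) k) \<epsilon>))"
proof -
  from decomposable_basis obtain B W where B0: "\<forall>w. finite (B w) \<and> B w \<subseteq> aut (int w) \<and>
     (\<forall>h\<in>aut (int w). \<exists>s\<in>cf.span (B w). h - s \<in> QJ w) \<and>
     (\<forall>c. (\<lambda>z. \<Sum>b\<in>B w. c b * b z) \<in> QJ w \<longrightarrow> (\<forall>b\<in>B w. c b = 0))"
    and W0: "\<forall>w>W. B w = {}" by (elim exE conjE)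
  have W: "B w = {}" if "w > W" for w using W0 that by blast
  have B: "finite (B w)" "B w \<subseteq> aut (int w)"
    "h \<in> aut (int w) \<Longrightarrow> \<exists>s\<in>cf.span (B w). h - s \<in> QJ w"
    "(\<lambda>z. \<Sum>b\<in>B w. c b * b z) \<in> QJ w \<Longrightarrow> b \<in> B w \<Longrightarrow> c b = 0" for w h c b
    subgoal using B0 by blast
    subgoal using B0 by blast
    subgoal using B0 by blast
    subgoal using B0[rule_format, of w] by (elim conjE allE impE) (assumption, blast)
    done
  have Bin: "b \<in> aut (int w)" if "b \<in> B w" for b w using B(2) that by (rule subsetD)
  have Bspan: "\<exists>c. (\<lambda>z. h z - (\<Sum>b\<in>B w. c b * b z)) \<in> QJ w" if h: "h \<in> aut (int w)" for h w
  proof -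
    obtain s where s: "s \<in> cf.span (B w)" "h - s \<in> QJ w" using B(3)[OF h] by blast
    obtain c where "s = (\<lambda>z. \<Sum>b\<in>B w. c b * b z)" using cf_span_finiteE[OF B(1) s(1)] .
    then show ?thesis using s(2) by (auto simp: fun_diff_def)
  qed
  have Bvan: "b z = 0" if "b \<in> B w" "z \<notin> UHP" for b w z using B(2) autD(2) that by blast
  \<comment> \<open>Pairs with their weight keep basis elements of different weights apart; weight 0
    is left out because the ideal has positive weight.\<close>
  define X where "X = Sigma {0<..W} B"
  define \<epsilon> where "\<epsilon> = card X"
  have finX: "finite X" unfolding X_def using B(1) by auto
  have Xj: "{b. (j, b) \<in> X} = (if 0 < j then B j else {})" for j
    using W[of j] by (cases "j \<le> W") (auto simp: X_def)
  let ?I = "modular_ideal \<Gamma>" and ?J = "quasimodular_ideal_sq \<Gamma>"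
  let ?u = "\<lambda>x. Polynomial.monom (snd x) (fst x) :: graded_form"
  have idM: "ideal (?I \<inter> ?J) (graded_ring (modular_forms \<Gamma>))"
    using ideal_modular_ideal_Int_sq[OF carrier] by (simp add: modular_ring_def)
  have idQ: "ideal ?J (graded_ring QM)"
    using ideal_quasimodular_ideal_sq[OF carrier] by (simp add: quasimodular_ring_def)
  have MQ: "carrier (graded_ring (modular_forms \<Gamma>)) \<subseteq> carrier (graded_ring QM)"
    using modular_forms_subset_quasimodular by (auto simp: graded_ring_def)
  have ucoeff: "poly.coeff (?u x) j \<in> aut (int j) \<and> (j = 0 \<longrightarrow> poly.coeff (?u x) j = 0)" if "x \<in> X" for x j
    using that Bin aut_zero by (auto simp: X_def coeff_monom zero_fun_def)
  have uM: "?u x \<in> carrier (graded_ring (modular_forms \<Gamma>))" if "x \<in> X" for x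
    using ucoeff[OF that] by (simp add: graded_ring_def modular_forms_eq)
  have Lcoeff: "poly.coeff (\<Sum>x\<in>Y. cmul (c x) (?u x)) j = (\<lambda>z. \<Sum>b\<in>{b. (j, b) \<in> Y}. c (j, b) * b z)"
    if "Y \<subseteq> X" for Y c j
    using that finX Bvan by (intro coeff_sum_cmul_monom) (auto simp: X_def intro: finite_subset)
  have LM: "(\<Sum>x\<in>Y. cmul (c x) (?u x)) \<in> carrier (graded_ring (modular_forms \<Gamma>))" if "Y \<subseteq> X" for Y c
    using that uM by (intro M.sum_carrier M.cmul_carrier) auto
  have memI: "F \<in> ?I \<longleftrightarrow> F \<in> carrier (graded_ring (modular_forms \<Gamma>)) \<and> poly.coeff F 0 = 0" for F
    by (simp add: positive_weight_def modular_ring_def)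
  have L0: "poly.coeff (\<Sum>x\<in>Y. cmul (c x) (?u x)) 0 = 0" if "Y \<subseteq> X" for Y c
  proof -
    have "{b. (0, b) \<in> Y} = {}" using that by (auto simp: X_def)
    then show ?thesis unfolding Lcoeff[OF that] by (simp add: zero_fun_def)
  qed
  have LI: "(\<Sum>x\<in>Y. cmul (c x) (?u x)) \<in> ?I" if "Y \<subseteq> X" for Y c
    using memI LM[OF that] L0[OF that] by blast
  have indX: "c x = 0" if "(\<Sum>x\<in>Y. cmul (c x) (?u x)) \<in> ?J" "x \<in> Y" "Y \<subseteq> X"
    "\<And>j. {b. (j, b) \<in> Y} = B j \<or> {b. (j, b) \<in> Y} = {}" for Y c x
  proof -
    obtain j b where x: "x = (j, b)" by force
    then have "b \<in> {b. (j, b) \<in> Y}" using that(2) by simp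
    then have eq: "{b. (j, b) \<in> Y} = B j" and b: "b \<in> B j" using that(4)[of j] by auto
    have "poly.coeff (\<Sum>x\<in>Y. cmul (c x) (?u x)) j \<in> QJ j" using that(1) unfolding quasimodular_ideal_sq_def by blast
    then have "(\<lambda>z. \<Sum>b\<in>B j. c (j, b) * b z) \<in> QJ j" unfolding Lcoeff[OF that(3)] eq .
    from B(4)[OF this b] show ?thesis by (simp add: x)
  qed
  \<comment> \<open>The coefficients depend on \<open>F\<close> alone, so one statement serves
    \<open>X\<close> and its part \<open>Xk\<close> of weight at most \<open>k\<close>.\<close>
  have spanX: "\<exists>c. \<forall>Y\<subseteq>X. (\<forall>j. poly.coeff F j = 0 \<or> {b. (j, b) \<in> Y} = B j) \<longrightarrow>
      F - (\<Sum>x\<in>Y. cmul (c x) (?u x)) \<in> ?J" if F: "F \<in> ?I" for F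
  proof -
    have "\<exists>c. (poly.coeff F j = 0 \<longrightarrow> c = (\<lambda>b. 0)) \<and> (\<lambda>z. poly.coeff F j z - (\<Sum>b\<in>B j. c b * b z)) \<in> QJ j" for j
    proof (cases "poly.coeff F j = 0")
      case True
      then show ?thesis using Q.product_component_zero[of j] by (intro exI[of _ "\<lambda>b. 0"]) (simp add: zero_fun_def)
    next
      case False
      have "poly.coeff F j \<in> aut (int j)" using F memI by (auto simp: graded_ring_def modular_forms_eq)
      then show ?thesis using Bspan False by blast
    qed
    then have "\<forall>j. \<exists>c. (poly.coeff F j = 0 \<longrightarrow> c = (\<lambda>b. 0)) \<and> (\<lambda>z. poly.coeff F j z - (\<Sum>b\<in>B j. c b * b z)) \<in> QJ j"
      by (rule allI)
    from choice[OF this] obtain c where "\<forall>j. (poly.coeff F j = 0 \<longrightarrow> c j = (\<lambda>b. 0)) \<and>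
      (\<lambda>z. poly.coeff F j z - (\<Sum>b\<in>B j. c j b * b z)) \<in> QJ j" by (rule exE)
    then have c: "poly.coeff F j = 0 \<Longrightarrow> c j = (\<lambda>b. 0)"
      "(\<lambda>z. poly.coeff F j z - (\<Sum>b\<in>B j. c j b * b z)) \<in> QJ j" for j by blast+
    have "F - (\<Sum>x\<in>Y. cmul (case_prod c x) (?u x)) \<in> ?J"
      if Y: "Y \<subseteq> X" "\<forall>j. poly.coeff F j = 0 \<or> {b. (j, b) \<in> Y} = B j" for Y
    proof -
      have "poly.coeff (F - (\<Sum>x\<in>Y. cmul (case_prod c x) (?u x))) j \<in> QJ j" for j
      proof -
        have "(\<Sum>b\<in>{b. (j, b) \<in> Y}. c j b * b z) = (\<Sum>b\<in>B j. c j b * b z)" for z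
          using Y(2) c(1)[of j] by (cases "poly.coeff F j = 0") auto
        then have "poly.coeff (F - (\<Sum>x\<in>Y. cmul (case_prod c x) (?u x))) j = (\<lambda>z. poly.coeff F j z - (\<Sum>b\<in>B j. c j b * b z))"
          unfolding coeff_diff Lcoeff[OF Y(1)] by (simp add: fun_diff_def)
        then show ?thesis using c(2)[of j] by simp
      qed
      then show ?thesis by (simp add: quasimodular_ideal_sq_def)
    qed
    then show ?thesis by (intro exI[of _ "case_prod c"]) blast
  qed
  have dimM: "has_dim_mod (graded_ring (modular_forms \<Gamma>)) constants (?I \<inter> ?J) ?I \<epsilon>"
    unfolding \<epsilon>_def
  proof (rule M.has_dim_mod_basis[OF idM finX, where u = ?u])
    show "?I \<subseteq> carrier (graded_ring (modular_forms \<Gamma>))" using memI by blast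
    show "(\<Sum>x\<in>X. cmul (c x) (?u x)) \<in> ?I" for c by (rule LI) simp
    show "?u x \<in> carrier (graded_ring (modular_forms \<Gamma>))" if "x \<in> X" for x by (rule uM[OF that])
    show "c x = 0" if "(\<Sum>x\<in>X. cmul (c x) (?u x)) \<in> ?I \<inter> ?J" "x \<in> X" for c x
      by (rule indX[where Y = X]) (use that Xj in auto)
    fix F assume F: "F \<in> ?I"
    have "poly.coeff F j = 0 \<or> {b. (j, b) \<in> X} = B j" for j
      using F memI by (cases "j = 0") (auto simp: Xj)
    then obtain c where c: "F - (\<Sum>x\<in>X. cmul (c x) (?u x)) \<in> ?J" using spanX[OF F] by blast
    interpret RM: cring "graded_ring (modular_forms \<Gamma>)" by (rule M.cring_graded_ring)
    have "F - (\<Sum>x\<in>X. cmul (c x) (?u x)) \<in> carrier (graded_ring (modular_forms \<Gamma>))"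
    proof -
      have FL: "F \<in> carrier (graded_ring (modular_forms \<Gamma>))"
        "(\<Sum>x\<in>X. cmul (c x) (?u x)) \<in> carrier (graded_ring (modular_forms \<Gamma>))"
        using F memI LM[OF subset_refl] by blast+
      show ?thesis using RM.minus_closed[OF FL] M.minus_graded_ring[OF FL] by (simp only:)
    qed
    moreover have "poly.coeff (F - (\<Sum>x\<in>X. cmul (c x) (?u x))) 0 = 0"
      using F memI L0[OF subset_refl, of c] by (simp only: coeff_diff) simp
    ultimately show "\<exists>c. F - (\<Sum>x\<in>X. cmul (c x) (?u x)) \<in> ?I \<inter> ?J" using c memI by blast
  qed
  \<comment> \<open>If \<open>\<epsilon>\<close> were 0 the weight condition would be empty and
    would admit \<open>k = 0\<close>; positivity of \<open>\<epsilon>\<close> is what yields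
    \<open>k0\<close> below.\<close>
  have \<epsilon>pos: "\<epsilon> > 0"
  proof -
    obtain w f where f: "0 < w" "f \<in> aut (int w)" "f \<notin> QJ w" using exists_indecomposable by blast
    have "B w \<noteq> {}"
    proof
      assume "B w = {}"
      then show False using Bspan[OF f(2)] f(3) by simp
    qed
    then have "X \<noteq> {}" using f(1) Xj[of w] by auto
    then show ?thesis using finX by (simp add: \<epsilon>_def card_gt_0_iff)
  qed
  have "has_dim_mod (graded_ring QM) constants ?J (weight_part (quasimodular_ideal \<Gamma>) k) \<epsilon>"
    if A: "length A = \<epsilon>" "\<forall>i<\<epsilon>. A ! i \<in> weight_part ?I (w ! i)"
      and ind: "independent_mod (graded_ring QM) constants ?J A"
      and k: "even k" "\<forall>i<\<epsilon>. w ! i \<le> k" for A w k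
  proof -
    define Xk where "Xk = {x\<in>X. fst x \<le> k}"
    have XkX: "Xk \<subseteq> X" and finXk: "finite Xk" using finX by (auto simp: Xk_def)
    have Xkj: "{b. (j, b) \<in> Xk} = (if 0 < j \<and> j \<le> k then B j else {})" for j
    proof -
      have "{b. (j, b) \<in> Xk} = (if j \<le> k then {b. (j, b) \<in> X} else {})" by (auto simp: Xk_def)
      then show ?thesis unfolding Xj by simp
    qed
    \<comment> \<open>All \<open>A_i\<close> lie in this space, whose dimension modulo decomposables
      is \<open>card Xk\<close>. Their independence gives \<open>\<epsilon> \<le> card Xk\<close>,
      so no basis element has weight above \<open>k\<close>.\<close>
    define E where "E = {F\<in>?I. \<forall>j>k. poly.coeff F j = 0}"
    have "has_dim_mod (graded_ring QM) constants ?J E (card Xk)"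
    proof (rule Q.has_dim_mod_basis[OF idQ finXk, where u = ?u])
      show "E \<subseteq> carrier (graded_ring QM)" using memI MQ by (auto simp: E_def)
      show "(\<Sum>x\<in>Xk. cmul (c x) (?u x)) \<in> E" for c
      proof -
        have "poly.coeff (\<Sum>x\<in>Xk. cmul (c x) (?u x)) j = 0" if "j > k" for j
        proof -
          have "{b. (j, b) \<in> Xk} = {}" using that by (simp add: Xkj)
          then show ?thesis unfolding Lcoeff[OF XkX] by (simp add: zero_fun_def)
        qed
        then show ?thesis using LI[OF XkX] by (simp add: E_def)
      qed
      show "?u x \<in> carrier (graded_ring QM)" if "x \<in> Xk" for x using uM MQ XkX that by blast
      show "c x = 0" if "(\<Sum>x\<in>Xk. cmul (c x) (?u x)) \<in> ?J" "x \<in> Xk" for c x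
        by (rule indX[OF that XkX]) (simp add: Xkj)
      fix F assume F: "F \<in> E"
      then have FI: "F \<in> ?I" by (simp add: E_def)
      have "poly.coeff F j = 0 \<or> {b. (j, b) \<in> Xk} = B j" for j
        using F FI memI by (cases "0 < j \<and> j \<le> k") (auto simp: Xkj E_def not_le)
      then show "\<exists>c. F - (\<Sum>x\<in>Xk. cmul (c x) (?u x)) \<in> ?J" using spanX[OF FI] XkX by blast
    qed
    moreover have "set A \<subseteq> E"
    proof
      fix a assume "a \<in> set A"
      then obtain i where i: "i < \<epsilon>" "a = A ! i" using A(1) by (metis in_set_conv_nth)
      then have "a \<in> weight_part ?I (w ! i)" "w ! i \<le> k" using A(2) k(2) by auto
      then show "a \<in> E" unfolding weight_part_def E_def by auto
    qed
    ultimately have "length A \<le> card Xk" by (intro Q.independent_mod_length_le[OF idQ one_notin_sq _ ind])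
    moreover have "card Xk \<le> card X" by (rule card_mono[OF finX XkX])
    ultimately have cardXk: "card Xk = \<epsilon>" using A(1) by (simp add: \<epsilon>_def)
    have k0: "0 < k"
    proof (rule ccontr)
      assume "\<not> 0 < k"
      then have "Xk = {}" by (auto simp: Xk_def X_def)
      then show False using cardXk \<epsilon>pos by simp
    qed
    define N where "N = {n. 2 * n < k}"
    have finN: "finite N" unfolding N_def by (rule finite_subset[of _ "{..k}"]) auto
    have Nw: "int k - 2 * int n = int (k - 2 * n)" if "n \<in> N" for n using that by (simp add: N_def)
    define Y where "Y = Sigma N (\<lambda>n. B (k - 2 * n))"
    have finY: "finite Y" unfolding Y_def using finN B(1) by auto
    have "bij_betw (\<lambda>(n, b). (k - 2 * n, b)) Y Xk"
    proof (rule bij_betw_byWitness[where f' = "\<lambda>(w, b). ((k - w) div 2, b)"])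
      \<comment> \<open>Forms of odd weight are zero, and zero cannot belong to an independent set.
        So \<open>k - w\<close> is even and halving it inverts \<open>k - 2 * n\<close>.\<close>
      have Xk_odd: "even w" if "(w, b) \<in> Xk" for w b
      proof (rule ccontr)
        assume "odd w"
        have b: "b \<in> B w" using that by (auto simp: Xk_def X_def)
        then have "b = 0" using Bin \<open>odd w\<close> aut_odd_weight[of b "int w"] by simp
        have "(\<lambda>z. \<Sum>b'\<in>B w. (if b' = b then 1 else 0) * b' z) = (\<lambda>z. 0)"
        proof
          fix z
          have "(if b' = b then 1 else 0) * b' z = 0" for b' using \<open>b = 0\<close> by simp
          then show "(\<Sum>b'\<in>B w. (if b' = b then 1 else 0) * b' z) = 0" by (intro sum.neutral ballI)
        qed
        also have "\<dots> \<in> QJ w" using Q.product_component_zero by (simp add: zero_fun_def)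
        finally have "(\<lambda>z. \<Sum>b'\<in>B w. (if b' = b then 1 else 0) * b' z) \<in> QJ w" .
        from B(4)[OF this b] show False by simp
      qed
      show "\<forall>a\<in>Y. (\<lambda>(w, b). ((k - w) div 2, b)) ((\<lambda>(n, b). (k - 2 * n, b)) a) = a"
        by (auto simp: Y_def N_def)
      show "\<forall>a'\<in>Xk. (\<lambda>(n, b). (k - 2 * n, b)) ((\<lambda>(w, b). ((k - w) div 2, b)) a') = a'"
        using Xk_odd k(1) by (auto simp: Xk_def)
      show "(\<lambda>(n, b). (k - 2 * n, b)) ` Y \<subseteq> Xk"
      proof
        fix x assume "x \<in> (\<lambda>(n, b). (k - 2 * n, b)) ` Y"
        then obtain n b where x: "x = (k - 2 * n, b)" "n \<in> N" "b \<in> B (k - 2 * n)" by (auto simp: Y_def)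
        then have "b \<in> {b. (k - 2 * n, b) \<in> Xk}" unfolding Xkj by (auto simp: N_def)
        then show "x \<in> Xk" by (simp add: x)
      qed
      show "(\<lambda>(w, b). ((k - w) div 2, b)) ` Xk \<subseteq> Y"
      proof
        fix x assume "x \<in> (\<lambda>(w, b). ((k - w) div 2, b)) ` Xk"
        then obtain w b where x: "x = ((k - w) div 2, b)" "(w, b) \<in> Xk" by auto
        have w: "even w" "0 < w" "w \<le> k" "b \<in> B w" using x(2) Xk_odd by (auto simp: Xk_def X_def)
        then have "k - 2 * ((k - w) div 2) = w" "2 * ((k - w) div 2) < k" using k(1) by auto
        then show "x \<in> Y" using w by (simp add: x(1) Y_def N_def)
      qed
    qed
    then have cardY: "card Y = \<epsilon>" using cardXk bij_betw_same_card by metis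
    let ?v = "\<lambda>x. Polynomial.monom ((D ^^ fst x) (snd x)) k :: graded_form"
    have bQ: "(D ^^ n) b \<in> QM k" if "(n, b) \<in> Y" for n b
    proof -
      have "b \<in> QM (k - 2 * n)" using that B(2) aut_subset_QM unfolding Y_def by blast
      from QM_Dn[OF this, of n] show ?thesis using that by (simp add: Y_def N_def)
    qed
    have vc: "?v x \<in> carrier (graded_ring QM)" if "x \<in> Y" for x
      using bQ[of "fst x" "snd x"] that Q.zero by (auto simp: graded_ring_def coeff_monom)
    have Vcoeff: "poly.coeff (\<Sum>x\<in>Y. cmul (c x) (?v x)) j =
        (if j = k then (\<lambda>z. \<Sum>n\<in>N. (D ^^ n) (\<lambda>z. \<Sum>b\<in>B (k - 2 * n). c (n, b) * b z) z) else 0)" for c j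
    proof
      fix z
      have "poly.coeff (\<Sum>x\<in>Y. cmul (c x) (?v x)) j z = (\<Sum>x\<in>Y. c x * indicator UHP z * poly.coeff (?v x) j z)"
        by (simp only: coeff_sum sum_fun_apply coeff_cmul)
      also have "\<dots> = (\<Sum>x\<in>Y. if j = k then c x * (D ^^ fst x) (snd x) z else 0)"
      proof (rule sum.cong)
        fix x assume x: "x \<in> Y"
        have "(D ^^ fst x) (snd x) z = 0" if "z \<notin> UHP"
          using Q.vanish[OF bQ[of "fst x" "snd x"] that] x by simp
        then show "c x * indicator UHP z * poly.coeff (?v x) j z = (if j = k then c x * (D ^^ fst x) (snd x) z else 0)"
          by (cases "z \<in> UHP") (auto simp: coeff_monom)
      qed simp
      also have "\<dots> = (if j = k then (\<Sum>n\<in>N. \<Sum>b\<in>B (k - 2 * n). c (n, b) * (D ^^ n) b z) else 0)"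
        unfolding Y_def using finN B(1) by (simp add: sum.Sigma split_def)
      also have "\<dots> = (if j = k then (\<lambda>z. \<Sum>n\<in>N. (D ^^ n) (\<lambda>z. \<Sum>b\<in>B (k - 2 * n). c (n, b) * b z) z) else 0) z"
      proof -
        have "(D ^^ n) (\<lambda>z. \<Sum>b\<in>B (k - 2 * n). c (n, b) * b z) z = (\<Sum>b\<in>B (k - 2 * n). c (n, b) * (D ^^ n) b z)" for n
          by (subst D_power_lincomb[OF B(1)]) (auto intro: autD(1)[OF Bin])
        then show ?thesis by simp
      qed
      finally show "poly.coeff (\<Sum>x\<in>Y. cmul (c x) (?v x)) j z =
        (if j = k then (\<lambda>z. \<Sum>n\<in>N. (D ^^ n) (\<lambda>z. \<Sum>b\<in>B (k - 2 * n). c (n, b) * b z) z) else 0) z" .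
    qed
    have lin: "(\<lambda>z. \<Sum>b\<in>B (k - 2 * n). c b * b z) \<in> aut (int (k - 2 * n))" for c :: "(complex \<Rightarrow> complex) \<Rightarrow> complex" and n
      by (intro aut_sum aut_scale Bin)
    have "has_dim_mod (graded_ring QM) constants ?J (weight_part (quasimodular_ideal \<Gamma>) k) (card Y)"
    proof (rule Q.has_dim_mod_basis[OF idQ finY, where u = ?v])
      show "weight_part (quasimodular_ideal \<Gamma>) k \<subseteq> carrier (graded_ring QM)"
        by (auto simp: weight_part_def positive_weight_def quasimodular_ring_def)
      show "(\<Sum>x\<in>Y. cmul (c x) (?v x)) \<in> weight_part (quasimodular_ideal \<Gamma>) k" for c
      proof -
        have "(\<Sum>x\<in>Y. cmul (c x) (?v x)) \<in> carrier (graded_ring QM)"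
          using vc by (intro Q.sum_carrier Q.cmul_carrier) auto
        then show ?thesis using Vcoeff[of c] k0
          by (simp add: weight_part_def positive_weight_def quasimodular_ring_def)
      qed
      show "?v x \<in> carrier (graded_ring QM)" if "x \<in> Y" for x by (rule vc[OF that])
      show "c x = 0" if J: "(\<Sum>x\<in>Y. cmul (c x) (?v x)) \<in> ?J" and x: "x \<in> Y" for c x
      proof -
        obtain n b where nb: "x = (n, b)" "n \<in> N" "b \<in> B (k - 2 * n)" using x by (auto simp: Y_def)
        define g where "g = (\<lambda>n. if n \<in> N then (\<lambda>z. \<Sum>b\<in>B (k - 2 * n). c (n, b) * b z) else (\<lambda>z. 0))"
        have "g n \<in> QJ (k - 2 * n)"
        proof (rule QJ_components')
          show "g n \<in> aut (int k - 2 * int n)" for n using lin Nw aut_zero by (simp add: g_def)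
          show "g n = (\<lambda>z. 0)" if "k \<le> 2 * n" for n using that by (simp add: g_def N_def)
          show "2 * n < k" using nb by (simp add: N_def)
          have "poly.coeff (\<Sum>x\<in>Y. cmul (c x) (?v x)) k \<in> QJ k" using J unfolding quasimodular_ideal_sq_def by blast
          then show "(\<lambda>z. \<Sum>n\<in>{n. 2 * n < k}. (D ^^ n) (g n) z) \<in> QJ k"
            unfolding Vcoeff N_def[symmetric] by (simp add: g_def cong: sum.cong)
        qed
        then have "(\<lambda>z. \<Sum>b\<in>B (k - 2 * n). c (n, b) * b z) \<in> QJ (k - 2 * n)" using nb by (simp add: g_def)
        from B(4)[OF this nb(3)] show ?thesis by (simp add: nb)
      qed
      fix F assume F: "F \<in> weight_part (quasimodular_ideal \<Gamma>) k"
      define f where "f = poly.coeff F k"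
      have Fj: "poly.coeff F j = 0" if "j \<noteq> k" for j using F that by (simp add: weight_part_def)
      have "f \<in> QM k" using F by (simp add: f_def weight_part_def positive_weight_def quasimodular_ring_def graded_ring_def)
      from QM_structure[OF this k0] obtain g where g0: "\<forall>n. g n \<in> aut (int k - 2 * int n)"
        and g2: "f = (\<lambda>z. \<Sum>n\<in>N. (D ^^ n) (g n) z)" unfolding N_def by (elim exE conjE)
      have g1: "g n \<in> aut (int k - 2 * int n)" for n using g0 by (rule spec)
      have "\<exists>c. (\<lambda>z. g n z - (\<Sum>b\<in>B (k - 2 * n). c b * b z)) \<in> QJ (k - 2 * n)" if "n \<in> N" for n
        by (rule Bspan) (use g1[of n] in \<open>simp only: Nw[OF that]\<close>)
      then have "\<forall>n\<in>N. \<exists>c. (\<lambda>z. g n z - (\<Sum>b\<in>B (k - 2 * n). c b * b z)) \<in> QJ (k - 2 * n)" by (rule ballI)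
      from bchoice[OF this] obtain c
        where c: "n \<in> N \<Longrightarrow> (\<lambda>z. g n z - (\<Sum>b\<in>B (k - 2 * n). c n b * b z)) \<in> QJ (k - 2 * n)" for n
        by blast
      \<comment> \<open>The error of \<open>g n\<close> against the basis is decomposable of weight
        \<open>k - 2 * n\<close>, and \<open>D^n\<close> carries it to a decomposable form of weight
        \<open>k\<close>.\<close>
      define r where "r = (\<lambda>n z. g n z - (\<Sum>b\<in>B (k - 2 * n). c n b * b z))"
      have Dr: "(D ^^ n) (r n) z = (D ^^ n) (g n) z - (D ^^ n) (\<lambda>z. \<Sum>b\<in>B (k - 2 * n). c n b * b z) z" if n: "n \<in> N" for n z
      proof -
        define s where "s = (\<lambda>z. \<Sum>b\<in>B (k - 2 * n). c n b * b z)"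
        have hol: "g n holomorphic_on UHP" "s holomorphic_on UHP"
          using autD(1)[OF g1] autD(1)[OF lin] by (auto simp: s_def)
        show ?thesis
        proof (cases "g n = s")
          case True
          then have "r n = (\<lambda>z. 0)" by (auto simp: r_def s_def fun_eq_iff)
          then show ?thesis using True by (simp add: s_def)
        next
          case False
          \<comment> \<open>\<open>D_power_lincomb\<close> sums over a set of functions, so it
            handles a difference only when the two functions are distinct; hence the case
            split.\<close>
          have "r n = (\<lambda>z. \<Sum>b\<in>{g n, s}. (if b = g n then 1 else -1) * b z)"
            using False by (auto simp: r_def s_def)
          then have "(D ^^ n) (r n) = (\<lambda>z. \<Sum>b\<in>{g n, s}. (if b = g n then 1 else -1) * (D ^^ n) b z)"
            using hol by (simp only:) (intro D_power_lincomb, auto)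
          then show ?thesis using False by (simp add: s_def[symmetric])
        qed
      qed
      have "poly.coeff (F - (\<Sum>x\<in>Y. cmul (case_prod c x) (?v x))) j \<in> QJ j" for j
      proof (cases "j = k")
        case True
        have "(D ^^ n) (r n) \<in> QJ k" if n: "n \<in> N" for n
          using QJ_Dn[OF c[OF n], of n] n by (simp add: r_def N_def)
        then have "(\<Sum>n\<in>N. (D ^^ n) (r n)) \<in> QJ k" by (rule Q.product_component_sum)
        moreover have "poly.coeff (F - (\<Sum>x\<in>Y. cmul (case_prod c x) (?v x))) k = (\<Sum>n\<in>N. (D ^^ n) (r n))"
        proof
          fix z
          have "poly.coeff (F - (\<Sum>x\<in>Y. cmul (case_prod c x) (?v x))) k z =
            f z - (\<Sum>n\<in>N. (D ^^ n) (\<lambda>z. \<Sum>b\<in>B (k - 2 * n). c n b * b z) z)"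
            unfolding coeff_diff Vcoeff by (simp add: f_def)
          also have "\<dots> = (\<Sum>n\<in>N. (D ^^ n) (r n) z)" unfolding g2 by (simp add: Dr sum_subtractf)
          finally show "poly.coeff (F - (\<Sum>x\<in>Y. cmul (case_prod c x) (?v x))) k z = (\<Sum>n\<in>N. (D ^^ n) (r n)) z"
            by (simp add: sum_fun_apply)
        qed
        ultimately show ?thesis using True by simp
      next
        case False
        then have "poly.coeff (F - (\<Sum>x\<in>Y. cmul (case_prod c x) (?v x))) j = 0"
          unfolding coeff_diff Vcoeff by (simp add: Fj)
        then show ?thesis using Q.product_component_zero by simp
      qed
      then show "\<exists>c. F - (\<Sum>x\<in>Y. cmul (c x) (?v x)) \<in> ?J"
        by (intro exI[of _ "case_prod c"]) (simp add: quasimodular_ideal_sq_def)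
    qed
    then show ?thesis by (simp add: cardY)
  qed
  then show ?thesis
    using dimM unfolding modular_ring_def[symmetric] quasimodular_ring_def[symmetric] by blast
qed

end

theorem mainTheorem2:
  fixes \<Gamma> :: "(real^2^2) set set"
  assumes "subgroup \<Gamma> PSL2R"
    and "discrete_in_PSL2R \<Gamma>"
    and "cocompact \<Gamma>"
  shows
    "(\<exists>\<epsilon>. has_dim_mod (modular_ring \<Gamma>) constants
            (modular_ideal \<Gamma> \<inter> quasimodular_ideal_sq \<Gamma>) (modular_ideal \<Gamma>) \<epsilon> \<and>
         (\<forall>A w. length A = \<epsilon> \<and> length w = \<epsilon> \<and>
            (\<forall>i<\<epsilon>. A ! i \<in> weight_part (modular_ideal \<Gamma>) (w ! i)) \<and>
            independent_mod (quasimodular_ring \<Gamma>) constants (quasimodular_ideal_sq \<Gamma>) A \<longrightarrow>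
            (\<forall>k. even k \<and> (\<forall>i<\<epsilon>. w ! i \<le> k) \<longrightarrow>
               has_dim_mod (quasimodular_ring \<Gamma>) constants (quasimodular_ideal_sq \<Gamma>)
                 (weight_part (quasimodular_ideal \<Gamma>) k) \<epsilon>))) \<and>
     \<not> finitely_generated_algebra (quasimodular_ring \<Gamma>) constants"
proof -
  interpret cocompact_fuchsian \<Gamma> by (rule cocompact_fuchsian.intro[OF assms])
  show ?thesis using dimension_theorem not_finitely_generated by blast
qed

end
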